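(* Let $n\ge1$, $[n]=\{1,\dots,n\}$, $\widetilde{[n]}=[n]\cup\{0\}$, and let $\Omega$ be any ordering with ordering function $\chi$. Then $$T_n^\Omega=2^2\cdot[u_0^0]\Big(\sum_{\pi\in\Pi^*_{\widetilde{[n]}}}\frac{(-1)^\pi}{|\pi|}G_\pi\Big),$$ where $\Pi^*_{\widetilde{[n]}}$ is the set of set partitions of $\widetilde{[n]}$ in which the singlet $\{0\}$ is not a block. In particular, $T_n^\Omega$ is a quasi-elliptic function of mixed weight with leading weight $n-1$, whose leading part is independent of the ordering $\Omega$.
   Context: Let $\mathrm{Im}\,\tau>0$, $q=e^{2\pi i\tau}$, and $$\theta(z)=\frac{\sum_{m\in\mathbb{Z}}(-1)^m q^{\frac12(m+\frac12)^2}e^{(m+\frac12)z}}{\sum_{m\in\mathbb{Z}}(-1)^m (m+\frac12)q^{\frac12(m+\frac12)^2}}$$ (the odd Jacobi theta function with $\theta'(0)=1$). Put $u_i=e^{z_i}$, $v_i=e^{w_i}$ and $$\varpi=\theta\Big(\sum_k z_k\Big)\cdot\frac{\prod_{i<j}\theta(z_i+w_i-z_j-w_j)\,\theta(w_i-w_j)}{\prod_i\theta(z_i)\ \prod_{i<j}\theta(z_i+w_i-w_j)\,\theta(w_i-z_j-w_j)},\qquad 1\le i,j\le n.$$ Orderings. Let $\overline{[n]}=\{\bar1,\dots,\bar n\}$, $x_i=u_iv_i$, $x_{\bar j}=v_j$. An ordering is a strict total order by modulus of the $2n$ quantities $x_a$, $a\in[n]\cup\overline{[n]}$, encoded by $\chi_{ab}\in\{0,1\}$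 for $a\ne b$: $\chi_{ab}=0$ if $|x_a|>|x_b|$ and $\chi_{ab}=1$ if $|x_a|<|x_b|$. $\Omega$ is the corresponding region of $(u,v)$, where moreover $|q|<|x_a/x_b|<|q|^{-1}$ for all $a\neq b$. Then $$T_n^\Omega=[v_1^0\cdots v_n^0]\,\varpi=\Big(\frac1{2\pi i}\Big)^n\int_{\gamma_n^\Omega}\varpi\,\frac{dv_1}{v_1}\cdots\frac{dv_n}{v_n},$$ where $\gamma_n^\Omega$ is a product of circles $|v_j|=\text{const}$ contained in $\Omega$; the result is extended meromorphically in $z_1,\dots,z_n$. For $0\le a\le b$, $b\geq 1$, let $$g_{b,a}(u)=(-1)^a\Big(\frac12\Big)^b+(-1)^b\sum_{k\ne0}\frac{q^{(b-a)k}u^k}{(1-q^k)^b},$$ a series convergent for $|q|^a<|u|<|q|^{a-b}$ and continued to a meromorphic function on $\mathbb{C}^*$. Extend $\chi$ to the index $0$ by $\chi_{0\bar i}=0$, $\chi_{i\bar0}=1$ for $i\in[n]$, with an extra variable $u_0$. For a non-recurring sequence $K=(k_r,k_{r-1},\dots,k_1)$ set $\chi_K=\sum_{a=1}^r\chi_{k_{a+1}\overline{k_a}}$ with $k_{r+1}:=k_1$. For a nonempty finite set $S\subseteq\widetilde{[n]}$, $S\ne\{0\}$, set $$G_S=\sum_{\tau}g_{|S|,\chi_\tau}\Big(\prod_{i\in S}u_i\Big),$$ the sum being over all $|S|!$ orderings (sequences) $\tau$ of $S$. (For $|S|=1$, $\chi_\tau=\chi_{i\bar i}$; note $g_{1,0}=g_{1,1}=\theta'/\theta$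 after continuation.) For a partition $\pi=\{\pi_1,\dots,\pi_\ell\}$ of a set with $N$ elements, $(-1)^\pi=(-1)^{N-\ell}$ and $\frac1{|\pi|}G_\pi=\prod_k\frac1{|\pi_k|}G_{\pi_k}$. The operation $[u_0^0]$ acts only on the factor of the block containing $0$ and extracts the constant term of the series defining each $g_{b,a}$ there, i.e. it sends $g_{b,a}$ to $(-1)^a(1/2)^b$. Quasi-elliptic functions: for even $m\geq 2$ let $\mathbb{G}_m=\frac12(m-1)!\sum_{\lambda\ne0}\lambda^{-m}$, $\lambda\in2\pi i\mathbb{Z}\oplus2\pi i\tau\mathbb{Z}$ (Eisenstein summation for $m=2$). Quasi-elliptic functions here are elements of the ring generated over $\mathbb{C}[\mathbb{G}_2,\mathbb{G}_4,\mathbb{G}_6]$ by the functions $\frac{\theta^{(k)}}{\theta}(\sum_{i\in I}z_i)$, $k\ge1$, $\emptyset\ne I\subseteq[n]$, graded with $\frac{\theta^{(k)}}{\theta}$ of weight $k$ and $\mathbb{G}_m$ of weight $m$. "Mixed weight with leading weight $m$" means the highest-weight nonzero homogeneous component, called the leading part, has weight $m$. *)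

theory Defs
  imports
    "HOL-Complex_Analysis.Complex_Analysis"
    "HOL-Combinatorics.Multiset_Permutations"
begin

section \<open>The theta function and the function \<open>\<varpi>\<close>\<close>

definition nome :: "complex \<Rightarrow> complex" where
  "nome \<tau> = exp (2 * of_real pi * \<i> * \<tau>)"

text \<open>The power \<open>q\<^sup>x\<close> with half-integer \<open>x\<close> is read as \<open>exp (2 \<pi> \<i> \<tau> x)\<close>.\<close>

definition theta :: "complex \<Rightarrow> complex \<Rightarrow> complex" where
  "theta \<tau> z =
     (\<Sum>\<^sub>\<infinity>m\<in>(UNIV :: int set). (-1) powi m
        * exp (2 * of_real pi * \<i> * \<tau> * (1/2 * (of_int m + 1/2)^2)) * exp ((of_int m + 1/2) * z))
   / (\<Sum>\<^sub>\<infinity>m\<in>(UNIV :: int set). (-1) powi m * (of_int m + 1/2)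
        * exp (2 * of_real pi * \<i> * \<tau> * (1/2 * (of_int m + 1/2)^2)))"

text \<open>Tuples \<open>(z\<^sub>1, \<dots>, z\<^sub>n)\<close> are functions on \<^typ>\<open>nat\<close>, of which only the values at
  \<open>1, \<dots>, n\<close> matter.\<close>

definition varpi :: "nat \<Rightarrow> complex \<Rightarrow> (nat \<Rightarrow> complex) \<Rightarrow> (nat \<Rightarrow> complex) \<Rightarrow> complex" where
  "varpi n \<tau> z w =
     theta \<tau> (\<Sum>k\<in>{1..n}. z k)
     * (\<Prod>(i,j)\<in>{(i,j). 1 \<le> i \<and> i < j \<and> j \<le> n}.
          theta \<tau> (z i + w i - z j - w j) * theta \<tau> (w i - w j))
     / ((\<Prod>i\<in>{1..n}. theta \<tau> (z i))
        * (\<Prod>(i,j)\<in>{(i,j). 1 \<le> i \<and> i < j \<and> j \<le> n}.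
             theta \<tau> (z i + w i - w j) * theta \<tau> (w i - z j - w j)))"


section \<open>Orderings and their regions\<close>

datatype index = Idx nat | Bar nat

definition indices :: "nat \<Rightarrow> index set" where
  "indices n = Idx ` {1..n} \<union> Bar ` {1..n}"

fun xval :: "(nat \<Rightarrow> complex) \<Rightarrow> (nat \<Rightarrow> complex) \<Rightarrow> index \<Rightarrow> complex" where
  "xval u v (Idx i) = u i * v i"
| "xval u v (Bar j) = v j"

text \<open>\<open>chi a b = 0\<close> encodes \<open>\<bar>x\<^sub>a\<bar> > \<bar>x\<^sub>b\<bar>\<close>. The function \<open>chi\<close> is an ordering function if
  this is a strict total order; values at equal arguments or outside the index set are irrelevant.\<close>

definition is_ordering :: "nat \<Rightarrow> (index \<Rightarrow> index \<Rightarrow> nat) \<Rightarrow> bool" where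
  "is_ordering n chi \<longleftrightarrow>
     (\<forall>a\<in>indices n. \<forall>b\<in>indices n. a \<noteq> b \<longrightarrow> chi a b \<in> {0, 1} \<and> chi a b + chi b a = 1) \<and>
     (\<forall>a\<in>indices n. \<forall>b\<in>indices n. \<forall>c\<in>indices n.
        a \<noteq> b \<and> b \<noteq> c \<and> a \<noteq> c \<and> chi a b = 0 \<and> chi b c = 0 \<longrightarrow> chi a c = 0)"

definition Omega ::
    "nat \<Rightarrow> (index \<Rightarrow> index \<Rightarrow> nat) \<Rightarrow> complex \<Rightarrow> ((nat \<Rightarrow> complex) \<times> (nat \<Rightarrow> complex)) set" where
  "Omega n chi \<tau> = {(u, v). \<forall>a\<in>indices n. \<forall>b\<in>indices n. a \<noteq> b \<longrightarrow>
     (chi a b = 0 \<longrightarrow> norm (xval u v a) > norm (xval u v b)) \<and>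
     (chi a b = 1 \<longrightarrow> norm (xval u v a) < norm (xval u v b)) \<and>
     norm (nome \<tau>) < norm (xval u v a / xval u v b) \<and>
     norm (xval u v a / xval u v b) < inverse (norm (nome \<tau>))}"


section \<open>Meromorphic functions of \<open>n\<close> complex variables\<close>

text \<open>\<open>\<complex>\<^sup>n\<close> is the set of functions supported on \<open>{1..n}\<close>; the product topology of
  \<^typ>\<open>nat \<Rightarrow> complex\<close> induces the usual topology on it.\<close>

definition Cn :: "nat \<Rightarrow> (nat \<Rightarrow> complex) set" where
  "Cn n = {z. \<forall>i. i \<notin> {1..n} \<longrightarrow> z i = 0}"

definition polydisc :: "nat \<Rightarrow> (nat \<Rightarrow> complex) \<Rightarrow> real \<Rightarrow> (nat \<Rightarrow> complex) set" where
  "polydisc n p r = {z \<in> Cn n. \<forall>i\<in>{1..n}. norm (z i - p i) < r}"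

definition holomorphic_Cn ::
    "nat \<Rightarrow> ((nat \<Rightarrow> complex) \<Rightarrow> complex) \<Rightarrow> (nat \<Rightarrow> complex) set \<Rightarrow> bool" where
  "holomorphic_Cn n f U \<longleftrightarrow> continuous_on U f \<and>
     (\<forall>z\<in>U. \<forall>i\<in>{1..n}. (\<lambda>x. f (z(i := x))) field_differentiable at (z i))"

text \<open>Locally a quotient of holomorphic functions. The second condition fixes the pointwise
  values at removable singularities: wherever the function extends holomorphically, its value is
  that of the extension. Values at the other points of the polar set are left unspecified.\<close>

definition meromorphic_Cn :: "nat \<Rightarrow> ((nat \<Rightarrow> complex) \<Rightarrow> complex) \<Rightarrow> bool" where
  "meromorphic_Cn n F \<longleftrightarrow>
     (\<forall>p\<in>Cn n. \<exists>r>0. \<exists>A B.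
        holomorphic_Cn n A (polydisc n p r) \<and> holomorphic_Cn n B (polydisc n p r) \<and>
        (\<exists>z\<in>polydisc n p r. B z \<noteq> 0) \<and>
        (\<forall>z\<in>polydisc n p r. B z \<noteq> 0 \<longrightarrow> F z = A z / B z)) \<and>
     (\<forall>p\<in>Cn n. \<forall>r>0. \<forall>H.
        holomorphic_Cn n H (polydisc n p r) \<and>
        polydisc n p r \<subseteq> closure {z \<in> polydisc n p r. F z = H z} \<longrightarrow> F p = H p)"


section \<open>The functions \<open>T\<^sub>n\<^sup>\<Omega>\<close>\<close>

text \<open>\<open>(1/(2\<pi>\<i>))\<^sup>n \<integral> f dv\<^sub>1/v\<^sub>1 \<dots> dv\<^sub>n/v\<^sub>n\<close> over the product of the circles \<open>\<bar>v\<^sub>j\<bar> = r j\<close>,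
  \<open>1 \<le> j \<le> n\<close>, as an iterated integral; \<open>v\<close> supplies the coordinates outside \<open>{1..n}\<close>.\<close>

primrec torus_integral ::
    "nat \<Rightarrow> (nat \<Rightarrow> real) \<Rightarrow> ((nat \<Rightarrow> complex) \<Rightarrow> complex) \<Rightarrow> (nat \<Rightarrow> complex) \<Rightarrow> complex" where
  "torus_integral 0 r f v = f v"
| "torus_integral (Suc k) r f v =
     torus_integral k r
       (\<lambda>v'. 1 / (2 * of_real pi * \<i>) *
          contour_integral (circlepath 0 (r (Suc k))) (\<lambda>x. f (v'(Suc k := x)) / x)) v"

text \<open>\<open>\<varpi>\<close> is invariant under \<open>w\<^sub>j \<mapsto> w\<^sub>j + 2\<pi>\<i>\<close>, because \<open>\<theta>(z + 2\<pi>\<i>) = -\<theta>(z)\<close> and every \<open>w\<^sub>j\<close>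
  occurs in an even number of factors; so it is a function of \<open>v\<^sub>j = exp w\<^sub>j\<close> and the branch of
  the logarithm is irrelevant.\<close>

definition T_integral :: "nat \<Rightarrow> (nat \<Rightarrow> real) \<Rightarrow> complex \<Rightarrow> (nat \<Rightarrow> complex) \<Rightarrow> complex" where
  "T_integral n r \<tau> z = torus_integral n r (\<lambda>v. varpi n \<tau> z (\<lambda>i. Ln (v i))) (\<lambda>_. 0)"

text \<open>\<open>F\<close> is the meromorphic continuation to \<open>\<complex>\<^sup>n\<close> of the integral, which is given for those
  \<open>z\<close> over which \<open>\<Omega>\<close> contains a product of circles (with \<open>u\<^sub>i = exp z\<^sub>i\<close>).\<close>

definition is_T ::
    "nat \<Rightarrow> (index \<Rightarrow> index \<Rightarrow> nat) \<Rightarrow> complex \<Rightarrow> ((nat \<Rightarrow> complex) \<Rightarrow> complex) \<Rightarrow> bool" where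
  "is_T n chi \<tau> F \<longleftrightarrow> meromorphic_Cn n F \<and>
     (\<forall>z\<in>Cn n. \<forall>r.
        (\<forall>j\<in>{1..n}. r j > 0) \<and>
        (\<forall>v. (\<forall>j\<in>{1..n}. norm (v j) = r j) \<longrightarrow> (\<lambda>i. exp (z i), v) \<in> Omega n chi \<tau>)
        \<longrightarrow> F z = T_integral n r \<tau> z)"

definition T :: "nat \<Rightarrow> (index \<Rightarrow> index \<Rightarrow> nat) \<Rightarrow> complex \<Rightarrow> (nat \<Rightarrow> complex) \<Rightarrow> complex" where
  "T n chi \<tau> = (SOME F. is_T n chi \<tau> F)"


section \<open>The functions \<open>g\<^sub>b\<^sub>,\<^sub>a\<close> and \<open>G\<^sub>S\<close>\<close>

definition g_coeff :: "complex \<Rightarrow> nat \<Rightarrow> nat \<Rightarrow> int \<Rightarrow> complex" where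
  "g_coeff \<tau> b a k =
     (if k = 0 then (-1)^a * (1/2)^b
      else (-1)^b * nome \<tau> powi ((int b - int a) * k) / (1 - nome \<tau> powi k)^b)"

definition g :: "complex \<Rightarrow> nat \<Rightarrow> nat \<Rightarrow> complex \<Rightarrow> complex" where
  "g \<tau> b a = (SOME F. F nicely_meromorphic_on (- {0}) \<and>
     (\<forall>u. norm (nome \<tau>) ^ a < norm u \<and> norm u < norm (nome \<tau>) powi (int a - int b) \<longrightarrow>
        F u = (\<Sum>\<^sub>\<infinity>k\<in>UNIV. g_coeff \<tau> b a k * u powi k)))"

text \<open>\<open>chi0 chi i j\<close> is \<open>chi\<close> at \<open>i\<close> and \<open>j\<close>-bar, extended to the index \<open>0\<close>. The value at \<open>i = j = 0\<close>
  is never used.\<close>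

definition chi0 :: "(index \<Rightarrow> index \<Rightarrow> nat) \<Rightarrow> nat \<Rightarrow> nat \<Rightarrow> nat" where
  "chi0 chi i j = (if i = 0 then 0 else if j = 0 then 1 else chi (Idx i) (Bar j))"

text \<open>The sequence \<open>(k\<^sub>r, \<dots>, k\<^sub>1)\<close> is the list \<open>[k\<^sub>r, \<dots>, k\<^sub>1]\<close>, so that \<open>k\<^bsub>a+1\<^esub>\<close> stands
  immediately to the left of \<open>k\<^sub>a\<close>, and the cyclic successor of the last entry is the first.\<close>

definition chi_seq :: "(index \<Rightarrow> index \<Rightarrow> nat) \<Rightarrow> nat list \<Rightarrow> nat" where
  "chi_seq chi K = (\<Sum>j<length K. chi0 chi (K ! j) (K ! (Suc j mod length K)))"

definition G :: "(index \<Rightarrow> index \<Rightarrow> nat) \<Rightarrow> complex \<Rightarrow> nat set \<Rightarrow> (nat \<Rightarrow> complex) \<Rightarrow> complex" where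
  "G chi \<tau> S u = (\<Sum>K\<in>permutations_of_set S. g \<tau> (card S) (chi_seq chi K) (\<Prod>i\<in>S. u i))"

text \<open>The result of \<open>[u\<^sub>0\<^sup>0]\<close> on \<open>G\<^sub>S\<close> for a block \<open>S\<close> containing \<open>0\<close>: each \<open>g\<^sub>b\<^sub>,\<^sub>a\<close> is replaced
  by the constant term of its series.\<close>

definition G_u0 :: "(index \<Rightarrow> index \<Rightarrow> nat) \<Rightarrow> complex \<Rightarrow> nat set \<Rightarrow> complex" where
  "G_u0 chi \<tau> S = (\<Sum>K\<in>permutations_of_set S. g_coeff \<tau> (card S) (chi_seq chi K) 0)"

definition partitions_star :: "nat \<Rightarrow> nat set set set" where
  "partitions_star n = {P. partition_on {0..n} P \<and> {0} \<notin> P}"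

text \<open>\<open>[u\<^sub>0\<^sup>0] ((-1)\<^sup>\<pi> / \<bar>\<pi>\<bar> G\<^sub>\<pi>)\<close> for a partition \<open>\<pi>\<close> of \<open>{0..n}\<close>, which has \<open>n + 1\<close> elements.\<close>

definition partition_term ::
    "nat \<Rightarrow> (index \<Rightarrow> index \<Rightarrow> nat) \<Rightarrow> complex \<Rightarrow> (nat \<Rightarrow> complex) \<Rightarrow> nat set set \<Rightarrow> complex" where
  "partition_term n chi \<tau> u P =
     (-1) ^ (n + 1 - card P) *
     (\<Prod>S\<in>P. 1 / of_nat (card S) * (if 0 \<in> S then G_u0 chi \<tau> S else G chi \<tau> S u))"


section \<open>Quasi-elliptic functions\<close>

definition lattice :: "complex \<Rightarrow> complex set" where
  "lattice \<tau> = {2 * of_real pi * \<i> * of_int a + 2 * of_real pi * \<i> * \<tau> * of_int b | a b. True}"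

text \<open>Off these hyperplanes all functions \<open>\<theta>\<^sup>(\<^sup>k\<^sup>)/\<theta>\<close> of \<open>\<Sum>i\<in>I. z i\<close>, and all \<open>G\<^sub>S\<close> with \<open>0 \<notin> S\<close>,
  are holomorphic. It is a dense open subset of \<open>\<complex>\<^sup>n\<close>, on which identities between
  meromorphic functions are tested pointwise.\<close>

definition regular_points :: "nat \<Rightarrow> complex \<Rightarrow> (nat \<Rightarrow> complex) set" where
  "regular_points n \<tau> = {z \<in> Cn n. \<forall>I. I \<noteq> {} \<and> I \<subseteq> {1..n} \<longrightarrow> (\<Sum>i\<in>I. z i) \<notin> lattice \<tau>}"

text \<open>Eisenstein summation: the inner sum runs over multiples of \<open>2\<pi>\<i>\<close>, the outer one over
  multiples of \<open>2\<pi>\<i>\<tau>\<close>. For \<open>m \<ge> 4\<close> the double series converges absolutely and the order is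
  irrelevant.\<close>

definition eisenstein :: "nat \<Rightarrow> complex \<Rightarrow> complex" where
  "eisenstein m \<tau> = 1/2 * fact (m - 1) *
     (\<Sum>\<^sub>\<infinity>b\<in>(UNIV :: int set). \<Sum>\<^sub>\<infinity>a\<in>{a :: int. (a, b) \<noteq> (0, 0)}.
        1 / (2 * of_real pi * \<i> * of_int a + 2 * of_real pi * \<i> * \<tau> * of_int b) ^ m)"

text \<open>\<open>quasi_elliptic n m f\<close>: \<open>f\<close> is homogeneous of weight \<open>m\<close>. The functions depend on \<open>\<tau>\<close> as
  well as on \<open>z\<close>, and the scalars are independent of \<open>\<tau>\<close>: for a fixed \<open>\<tau>\<close> the Eisenstein
  series are mere numbers and there is no grading.\<close>

inductive quasi_elliptic ::
    "nat \<Rightarrow> nat \<Rightarrow> (complex \<Rightarrow> (nat \<Rightarrow> complex) \<Rightarrow> complex) \<Rightarrow> bool" for n :: nat where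
  zero: "quasi_elliptic n m (\<lambda>\<tau> z. 0)"
| const: "quasi_elliptic n 0 (\<lambda>\<tau> z. c)"
| eisenstein: "m \<in> {2, 4, 6} \<Longrightarrow> quasi_elliptic n m (\<lambda>\<tau> z. eisenstein m \<tau>)"
| theta: "k \<ge> 1 \<Longrightarrow> I \<noteq> {} \<Longrightarrow> I \<subseteq> {1..n} \<Longrightarrow>
    quasi_elliptic n k
      (\<lambda>\<tau> z. (deriv ^^ k) (theta \<tau>) (\<Sum>i\<in>I. z i) / theta \<tau> (\<Sum>i\<in>I. z i))"
| add: "quasi_elliptic n m f \<Longrightarrow> quasi_elliptic n m h \<Longrightarrow>
    quasi_elliptic n m (\<lambda>\<tau> z. f \<tau> z + h \<tau> z)"
| mult: "quasi_elliptic n m f \<Longrightarrow> quasi_elliptic n l h \<Longrightarrow>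
    quasi_elliptic n (m + l) (\<lambda>\<tau> z. f \<tau> z * h \<tau> z)"

text \<open>\<open>f\<close> is quasi-elliptic of mixed weight, with leading weight \<open>m\<close> and leading part \<open>L\<close>.\<close>

definition has_leading_part ::
    "nat \<Rightarrow> nat \<Rightarrow> (complex \<Rightarrow> (nat \<Rightarrow> complex) \<Rightarrow> complex)
       \<Rightarrow> (complex \<Rightarrow> (nat \<Rightarrow> complex) \<Rightarrow> complex) \<Rightarrow> bool" where
  "has_leading_part n m f L \<longleftrightarrow>
     quasi_elliptic n m L \<and>
     (\<exists>\<tau> z. Im \<tau> > 0 \<and> z \<in> regular_points n \<tau> \<and> L \<tau> z \<noteq> 0) \<and>
     (\<exists>c. (\<forall>k<m. quasi_elliptic n k (c k)) \<and>
        (\<forall>\<tau> z. Im \<tau> > 0 \<and> z \<in> regular_points n \<tau> \<longrightarrow> f \<tau> z = L \<tau> z + (\<Sum>k<m. c k \<tau> z)))"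

end

theory Submission
  imports Defs
begin

text \<open>By Frobenius' formula, \<open>\<varpi>\<close> is, up to a factor \<open>\<theta>(t) / \<theta>(t + \<Sum>z)\<close>, the determinant of the Kronecker
  functions \<open>\<theta>(x + t) / (\<theta>(x) \<theta>(t))\<close> at \<open>x = z\<^sub>i + w\<^sub>i - w\<^sub>j\<close>. Their Fourier expansions turn the constant
  term in \<open>v\<close> of each cycle of the determinant into a single series, a deformation of \<open>g\<close> in \<open>t\<close>. As
  \<open>t \<rightarrow> 0\<close> only the Fourier modes \<open>0\<close> are singular; their singular part has rank one, and its residue
  is the contribution of the block containing \<open>0\<close>. The functions \<open>g\<close> are combinations, with coefficients
  independent of \<open>\<tau>\<close>, of the Taylor coefficients in \<open>t\<close> of the Kronecker function; these are
  quasi-elliptic because the addition theorem expresses the higher derivatives of \<open>\<theta>\<close> at \<open>0\<close> by the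
  third one, a multiple of the second Eisenstein series.\<close>

section \<open>Sums over set partitions\<close>

text \<open>The parameter t is forced: \<varpi> itself has no expansion that decouples the variables
  v_j, the determinant has one. But the factor theta(t) / theta(t + sum of z) vanishes at t = 0 for
  generic z and is compensated only by the simple pole of the mode-0 entries. The integral does not
  depend on t, so the limit t -> 0 may be taken through values of t at which all pivots of the
  determinant are nonzero. The factor 4 comes from the border that the index 0 adds to a determinant
  with entries 1/2 - \<chi>: its row is 1/2 and its column is -1/2. Since \<open>T\<close> is a
  choice, the computation on a torus must be complemented by existence, with the prescribed values
  at removable singularities, and by uniqueness at regular points. The region may lie over points of
  the polar hyperplanes, so existence is not automatic. The leading weight is n - 1 because the
  block of 0 absorbs at least one index and carries only a constant. It does not see the ordering
  because \<chi> enters g_{b,a} only below its top Taylor coefficient.\<close>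

definition partition_sum :: "('a set => complex) => 'a set => complex" where
  "partition_sum f A = (\<Sum>P | partition_on A P. \<Prod>S\<in>P. f S)"

lemma partition_sum_empty [simp]: "partition_sum f {} = 1"
proof -
  have "{P. partition_on ({}::'a set) P} = {{}}"
    by (auto simp: partition_on_empty)
  thus ?thesis by (simp add: partition_sum_def)
qed

lemma partition_sum_cong:
  assumes "\<And>S. S \<subseteq> A ==> S \<noteq> {} ==> f S = h S"
  shows "partition_sum f A = partition_sum h A"
  unfolding partition_sum_def
proof (rule sum.cong[OF refl], rule prod.cong[OF refl])
  fix P S assume "P \<in> {P. partition_on A P}" "S \<in> P"
  thus "f S = h S"
    using assms[of S] by (auto simp: partition_on_def)
qed

text \<open>The summation variable \<open>S\<close> is the rest of the block containing \<open>r\<close>.\<close>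

lemma partition_sum_insert:
  assumes "finite A" "r \<notin> A"
  shows "partition_sum f (insert r A) = (\<Sum>S\<in>Pow A. f (insert r S) * partition_sum f (A - S))"
proof -
  define X where "X = (SIGMA S:Pow A. {P. partition_on (A - S) P})"
  have finX: "finite (Pow A)" "\<And>S. S \<in> Pow A ==> finite {P. partition_on (A - S) P}"
    using assms by (auto intro!: finitely_many_partition_on)
  have o_notin: "insert r S \<notin> P" if "partition_on (A - S') P" for S S' P
    using that assms(2) by (auto simp: partition_on_def)
  have bij: "bij_betw (\<lambda>(S, P). insert (insert r S) P) X {P. partition_on (insert r A) P}"
  proof (rule bij_betwI')
    fix x y assume x: "x \<in> X" and y: "y \<in> X"
    obtain S P S' P' where xy: "x = (S, P)" "y = (S', P')" by (cases x, cases y) auto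
    have P: "S \<subseteq> A" "partition_on (A - S) P" "S' \<subseteq> A" "partition_on (A - S') P'"
      using x y by (auto simp: X_def xy)
    show "((case x of (S, P) => insert (insert r S) P) = (case y of (S, P) => insert (insert r S) P)) = (x = y)"
    proof
      assume eq: "(case x of (S, P) => insert (insert r S) P) = (case y of (S, P) => insert (insert r S) P)"
      hence e: "insert (insert r S) P = insert (insert r S') P'" by (simp add: xy)
      \<comment> \<open>The block through \<open>r\<close> is the only block containing
        \<open>r\<close>, so the pair is recovered from the enlarged partition.\<close>
      have 1: "{B \<in> insert (insert r S) P. r \<in> B} = {insert r S}"
        using P(2) assms(2) by (auto simp: partition_on_def)
      have 2: "{B \<in> insert (insert r S') P'. r \<in> B} = {insert r S'}"
        using P(4) assms(2) by (auto simp: partition_on_def)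
      have "insert r S = insert r S'" using 1 2 e by auto
      hence SS: "S = S'" using P(1,3) assms(2) by (metis insert_ident subsetD)
      have "P = P'" using e o_notin[OF P(2)] o_notin[OF P(4)] unfolding SS
        by (metis insert_ident)
      thus "x = y" by (simp add: xy SS)
    qed auto
  next
    fix x assume "x \<in> X"
    then obtain S P where x: "x = (S, P)" "S \<subseteq> A" "partition_on (A - S) P" by (auto simp: X_def)
    have "disjnt (insert r S) (\<Union>P)" using x(3) assms(2) by (auto simp: partition_on_def disjnt_def)
    hence "partition_on (insert r A) (insert (insert r S) P)"
      using x assms(2) by (subst partition_on_insert) (auto simp: insert_Diff_if Diff_insert2[symmetric])
    thus "(case x of (S, P) => insert (insert r S) P) \<in> {P. partition_on (insert r A) P}"
      by (simp add: x)
  next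
    fix R assume "R \<in> {P. partition_on (insert r A) P}"
    hence R: "partition_on (insert r A) R" by simp
    then obtain B where B: "B \<in> R" "r \<in> B" unfolding partition_on_def by blast
    define S P where "S = B - {r}" and "P = R - {B}"
    have RB: "R = insert B P" "B = insert r S" using B by (auto simp: P_def S_def)
    have "disjnt B (\<Union>P)"
      using R B(1) unfolding partition_on_def P_def disjoint_def disjnt_def by blast
    hence "partition_on (insert r A - B) P \<and> B \<subseteq> insert r A \<and> B \<noteq> {}"
      using R unfolding RB(1) by (subst (asm) partition_on_insert) auto
    moreover have "insert r A - B = A - S" using B(2) assms(2) by (auto simp: S_def)
    ultimately have "partition_on (A - S) P" "S \<subseteq> A" by (auto simp: S_def)
    thus "\<exists>x\<in>X. R = (case x of (S, P) => insert (insert r S) P)"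
      by (intro bexI[of _ "(S, P)"]) (auto simp: X_def RB)
  qed
  have "partition_sum f (insert r A) = (\<Sum>x\<in>X. \<Prod>S\<in>(case x of (S, P) => insert (insert r S) P). f S)"
    unfolding partition_sum_def using sum.reindex_bij_betw[OF bij, of "\<lambda>P. \<Prod>S\<in>P. f S"] by simp
  also have "\<dots> = (\<Sum>x\<in>X. case x of (S, P) => f (insert r S) * (\<Prod>S\<in>P. f S))"
  proof (rule sum.cong[OF refl])
    fix x assume "x \<in> X"
    then obtain S P where x: "x = (S, P)" "S \<subseteq> A" "partition_on (A - S) P" by (auto simp: X_def)
    have "finite P" using x(3) assms(1) by (meson finite_Diff finite_elements)
    thus "(\<Prod>S\<in>(case x of (S, P) => insert (insert r S) P). f S)
           = (case x of (S, P) => f (insert r S) * (\<Prod>S\<in>P. f S))"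
      using o_notin[OF x(3)] by (simp add: x(1))
  qed
  also have "\<dots> = (\<Sum>S\<in>Pow A. \<Sum>P | partition_on (A - S) P. f (insert r S) * (\<Prod>S\<in>P. f S))"
    unfolding X_def using finX by (subst sum.Sigma) auto
  finally show ?thesis by (simp add: partition_sum_def sum_distrib_left)
qed

text \<open>Every partition has a block through \<open>r\<close>, and that block contributes a zero
  factor. This discards the terms in which the element 0 is left to a function vanishing on all
  blocks that contain 0.\<close>

lemma partition_sum_eq_0:
  assumes "finite A" "r \<in> A" "\<And>S. S \<subseteq> A ==> r \<in> S ==> f S = 0"
  shows "partition_sum f A = 0"
proof -
  have "partition_sum f (insert r (A - {r})) = 0"
    using assms by (subst partition_sum_insert) (auto intro!: sum.neutral assms(3))
  moreover have "insert r (A - {r}) = A" using assms by auto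
  ultimately show ?thesis by simp
qed

lemma sum_Pow_insert:
  assumes "finite A" "r \<notin> A"
  shows "(\<Sum>B\<in>Pow (insert r A). f B) = (\<Sum>B\<in>Pow A. f B) + (\<Sum>B\<in>Pow A. f (insert r B) :: complex)"
proof -
  have "inj_on (insert r) (Pow A)" using assms(2) by (auto simp: inj_on_def)
  thus ?thesis unfolding Pow_insert using assms
    by (subst sum.union_disjoint) (auto simp: sum.reindex)
qed

text \<open>Both sides run over ordered pairs of disjoint subsets; the right side records such a
  pair by its union and its first member.\<close>

lemma sum_Pow_Pow_diff:
  assumes "finite A"
  shows "(\<Sum>S\<in>Pow A. \<Sum>B\<in>Pow (A - S). f S B) = (\<Sum>B\<in>Pow A. \<Sum>S\<in>Pow B. f S (B - S) :: complex)"
proof -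
  have "(\<Sum>S\<in>Pow A. \<Sum>B\<in>Pow (A - S). f S B) = (\<Sum>(S,B)\<in>(SIGMA S:Pow A. Pow (A - S)). f S B)"
    using assms by (subst sum.Sigma) auto
  also have "\<dots> = (\<Sum>(B,S)\<in>(SIGMA B:Pow A. Pow B). f S (B - S))"
    by (rule sum.reindex_bij_witness[where i = "\<lambda>(B,S). (S, B - S)" and j = "\<lambda>(S,B). (S \<union> B, S)"])
       (auto simp: Un_Diff Diff_triv Int_commute intro!: arg_cong2[where f = f])
  also have "\<dots> = (\<Sum>B\<in>Pow A. \<Sum>S\<in>Pow B. f S (B - S))"
    using assms by (subst sum.Sigma) (auto intro: finite_subset)
  finally show ?thesis .
qed

lemma sum_Pow_compl:
  "(\<Sum>B\<in>Pow A. f B) = (\<Sum>B\<in>Pow A. f (A - B) :: complex)"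
  by (rule sum.reindex_bij_witness[where i = "\<lambda>B. A - B" and j = "\<lambda>B. A - B"])
     (auto simp: Diff_Diff_Int Int_absorb1)

text \<open>\<open>partition_sum\<close> is the exponential of a set function in the algebra of
  subset convolution, so a sum in the exponent becomes a convolution product. It separates the
  blocks that carry mode 0 from those that carry the nonzero modes. The induction follows the block
  of one element r and asks which of the two summands that block received.\<close>

lemma partition_sum_add:
  assumes "finite A"
  shows "partition_sum (\<lambda>S. f S + h S) A
          = (\<Sum>B\<in>Pow A. partition_sum f B * partition_sum h (A - B))"
  using assms
proof (induction "card A" arbitrary: A rule: less_induct)
  case less
  show ?case
  proof (cases "A = {}")
    case False
    then obtain r where r: "r \<in> A" by blast
    define A' where "A' = A - {r}"
    have A: "A = insert r A'" "r \<notin> A'" "finite A'" using r less.prems by (auto simp: A'_def)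
    have cardA: "card (A' - S) < card A" for S
      using A by (simp add: le_imp_less_Suc card_mono)
    let ?h = "partition_sum (\<lambda>S. f S + h S)"
    let ?F = "partition_sum f" and ?G = "partition_sum h"
    have 1: "?h A = (\<Sum>S\<in>Pow A'. \<Sum>B\<in>Pow (A' - S). f (insert r S) * (?F B * ?G (A' - S - B)))
                + (\<Sum>S\<in>Pow A'. \<Sum>B\<in>Pow (A' - S). h (insert r S) * (?F B * ?G (A' - S - B)))"
      using A by (simp add: partition_sum_insert less.hyps[OF cardA] ring_distribs sum.distrib sum_distrib_left)
    have 2: "(\<Sum>S\<in>Pow A'. \<Sum>B\<in>Pow (A' - S). f (insert r S) * (?F B * ?G (A' - S - B)))
        = (\<Sum>B\<in>Pow A'. ?F (insert r B) * ?G (A' - B))"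
    proof (subst sum_Pow_Pow_diff[OF A(3)], rule sum.cong[OF refl])
      fix B assume "B \<in> Pow A'"
      hence B: "finite B" "r \<notin> B" "B \<subseteq> A'" using A by (auto intro: finite_subset)
      have "A' - S - (B - S) = A' - B" if "S \<in> Pow B" for S using that by auto
      thus "(\<Sum>S\<in>Pow B. f (insert r S) * (?F (B - S) * ?G (A' - S - (B - S)))) = ?F (insert r B) * ?G (A' - B)"
        using B by (simp add: partition_sum_insert sum_distrib_right mult.assoc)
    qed
    have 3: "(\<Sum>S\<in>Pow A'. \<Sum>B\<in>Pow (A' - S). h (insert r S) * (?F B * ?G (A' - S - B)))
        = (\<Sum>B\<in>Pow A'. ?F B * ?G (insert r (A' - B)))"
    proof -
      have "(\<Sum>S\<in>Pow A'. \<Sum>B\<in>Pow (A' - S). h (insert r S) * (?F B * ?G (A' - S - B)))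
        = (\<Sum>S\<in>Pow A'. \<Sum>B\<in>Pow (A' - S). h (insert r S) * (?F (A' - S - B) * ?G B))"
        by (rule sum.cong[OF refl], subst sum_Pow_compl) (auto intro!: sum.cong simp: Diff_Diff_Int Int_absorb1)
      also have "\<dots> = (\<Sum>B\<in>Pow A'. ?F (A' - B) * ?G (insert r B))"
      proof (subst sum_Pow_Pow_diff[OF A(3)], rule sum.cong[OF refl])
        fix B assume "B \<in> Pow A'"
        hence B: "finite B" "r \<notin> B" "B \<subseteq> A'" using A by (auto intro: finite_subset)
        have "A' - S - (B - S) = A' - B" if "S \<in> Pow B" for S using that by auto
        thus "(\<Sum>S\<in>Pow B. h (insert r S) * (?F (A' - S - (B - S)) * ?G (B - S))) = ?F (A' - B) * ?G (insert r B)"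
          using B by (simp add: partition_sum_insert sum_distrib_right sum_distrib_left mult_ac)
      qed
      also have "\<dots> = (\<Sum>B\<in>Pow A'. ?F B * ?G (insert r (A' - B)))"
        by (subst sum_Pow_compl) (auto intro!: sum.cong simp: Diff_Diff_Int Int_absorb1)
      finally show ?thesis .
    qed
    have 4: "insert r A' - B = insert r (A' - B)" if "B \<in> Pow A'" for B using that A by auto
    have 5: "insert r A' - insert r B = A' - B" for B using A by auto
    have "(\<Sum>B\<in>Pow A. ?F B * ?G (A - B)) = (\<Sum>B\<in>Pow A'. ?F B * ?G (insert r (A' - B)))
            + (\<Sum>B\<in>Pow A'. ?F (insert r B) * ?G (A' - B))"
      unfolding A(1) sum_Pow_insert[OF A(3,2)]
      by (intro arg_cong2[where f = "(+)"] sum.cong refl) (simp_all only: 4 5)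
    thus ?thesis by (simp add: 1 2 3)
  qed auto
qed


section \<open>Determinants over finite index sets\<close>

text \<open>The index set is an argument, not a type, because the proof runs through principal
  minors over all subsets of {1..n} and over such subsets enlarged by 0.\<close>

definition dt :: "'a set => ('a => 'a => complex) => complex" where
  "dt A M = (\<Sum>p | p permutes A. of_int (sign p) * (\<Prod>i\<in>A. M i (p i)))"

lemma dt_empty [simp]: "dt {} M = 1"
  by (simp add: dt_def)

lemma dt_cong:
  assumes "\<And>i j. i \<in> A ==> j \<in> A ==> M i j = N i j"
  shows "dt A M = dt A N"
  unfolding dt_def
  by (intro sum.cong refl arg_cong2[where f = "(*)"] prod.cong assms) (auto dest: permutes_in_image)

text \<open>Expansion along row \<open>r\<close>, by writing a permutation of
  \<open>insert r A\<close> as a transposition of r and b after a permutation of A. The minor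
  without row r and column b appears as the determinant over A in which column b is overwritten by
  column r. Rows and columns thus keep their names, and the sign is -1 for every b.\<close>

lemma dt_insert:
  assumes "finite A" "r \<notin> A"
  shows "dt (insert r A) M
    = M r r * dt A M - (\<Sum>b\<in>A. M r b * dt A (\<lambda>i j. if j = b then M i r else M i j))"
proof -
  have p_o: "p r = r" if "p permutes A" for p using that assms(2) by (auto simp: permutes_def)
  have part_o: "(\<Sum>q | q permutes A. of_int (sign (Transposition.transpose r r \<circ> q)) * (\<Prod>i\<in>insert r A. M i ((Transposition.transpose r r \<circ> q) i)))
     = M r r * dt A M"
    unfolding dt_def sum_distrib_left using assms by (intro sum.cong refl) (auto simp: p_o mult_ac)
  have part_b: "(\<Sum>q | q permutes A. of_int (sign (Transposition.transpose r b \<circ> q)) * (\<Prod>i\<in>insert r A. M i ((Transposition.transpose r b \<circ> q) i)))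
     = - (M r b * dt A (\<lambda>i j. if j = b then M i r else M i j))" if b: "b \<in> A" for b
    unfolding dt_def sum_distrib_left sum_negf[symmetric]
  proof (intro sum.cong refl)
    fix q assume "q \<in> {p. p permutes A}"
    hence q: "q permutes A" by simp
    have ob: "r \<noteq> b" using b assms by auto
    have "permutation q" "permutation (Transposition.transpose r b)"
      using q assms(1) permutation_permutes by (auto intro: permutation_swap_id)
    hence s: "sign (Transposition.transpose r b \<circ> q) = - sign q"
      using ob by (simp add: sign_compose sign_swap_id)
    \<comment> \<open>The index that \<open>q\<close> sends to b is redirected to r, and r, which
      \<open>q\<close> fixes, is sent to b.\<close>
    have "(\<Prod>i\<in>insert r A. M i ((Transposition.transpose r b \<circ> q) i)) = M r b * (\<Prod>i\<in>A. if q i = b then M i r else M i (q i))"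
    proof (subst prod.insert[OF assms], rule arg_cong2[where f = "(*)"])
      show "M r ((Transposition.transpose r b \<circ> q) r) = M r b" using p_o[OF q] by simp
      show "(\<Prod>i\<in>A. M i ((Transposition.transpose r b \<circ> q) i)) = (\<Prod>i\<in>A. if q i = b then M i r else M i (q i))"
      proof (rule prod.cong[OF refl])
        fix i assume "i \<in> A"
        hence "q i \<noteq> r" using permutes_in_image[OF q, of i] assms(2) by metis
        thus "M i ((Transposition.transpose r b \<circ> q) i) = (if q i = b then M i r else M i (q i))"
          by (simp add: Transposition.transpose_def)
      qed
    qed
    thus "of_int (sign (Transposition.transpose r b \<circ> q)) * (\<Prod>i\<in>insert r A. M i ((Transposition.transpose r b \<circ> q) i)) =
       - (M r b * (of_int (sign q) * (\<Prod>i\<in>A. if q i = b then M i r else M i (q i))))"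
      by (simp add: s mult_ac)
  qed
  have "dt (insert r A) M = (\<Sum>b\<in>insert r A. \<Sum>q | q permutes A.
      of_int (sign (Transposition.transpose r b \<circ> q)) * (\<Prod>i\<in>insert r A. M i ((Transposition.transpose r b \<circ> q) i)))"
    unfolding dt_def by (rule sum_over_permutations_insert[OF assms])
  also have "\<dots> = M r r * dt A M + (\<Sum>b\<in>A. - (M r b * dt A (\<lambda>i j. if j = b then M i r else M i j)))"
    by (subst sum.insert[OF assms], intro arg_cong2[where f = "(+)"] part_o sum.cong refl part_b)
  finally show ?thesis by (simp add: sum_negf)
qed

lemma dt_column_linear:
  assumes "finite A" "b \<in> A"
  shows "dt A (\<lambda>i j. if j = b then x i + c * y i else M i j)
       = dt A (\<lambda>i j. if j = b then x i else M i j) + c * dt A (\<lambda>i j. if j = b then y i else M i j)"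
  unfolding dt_def sum_distrib_left sum.distrib[symmetric]
proof (rule sum.cong[OF refl])
  fix p assume "p \<in> {p. p permutes A}"
  hence p: "p permutes A" by simp
  then obtain a where a: "a \<in> A" "p a = b" using assms(2) by (metis permutes_image imageE)
  have other: "p i = b \<longleftrightarrow> i = a" for i using a permutes_inj[OF p] by (auto dest: injD)
  have *: "(\<Prod>i\<in>A. if p i = b then z i else M i (p i)) = z a * (\<Prod>i\<in>A-{a}. M i (p i))" for z
    using assms(1) a by (subst prod.remove[of _ a]) (auto simp: other intro!: prod.cong)
  show "of_int (sign p) * (\<Prod>i\<in>A. if p i = b then x i + c * y i else M i (p i)) =
          of_int (sign p) * (\<Prod>i\<in>A. if p i = b then x i else M i (p i)) +
          c * (of_int (sign p) * (\<Prod>i\<in>A. if p i = b then y i else M i (p i)))"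
    unfolding * by (simp add: algebra_simps)
qed

text \<open>Composition with the transposition of b and c keeps every product and reverses the sign,
  so the determinant equals its own negative.\<close>

lemma dt_equal_columns:
  assumes "finite A" "b \<in> A" "c \<in> A" "b \<noteq> c" "\<And>i. i \<in> A ==> M i b = M i c"
  shows "dt A M = 0"
proof -
  have tt: "Transposition.transpose b c \<circ> (Transposition.transpose b c \<circ> p) = p" for p :: "'a => 'a"
    by (simp add: fun_eq_iff)
  have "dt A M = (\<Sum>p | p permutes A. of_int (sign (Transposition.transpose b c \<circ> p)) * (\<Prod>i\<in>A. M i ((Transposition.transpose b c \<circ> p) i)))"
    unfolding dt_def
    by (rule sum.reindex_bij_witness[where i = "\<lambda>p. Transposition.transpose b c \<circ> p" and j = "\<lambda>p. Transposition.transpose b c \<circ> p"])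
       (auto simp: tt intro!: permutes_compose permutes_swap_id assms)
  also have "\<dots> = - dt A M"
    unfolding dt_def sum_negf[symmetric]
  proof (rule sum.cong[OF refl])
    fix p assume "p \<in> {p. p permutes A}"
    hence p: "p permutes A" by simp
    have "permutation p" "permutation (Transposition.transpose b c)"
      using p assms(1) permutation_permutes by (auto intro: permutation_swap_id)
    hence s: "sign (Transposition.transpose b c \<circ> p) = - sign p"
      using assms(4) by (simp add: sign_compose sign_swap_id)
    have "(\<Prod>i\<in>A. M i ((Transposition.transpose b c \<circ> p) i)) = (\<Prod>i\<in>A. M i (p i))"
      using assms(5) by (intro prod.cong refl) (auto simp: Transposition.transpose_def)
    thus "of_int (sign (Transposition.transpose b c \<circ> p)) * (\<Prod>i\<in>A. M i ((Transposition.transpose b c \<circ> p) i)) = - (of_int (sign p) * (\<Prod>i\<in>A. M i (p i)))"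
      by (simp add: s)
  qed
  finally show ?thesis by simp
qed

lemma dt_column_add_multiples:
  assumes "finite A" "b \<in> A" "finite B" "B \<subseteq> A" "b \<notin> B"
  shows "dt A (\<lambda>i j. if j = b then s i else if j \<in> B then M i j + s i * l j else M i j)
       = dt A (\<lambda>i j. if j = b then s i else M i j)"
  using assms(3-)
proof (induction B rule: finite_induct)
  case (insert c B)
  let ?N = "\<lambda>i j. if j = b then s i else if j \<in> B then M i j + s i * l j else M i j"
  have "dt A (\<lambda>i j. if j = b then s i else if j \<in> insert c B then M i j + s i * l j else M i j)
      = dt A (\<lambda>i j. if j = c then M i c + l c * s i else ?N i j)"
    using insert by (intro dt_cong) auto
  also have "\<dots> = dt A (\<lambda>i j. if j = c then M i c else ?N i j) + l c * dt A (\<lambda>i j. if j = c then s i else ?N i j)"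
    using insert assms by (intro dt_column_linear) auto
  also have "dt A (\<lambda>i j. if j = c then s i else ?N i j) = 0"
    using insert assms by (intro dt_equal_columns[of A b c]) auto
  also have "dt A (\<lambda>i j. if j = c then M i c else ?N i j) = dt A ?N"
    using insert by (intro dt_cong) auto
  finally show ?case using insert by simp
next
  case empty
  show ?case by (rule dt_cong) simp
qed

text \<open>The matrix determinant lemma: by linearity in the columns, a term in which two columns
  are replaced by s vanishes. It serves twice, for the Schur complement and for the pole of the
  mode-0 matrix at t = 0, whose singular part has rank one.\<close>

lemma dt_rank_one_update:
  assumes "finite A"
  shows "dt A (\<lambda>i j. M i j + s i * l j)
       = dt A M + (\<Sum>b\<in>A. l b * dt A (\<lambda>i j. if j = b then s i else M i j))"
proof -
  have "dt A (\<lambda>i j. if j \<in> B then M i j + s i * l j else M i j)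
       = dt A M + (\<Sum>b\<in>B. l b * dt A (\<lambda>i j. if j = b then s i else M i j))" if "finite B" "B \<subseteq> A" for B
    using that
  proof (induction B rule: finite_induct)
    case (insert b B)
    let ?N = "\<lambda>i j. if j \<in> B then M i j + s i * l j else M i j"
    have "dt A (\<lambda>i j. if j \<in> insert b B then M i j + s i * l j else M i j)
       = dt A (\<lambda>i j. if j = b then M i b + l b * s i else ?N i j)"
      by (intro dt_cong) auto
    also have "\<dots> = dt A (\<lambda>i j. if j = b then M i b else ?N i j) + l b * dt A (\<lambda>i j. if j = b then s i else ?N i j)"
      using insert assms by (intro dt_column_linear) auto
    also have "dt A (\<lambda>i j. if j = b then M i b else ?N i j) = dt A ?N"
      using insert by (intro dt_cong) auto
    \<comment> \<open>With column b equal to s, the multiples of s added to the earlier columns can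
      be subtracted again.\<close>
    also have "dt A (\<lambda>i j. if j = b then s i else ?N i j) = dt A (\<lambda>i j. if j = b then s i else M i j)"
      using insert assms by (intro dt_column_add_multiples) auto
    finally show ?case using insert by simp
  qed simp
  from this[of A] have "dt A (\<lambda>i j. if j \<in> A then M i j + s i * l j else M i j)
       = dt A M + (\<Sum>b\<in>A. l b * dt A (\<lambda>i j. if j = b then s i else M i j))" using assms by simp
  moreover have "dt A (\<lambda>i j. if j \<in> A then M i j + s i * l j else M i j) = dt A (\<lambda>i j. M i j + s i * l j)"
    by (intro dt_cong) auto
  ultimately show ?thesis by simp
qed

text \<open>Eliminating the pivot is a rank-one update by column r, and its correction terms are
  those of the expansion along row r.\<close>

lemma dt_Schur_complement:
  assumes "finite A" "r \<notin> A" "M r r \<noteq> 0"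
  shows "dt (insert r A) M = M r r * dt A (\<lambda>i j. M i j - M i r * M r j / M r r)"
proof -
  have "dt A (\<lambda>i j. M i j - M i r * M r j / M r r) = dt A (\<lambda>i j. M i j + M i r * (- M r j / M r r))"
    by (intro dt_cong) simp
  also have "\<dots> = dt A M - (\<Sum>b\<in>A. M r b / M r r * dt A (\<lambda>i j. if j = b then M i r else M i j))"
    by (subst dt_rank_one_update[OF assms(1)]) (simp add: sum_negf)
  finally show ?thesis using assms
    by (simp add: dt_insert right_diff_distrib sum_distrib_left)
qed

lemma dt_scale:
  "dt A (\<lambda>i j. a i * b j * M i j) = (\<Prod>i\<in>A. a i) * (\<Prod>j\<in>A. b j) * dt A M"
  unfolding dt_def sum_distrib_left
proof (rule sum.cong[OF refl])
  fix p assume "p \<in> {p. p permutes A}"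
  hence "(\<Prod>i\<in>A. b (p i)) = (\<Prod>i\<in>A. b i)" using prod.permute[of p A b] by (simp add: o_def)
  thus "of_int (sign p) * (\<Prod>i\<in>A. a i * b (p i) * M i (p i)) =
         prod a A * prod b A * (of_int (sign p) * (\<Prod>i\<in>A. M i (p i)))"
    by (simp add: prod.distrib)
qed


section \<open>Cycle expansion of determinants\<close>

definition cyc :: "('a => 'a => complex) => 'a list => complex" where
  "cyc M K = (\<Prod>j<length K. M (K ! j) (K ! (Suc j mod length K)))"

text \<open>Weight of a path from its starting vertex through the listed ones, where
  \<open>s\<close> weighs the last vertex. If \<open>s\<close> is the column of the starting vertex,
  the path closes to a cycle; for general \<open>s\<close> it ends in a replaced column.\<close>

fun chain :: "('a => 'a => complex) => ('a => complex) => 'a => 'a list => complex" where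
  "chain M s a [] = s a"
| "chain M s a (b # L) = M a b * chain M s b L"

lemma chain_conv_prod:
  "chain M s a L = (\<Prod>j<length L. M ((a # L) ! j) (L ! j)) * s (last (a # L))"
proof (induction L arbitrary: a)
  case (Cons b L)
  thus ?case by (simp add: prod.lessThan_Suc_shift mult.assoc del: prod.lessThan_Suc)
qed simp

lemma cyc_Cons: "cyc M (a # L) = chain M (\<lambda>i. M i a) a L"
proof -
  have "cyc M (a # L) = (\<Prod>j<length L. M ((a # L) ! j) ((a # L) ! (Suc j mod Suc (length L)))) * M ((a # L) ! length L) a"
    by (simp add: cyc_def)
  also have "(\<Prod>j<length L. M ((a # L) ! j) ((a # L) ! (Suc j mod Suc (length L)))) = (\<Prod>j<length L. M ((a # L) ! j) (L ! j))"
    by (intro prod.cong refl) simp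
  also have "(a # L) ! length L = last (a # L)" by (simp add: last_conv_nth nth_Cons' )
  finally show ?thesis by (simp add: chain_conv_prod)
qed

lemma cyc_rotate1: "cyc M (rotate1 K) = cyc M K"
proof (cases K)
  case (Cons a L)
  show ?thesis
  proof (cases L)
    case (Cons b L')
    have 1: "chain M s x (L1 @ [a]) = chain M (\<lambda>i. M i a * s a) x L1" for s x L1
      by (induction L1 arbitrary: x) auto
    have 2: "chain M (\<lambda>i. c i * d) x L1 = chain M c x L1 * d" for c d x L1
      by (induction L1 arbitrary: x) auto
    show ?thesis using \<open>K = a # L\<close> Cons by (simp add: cyc_Cons 1 2 del: chain.simps(1))
  qed (use Cons in simp)
qed simp

lemma cyc_rotate: "cyc M (rotate k K) = cyc M K"
  by (induction k) (simp_all add: cyc_rotate1)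

text \<open>Each cyclic arrangement of \<open>insert r A\<close> has exactly one rotation that
  starts at r, and rotation preserves \<open>cyc\<close>. The resulting factor cancels the 1/|S| in
  the weight of a block.\<close>

lemma sum_cyc_permutations:
  assumes "finite A" "r \<notin> A"
  shows "(\<Sum>K\<in>permutations_of_set (insert r A). cyc M K)
       = of_nat (Suc (card A)) * (\<Sum>L\<in>permutations_of_set A. cyc M (r # L))"
proof -
  let ?n = "Suc (card A)"
  have bij: "bij_betw (\<lambda>(k, L). rotate k (r # L)) ({..<?n} \<times> permutations_of_set A) (permutations_of_set (insert r A))"
    unfolding bij_betw_def
  proof
    have len: "length L = card A" if "L \<in> permutations_of_set A" for L
      using that by (rule length_finite_permutations_of_set)
    \<comment> \<open>The position of r after k rotations determines k, hence also the list.\<close>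
    have pos: "rotate k (r # L) ! ((?n - k) mod ?n) = r" if "k < ?n" "L \<in> permutations_of_set A" for k L
      using that len[OF that(2)] by (subst nth_rotate) (auto simp: mod_add_right_eq)
    show inj: "inj_on (\<lambda>(k, L). rotate k (r # L)) ({..<?n} \<times> permutations_of_set A)"
    proof (rule inj_onI, clarify)
      fix k L k' L' assume k: "k < ?n" "k' < ?n" and L: "L \<in> permutations_of_set A" "L' \<in> permutations_of_set A"
        and eq: "rotate k (r # L) = rotate k' (r # L')"
      have d: "distinct (rotate k (r # L))" "length (rotate k (r # L)) = ?n"
        using L(1) assms len[OF L(1)] by (auto dest: permutations_of_setD)
      have "rotate k (r # L) ! ((?n - k) mod ?n) = rotate k (r # L) ! ((?n - k') mod ?n)"
        using pos[OF k(1) L(1)] pos[OF k(2) L(2)] eq by simp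
      hence "(?n - k) mod ?n = (?n - k') mod ?n"
        using d nth_eq_iff_index_eq[OF d(1)] by simp
      moreover have "(?n - k) mod ?n = (if k = 0 then 0 else ?n - k)" "(?n - k') mod ?n = (if k' = 0 then 0 else ?n - k')" using k by auto
      ultimately have kk: "k = k'" using k by (auto split: if_splits)
      moreover have "rotate (?n - k) (rotate k (r # L)) = r # L" "rotate (?n - k) (rotate k (r # L')) = r # L'"
        using k len[OF L(1)] len[OF L(2)] by (simp_all add: rotate_rotate rotate_id del: rotate_Suc)
      ultimately show "k = k' \<and> L = L'" using eq kk by (metis list.inject)
    qed
    have sub: "(\<lambda>(k, L). rotate k (r # L)) ` ({..<?n} \<times> permutations_of_set A) \<subseteq> permutations_of_set (insert r A)"
      using assms by (auto simp: permutations_of_set_def)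
    show "(\<lambda>(k, L). rotate k (r # L)) ` ({..<?n} \<times> permutations_of_set A) = permutations_of_set (insert r A)"
    \<comment> \<open>Surjectivity by counting: both sides have (|A| + 1)! elements.\<close>
    proof (rule card_subset_eq[OF _ sub])
      show "card ((\<lambda>(k, L). rotate k (r # L)) ` ({..<?n} \<times> permutations_of_set A)) = card (permutations_of_set (insert r A))"
        using assms by (subst card_image[OF inj]) (simp add: card_cartesian_product)
    qed simp
  qed
  have "(\<Sum>K\<in>permutations_of_set (insert r A). cyc M K)
      = (\<Sum>x\<in>{..<?n} \<times> permutations_of_set A. cyc M (case x of (k, L) => rotate k (r # L)))"
    by (rule sum.reindex_bij_betw[OF bij, symmetric])
  also have "\<dots> = (\<Sum>(k,L)\<in>{..<?n} \<times> permutations_of_set A. cyc M (r # L))"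
    by (intro sum.cong refl) (simp only: cyc_rotate split: prod.splits, simp)
  also have "\<dots> = (\<Sum>k<?n. \<Sum>L\<in>permutations_of_set A. cyc M (r # L))"
    by (rule sum.cartesian_product[symmetric])
  finally show ?thesis by (simp only: sum_constant card_lessThan)
qed

text \<open>The first entry b of a nonempty list is split off, which gives the sum the shape of one
  expansion along a row.\<close>

lemma sum_permutations_subsets_insert:
  fixes F :: "'a list => 'a set => complex"
  assumes "finite A"
  shows "(\<Sum>S\<in>Pow A. \<Sum>L\<in>permutations_of_set S. F L (A - S))
    = F [] A + (\<Sum>b\<in>A. \<Sum>S\<in>Pow (A - {b}). \<Sum>L\<in>permutations_of_set S. F (b # L) (A - {b} - S))"
proof -
  have 1: "(\<Sum>L\<in>permutations_of_set S. F L (A - S))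
     = (\<Sum>b\<in>S. \<Sum>L\<in>permutations_of_set (S - {b}). F (b # L) (A - S))" if "S \<noteq> {}" "finite S" for S
  proof -
    have "permutations_of_set S = (\<Union>b\<in>S. (#) b ` permutations_of_set (S - {b}))"
      using permutations_of_set_nonempty[OF that(1)] by simp
    hence "(\<Sum>L\<in>permutations_of_set S. F L (A - S)) = (\<Sum>b\<in>S. \<Sum>L\<in>(#) b ` permutations_of_set (S - {b}). F L (A - S))"
      using that by (simp only:, subst sum.UNION_disjoint) auto
    also have "\<dots> = (\<Sum>b\<in>S. \<Sum>L\<in>permutations_of_set (S - {b}). F (b # L) (A - S))"
      by (rule sum.cong[OF refl], subst sum.reindex) (auto simp: inj_on_def)
    finally show ?thesis .
  qed
  have "(\<Sum>S\<in>Pow A. \<Sum>L\<in>permutations_of_set S. F L (A - S))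
     = F [] A + (\<Sum>S\<in>Pow A - {{}}. \<Sum>L\<in>permutations_of_set S. F L (A - S))"
    using assms by (subst sum.remove[of _ "{}"]) auto
  also have "(\<Sum>S\<in>Pow A - {{}}. \<Sum>L\<in>permutations_of_set S. F L (A - S))
     = (\<Sum>S\<in>Pow A - {{}}. \<Sum>b\<in>S. \<Sum>L\<in>permutations_of_set (S - {b}). F (b # L) (A - S))"
    using assms by (intro sum.cong refl 1) (auto intro: finite_subset)
  also have "\<dots> = (\<Sum>(S,b)\<in>(SIGMA S:Pow A - {{}}. S). \<Sum>L\<in>permutations_of_set (S - {b}). F (b # L) (A - S))"
    using assms by (subst sum.Sigma) (auto intro: finite_subset)
  also have "\<dots> = (\<Sum>(b,S)\<in>(SIGMA b:A. Pow (A - {b})). \<Sum>L\<in>permutations_of_set S. F (b # L) (A - {b} - S))"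
  proof (rule sum.reindex_bij_witness[where i = "\<lambda>(b,S). (insert b S, b)" and j = "\<lambda>(S,b). (b, S - {b})"])
    fix a assume "a \<in> (SIGMA b:A. Pow (A - {b}))"
    thus "(case case a of (b, S) => (insert b S, b) of (S, b) => (b, S - {b})) = a" by auto
  next
    fix a assume "a \<in> (SIGMA S:Pow A - {{}}. S)"
    moreover have "A - {b} - (S - {b}) = A - S" if "b \<in> S" for b S using that by auto
    ultimately show "(case case a of (S, b) => (b, S - {b}) of (b, S) => \<Sum>L\<in>permutations_of_set S. F (b # L) (A - {b} - S))
       = (case a of (S, b) => \<Sum>L\<in>permutations_of_set (S - {b}). F (b # L) (A - S))" by auto
  qed auto
  also have "\<dots> = (\<Sum>b\<in>A. \<Sum>S\<in>Pow (A - {b}). \<Sum>L\<in>permutations_of_set S. F (b # L) (A - {b} - S))"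
    using assms by (subst sum.Sigma) auto
  finally show ?thesis .
qed

text \<open>Iterated row expansion. Row r either uses the replaced column, which ends the path, or
  steps to an index b, after which column b is the replaced one on the smaller set. What remains at
  the end of the path is the determinant on the unvisited indices.\<close>

lemma dt_chain_expansion:
  assumes "finite A" "r \<notin> A"
  shows "dt (insert r A) (\<lambda>i j. if j = r then s i else M i j)
    = (\<Sum>S\<in>Pow A. \<Sum>L\<in>permutations_of_set S. (-1) ^ length L * chain M s r L * dt (A - S) M)"
  using assms
proof (induction "card A" arbitrary: A r rule: less_induct)
  case less
  have IH: "dt A (\<lambda>i j. if j = b then s i else M i j)
      = (\<Sum>S\<in>Pow (A - {b}). \<Sum>L\<in>permutations_of_set S. (-1) ^ length L * chain M s b L * dt (A - {b} - S) M)"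
    if b: "b \<in> A" for b
  proof -
    have "card (A - {b}) < card A" "b \<notin> A - {b}" "finite (A - {b})" "insert b (A - {b}) = A"
      using b less.prems card_Diff1_less[of A b] by auto
    thus ?thesis using less.hyps[of "A - {b}" b] by simp
  qed
  have "dt (insert r A) (\<lambda>i j. if j = r then s i else M i j)
    = s r * dt A M - (\<Sum>b\<in>A. M r b * dt A (\<lambda>i j. if j = b then s i else M i j))"
  proof -
    have "dt A (\<lambda>i j. if j = r then s i else M i j) = dt A M"
      using less.prems by (intro dt_cong) auto
    moreover have "dt A (\<lambda>i j. if j = b then if r = r then s i else M i r else if j = r then s i else M i j)
       = dt A (\<lambda>i j. if j = b then s i else M i j)" if "b \<in> A" for b
      using less.prems by (intro dt_cong) auto
    moreover have "b \<noteq> r" if "b \<in> A" for b using that less.prems by auto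
    ultimately show ?thesis using less.prems by (subst dt_insert) (auto intro!: sum.cong)
  qed
  also have "\<dots> = (\<Sum>S\<in>Pow A. \<Sum>L\<in>permutations_of_set S. (-1) ^ length L * chain M s r L * dt (A - S) M)"
    by (subst sum_permutations_subsets_insert[OF less.prems(1), of "\<lambda>L B. (-1) ^ length L * chain M s r L * dt B M"])
       (simp add: IH sum_distrib_left sum_negf mult_ac cong: sum.cong)
  finally show ?case .
qed

text \<open>The sign is that of a cycle of length |S|; the division by |S| corrects for summing over
  sequences, which list every cycle |S| times.\<close>

definition cycle_weight :: "('a => 'a => complex) => 'a set => complex" where
  "cycle_weight M S = (-1) ^ (card S - 1) / of_nat (card S) * (\<Sum>K\<in>permutations_of_set S. cyc M K)"

text \<open>A permutation is a partition into the supports of its cycles together with a cycle on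
  each block. In the induction, the path that leaves r and ends in the column of r is the cycle
  through r.\<close>

lemma dt_eq_partition_sum:
  assumes "finite A"
  shows "dt A M = partition_sum (cycle_weight M) A"
  using assms
proof (induction "card A" arbitrary: A rule: less_induct)
  case less
  show ?case
  proof (cases "A = {}")
    case False
    then obtain r where r: "r \<in> A" by blast
    define A' where "A' = A - {r}"
    have A: "A = insert r A'" "r \<notin> A'" "finite A'" using r less.prems by (auto simp: A'_def)
    have cardA: "card (A' - S) < card A" for S
      using A by (simp add: le_imp_less_Suc card_mono)
    have w: "cycle_weight M (insert r S) = (\<Sum>L\<in>permutations_of_set S. (-1) ^ length L * chain M (\<lambda>i. M i r) r L)"
      if "S \<in> Pow A'" for S
    proof -
      have S: "finite S" "r \<notin> S" using that A by (auto intro: finite_subset)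
      have "length L = card S" if "L \<in> permutations_of_set S" for L
        using that by (rule length_finite_permutations_of_set)
      thus ?thesis
        unfolding cycle_weight_def sum_cyc_permutations[OF S] using S
        by (simp add: cyc_Cons sum_distrib_left del: of_nat_Suc cong: sum.cong)
    qed
    have "dt A M = dt (insert r A') (\<lambda>i j. if j = r then M i r else M i j)"
      unfolding A(1) by (intro dt_cong) auto
    also have "\<dots> = (\<Sum>S\<in>Pow A'. \<Sum>L\<in>permutations_of_set S. (-1) ^ length L * chain M (\<lambda>i. M i r) r L * dt (A' - S) M)"
      by (rule dt_chain_expansion[OF A(3,2)])
    also have "\<dots> = (\<Sum>S\<in>Pow A'. cycle_weight M (insert r S) * partition_sum (cycle_weight M) (A' - S))"
      using less.hyps[OF cardA] A by (intro sum.cong refl) (simp add: w sum_distrib_right)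
    also have "\<dots> = partition_sum (cycle_weight M) A"
      using A by (simp add: partition_sum_insert)
    finally show ?thesis .
  qed auto
qed

section \<open>Infinite sums of holomorphic functions\<close>

lemma higher_deriv_sum:
  assumes "finite X" "\<And>k. k \<in> X ==> f k holomorphic_on A" "open A" "z \<in> A"
  shows "(deriv ^^ m) (\<lambda>w. \<Sum>k\<in>X. f k w) z = (\<Sum>k\<in>X. (deriv ^^ m) (f k) z)"
  using assms(1,2)
proof (induction X rule: finite_induct)
  case (insert k X)
  have "(deriv ^^ m) (\<lambda>w. f k w + (\<Sum>k\<in>X. f k w)) z = (deriv ^^ m) (f k) z + (deriv ^^ m) (\<lambda>w. \<Sum>k\<in>X. f k w) z"
    using insert assms by (intro higher_deriv_add[where S = A] holomorphic_intros) auto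
  thus ?case using insert by simp
qed (simp add: higher_deriv_const)

text \<open>The partial sums over finite subsets converge uniformly by the M-test, so the limit is
  holomorphic and derivatives may be taken term by term. The latter extracts Taylor coefficients in
  t from a Fourier series.\<close>

lemma
  assumes "open A" "\<And>k. k \<in> X ==> f k holomorphic_on A"
    and "\<And>k w. k \<in> X ==> w \<in> A ==> norm (f k w) \<le> M k" "M summable_on X"
  shows infsum_holomorphic: "(\<lambda>w. \<Sum>\<^sub>\<infinity>k\<in>X. f k w) holomorphic_on A"
    and has_sum_higher_deriv:
      "z \<in> A ==> ((\<lambda>k. (deriv ^^ m) (f k) z) has_sum (deriv ^^ m) (\<lambda>w. \<Sum>\<^sub>\<infinity>k\<in>X. f k w) z) X"
proof -
  have ul: "uniform_limit A (\<lambda>Y w. \<Sum>k\<in>Y. f k w) (\<lambda>w. \<Sum>\<^sub>\<infinity>k\<in>X. f k w) (finite_subsets_at_top X)"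
    using assms(3,4) by (rule Weierstrass_m_test_general)
  have ev: "\<forall>\<^sub>F Y in finite_subsets_at_top X. finite Y \<and> Y \<subseteq> X"
    by (rule eventually_finite_subsets_at_top_weakI) auto
  have hol: "\<forall>\<^sub>F Y in finite_subsets_at_top X. (\<lambda>w. \<Sum>k\<in>Y. f k w) holomorphic_on A"
    using ev by eventually_elim (use assms(2) in \<open>auto intro!: holomorphic_intros\<close>)
  show "(\<lambda>w. \<Sum>\<^sub>\<infinity>k\<in>X. f k w) holomorphic_on A"
  proof (subst holomorphic_on_open[OF assms(1)], intro ballI)
    fix z assume "z \<in> A"
    then obtain e where e: "e > 0" "cball z e \<subseteq> A" using assms(1) open_contains_cball by blast
    have "\<forall>\<^sub>F Y in finite_subsets_at_top X. continuous_on (cball z e) (\<lambda>w. \<Sum>k\<in>Y. f k w) \<and>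
            (\<lambda>w. \<Sum>k\<in>Y. f k w) holomorphic_on ball z e"
      using hol
    proof eventually_elim
      case (elim Y)
      have "ball z e \<subseteq> A" using e(2) ball_subset_cball by blast
      thus ?case using elim e(2)
        by (meson holomorphic_on_imp_continuous_on holomorphic_on_subset)
    qed
    then obtain "(\<lambda>w. \<Sum>\<^sub>\<infinity>k\<in>X. f k w) holomorphic_on ball z e"
      by (rule holomorphic_uniform_limit[OF _ uniform_limit_on_subset[OF ul e(2)]]) auto
    thus "\<exists>f'. ((\<lambda>w. \<Sum>\<^sub>\<infinity>k\<in>X. f k w) has_field_derivative f') (at z)"
      using e(1) by (auto simp: holomorphic_on_open)
  qed
  show "((\<lambda>k. (deriv ^^ m) (f k) z) has_sum (deriv ^^ m) (\<lambda>w. \<Sum>\<^sub>\<infinity>k\<in>X. f k w) z) X" if z: "z \<in> A"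
  proof -
    have "((\<lambda>Y. (deriv ^^ m) (\<lambda>w. \<Sum>k\<in>Y. f k w) z) \<longlongrightarrow> (deriv ^^ m) (\<lambda>w. \<Sum>\<^sub>\<infinity>k\<in>X. f k w) z) (finite_subsets_at_top X)"
      by (rule higher_deriv_complex_uniform_limit[OF ul hol _ assms(1) z]) auto
    moreover have "\<forall>\<^sub>F Y in finite_subsets_at_top X. (deriv ^^ m) (\<lambda>w. \<Sum>k\<in>Y. f k w) z = (\<Sum>k\<in>Y. (deriv ^^ m) (f k) z)"
      using ev by eventually_elim (use assms z in \<open>auto intro!: higher_deriv_sum\<close>)
    ultimately show ?thesis
      unfolding has_sum_def by (simp add: filterlim_cong)
  qed
qed

lemma summable_on_int_geometric:
  assumes "0 \<le> c" "c < (1::real)"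
  shows "(\<lambda>k::int. c ^ nat \<bar>k\<bar>) summable_on UNIV"
proof -
  have "summable (\<lambda>n. norm (c ^ n))" using assms by (simp add: summable_geometric)
  hence s: "(\<lambda>n::nat. c ^ n) summable_on UNIV" by (rule norm_summable_imp_summable_on)
  have "(\<lambda>k::int. c ^ nat \<bar>k\<bar>) summable_on (range int)"
    using s by (subst summable_on_reindex) (auto simp: o_def)
  moreover have "(\<lambda>k::int. c ^ nat \<bar>k\<bar>) summable_on (range (\<lambda>n. - int n))"
    using s by (subst summable_on_reindex) (auto simp: o_def inj_on_def)
  ultimately have "(\<lambda>k::int. c ^ nat \<bar>k\<bar>) summable_on (range int \<union> range (\<lambda>n. - int n))"
    by (rule summable_on_union)
  moreover have "range int \<union> range (\<lambda>n. - int n) = UNIV"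
  proof -
    have "k \<in> range int \<or> k \<in> range (\<lambda>n. - int n)" for k
      by (cases k rule: int_cases2) auto
    thus ?thesis by auto
  qed
  ultimately show ?thesis by simp
qed


section \<open>Division of entire functions\<close>

text \<open>At a simple zero a of h both functions are divided by z - a, which leaves a denominator
  that is nonzero near a. This provides division by theta, by 1 - q^k exp t, and by t.\<close>

lemma entire_quotient:
  assumes f: "f holomorphic_on UNIV" and h: "h holomorphic_on UNIV"
    and zeros: "\<And>z. h z = 0 ==> f z = 0" and simple: "\<And>z. h z = 0 ==> deriv h z \<noteq> 0"
  obtains k where "k holomorphic_on UNIV" "\<And>z. f z = h z * k z"
proof
  define k where "k = (\<lambda>z. if h z = 0 then deriv f z / deriv h z else f z / h z)"
  show "f z = h z * k z" for z by (auto simp: k_def zeros)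
  show "k holomorphic_on UNIV"
  proof (subst holomorphic_on_open, simp, intro ballI)
    fix a :: complex
    have ch: "continuous_on UNIV h'" if "h' holomorphic_on UNIV" for h' :: "complex => complex"
      using that by (rule holomorphic_on_imp_continuous_on)
    show "\<exists>k'. (k has_field_derivative k') (at a)"
    proof (cases "h a = 0")
      case False
      define A where "A = {z. h z \<noteq> 0}"
      have A: "open A" "a \<in> A" unfolding A_def using ch[OF h] False
        by (auto intro!: open_Collect_neq continuous_intros)
      have "(\<lambda>z. f z / h z) holomorphic_on A"
        using f h by (intro holomorphic_intros) (auto simp: A_def intro: holomorphic_on_subset)
      hence "k holomorphic_on A" by (rule holomorphic_transform) (auto simp: A_def k_def)
      thus ?thesis using A by (auto simp: holomorphic_on_open)
    next
      case True
      define F where "F = (\<lambda>z. if z = a then deriv f a else f z / (z - a))"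
      define H where "H = (\<lambda>z. if z = a then deriv h a else h z / (z - a))"
      have F: "F holomorphic_on UNIV"
        by (rule pole_theorem_open_0[OF f, of a]) (auto simp: F_def zeros True)
      have H: "H holomorphic_on UNIV"
        by (rule pole_theorem_open_0[OF h, of a]) (auto simp: H_def True)
      define A where "A = {z. H z \<noteq> 0}"
      have "H a \<noteq> 0" using simple[OF True] by (simp add: H_def)
      hence A: "open A" "a \<in> A" unfolding A_def using ch[OF H]
        by (auto intro!: open_Collect_neq continuous_intros)
      have "(\<lambda>z. F z / H z) holomorphic_on A"
        using F H by (intro holomorphic_intros) (auto simp: A_def intro: holomorphic_on_subset)
      hence "k holomorphic_on A"
        by (rule holomorphic_transform) (auto simp: A_def k_def F_def H_def True split: if_splits)
      thus ?thesis using A by (auto simp: holomorphic_on_open)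
    qed
  qed
qed


section \<open>Constant terms of Laurent series by torus integrals\<close>

lemma has_contour_integral_powi_circlepath:
  assumes "s > 0"
  shows "((\<lambda>x. x powi l) has_contour_integral (if l = -1 then 2 * of_real pi * \<i> else 0)) (circlepath 0 s)"
proof (cases "l = -1")
  case True
  have "((\<lambda>x. 1 / (x - 0)) has_contour_integral 2 * of_real pi * \<i> * 1) (circlepath 0 s)"
    by (rule Cauchy_integral_circlepath_simple) (use assms in auto)
  thus ?thesis using True by (simp add: power_int_minus divide_inverse)
next
  case False
  have "((\<lambda>x. x powi l) has_contour_integral 0) (circlepath 0 s)"
  proof (rule Cauchy_theorem_primitive)
    fix x :: complex assume "x \<in> - {0}"
    thus "((\<lambda>x. x powi (l + 1) / of_int (l + 1)) has_field_derivative x powi l) (at x within - {0})"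
      using False by (auto intro!: derivative_eq_intros simp: add_eq_0_iff simp flip: of_int_add)
  qed (use assms in auto)
  thus ?thesis using False by simp
qed

text \<open>The index set is abstract and several indices may carry the same monomial, as happens
  when terms come from different permutations. Summability on the torus gives uniform convergence in
  the innermost variable, whose integration retains the indices with exponent 0; the induction
  continues on this smaller index set.\<close>

lemma torus_integral_infsum:
  fixes c :: "'k => complex" and m :: "'k => nat => int"
  assumes "\<And>j. j \<in> {1..n} ==> s j > 0"
    and "(\<lambda>k. norm (c k) * (\<Prod>j\<in>{1..n}. s j powi m k j)) summable_on I"
    and "\<And>v. (\<forall>j\<in>{1..n}. norm (v j) = s j) ==> f v = (\<Sum>\<^sub>\<infinity>k\<in>I. c k * (\<Prod>j\<in>{1..n}. v j powi m k j))"
  shows "torus_integral n s f v0 = (\<Sum>\<^sub>\<infinity>k\<in>{k\<in>I. \<forall>j\<in>{1..n}. m k j = 0}. c k)"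
  using assms
proof (induction n arbitrary: f I)
  case 0
  thus ?case by simp
next
  case (Suc n)
  let ?N = "Suc n" and ?S = "s (Suc n)"
  have S: "?S > 0" using Suc.prems(1) by simp
  define I' where "I' = {k\<in>I. m k ?N = 0}"
  define f' where "f' = (\<lambda>v'. 1 / (2 * of_real pi * \<i>) * contour_integral (circlepath 0 ?S) (\<lambda>x. f (v'(?N := x)) / x))"
  have prod_Suc: "(\<Prod>j\<in>{1..?N}. F j) = F ?N * (\<Prod>j\<in>{1..n}. F j)" for F :: "nat => 'b::comm_monoid_mult"
    by (simp add: prod.nat_ivl_Suc' mult.commute)
  have summ: "(\<lambda>k. norm (c k) * (\<Prod>j\<in>{1..n}. s j powi m k j)) summable_on I'"
  proof -
    have "(\<lambda>k. norm (c k) * (\<Prod>j\<in>{1..?N}. s j powi m k j)) summable_on I'"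
      by (rule summable_on_subset[OF Suc.prems(2)]) (auto simp: I'_def)
    also have "?this \<longleftrightarrow> ?thesis"
      by (rule summable_on_cong) (simp add: I'_def prod_Suc)
    finally show ?thesis .
  qed
  have f': "f' v = (\<Sum>\<^sub>\<infinity>k\<in>I'. c k * (\<Prod>j\<in>{1..n}. v j powi m k j))"
    if v: "\<forall>j\<in>{1..n}. norm (v j) = s j" for v
  proof -
    define d where "d = (\<lambda>k. c k * (\<Prod>j\<in>{1..n}. v j powi m k j))"
    have norm_d: "norm (d k) = norm (c k) * (\<Prod>j\<in>{1..n}. s j powi m k j)" for k
      using v by (auto simp: d_def norm_mult prod_norm[symmetric] norm_power_int intro!: prod.cong)
    have fx: "f (v(?N := x)) / x = (\<Sum>\<^sub>\<infinity>k\<in>I. d k * x powi (m k ?N - 1))" if x: "x \<in> sphere 0 ?S" for x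
    proof -
      have x0: "x \<noteq> 0" "norm x = ?S" using x S by auto
      have "f (v(?N := x)) = (\<Sum>\<^sub>\<infinity>k\<in>I. c k * (\<Prod>j\<in>{1..?N}. (v(?N := x)) j powi m k j))"
        using v x0 by (intro Suc.prems(3)) (auto simp: le_Suc_eq)
      also have "\<dots> = (\<Sum>\<^sub>\<infinity>k\<in>I. x * (d k * x powi (m k ?N - 1)))"
      proof (rule infsum_cong)
        fix k
        have "(\<Prod>j\<in>{1..n}. (v(?N := x)) j powi m k j) = (\<Prod>j\<in>{1..n}. v j powi m k j)"
          by (intro prod.cong) auto
        moreover have "x powi m k ?N = x * x powi (m k ?N - 1)" using x0
          by (metis diff_add_cancel power_int_add_1')
        ultimately show "c k * (\<Prod>j\<in>{1..?N}. (v(?N := x)) j powi m k j) = x * (d k * x powi (m k ?N - 1))"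
          by (simp add: prod_Suc d_def)
      qed
      also have "\<dots> = x * (\<Sum>\<^sub>\<infinity>k\<in>I. d k * x powi (m k ?N - 1))"
        by (rule infsum_cmult_right')
      finally show ?thesis using x0 by simp
    qed
    have ul: "uniform_limit (sphere 0 ?S) (\<lambda>Y x. \<Sum>k\<in>Y. d k * x powi (m k ?N - 1))
                 (\<lambda>x. f (v(?N := x)) / x) (finite_subsets_at_top I)"
    proof (rule uniform_limit_cong'[THEN iffD2])
      show "uniform_limit (sphere 0 ?S) (\<lambda>Y x. \<Sum>k\<in>Y. d k * x powi (m k ?N - 1))
                 (\<lambda>x. \<Sum>\<^sub>\<infinity>k\<in>I. d k * x powi (m k ?N - 1)) (finite_subsets_at_top I)"
      proof (rule Weierstrass_m_test_general)
        show "(\<lambda>k. norm (c k) * (\<Prod>j\<in>{1..?N}. s j powi m k j) * inverse ?S) summable_on I"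
          by (rule summable_on_cmult_left[OF Suc.prems(2)])
        fix k and x :: complex assume "x \<in> sphere 0 ?S"
        hence "norm x = ?S" "x \<noteq> 0" using S by auto
        thus "norm (d k * x powi (m k ?N - 1)) \<le> norm (c k) * (\<Prod>j\<in>{1..?N}. s j powi m k j) * inverse ?S"
          using S by (simp add: norm_mult norm_power_int norm_divide norm_d prod_Suc power_int_diff field_simps)
      qed
    qed (use fx in auto)
    have int: "((\<lambda>x. \<Sum>k\<in>Y. d k * x powi (m k ?N - 1)) has_contour_integral
        (\<Sum>k\<in>Y. d k * (if m k ?N = 0 then 2 * of_real pi * \<i> else 0))) (circlepath 0 ?S)" if "finite Y" for Y
    proof (rule has_contour_integral_sum[OF that])
      fix k
      show "((\<lambda>x. d k * x powi (m k ?N - 1)) has_contour_integral d k * (if m k ?N = 0 then 2 * of_real pi * \<i> else 0)) (circlepath 0 ?S)"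
        using has_contour_integral_powi_circlepath[OF S, of "m k ?N - 1"]
        by (intro has_contour_integral_lmul) (simp split: if_splits)
    qed
    have fin: "\<forall>\<^sub>F Y in finite_subsets_at_top I. finite Y"
      by (rule eventually_finite_subsets_at_top_weakI) auto
    have "\<forall>\<^sub>F Y in finite_subsets_at_top I.
        (\<lambda>x. \<Sum>k\<in>Y. d k * x powi (m k ?N - 1)) contour_integrable_on circlepath 0 ?S"
      using fin by eventually_elim (rule has_contour_integral_integrable[OF int])
    hence "((\<lambda>Y. contour_integral (circlepath 0 ?S) (\<lambda>x. \<Sum>k\<in>Y. d k * x powi (m k ?N - 1)))
        \<longlongrightarrow> contour_integral (circlepath 0 ?S) (\<lambda>x. f (v(?N := x)) / x)) (finite_subsets_at_top I)"
      by (rule contour_integral_uniform_limit_circlepath(2)[OF _ ul _ S]) simp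
    also have "?this \<longleftrightarrow> ((\<lambda>Y. \<Sum>k\<in>Y. d k * (if m k ?N = 0 then 2 * of_real pi * \<i> else 0))
        \<longlongrightarrow> contour_integral (circlepath 0 ?S) (\<lambda>x. f (v(?N := x)) / x)) (finite_subsets_at_top I)"
      by (rule filterlim_cong[OF refl refl], use fin in eventually_elim)
         (rule contour_integral_unique[OF int])
    finally have "((\<lambda>k. d k * (if m k ?N = 0 then 2 * of_real pi * \<i> else 0))
        has_sum contour_integral (circlepath 0 ?S) (\<lambda>x. f (v(?N := x)) / x)) I"
      by (simp add: has_sum_def)
    hence "((\<lambda>k. 1 / (2 * of_real pi * \<i>) * (d k * (if m k ?N = 0 then 2 * of_real pi * \<i> else 0))) has_sum f' v) I"
      unfolding f'_def by (rule has_sum_cmult_right)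
    hence "f' v = (\<Sum>\<^sub>\<infinity>k\<in>I. 1 / (2 * of_real pi * \<i>) * (d k * (if m k ?N = 0 then 2 * of_real pi * \<i> else 0)))"
      by (rule infsumI[symmetric])
    also have "\<dots> = (\<Sum>\<^sub>\<infinity>k\<in>I'. d k)"
      by (rule infsum_cong_neutral) (auto simp: I'_def)
    finally show ?thesis by (simp add: d_def)
  qed
  have "torus_integral ?N s f v0 = torus_integral n s f' v0" by (simp add: f'_def)
  also have "\<dots> = (\<Sum>\<^sub>\<infinity>k\<in>{k\<in>I'. \<forall>j\<in>{1..n}. m k j = 0}. c k)"
    by (rule Suc.IH[OF _ summ f']) (use Suc.prems(1) in auto)
  also have "{k\<in>I'. \<forall>j\<in>{1..n}. m k j = 0} = {k\<in>I. \<forall>j\<in>{1..?N}. m k j = 0}"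
    by (auto simp: I'_def le_Suc_eq)
  finally show ?case .
qed

section \<open>The theta function as an infinite product\<close>

abbreviation "period \<equiv> 2 * of_real pi * \<i>"

locale upper_half_plane =
  fixes \<tau> :: complex
  assumes Im_pos: "Im \<tau> > 0"
begin

abbreviation "q \<equiv> nome \<tau>"
abbreviation "\<omega> \<equiv> 2 * of_real pi * \<i> * \<tau>"

lemma q_nonzero [simp]: "q \<noteq> 0"
  by (simp add: nome_def)

lemma norm_q: "norm q = exp (- 2 * pi * Im \<tau>)"
  by (simp add: nome_def)

lemma norm_q_less_1: "norm q < 1"
  using Im_pos by (simp add: norm_q)

lemma q_powi: "q powi b = exp (\<omega> * of_int b)"
  by (simp add: nome_def exp_power_int mult.commute)

lemma norm_q_powi_eq_1_iff: "norm (q powi k) = 1 \<longleftrightarrow> k = 0"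
proof -
  have "norm (q powi k) = exp (- 2 * pi * Im \<tau> * of_int k)"
    by (simp add: norm_power_int norm_q exp_power_int mult.commute)
  thus ?thesis using Im_pos by simp
qed

lemma q_powi_eq_1_iff [simp]: "q powi k = 1 \<longleftrightarrow> k = 0"
proof
  assume "q powi k = 1"
  hence "norm (q powi k) = 1" by simp
  thus "k = 0" by (simp only: norm_q_powi_eq_1_iff)
qed auto

lemma one_minus_q_power_nonzero: "1 - q ^ Suc n \<noteq> 0"
  using q_powi_eq_1_iff[of "int (Suc n)"] unfolding power_int_of_nat by auto

lemma mem_lattice_iff: "z \<in> lattice \<tau> \<longleftrightarrow> (\<exists>b::int. exp z = q powi b)"
proof
  assume "z \<in> lattice \<tau>"
  then obtain a b :: int where "z = period * of_int a + \<omega> * of_int b"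
    by (auto simp: lattice_def)
  thus "\<exists>b::int. exp z = q powi b"
    by (auto simp: q_powi exp_add exp_eq_1 mult_ac intro!: exI[of _ b])
next
  assume "\<exists>b::int. exp z = q powi b"
  then obtain b where "exp z = exp (\<omega> * of_int b)" by (auto simp: q_powi)
  then obtain a :: int where "z = \<omega> * of_int b + (of_int (2 * a) * pi) * \<i>"
    by (auto simp: exp_eq)
  hence "z = period * of_int a + \<omega> * of_int b" by (simp add: mult_ac)
  thus "z \<in> lattice \<tau>" unfolding lattice_def by blast
qed

lemma zero_in_lattice [simp]: "0 \<in> lattice \<tau>"
  unfolding mem_lattice_iff by (rule exI[of _ 0]) simp

lemma uminus_in_lattice_iff [simp]: "- z \<in> lattice \<tau> \<longleftrightarrow> z \<in> lattice \<tau>"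
proof -
  have "- z \<in> lattice \<tau>" if "z \<in> lattice \<tau>" for z
  proof -
    from that obtain b where "exp z = q powi b" unfolding mem_lattice_iff by blast
    hence "exp (-z) = q powi (-b)" by (simp add: exp_minus power_int_minus)
    thus ?thesis unfolding mem_lattice_iff by blast
  qed
  from this[of z] this[of "-z"] show ?thesis by auto
qed

lemma lattice_coordinates:
  obtains s t :: real where "z = period * of_real s + \<omega> * of_real t"
proof
  define t where "t = - Re z / (2 * pi * Im \<tau>)"
  define s where "s = (Im z - 2 * pi * Re \<tau> * t) / (2 * pi)"
  show "z = period * of_real s + \<omega> * of_real t"
    using Im_pos by (simp add: complex_eq_iff s_def t_def field_simps)
qed

text \<open>Invariance under the second period is asked of the modulus only, so that a multiplier
  such as -1 is covered. The closed period parallelogram bounds h, and Liouville's theorem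
  applies.\<close>

lemma elliptic_constant:
  assumes "h holomorphic_on UNIV" "\<And>z. h (z + period) = h z" "\<And>z. norm (h (z + \<omega>)) = norm (h z)"
  obtains c where "\<And>z. h z = c"
proof -
  have 1: "norm (h (z + period * of_int a)) = norm (h z)" for z a
  proof (induction a rule: int_induct[where k = 0])
    case (step1 i)
    thus ?case using assms(2)[of "z + period * of_int i"] by (simp add: algebra_simps)
  next
    case (step2 i)
    thus ?case using assms(2)[of "z + period * of_int (i - 1)"] by (simp add: algebra_simps)
  qed simp
  have 2: "norm (h (z + \<omega> * of_int b)) = norm (h z)" for z b
  proof (induction b rule: int_induct[where k = 0])
    case (step1 i)
    thus ?case using assms(3)[of "z + \<omega> * of_int i"] by (simp add: algebra_simps)
  next
    case (step2 i)
    thus ?case using assms(3)[of "z + \<omega> * of_int (i - 1)"] by (simp add: algebra_simps)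
  qed simp
  define K where "K = (\<lambda>(s,t). period * of_real s + \<omega> * of_real t) ` ({0..1::real} \<times> {0..1::real})"
  have "compact K"
    unfolding K_def case_prod_unfold by (intro compact_continuous_image continuous_intros compact_Times) auto
  moreover have "continuous_on K h"
    using assms(1) holomorphic_on_imp_continuous_on continuous_on_subset by blast
  ultimately have "bounded (h ` K)" by (intro compact_imp_bounded compact_continuous_image)
  then obtain B where B: "\<And>z. z \<in> K ==> norm (h z) \<le> B" by (auto simp: bounded_iff)
  have "norm (h z) \<le> B" for z
  proof -
    obtain s t where z: "z = period * of_real s + \<omega> * of_real t" by (rule lattice_coordinates)
    define z0 where "z0 = period * of_real (frac s) + \<omega> * of_real (frac t)"
    have "z0 \<in> K" unfolding K_def z0_def
      using frac_ge_0 frac_lt_1 less_imp_le by (force intro!: image_eqI[of _ _ "(frac s, frac t)"])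
    have "z = (z0 + period * of_int \<lfloor>s\<rfloor>) + \<omega> * of_int \<lfloor>t\<rfloor>"
      by (simp add: z z0_def frac_def algebra_simps)
    hence "norm (h z) = norm (h z0)" by (simp only: 1 2)
    thus ?thesis using B[OF \<open>z0 \<in> K\<close>] by simp
  qed
  hence "bounded (range h)" by (auto simp: bounded_iff)
  from Liouville_theorem[OF assms(1) this] that show ?thesis by (auto simp: constant_on_def)
qed

text \<open>The quasi-periods of the odd theta function. They determine an entire function up to a
  constant factor, which identifies the series with the product and later sums the Kronecker
  series.\<close>

definition theta_like :: "(complex => complex) => bool" where
  "theta_like f \<longleftrightarrow> f holomorphic_on UNIV \<and> (\<forall>z. f (z + period) = - f z) \<and>
     (\<forall>z. f (z + \<omega>) = - exp (- (\<omega> / 2) - z) * f z)"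

lemma theta_like_lattice:
  assumes "theta_like f"
  shows "f (z + (period * of_int a + \<omega> * of_int b))
    = (-1) powi (a + b) * exp (- (\<omega> / 2 * of_int b ^ 2 + of_int b * z)) * f z"
proof -
  have p: "f (z + period) = - f z" and w: "f (z + \<omega>) = - exp (- (\<omega> / 2) - z) * f z" for z
    using assms by (auto simp: theta_like_def)
  have 1: "f (z + period * of_int a) = (-1) powi a * f z" for z a
  proof (induction a rule: int_induct[where k = 0])
    case (step1 i)
    thus ?case using p[of "z + period * of_int i"] by (simp add: algebra_simps power_int_add)
  next
    case (step2 i)
    thus ?case using p[of "z + period * of_int (i - 1)"] by (simp add: algebra_simps power_int_diff)
  qed simp
  have 2: "f (z + \<omega> * of_int b) = (-1) powi b * exp (- (\<omega> / 2 * of_int b ^ 2 + of_int b * z)) * f z" for z b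
  proof (induction b rule: int_induct[where k = 0])
    case (step1 i)
    have "f (z + \<omega> * of_int (i + 1)) = - exp (- (\<omega> / 2) - (z + \<omega> * of_int i)) * f (z + \<omega> * of_int i)"
      using w[of "z + \<omega> * of_int i"] by (simp add: algebra_simps)
    also have "\<dots> = (-1) powi (i + 1) * (exp (- (\<omega> / 2) - (z + \<omega> * of_int i)) * exp (- (\<omega> / 2 * of_int i ^ 2 + of_int i * z))) * f z"
      by (simp only: step1) (simp add: power_int_add)
    also have "exp (- (\<omega> / 2) - (z + \<omega> * of_int i)) * exp (- (\<omega> / 2 * of_int i ^ 2 + of_int i * z))
        = exp (- (\<omega> / 2 * of_int (i + 1) ^ 2 + of_int (i + 1) * z))"
      unfolding exp_add[symmetric] by (rule arg_cong[where f = exp]) (simp add: power2_eq_square algebra_simps)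
    finally show ?case .
  next
    case (step2 i)
    have "f (z + \<omega> * of_int i) = - exp (- (\<omega> / 2) - (z + \<omega> * of_int (i - 1))) * f (z + \<omega> * of_int (i - 1))"
      using w[of "z + \<omega> * of_int (i - 1)"] by (simp add: algebra_simps)
    hence "f (z + \<omega> * of_int (i - 1)) = - (exp ((\<omega> / 2) + (z + \<omega> * of_int (i - 1))) * f (z + \<omega> * of_int i))"
      by (simp add: exp_minus exp_diff exp_add field_simps)
    also have "\<dots> = (-1) powi (i - 1) * (exp ((\<omega> / 2) + (z + \<omega> * of_int (i - 1))) * exp (- (\<omega> / 2 * of_int i ^ 2 + of_int i * z))) * f z"
      by (simp only: step2) (simp add: power_int_diff)
    also have "exp ((\<omega> / 2) + (z + \<omega> * of_int (i - 1))) * exp (- (\<omega> / 2 * of_int i ^ 2 + of_int i * z))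
        = exp (- (\<omega> / 2 * of_int (i - 1) ^ 2 + of_int (i - 1) * z))"
      unfolding exp_add[symmetric] by (rule arg_cong[where f = exp]) (simp add: power2_eq_square algebra_simps)
    finally show ?case .
  qed simp
  have "f (z + (period * of_int a + \<omega> * of_int b)) = f ((z + period * of_int a) + \<omega> * of_int b)"
    by (simp add: add.assoc)
  also have "\<dots> = (-1) powi b * exp (- (\<omega> / 2 * of_int b ^ 2 + of_int b * (z + period * of_int a))) * ((-1) powi a * f z)"
    by (simp only: 2 1)
  also have "exp (- (\<omega> / 2 * of_int b ^ 2 + of_int b * (z + period * of_int a))) = exp (- (\<omega> / 2 * of_int b ^ 2 + of_int b * z))"
  proof -
    have "exp (- (\<omega> / 2 * of_int b ^ 2 + of_int b * (z + period * of_int a)))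
        = exp (- (\<omega> / 2 * of_int b ^ 2 + of_int b * z)) * exp (period * of_int (- (a * b)))"
      unfolding exp_add[symmetric] by (simp add: algebra_simps)
    also have "exp (period * of_int (- (a * b))) = 1"
      by (subst exp_eq_1) (auto intro!: exI[of _ "- (a * b)"])
    finally show ?thesis by simp
  qed
  finally show ?thesis by (simp add: power_int_add)
qed

lemma theta_like_odd_vanishes:
  assumes "theta_like f" "f 0 = 0" "z \<in> lattice \<tau>"
  shows "f z = 0"
proof -
  obtain a b :: int where "z = period * of_int a + \<omega> * of_int b"
    using assms(3) by (auto simp: lattice_def)
  thus ?thesis using theta_like_lattice[OF assms(1), of 0 a b] assms(2) by simp
qed

text \<open>Chosen so that, with m = n + 1, the pair of factors (1 - q^m e^z)(1 - q^m e^(-z)) / (1 -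
  q^m)^2 becomes 1 - \<open>product_coeff n\<close> (e^z + e^(-z) - 2). The product is then an
  entire function of the single variable e^z + e^(-z) - 2, and the sum of these coefficients
  reappears in the second Eisenstein series.\<close>

definition product_coeff :: "nat => complex" where
  "product_coeff n = q ^ Suc n / (1 - q ^ Suc n)\<^sup>2"

lemma summable_product_coeff: "summable (\<lambda>n. norm (product_coeff n))"
proof (rule summable_comparison_test')
  show "summable (\<lambda>n. norm q ^ n / (1 - norm q)\<^sup>2)"
    using norm_q_less_1 by (intro summable_divide summable_geometric) auto
  fix n
  have "1 - norm q \<le> 1 - norm q ^ Suc n"
    using norm_q_less_1 power_decreasing[of 1 "Suc n" "norm q"] by simp
  also have "\<dots> \<le> norm (1 - q ^ Suc n)"
    using norm_triangle_ineq2[of 1 "q ^ Suc n"] by (simp add: norm_power norm_mult)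
  finally have "(1 - norm q)\<^sup>2 \<le> norm (1 - q ^ Suc n) ^ 2" using norm_q_less_1 by (intro power_mono) auto
  moreover have "norm q ^ Suc n \<le> norm q ^ n" using norm_q_less_1 by (intro power_decreasing) auto
  ultimately show "norm (norm (product_coeff n)) \<le> norm q ^ n / (1 - norm q)\<^sup>2"
    using norm_q_less_1 unfolding product_coeff_def norm_divide norm_power
    by (auto intro!: frac_le)
qed

definition prod_fun :: "complex => complex" where
  "prod_fun s = (\<Prod>n. 1 - product_coeff n * s)"

lemma convergent_prod_prod_fun: "convergent_prod (\<lambda>n. 1 - product_coeff n * s)"
proof -
  have "summable (\<lambda>n. norm (1 - product_coeff n * s - 1))"
    using summable_mult2[OF summable_product_coeff, of "norm s"] by (simp add: norm_mult)
  thus ?thesis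
    by (intro abs_convergent_prod_imp_convergent_prod summable_imp_abs_convergent_prod)
qed

lemma prod_fun_LIMSEQ: "(\<lambda>N. \<Prod>n<N. 1 - product_coeff n * s) \<longlonglongrightarrow> prod_fun s"
  using convergent_prod_LIMSEQ[OF convergent_prod_prod_fun[of s]]
  unfolding prod_fun_def LIMSEQ_lessThan_iff_atMost .

lemma prod_fun_eq_0_iff: "prod_fun s = 0 \<longleftrightarrow> (\<exists>n. product_coeff n * s = 1)"
  using has_prod_eq_0_iff[OF convergent_prod_has_prod[OF convergent_prod_prod_fun[of s]]]
  by (auto simp: prod_fun_def image_iff)

lemma uniform_limit_prod_fun:
  "uniform_limit (cball 0 R) (\<lambda>N s. \<Prod>n<N. 1 - product_coeff n * s) prod_fun sequentially"
proof -
  have "uniformly_convergent_on (cball 0 R) (\<lambda>N s. \<Prod>n<N. 1 - product_coeff n * s)"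
  proof (rule uniformly_convergent_on_prod')
    have "uniform_limit (cball 0 R) (\<lambda>N s. \<Sum>n<N. norm (1 - product_coeff n * s - 1))
       (\<lambda>s. \<Sum>n. norm (1 - product_coeff n * s - 1)) sequentially"
    proof (rule Weierstrass_m_test)
      show "summable (\<lambda>n. norm (product_coeff n) * R)"
        by (rule summable_mult2[OF summable_product_coeff])
    qed (auto simp: norm_mult intro: mult_left_mono)
    thus "uniformly_convergent_on (cball 0 R) (\<lambda>N s. \<Sum>n<N. norm (1 - product_coeff n * s - 1))"
      by (auto simp: uniformly_convergent_on_def)
  qed (auto intro!: continuous_intros)
  then obtain l where l: "uniform_limit (cball 0 R) (\<lambda>N s. \<Prod>n<N. 1 - product_coeff n * s) l sequentially"
    by (auto simp: uniformly_convergent_on_def)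
  have "l s = prod_fun s" if "s \<in> cball 0 R" for s
    using LIMSEQ_unique[OF tendsto_uniform_limitI[OF l that] prod_fun_LIMSEQ] .
  thus ?thesis using l uniform_limit_cong'[of "cball 0 R" "\<lambda>N s. \<Prod>n<N. 1 - product_coeff n * s"
      "\<lambda>N s. \<Prod>n<N. 1 - product_coeff n * s" l prod_fun sequentially] by simp
qed

lemma prod_fun_holomorphic: "prod_fun holomorphic_on UNIV"
proof (subst holomorphic_on_open, simp, intro ballI)
  fix z :: complex
  obtain "prod_fun holomorphic_on ball 0 (norm z + 1)"
    by (rule holomorphic_uniform_limit[OF _ uniform_limit_prod_fun[of "norm z + 1"]])
       (auto intro!: always_eventually continuous_intros holomorphic_intros)
  thus "\<exists>f'. (prod_fun has_field_derivative f') (at z)"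
    by (auto simp: holomorphic_on_open)
qed

lemma prod_fun_0 [simp]: "prod_fun 0 = 1"
  by (simp add: prod_fun_def)

lemma deriv_prod_fun_0: "deriv prod_fun 0 = - (\<Sum>n. product_coeff n)"
proof -
  have "(\<lambda>k. deriv (\<lambda>s. 1 - product_coeff k * s) 0 / (1 - product_coeff k * 0)) sums (deriv prod_fun 0 / prod_fun 0)"
    by (rule logderiv_prodinf_complex_uniform_limit[where A = "ball 0 1"])
       (auto intro!: holomorphic_intros uniform_limit_on_subset[OF uniform_limit_prod_fun[of 1]])
  moreover have "deriv (\<lambda>s. 1 - product_coeff k * s) 0 = - product_coeff k" for k
    by (rule DERIV_imp_deriv) (auto intro!: derivative_eq_intros)
  ultimately have "(\<lambda>k. - product_coeff k) sums deriv prod_fun 0" by simp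
  thus ?thesis
    using sums_unique suminf_minus[OF summable_norm_cancel[OF summable_product_coeff]] by metis
qed

definition theta_product :: "complex => complex" where
  "theta_product z = (exp (z / 2) - exp (- z / 2)) * prod_fun (exp z + exp (- z) - 2)"

lemma theta_product_factor:
  "1 - product_coeff n * (exp z + exp (- z) - 2)
     = (1 - q ^ Suc n * exp z) * (1 - q ^ Suc n * exp (- z)) / (1 - q ^ Suc n)\<^sup>2"
proof -
  have "exp z * exp (-z) = 1" by (simp add: exp_minus)
  hence "(1 - q ^ Suc n * exp z) * (1 - q ^ Suc n * exp (- z))
     = (1 - q ^ Suc n)\<^sup>2 - q ^ Suc n * (exp z + exp (- z) - 2)"
    by (simp add: algebra_simps power2_eq_square del: power_Suc)
  thus ?thesis using one_minus_q_power_nonzero[of n]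
    by (simp add: product_coeff_def diff_divide_distrib del: power_Suc)
qed

lemma theta_product_holomorphic: "theta_product holomorphic_on UNIV"
proof -
  have "(prod_fun \<circ> (\<lambda>z. exp z + exp (- z) - 2)) holomorphic_on UNIV"
    by (rule holomorphic_on_compose_gen[OF _ prod_fun_holomorphic]) (auto intro!: holomorphic_intros)
  thus ?thesis unfolding theta_product_def[abs_def] o_def by (intro holomorphic_intros) auto
qed

lemma theta_product_shift: "theta_product (z + \<omega>) = - exp (- (\<omega> / 2) - z) * theta_product z"
proof -
  define a where "a = (\<lambda>N z. (exp (z / 2) - exp (- z / 2)) * (\<Prod>n<N. 1 - product_coeff n * (exp z + exp (- z) - 2)))"
  have lim: "(\<lambda>N. a N z) \<longlonglongrightarrow> theta_product z" for z
    unfolding a_def theta_product_def by (intro tendsto_intros prod_fun_LIMSEQ)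
  have qe: "exp (z + \<omega>) = q * exp z" "exp (- (z + \<omega>)) = exp (- z) / q"
    by (simp_all add: nome_def exp_add exp_diff exp_minus field_simps)
  have inv: "exp z * exp (- z) = 1" by (simp add: exp_minus)
  \<comment> \<open>The truncated products satisfy the functional equation up to the boundary
    factors 1 - q^N exp(-z) and 1 - q^(N+1) exp z, which both tend to 1.\<close>
  have rec: "(1 - q ^ N * exp (- z)) * a N (z + \<omega>) = - exp (- (\<omega> / 2) - z) * (1 - q ^ Suc N * exp z) * a N z" for N
  proof (induction N)
    case 0
    define x y where "x = exp (z / 2)" and "y = exp (\<omega> / 2)"
    have "\<omega> / 2 + \<omega> / 2 = \<omega>" by (simp add: field_simps)
    hence "q = exp (\<omega> / 2 + \<omega> / 2)" by (simp only: nome_def)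
    hence e: "exp z = x * x" "q = y * y"
      by (simp_all add: x_def y_def exp_add[symmetric])
    have x0: "x \<noteq> 0" "y \<noteq> 0" by (simp_all add: x_def y_def)
    have x1: "exp (- z / 2) = inverse x" unfolding x_def exp_minus[symmetric] by simp
    have x2: "exp (- z) = inverse (x * x)" unfolding e(1)[symmetric] exp_minus ..
    have "(z + \<omega>) / 2 = z / 2 + \<omega> / 2" "- (z + \<omega>) / 2 = - (z / 2 + \<omega> / 2)"
      by (simp_all add: add_divide_distrib diff_divide_distrib)
    hence x3: "exp ((z + \<omega>) / 2) = x * y" "exp (- (z + \<omega>) / 2) = inverse (x * y)"
      by (simp_all only: exp_minus exp_add x_def y_def)
    have x4: "exp (- (\<omega> / 2) - z) = inverse (y * (x * x))"
      by (simp only: y_def e(1)[symmetric] exp_add[symmetric] exp_minus[symmetric] minus_add_distrib diff_conv_add_uminus)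
    have "(1 - inverse (x * x)) * (x * y - inverse (x * y))
        = - inverse (y * (x * x)) * (1 - y * y * (x * x)) * (x - inverse x)"
      using x0 by (simp add: field_simps)
    thus ?case unfolding a_def x1 x2 x3 x4 e(1) e(2) x_def[symmetric] by simp
  next
    case (Suc N)
    define A B X Y U V D E where "A = a N (z + \<omega>)" and "B = a N z" and "X = 1 - q ^ N * exp (- z)"
      and "Y = 1 - q ^ Suc N * exp z" and "U = 1 - q ^ Suc N * exp (- z)" and "V = 1 - q ^ Suc (Suc N) * exp z"
      and "D = (1 - q ^ Suc N)\<^sup>2" and "E = - exp (- (\<omega> / 2) - z)"
    have IH: "X * A = E * Y * B" using Suc by (simp add: A_def B_def X_def Y_def E_def)
    have "a (Suc N) z = B * (1 - product_coeff N * (exp z + exp (- z) - 2))" by (simp add: a_def B_def)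
    hence 1: "a (Suc N) z = B * (Y * U / D)"
      unfolding theta_product_factor by (simp add: Y_def U_def D_def)
    have "a (Suc N) (z + \<omega>) = A * (1 - product_coeff N * (exp (z + \<omega>) + exp (- (z + \<omega>)) - 2))" by (simp add: a_def A_def)
    also have "1 - product_coeff N * (exp (z + \<omega>) + exp (- (z + \<omega>)) - 2) = V * X / D"
      unfolding theta_product_factor unfolding qe V_def X_def D_def by (simp add: mult_ac)
    finally have "U * a (Suc N) (z + \<omega>) = U * V / D * (X * A)" by simp
    also have "\<dots> = E * V * a (Suc N) z" unfolding IH 1 by simp
    finally show ?case by (simp only: U_def V_def E_def)
  qed
  have "(\<lambda>N. (1 - q ^ N * exp (- z)) * a N (z + \<omega>)) \<longlonglongrightarrow> (1 - 0 * exp (- z)) * theta_product (z + \<omega>)"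
    using norm_q_less_1 by (intro tendsto_intros lim LIMSEQ_power_zero)
  moreover have "(\<lambda>N. - exp (- (\<omega> / 2) - z) * (1 - q ^ Suc N * exp z) * a N z) \<longlonglongrightarrow> - exp (- (\<omega> / 2) - z) * (1 - 0 * exp z) * theta_product z"
    using norm_q_less_1 by (intro tendsto_intros lim LIMSEQ_Suc LIMSEQ_power_zero)
  ultimately show ?thesis unfolding rec using LIMSEQ_unique by fastforce
qed


lemma theta_product_uminus: "theta_product (- z) = - theta_product z"
  unfolding theta_product_def minus_mult_left minus_diff_eq minus_minus
  by (simp only: add.commute[of "exp (- z)"])

lemma theta_product_period: "theta_product (z + period) = - theta_product z"
proof -
  have "(z + period) / 2 = z / 2 + \<i> * of_real pi"
    by (simp add: add_divide_distrib)
  hence 1: "exp ((z + period) / 2) = - exp (z / 2)"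
    by (simp only: exp_add exp_pi_i') simp
  have 2: "exp (- w / 2) = inverse (exp (w / 2))" for w :: complex
    by (metis exp_minus minus_divide_left)
  have "exp (z + period) = exp z" by (simp only: exp_add exp_two_pi_i) simp
  hence "exp (z + period) + exp (- (z + period)) - 2 = exp z + exp (- z) - 2"
    by (simp only: exp_minus)
  thus ?thesis unfolding theta_product_def 2 1 minus_mult_left by (simp only:) simp
qed

lemma theta_like_theta_product: "theta_like theta_product"
  by (simp add: theta_like_def theta_product_holomorphic theta_product_period theta_product_shift)

lemma theta_product_eq_0_iff: "theta_product z = 0 \<longleftrightarrow> z \<in> lattice \<tau>"
proof
  assume "theta_product z = 0"
  hence "exp (z / 2) = exp (- z / 2) \<or> prod_fun (exp z + exp (- z) - 2) = 0"
    by (simp add: theta_product_def)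
  thus "z \<in> lattice \<tau>"
  proof
    assume "exp (z / 2) = exp (- z / 2)"
    hence "exp (z / 2) * exp (z / 2) = exp (- z / 2) * exp (z / 2)" by simp
    hence "exp z = 1" unfolding exp_add[symmetric] by simp
    thus ?thesis unfolding mem_lattice_iff by (intro exI[of _ 0]) simp
  next
    assume "prod_fun (exp z + exp (- z) - 2) = 0"
    then obtain n where "1 - product_coeff n * (exp z + exp (- z) - 2) = 0"
      by (auto simp: prod_fun_eq_0_iff)
    hence "q ^ Suc n * exp z = 1 \<or> q ^ Suc n * exp (- z) = 1"
      unfolding theta_product_factor using one_minus_q_power_nonzero[of n] by simp
    hence "exp z = q powi (- int (Suc n)) \<or> exp z = q powi (int (Suc n))"
      unfolding power_int_minus power_int_of_nat by (auto simp: exp_minus field_simps simp del: power_Suc)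
    thus ?thesis unfolding mem_lattice_iff by blast
  qed
next
  have "theta_product 0 = 0" by (simp add: theta_product_def)
  thus "z \<in> lattice \<tau> ==> theta_product z = 0"
    by (rule theta_like_odd_vanishes[OF theta_like_theta_product])
qed

lemma deriv_theta_product_0: "deriv theta_product 0 = 1"
proof (rule DERIV_imp_deriv)
  define u where "u = (\<lambda>z. exp z + exp (- z) - 2 :: complex)"
  have u: "(u has_field_derivative 0) (at 0)"
    unfolding u_def by (auto intro!: derivative_eq_intros)
  have "(prod_fun has_field_derivative deriv prod_fun (u 0)) (at (u 0))"
    by (rule holomorphic_derivI[OF prod_fun_holomorphic open_UNIV UNIV_I])
  from DERIV_chain2[OF this u] have d: "((\<lambda>z. prod_fun (u z)) has_field_derivative 0) (at 0)" by simp
  have e: "((\<lambda>z. exp (z / 2) - exp (- z / 2) :: complex) has_field_derivative 1) (at 0)"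
    by (auto intro!: derivative_eq_intros)
  have "theta_product = (\<lambda>z. (exp (z / 2) - exp (- z / 2)) * prod_fun (u z))"
    by (simp add: fun_eq_iff theta_product_def u_def)
  moreover have "u 0 = 0" by (simp add: u_def)
  ultimately show "(theta_product has_field_derivative 1) (at 0)"
    using DERIV_mult[OF e d] by simp
qed

text \<open>The derivative at 0 is 1, and translation by a lattice point multiplies the function by
  a factor without zeros.\<close>

lemma deriv_theta_product_nonzero:
  assumes "z \<in> lattice \<tau>"
  shows "deriv theta_product z \<noteq> 0"
proof -
  obtain a b :: int where z: "z = period * of_int a + \<omega> * of_int b"
    using assms by (auto simp: lattice_def)
  define M where "M = (\<lambda>w. (-1) powi (a + b) * exp (- (\<omega> / 2 * of_int b ^ 2 + of_int b * w)) :: complex)"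
  have D: "(theta_product has_field_derivative 1) (at 0)"
    using holomorphic_derivI[OF theta_product_holomorphic, of 0] by (simp add: deriv_theta_product_0)
  have M: "M holomorphic_on UNIV" unfolding M_def by (intro holomorphic_intros)
  have 0: "theta_product 0 = 0" by (simp add: theta_product_def)
  have "((\<lambda>w. M w * theta_product w) has_field_derivative M 0 * 1 + deriv M 0 * theta_product 0) (at 0)"
    using DERIV_mult[OF holomorphic_derivI[OF M open_UNIV UNIV_I, of 0] D] by (simp add: 0 mult_ac)
  also have "(\<lambda>w. M w * theta_product w) = (\<lambda>w. theta_product (w + z))"
    unfolding M_def z theta_like_lattice[OF theta_like_theta_product] by simp
  finally have "(theta_product has_field_derivative M 0) (at z)"
    using DERIV_shift[of theta_product "M 0" 0 z] by (simp add: 0)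
  hence "deriv theta_product z = M 0" by (rule DERIV_imp_deriv)
  thus ?thesis by (simp add: M_def)
qed

lemma theta_product_divides:
  assumes "f holomorphic_on UNIV" "\<And>z. z \<in> lattice \<tau> ==> f z = 0"
  obtains k where "k holomorphic_on UNIV" "\<And>z. f z = theta_product z * k z"
  using entire_quotient[OF assms(1) theta_product_holomorphic] assms(2) deriv_theta_product_nonzero
  unfolding theta_product_eq_0_iff by metis

text \<open>The set where f and h differ is open. If it were nonempty, the product would vanish on
  it, hence everywhere, against its derivative 1 at 0.\<close>

lemma theta_product_cancel:
  assumes "f holomorphic_on UNIV" "h holomorphic_on UNIV" "\<And>z. theta_product z * f z = theta_product z * h z"
  shows "f z = h z"
proof (rule ccontr)
  assume ne: "f z \<noteq> h z"
  define A where "A = {w. f w \<noteq> h w}"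
  have A: "open A" "z \<in> A" unfolding A_def using ne assms(1,2)
    by (auto intro!: open_Collect_neq holomorphic_on_imp_continuous_on)
  have z: "theta_product w = 0" if "w \<in> A" for w using assms(3)[of w] that by (auto simp: A_def)
  have "theta_product w = 0" for w
    by (rule analytic_continuation_open[of A UNIV theta_product "\<lambda>_. 0"])
       (use A z theta_product_holomorphic in auto)
  hence "theta_product = (\<lambda>_. 0)" by auto
  hence "deriv theta_product 0 = 0" by simp
  thus False by (simp add: deriv_theta_product_0)
qed

lemma holomorphic_on_shift:
  fixes f :: "complex => complex"
  assumes "f holomorphic_on UNIV"
  shows "(\<lambda>z. f (z + c)) holomorphic_on UNIV"
proof -
  have "(f \<circ> (\<lambda>z. z + c)) holomorphic_on UNIV"
    by (rule holomorphic_on_compose_gen[OF _ assms]) (auto intro!: holomorphic_intros)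
  thus ?thesis by (simp add: o_def)
qed

text \<open>The even part of a theta-like function vanishes at the half-period \<open>\<pi>\<i>\<close>, hence is divisible by
  a translate of the product; the quotient is multiplied by \<open>-1\<close> under \<open>z \<mapsto> z + 2\<pi>\<i>\<tau>\<close>.\<close>

lemma theta_like_unique:
  assumes "theta_like f"
  obtains c where "\<And>z. f z = c * theta_product z"
proof -
  have f: "f holomorphic_on UNIV" "\<And>z. f (z + period) = - f z" "\<And>z. f (z + \<omega>) = - exp (- (\<omega> / 2) - z) * f z"
    using assms by (auto simp: theta_like_def)
  have fm: "(\<lambda>z. f (- z)) holomorphic_on UNIV"
    using holomorphic_on_compose_gen[OF holomorphic_on_minus[OF holomorphic_on_ident] f(1)]
    by (auto simp: o_def)
  have mp: "f (- (z + period)) = - f (- z)" for z using f(2)[of "- (z + period)"] by simp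
  have mw: "f (- (z + \<omega>)) = - exp (- (\<omega> / 2) - z) * f (- z)" for z
  proof -
    have "f (- z) = - exp (- (\<omega> / 2) + (z + \<omega>)) * f (- (z + \<omega>))" using f(3)[of "- (z + \<omega>)"] by simp
    also have "- (\<omega> / 2) + (z + \<omega>) = - (- (\<omega> / 2) - z)" by simp
    finally show ?thesis by (simp only: exp_minus) (simp add: field_simps)
  qed
  \<comment> \<open>Reflection preserves the quasi-periods, so the even and the odd part of f have
    them as well.\<close>
  have even: "theta_like (\<lambda>z. f z + f (- z))" and odd: "theta_like (\<lambda>z. f z - f (- z))"
    unfolding theta_like_def f(2) f(3) mp mw by (auto intro!: holomorphic_intros f(1) fm simp: algebra_simps)
  have tl: "theta_product (z + period) = - theta_product z" "theta_product (z + \<omega>) = - exp (- (\<omega> / 2) - z) * theta_product z" for z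
    by (rule theta_product_period theta_product_shift)+
  have pi_half: "exp (- (\<omega> / 2) - (z + of_real pi * \<i>)) = - exp (- (\<omega> / 2) - z)" for z
  proof -
    have "exp (- (\<omega> / 2) - (z + of_real pi * \<i>)) = exp (- (\<omega> / 2) - z) / exp (of_real pi * \<i>)"
      by (simp only: exp_diff[symmetric]) (simp only: diff_diff_eq)
    thus ?thesis by (simp add: exp_pi_i)
  qed
  define e where "e = (\<lambda>z. f (z + of_real pi * \<i>) + f (- (z + of_real pi * \<i>)))"
  have e: "e holomorphic_on UNIV"
  proof -
    have "((\<lambda>z. f z + f (- z)) \<circ> (\<lambda>z. z + of_real pi * \<i>)) holomorphic_on UNIV"
      by (rule holomorphic_on_compose_gen[of _ _ _ UNIV])
         (use even in \<open>auto simp: theta_like_def intro!: holomorphic_intros\<close>)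
    thus ?thesis by (simp add: e_def[abs_def] o_def)
  qed
  have "e z = 0" if lat: "z \<in> lattice \<tau>" for z
  proof -
    obtain a b :: int where z: "z = period * of_int a + \<omega> * of_int b"
      using lat by (auto simp: lattice_def)
    have "f (of_real pi * \<i>) + f (- (of_real pi * \<i>)) = 0"
    proof -
      have "- (of_real pi * \<i>) + period = of_real pi * \<i>" by simp
      thus ?thesis using f(2)[of "- (of_real pi * \<i>)"] by (simp only:) simp
    qed
    thus ?thesis using theta_like_lattice[OF even, of "of_real pi * \<i>" a b]
      by (simp add: e_def z add.commute)
  qed
  then obtain k where k: "k holomorphic_on UNIV" "\<And>z. e z = theta_product z * k z"
    using theta_product_divides[OF e] by metis
  have evenD: "f (z + period) + f (- (z + period)) = - (f z + f (- z))"
    "f (z + \<omega>) + f (- (z + \<omega>)) = - exp (- (\<omega> / 2) - z) * (f z + f (- z))" for z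
    using even by (auto simp: theta_like_def)
  have ep: "e (z + period) = - e z" for z
  proof -
    have "z + period + of_real pi * \<i> = z + of_real pi * \<i> + period" by simp
    thus ?thesis unfolding e_def by (simp only: evenD(1))
  qed
  have ew: "e (z + \<omega>) = exp (- (\<omega> / 2) - z) * e z" for z
  proof -
    have "e (z + \<omega>) = - exp (- (\<omega> / 2) - (z + of_real pi * \<i>)) * e z"
    proof -
      have "z + \<omega> + of_real pi * \<i> = z + of_real pi * \<i> + \<omega>" by simp
      thus ?thesis unfolding e_def by (simp only: evenD(2))
    qed
    thus ?thesis unfolding pi_half by simp
  qed
  have kp: "k (z + period) = k z" for z
  proof (rule theta_product_cancel[of "\<lambda>z. k (z + period)" k])
    fix z show "theta_product z * k (z + period) = theta_product z * k z"
      using ep[of z] unfolding k(2) tl by simp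
  qed (rule holomorphic_on_shift[OF k(1)], rule k(1))
  have cancel: "T * K' = T * - K" if "- exp X * T * K' = exp X * (T * K)" for T K K' X :: complex
  proof -
    have "exp X * (T * K' + T * K) = exp X * (T * K) - (- exp X * T * K')" by (simp add: algebra_simps)
    also have "\<dots> = 0" unfolding that by simp
    finally have "exp X * (T * K' + T * K) = 0" .
    thus ?thesis by (simp add: eq_neg_iff_add_eq_0)
  qed
  have kw: "k (z + \<omega>) = - k z" for z
  proof (rule theta_product_cancel[of "\<lambda>z. k (z + \<omega>)" "\<lambda>z. - k z"])
    fix z show "theta_product z * k (z + \<omega>) = theta_product z * - k z"
      using ew[of z] unfolding k(2) tl by (rule cancel)
  qed (rule holomorphic_on_shift[OF k(1)], rule holomorphic_on_minus[OF k(1)])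
  obtain c where c: "\<And>z. k z = c"
    by (rule elliptic_constant[OF k(1) kp]) (auto simp: kw)
  \<comment> \<open>A constant that changes sign under translation is 0; so the even part vanishes
    and f is odd.\<close>
  have "c = 0" using kw[of 0] by (simp add: c)
  hence e0: "e z = 0" for z by (simp add: k c)
  have f_odd: "f (- z) = - f z" for z
    using e0[of "z - of_real pi * \<i>"] by (simp add: e_def eq_neg_iff_add_eq_0 add.commute)
  have "f z = 0" if "z \<in> lattice \<tau>" for z
    using theta_like_odd_vanishes[OF assms _ that] f_odd[of 0] by simp
  then obtain l where l: "l holomorphic_on UNIV" "\<And>z. f z = theta_product z * l z"
    using theta_product_divides[OF f(1)] by metis
  have lp: "l (z + period) = l z" for z
  proof (rule theta_product_cancel[of "\<lambda>z. l (z + period)" l])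
    fix z show "theta_product z * l (z + period) = theta_product z * l z"
      using f(2)[of z] unfolding l(2) tl by simp
  qed (rule holomorphic_on_shift[OF l(1)], rule l(1))
  have lw: "l (z + \<omega>) = l z" for z
  proof (rule theta_product_cancel[of "\<lambda>z. l (z + \<omega>)" l])
    fix z show "theta_product z * l (z + \<omega>) = theta_product z * l z"
      using f(3)[of z] unfolding l(2) tl
      by (subst mult_left_cancel[of "- exp (- (\<omega> / 2) - z)", symmetric]) (simp, simp only: mult.assoc)
  qed (rule holomorphic_on_shift[OF l(1)], rule l(1))
  obtain d where "\<And>z. l z = d"
    by (rule elliptic_constant[OF l(1) lp]) (auto simp: lw)
  thus ?thesis using that[of d] l(2) by (simp add: mult.commute)
qed

end

section \<open>The defining series of theta and its identification with the product\<close>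

context upper_half_plane
begin

definition theta_term :: "int => complex => complex" where
  "theta_term m z = (-1) powi m * exp (2 * of_real pi * \<i> * \<tau> * (1/2 * (of_int m + 1/2)^2)) * exp ((of_int m + 1/2) * z)"

definition theta_num :: "complex => complex" where
  "theta_num z = (\<Sum>\<^sub>\<infinity>m\<in>UNIV. theta_term m z)"

lemma norm_theta_coeff:
  "norm ((-1) powi m * exp (2 * of_real pi * \<i> * \<tau> * (1/2 * (of_int m + 1/2)^2)) :: complex)
     = exp (- (pi * Im \<tau>) * (of_int m + 1/2)\<^sup>2)"
proof -
  have "Re (2 * of_real pi * \<i> * \<tau> * (1/2 * (of_int m + 1/2)^2)) = - (pi * Im \<tau>) * (of_int m + 1/2)\<^sup>2"
  proof -
    have "2 * of_real pi * \<i> * \<tau> * (1/2 * (of_int m + 1/2)^2) = \<i> * \<tau> * of_real (pi * (of_int m + 1/2)\<^sup>2)"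
      by simp
    thus ?thesis by (simp only:) simp
  qed
  thus ?thesis by (simp add: norm_mult norm_power_int)
qed

lemma theta_term_bound:
  obtains M where "M summable_on UNIV" "\<And>m z. norm z \<le> R ==> norm (theta_term m z) \<le> M m"
proof
  define c where "c = pi * Im \<tau>"
  have c: "c > 0" using Im_pos by (simp add: c_def)
  \<comment> \<open>The maximum over x of (R + 1) x - c x^2: the Gaussian coefficient absorbs exp(R
    x) and still leaves a decay exp(-x).\<close>
  define K where "K = (R + 1)\<^sup>2 / (4 * c)"
  show "(\<lambda>m::int. exp (K + 1/2) * exp (-1) ^ nat \<bar>m\<bar>) summable_on UNIV"
    by (intro summable_on_cmult_right summable_on_int_geometric) auto
  fix m :: int and z :: complex assume z: "norm z \<le> R"
  define x where "x = \<bar>of_int m + 1/2 :: real\<bar>"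
  have x: "x \<ge> \<bar>of_int m\<bar> - 1/2" "x \<ge> 0" unfolding x_def by linarith+
  have "norm (theta_term m z) = exp (- c * x\<^sup>2) * exp (Re ((of_int m + 1/2) * z))"
    unfolding theta_term_def norm_mult[of _ "exp ((of_int m + 1/2) * z)"] norm_theta_coeff
    by (simp add: c_def x_def)
  also have "Re ((of_int m + 1/2) * z) \<le> x * R"
  proof -
    have "Re ((of_int m + 1/2) * z) \<le> norm ((of_int m + 1/2) * z)" by (rule complex_Re_le_cmod)
    also have "\<dots> = x * norm z"
    proof -
      have "(of_int m + 1/2 :: complex) = of_real (of_int m + 1/2)" by simp
      thus ?thesis unfolding norm_mult x_def by (simp only: norm_of_real)
    qed
    also have "\<dots> \<le> x * R" using z x by (intro mult_left_mono)
    finally show ?thesis .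
  qed
  hence "exp (- c * x\<^sup>2) * exp (Re ((of_int m + 1/2) * z)) \<le> exp (- c * x\<^sup>2) * exp (x * R)" by simp
  also have "exp (- c * x\<^sup>2) * exp (x * R) = exp (- c * x\<^sup>2 + x * R)" by (rule exp_add[symmetric])
  also have "- c * x\<^sup>2 + x * R \<le> K - x"
  proof -
    have "K - x - (- c * x\<^sup>2 + x * R) = c * (x - (R + 1) / (2 * c))\<^sup>2"
      using c by (simp add: K_def field_simps power2_eq_square)
    moreover have "c * (x - (R + 1) / (2 * c))\<^sup>2 \<ge> 0" using c by simp
    ultimately show ?thesis by linarith
  qed
  also have "K - x \<le> K + 1/2 - real_of_int \<bar>m\<bar>" using x by simp
  also have "exp (K + 1/2 - real_of_int \<bar>m\<bar>) = exp (K + 1/2) * exp (-1) ^ nat \<bar>m\<bar>"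
  proof -
    have "exp (-1 :: real) ^ nat \<bar>m\<bar> = exp (- real_of_int \<bar>m\<bar>)"
      by (subst exp_of_nat_mult[symmetric]) simp
    thus ?thesis by (simp only: exp_add[symmetric]) simp
  qed
  finally show "norm (theta_term m z) \<le> exp (K + 1/2) * exp (-1) ^ nat \<bar>m\<bar>" by simp
qed

lemma theta_term_holomorphic: "theta_term m holomorphic_on A"
  unfolding theta_term_def[abs_def] by (intro holomorphic_intros)

lemma theta_num_holomorphic: "theta_num holomorphic_on UNIV"
proof (subst holomorphic_on_open, simp, intro ballI)
  fix z :: complex
  obtain M where "M summable_on UNIV" "\<And>m w. norm w \<le> norm z + 1 ==> norm (theta_term m w) \<le> M m"
    using theta_term_bound[of "norm z + 1"] by metis
  hence "theta_num holomorphic_on ball 0 (norm z + 1)"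
    unfolding theta_num_def[abs_def]
    by (intro infsum_holomorphic[where M = M] theta_term_holomorphic) auto
  thus "\<exists>f'. (theta_num has_field_derivative f') (at z)"
    by (auto simp: holomorphic_on_open)
qed

lemma deriv_theta_num_0:
  "deriv theta_num 0 = (\<Sum>\<^sub>\<infinity>m\<in>(UNIV :: int set). (-1) powi m * (of_int m + 1/2)
        * exp (2 * of_real pi * \<i> * \<tau> * (1/2 * (of_int m + 1/2)^2)))"
proof -
  obtain M where M: "M summable_on UNIV" "\<And>m w. norm w \<le> 1 ==> norm (theta_term m w) \<le> M m"
    using theta_term_bound[of 1] by metis
  have "((\<lambda>m. (deriv ^^ 1) (theta_term m) 0) has_sum (deriv ^^ 1) theta_num 0) UNIV"
    unfolding theta_num_def[abs_def]
    by (rule has_sum_higher_deriv[where A = "ball 0 1" and M = M]) (use M in \<open>auto intro: theta_term_holomorphic\<close>)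
  moreover have "deriv (theta_term m) 0 = (-1) powi m * (of_int m + 1/2)
        * exp (2 * of_real pi * \<i> * \<tau> * (1/2 * (of_int m + 1/2)^2))" for m
    by (rule DERIV_imp_deriv) (unfold theta_term_def[abs_def], auto intro!: derivative_eq_intros)
  ultimately show ?thesis by (simp add: infsumI)
qed

text \<open>Under translation by \<omega> the square in the exponent is completed and the summation
  index moves by one.\<close>

lemma theta_like_theta_num: "theta_like theta_num"
proof -
  have p: "theta_term m (z + period) = - theta_term m z" for m z
  proof -
    have "exp ((of_int m + 1/2) * (z + period)) = exp ((of_int m + 1/2) * z) * (exp (period * of_int m) * exp (\<i> * of_real pi))"
      unfolding exp_add[symmetric] by (simp add: algebra_simps)
    also have "exp (period * of_int m) = 1" by (subst exp_eq_1) auto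
    finally show ?thesis by (simp add: theta_term_def exp_pi_i')
  qed
  have w: "theta_term m (z + \<omega>) = - exp (- (\<omega> / 2) - z) * theta_term (m + 1) z" for m z
  proof -
    have "exp (2 * of_real pi * \<i> * \<tau> * (1/2 * (of_int m + 1/2)^2)) * exp ((of_int m + 1/2) * (z + \<omega>))
      = exp (- (\<omega> / 2) - z) * (exp (2 * of_real pi * \<i> * \<tau> * (1/2 * (of_int (m + 1) + 1/2)^2)) * exp ((of_int (m + 1) + 1/2) * z))"
      unfolding exp_add[symmetric] by (rule arg_cong[where f = exp]) (simp add: field_simps power2_eq_square)
    thus ?thesis by (simp add: theta_term_def power_int_add mult.assoc)
  qed
  have "theta_num (z + period) = - theta_num z" for z
    by (simp add: theta_num_def p infsum_uminus)
  moreover have "theta_num (z + \<omega>) = - exp (- (\<omega> / 2) - z) * theta_num z" for z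
  proof -
    have "bij_betw (\<lambda>m::int. m + 1) UNIV UNIV"
      by (rule bij_betw_byWitness[of _ "\<lambda>m. m - 1"]) auto
    hence "(\<Sum>\<^sub>\<infinity>m\<in>UNIV. theta_term (m + 1) z) = theta_num z"
      unfolding theta_num_def by (rule infsum_reindex_bij_betw)
    thus ?thesis by (simp only: theta_num_def w infsum_cmult_right')
  qed
  ultimately show ?thesis using theta_num_holomorphic by (auto simp: theta_like_def)
qed

text \<open>Without the factor exp(z/2) the series is a Laurent series in exp z. If the function
  vanished, extracting the constant term over the unit circle would give 0 instead of the nonzero
  coefficient of index 0.\<close>

lemma theta_num_nonzero: "\<exists>z. theta_num z \<noteq> 0"
proof (rule ccontr)
  assume "\<not> ?thesis"
  hence 0: "theta_num z = 0" for z by auto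
  define c where "c = (\<lambda>m::int. (-1) powi m * exp (2 * of_real pi * \<i> * \<tau> * (1/2 * (of_int m + 1/2)^2)) :: complex)"
  have c: "theta_term m z = c m * exp z powi m * exp (z / 2)" for m z
    by (simp add: theta_term_def c_def exp_power_int distrib_right exp_add[symmetric] mult.assoc add.assoc)
  have "torus_integral 1 (\<lambda>_. 1) (\<lambda>_. 0) undefined = (\<Sum>\<^sub>\<infinity>m\<in>{m\<in>UNIV. \<forall>j\<in>{1..1::nat}. m = 0}. c m)"
  proof (rule torus_integral_infsum[where m = "\<lambda>m _. m"])
    obtain M where M: "M summable_on UNIV" "\<And>m w. norm w \<le> 0 ==> norm (theta_term m w) \<le> M m"
      using theta_term_bound[of 0] by metis
    show "(\<lambda>m. norm (c m) * (\<Prod>j\<in>{1..1::nat}. 1 powi m)) summable_on UNIV"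
      using Infinite_Sum.abs_summable_on_comparison_test'[OF M(1), of "\<lambda>m. theta_term m 0"] M(2) by (simp add: c)
    fix v :: "nat => complex" assume "\<forall>j\<in>{1..1}. norm (v j) = 1"
    hence "v 1 \<noteq> 0" by auto
    define z where "z = Ln (v 1)"
    have z: "exp z = v 1" using \<open>v 1 \<noteq> 0\<close> by (simp add: z_def)
    have "0 = theta_num z * exp (- z / 2)" by (simp add: 0)
    also have "\<dots> = (\<Sum>\<^sub>\<infinity>m. theta_term m z * exp (- z / 2))"
      unfolding theta_num_def by (rule infsum_cmult_left'[symmetric])
    also have "\<dots> = (\<Sum>\<^sub>\<infinity>m. c m * (\<Prod>j\<in>{1..1}. v j powi m))"
      by (intro infsum_cong) (simp add: c z mult.assoc flip: exp_add)
    finally show "0 = (\<Sum>\<^sub>\<infinity>m. c m * (\<Prod>j\<in>{1..1}. v j powi m))" .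
  qed auto
  moreover have "{m\<in>UNIV. \<forall>j\<in>{1..1::nat}. m = 0} = {0::int}" by auto
  ultimately show False by (simp add: c_def)
qed

text \<open>By uniqueness the numerator of \<open>theta\<close> is a multiple of the product; the
  multiple is the derivative of the numerator at 0, and this is the denominator of
  \<open>theta\<close>.\<close>

theorem theta_eq_product: "theta \<tau> z = theta_product z"
proof -
  obtain c where c: "\<And>z. theta_num z = c * theta_product z"
    by (rule theta_like_unique[OF theta_like_theta_num]) blast
  have "c \<noteq> 0" using theta_num_nonzero c by auto
  have "theta_num = (\<lambda>z. c * theta_product z)" using c by auto
  hence "deriv theta_num 0 = c * deriv theta_product 0"
    using theta_product_holomorphic by (simp add: holomorphic_on_imp_differentiable_at[OF _ open_UNIV])
  hence d: "deriv theta_num 0 = c" by (simp add: deriv_theta_product_0)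
  have "theta \<tau> z = theta_num z / deriv theta_num 0"
    unfolding theta_def deriv_theta_num_0 theta_num_def theta_term_def by (simp only: mult.assoc)
  thus ?thesis using \<open>c \<noteq> 0\<close> by (simp add: c d)
qed

abbreviation "\<theta> \<equiv> theta \<tau>"

lemma theta_eq_theta_product: "\<theta> = theta_product"
  using theta_eq_product by auto

lemma theta_holomorphic: "\<theta> holomorphic_on A"
  unfolding theta_eq_theta_product by (rule holomorphic_on_subset[OF theta_product_holomorphic]) simp

lemmas theta_like_theta = theta_like_theta_product[folded theta_eq_theta_product]
lemmas theta_uminus [simp] = theta_product_uminus[folded theta_eq_theta_product]
lemmas theta_period = theta_product_period[folded theta_eq_theta_product]
lemmas theta_shift = theta_product_shift[folded theta_eq_theta_product]
lemmas theta_eq_0_iff = theta_product_eq_0_iff[folded theta_eq_theta_product]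
lemmas deriv_theta_0 = deriv_theta_product_0[folded theta_eq_theta_product]
lemmas theta_cancel = theta_product_cancel[folded theta_eq_theta_product]
lemmas theta_divides = theta_product_divides[folded theta_eq_theta_product]
lemmas theta_like_eq_mult_theta = theta_like_unique[folded theta_eq_theta_product]

lemma theta_0 [simp]: "\<theta> 0 = 0"
  by (simp add: theta_eq_0_iff)

end

section \<open>Addition formulas\<close>

context upper_half_plane
begin

lemma theta_DERIV: "(\<theta> has_field_derivative deriv \<theta> z) (at z)"
  by (rule holomorphic_derivI[OF theta_holomorphic open_UNIV UNIV_I])

lemma deriv_theta_holomorphic: "(deriv ^^ k) \<theta> holomorphic_on A"
  by (rule holomorphic_on_subset[OF holomorphic_higher_deriv[OF theta_holomorphic open_UNIV]]) simp

lemma deriv_theta_DERIV: "(deriv \<theta> has_field_derivative deriv (deriv \<theta>) z) (at z)"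
  by (rule holomorphic_derivI[OF _ open_UNIV UNIV_I]) (use deriv_theta_holomorphic[of 1] in simp)

lemma higher_deriv_theta_period: "(deriv ^^ k) \<theta> (z + period) = - (deriv ^^ k) \<theta> z"
proof -
  have "(deriv ^^ k) (\<lambda>w. \<theta> (1 * w + period)) z = 1 ^ k * (deriv ^^ k) \<theta> (1 * z + period)"
    by (rule higher_deriv_compose_linear'[where S = UNIV and T = UNIV]) (auto intro: theta_holomorphic)
  moreover have "(\<lambda>w. \<theta> (1 * w + period)) = (\<lambda>w. - \<theta> w)" by (simp add: theta_period)
  moreover have "(deriv ^^ k) (\<lambda>w. - \<theta> w) z = - (deriv ^^ k) \<theta> z"
    by (rule higher_deriv_uminus[where S = UNIV]) (auto intro: theta_holomorphic)
  ultimately show ?thesis by simp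
qed

lemma deriv_theta_shift:
  "deriv \<theta> (z + \<omega>) = - exp (- (\<omega> / 2) - z) * (deriv \<theta> z - \<theta> z)"
  "deriv (deriv \<theta>) (z + \<omega>) = - exp (- (\<omega> / 2) - z) * (deriv (deriv \<theta>) z - 2 * deriv \<theta> z + \<theta> z)"
proof -
  define e where "e = (\<lambda>z. - exp (- (\<omega> / 2) - z))"
  have e: "(e has_field_derivative - e z) (at z)" for z
    unfolding e_def by (auto intro!: derivative_eq_intros)
  have 1: "deriv \<theta> (z + \<omega>) = e z * (deriv \<theta> z - \<theta> z)" for z
  proof (rule DERIV_unique)
    show "((\<lambda>z. \<theta> (z + \<omega>)) has_field_derivative deriv \<theta> (z + \<omega>)) (at z)"
      using theta_DERIV[of "z + \<omega>"] by (simp add: DERIV_shift)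
    have "((\<lambda>z. e z * \<theta> z) has_field_derivative e z * (deriv \<theta> z - \<theta> z)) (at z)"
      using DERIV_mult[OF e theta_DERIV, of z] by (simp add: algebra_simps)
    thus "((\<lambda>z. \<theta> (z + \<omega>)) has_field_derivative e z * (deriv \<theta> z - \<theta> z)) (at z)"
      by (simp only: theta_shift e_def)
  qed
  have 2: "deriv (deriv \<theta>) (z + \<omega>) = e z * (deriv (deriv \<theta>) z - 2 * deriv \<theta> z + \<theta> z)" for z
  proof (rule DERIV_unique)
    show "((\<lambda>z. deriv \<theta> (z + \<omega>)) has_field_derivative deriv (deriv \<theta>) (z + \<omega>)) (at z)"
      using deriv_theta_DERIV[of "z + \<omega>"] by (simp add: DERIV_shift)
    have "((\<lambda>z. e z * (deriv \<theta> z - \<theta> z)) has_field_derivative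
        e z * (deriv (deriv \<theta>) z - 2 * deriv \<theta> z + \<theta> z)) (at z)"
      using DERIV_mult[OF e DERIV_diff[OF deriv_theta_DERIV theta_DERIV], of z] by (simp add: algebra_simps)
    thus "((\<lambda>z. deriv \<theta> (z + \<omega>)) has_field_derivative
        e z * (deriv (deriv \<theta>) z - 2 * deriv \<theta> z + \<theta> z)) (at z)"
      by (simp only: 1)
  qed
  show "deriv \<theta> (z + \<omega>) = - exp (- (\<omega> / 2) - z) * (deriv \<theta> z - \<theta> z)"
    "deriv (deriv \<theta>) (z + \<omega>) = - exp (- (\<omega> / 2) - z) * (deriv (deriv \<theta>) z - 2 * deriv \<theta> z + \<theta> z)"
    using 1[of z] 2[of z] by (simp_all add: e_def)
qed

text \<open>The quotient by theta has the quasi-periods of theta again, hence is a multiple of it: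
  second-order theta functions with these multipliers that vanish on the lattice form a
  line.\<close>

lemma square_theta_like:
  assumes "f holomorphic_on UNIV" "\<And>z. z \<in> lattice \<tau> ==> f z = 0" "\<And>z. f (z + period) = f z"
    "\<And>z. f (z + \<omega>) = exp (- (\<omega> / 2) - z) ^ 2 * f z"
  shows "\<exists>c. \<forall>z. f z = c * \<theta> z ^ 2"
proof -
  obtain k where k: "k holomorphic_on UNIV" "\<And>z. f z = \<theta> z * k z"
    using theta_divides[OF assms(1,2)] by metis
  have "k (z + period) = - k z" for z
  proof (rule theta_cancel[of "\<lambda>z. k (z + period)" "\<lambda>z. - k z"])
    fix z show "\<theta> z * k (z + period) = \<theta> z * - k z"
      using assms(3)[of z] unfolding k(2) theta_period by (metis minus_minus mult_minus_left mult_minus_right)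
  qed (rule holomorphic_on_shift[OF k(1)], rule holomorphic_on_minus[OF k(1)])
  moreover have "k (z + \<omega>) = - exp (- (\<omega> / 2) - z) * k z" for z
  proof (rule theta_cancel[of "\<lambda>z. k (z + \<omega>)" "\<lambda>z. - exp (- (\<omega> / 2) - z) * k z"])
    fix z
    define X where "X = exp (- (\<omega> / 2) - z)"
    have "X \<noteq> 0" by (simp add: X_def)
    have "- X * \<theta> z * k (z + \<omega>) = X ^ 2 * (\<theta> z * k z)"
      using assms(4)[of z] unfolding k(2) theta_shift by (simp add: X_def)
    hence "X * (\<theta> z * k (z + \<omega>)) = X * (\<theta> z * (- X * k z))"
      by (simp add: power2_eq_square algebra_simps minus_equation_iff)
    thus "\<theta> z * k (z + \<omega>) = \<theta> z * (- exp (- (\<omega> / 2) - z) * k z)"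
      unfolding X_def[symmetric] by (simp only: mult_left_cancel[OF \<open>X \<noteq> 0\<close>])
  next
    show "(\<lambda>z. - exp (- (\<omega> / 2) - z) * k z) holomorphic_on UNIV"
      by (intro holomorphic_intros k(1))
  qed (rule holomorphic_on_shift[OF k(1)])
  ultimately have "theta_like k" using k(1) by (auto simp: theta_like_def)
  then obtain c where "\<And>z. k z = c * \<theta> z" using theta_like_eq_mult_theta by metis
  thus ?thesis by (intro exI[of _ c]) (simp add: k power2_eq_square)
qed

text \<open>This is -theta^2 (log theta)'', that is, theta^2 times the Weierstrass P-function plus a
  constant. In this form it is entire, and the addition formula contains no division.\<close>

definition theta_hirota :: "complex => complex" where
  "theta_hirota z = deriv \<theta> z ^ 2 - \<theta> z * deriv (deriv \<theta>) z"

lemma theta_hirota_holomorphic: "theta_hirota holomorphic_on A"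
  unfolding theta_hirota_def[abs_def]
  using deriv_theta_holomorphic[of 1 A] deriv_theta_holomorphic[of 2 A]
  by (intro holomorphic_on_diff holomorphic_on_mult holomorphic_on_power theta_holomorphic) (simp_all add: numeral_2_eq_2)

lemma deriv_theta_period:
  "deriv \<theta> (z + period) = - deriv \<theta> z" "deriv (deriv \<theta>) (z + period) = - deriv (deriv \<theta>) z"
  using higher_deriv_theta_period[of 1 z] higher_deriv_theta_period[of 2 z] by (simp_all add: numeral_2_eq_2)

text \<open>The bilinear form of sigma(x + t) sigma(x - t) = sigma(x)^2 sigma(t)^2 (P(t) - P(x)).
  For fixed t off the lattice, the difference of both sides is, as a function of x, a second-order
  theta function vanishing on the lattice, hence c theta(x)^2, and x = t gives c = 0. For t in the
  lattice, x and t exchange roles or all terms vanish.\<close>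

theorem theta_addition:
  "\<theta> (x + t) * \<theta> (x - t) = \<theta> x ^ 2 * theta_hirota t - \<theta> t ^ 2 * theta_hirota x"
proof -
  have main: "\<theta> (x + t) * \<theta> (x - t) = \<theta> x ^ 2 * theta_hirota t - \<theta> t ^ 2 * theta_hirota x"
    if t: "\<theta> t \<noteq> 0" for x t
  proof -
    define D where "D = (\<lambda>x. \<theta> (x + t) * \<theta> (x - t) - \<theta> x ^ 2 * theta_hirota t + \<theta> t ^ 2 * theta_hirota x)"
    have "\<exists>c. \<forall>z. D z = c * \<theta> z ^ 2"
    proof (rule square_theta_like)
      have "(\<lambda>x. \<theta> (x + t)) holomorphic_on UNIV" "(\<lambda>x. \<theta> (x + (- t))) holomorphic_on UNIV"
        by (rule holomorphic_on_shift[OF theta_holomorphic])+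
      thus "D holomorphic_on UNIV"
        unfolding D_def by (intro holomorphic_intros theta_holomorphic theta_hirota_holomorphic) simp_all
    next
      fix z assume "z \<in> lattice \<tau>"
      then obtain a b :: int where z: "z = period * of_int a + \<omega> * of_int b"
        by (auto simp: lattice_def)
      define A where "A = \<omega> / 2 * of_int b ^ 2"
      define s where "s = (-1 :: complex) powi (a + b)"
      have s2: "s * s = 1" unfolding s_def by (simp flip: power_int_mult_distrib)
      have L: "\<theta> (w + z) = s * exp (- (A + of_int b * w)) * \<theta> w" for w
        unfolding z A_def s_def by (rule theta_like_lattice[OF theta_like_theta])
      have "(\<theta> has_field_derivative deriv \<theta> z) (at (0 + z))" using theta_DERIV[of z] by simp
      hence "((\<lambda>w. \<theta> (w + z)) has_field_derivative deriv \<theta> z) (at 0)" by (simp only: DERIV_shift)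
      moreover have "((\<lambda>w. s * exp (- (A + of_int b * w)) * \<theta> w) has_field_derivative s * exp (- A)) (at 0)"
      proof -
        have "(\<theta> has_field_derivative 1) (at 0)" using theta_DERIV[of 0] by (simp add: deriv_theta_0)
        moreover have "((\<lambda>w. s * exp (- (A + of_int b * w))) has_field_derivative - of_int b * s * exp (- A)) (at 0)"
          by (auto intro!: derivative_eq_intros)
        ultimately show ?thesis using DERIV_mult by fastforce
      qed
      \<comment> \<open>The derivative at a lattice point, read off from the quasi-periodicity near
        0.\<close>
      ultimately have d: "deriv \<theta> z = s * exp (- A)" unfolding L by (rule DERIV_unique)
      have "\<theta> z = 0" using L[of 0] by simp
      moreover have "\<theta> (z + t) * \<theta> (z - t) = - (\<theta> t ^ 2 * deriv \<theta> z ^ 2)"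
      proof -
        have "exp (- (A + of_int b * t)) * exp (- (A + of_int b * (- t))) = exp (- A) * exp (- A)"
          by (simp flip: exp_add)
        hence "\<theta> (t + z) * \<theta> (- t + z) = (s * s) * (exp (- A) * exp (- A)) * (\<theta> t * \<theta> (- t))"
          unfolding L by (simp add: mult_ac)
        thus ?thesis by (simp add: d s2 power2_eq_square add.commute mult_ac)
      qed
      ultimately show "D z = 0" by (simp add: D_def theta_hirota_def)
    next
      fix z
      have "z + period + t = (z + t) + period" "z + period - t = (z - t) + period" by simp_all
      thus "D (z + period) = D z"
        unfolding D_def theta_hirota_def by (simp only: theta_period deriv_theta_period) simp
    next
      fix z
      define X where "X = exp (- (\<omega> / 2) - z)"
      have s: "z + \<omega> + t = (z + t) + \<omega>" "z + \<omega> - t = (z - t) + \<omega>" by simp_all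
      have "exp (- (\<omega> / 2) - (z + t)) * exp (- (\<omega> / 2) - (z - t)) = X ^ 2"
        unfolding X_def power2_eq_square exp_add[symmetric] by simp
      hence "\<theta> (z + \<omega> + t) * \<theta> (z + \<omega> - t) = X ^ 2 * (\<theta> (z + t) * \<theta> (z - t))"
        unfolding s theta_shift by (simp add: algebra_simps)
      moreover have "theta_hirota (z + \<omega>) = X ^ 2 * theta_hirota z"
        unfolding theta_hirota_def theta_shift deriv_theta_shift X_def[symmetric]
        by (simp add: power2_eq_square algebra_simps)
      moreover have "\<theta> (z + \<omega>) ^ 2 = X ^ 2 * \<theta> z ^ 2"
        unfolding theta_shift X_def[symmetric] by (simp add: power_mult_distrib)
      ultimately show "D (z + \<omega>) = exp (- (\<omega> / 2) - z) ^ 2 * D z"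
        unfolding D_def X_def[symmetric] by (simp add: algebra_simps)
    qed
    then obtain c where c: "\<And>z. D z = c * \<theta> z ^ 2" by blast
    have "D t = 0" by (simp add: D_def)
    hence "c = 0" using c[of t] t by simp
    thus ?thesis using c[of x] by (simp add: D_def algebra_simps)
  qed
  show ?thesis
  proof (cases "\<theta> t = 0")
    case False
    thus ?thesis by (rule main)
  next
    case True
    show ?thesis
    proof (cases "\<theta> x = 0")
      case False
      have "\<theta> (x - t) = - \<theta> (t - x)" using theta_uminus[of "t - x"] by simp
      thus ?thesis using main[OF False, of t] by (simp add: add.commute)
    next
      assume x: "\<theta> x = 0"
      obtain a b where "exp t = q powi a" "exp x = q powi b"
        using True x by (auto simp: theta_eq_0_iff mem_lattice_iff)
      hence "exp (x + t) = q powi (b + a)" by (simp add: exp_add power_int_add)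
      hence "\<theta> (x + t) = 0" unfolding theta_eq_0_iff mem_lattice_iff by blast
      thus ?thesis using True x by simp
    qed
  qed
qed

text \<open>With \<open>[x y] = \<theta>(x)\<^sup>2 h(y) - \<theta>(y)\<^sup>2 h(x)\<close> this is the Pluecker relation
  \<open>[a b][c d] - [a d][c b] = [a c][b d]\<close>.\<close>

lemma theta_three_term:
  "\<theta> (c + t) * \<theta> (a + b - c + t) * \<theta> a * \<theta> b - \<theta> (a + t) * \<theta> (b + t) * \<theta> c * \<theta> (a + b - c)
     = \<theta> t * \<theta> (t + a + b) * \<theta> (c - a) * \<theta> (c - b)"
proof -
  \<comment> \<open>Half-sums that turn each of the six pairs of factors into theta(X + Y) theta(X -
    Y) with X and Y among A, B, C, D.\<close>
  define A B C D where "A = t + (a + b) / 2" and "B = c - (a + b) / 2" and "C = (a + b) / 2" and "D = (a - b) / 2"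
  have e: "c + t = A + B" "a + b - c + t = A - B" "a = C + D" "b = C - D" "a + t = A + D" "b + t = A - D"
    "c = C + B" "a + b - c = C - B" "t + a + b = A + C" "t = A - C" "c - a = B - D" "c - b = B + D"
    by (simp_all add: A_def B_def C_def D_def field_simps)
  let ?p = "\<lambda>x y. \<theta> x ^ 2 * theta_hirota y - \<theta> y ^ 2 * theta_hirota x"
  have "\<theta> (c + t) * \<theta> (a + b - c + t) * (\<theta> a * \<theta> b) = ?p A B * ?p C D"
    unfolding e(1,2) theta_addition by (simp only: e(3,4) theta_addition)
  moreover have "\<theta> (a + t) * \<theta> (b + t) * (\<theta> c * \<theta> (a + b - c)) = ?p A D * ?p C B"
    unfolding e(5,6,8) theta_addition by (simp only: e(7) theta_addition)
  moreover have "\<theta> (t + a + b) * \<theta> t * (\<theta> (c - b) * \<theta> (c - a)) = ?p A C * ?p B D"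
    unfolding e(9,11,12) theta_addition by (simp only: e(10) theta_addition)
  moreover have "?p A B * ?p C D - ?p A D * ?p C B = ?p A C * ?p B D"
    by (simp add: algebra_simps)
  ultimately show ?thesis by (simp only: mult.assoc) (simp add: mult_ac)
qed


section \<open>The Kronecker function and Frobenius' determinant\<close>

definition kronecker :: "complex => complex => complex" where
  "kronecker x t = \<theta> (x + t) / (\<theta> x * \<theta> t)"

text \<open>By the three-term relation, eliminating the pivot at c from a Kronecker matrix leaves a
  Kronecker matrix with parameter t + c, up to one factor for each row and each column.\<close>

lemma kronecker_Schur_complement:
  assumes "\<theta> t \<noteq> 0" "\<theta> a \<noteq> 0" "\<theta> b \<noteq> 0" "\<theta> c \<noteq> 0" "\<theta> (a + b - c) \<noteq> 0" "\<theta> (t + c) \<noteq> 0"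
  shows "kronecker (a + b - c) t - kronecker a t * kronecker b t / kronecker c t
     = (\<theta> (c - a) / \<theta> a) * (\<theta> (c - b) / \<theta> b) * kronecker (a + b - c) (t + c)"
proof -
  have e: "a + b - c + (t + c) = t + a + b" by simp
  have tc: "\<theta> (c + t) = \<theta> (t + c)" by (simp add: add.commute)
  have "kronecker (a + b - c) t - kronecker a t * kronecker b t / kronecker c t
    = (\<theta> (c + t) * \<theta> (a + b - c + t) * \<theta> a * \<theta> b - \<theta> (a + t) * \<theta> (b + t) * \<theta> c * \<theta> (a + b - c))
      / (\<theta> t * \<theta> (t + c) * \<theta> a * \<theta> b * \<theta> (a + b - c))"
    using assms unfolding kronecker_def tc by (simp add: field_simps)
  also have "\<dots> = (\<theta> t * \<theta> (t + a + b) * \<theta> (c - a) * \<theta> (c - b)) / (\<theta> t * \<theta> (t + c) * \<theta> a * \<theta> b * \<theta> (a + b - c))"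
    by (simp only: theta_three_term)
  also have "\<dots> = (\<theta> (c - a) / \<theta> a) * (\<theta> (c - b) / \<theta> b) * kronecker (a + b - c) (t + c)"
    using assms unfolding kronecker_def e by (simp add: field_simps)
  finally show ?thesis .
qed

abbreviation pairs :: "nat => (nat \<times> nat) set" where
  "pairs n \<equiv> {(i, j). 1 \<le> i \<and> i < j \<and> j \<le> n}"

text \<open>The elliptic Cauchy product. For i < j the differences are oriented as in \<varpi>,
  namely y_i - x_j, so that no signs enter the determinant formula.\<close>

definition cauchy_product :: "nat => (nat => complex) => (nat => complex) => complex" where
  "cauchy_product n x y = (\<Prod>(i,j)\<in>pairs n. \<theta> (x i - x j) * \<theta> (y i - y j))
     / ((\<Prod>i\<in>{1..n}. \<theta> (x i - y i)) * (\<Prod>(i,j)\<in>pairs n. \<theta> (x i - y j) * \<theta> (y i - x j)))"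

lemma prod_pairs_Suc:
  "(\<Prod>p\<in>pairs (Suc n). f p) = (\<Prod>p\<in>pairs n. f p) * (\<Prod>i\<in>{1..n}. f (i, Suc n) :: complex)"
proof -
  have "pairs n \<subseteq> {1..n} \<times> {1..n}" by auto
  hence fin: "finite (pairs n)" by (rule finite_subset) auto
  have "pairs (Suc n) = pairs n \<union> (\<lambda>i. (i, Suc n)) ` {1..n}"
    by (auto simp: le_Suc_eq)
  moreover have "pairs n \<inter> (\<lambda>i. (i, Suc n)) ` {1..n} = {}" by auto
  ultimately have "(\<Prod>p\<in>pairs (Suc n). f p) = (\<Prod>p\<in>pairs n. f p) * (\<Prod>p\<in>(\<lambda>i. (i, Suc n)) ` {1..n}. f p)"
    using fin by (simp add: prod.union_disjoint)
  thus ?thesis by (subst (asm) prod.reindex) (auto simp: inj_on_def)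
qed

lemma cauchy_product_Suc:
  "cauchy_product (Suc n) x y = cauchy_product n x y / \<theta> (x (Suc n) - y (Suc n))
     * (\<Prod>i\<in>{1..n}. \<theta> (x i - x (Suc n)) * \<theta> (y i - y (Suc n)) / (\<theta> (x i - y (Suc n)) * \<theta> (y i - x (Suc n))))"
  unfolding cauchy_product_def prod_pairs_Suc by (simp add: prod_dividef prod.nat_ivl_Suc' mult_ac)

text \<open>Induction by elimination of the last index: each step multiplies by one pivot and moves
  t to t + x_N - y_N. The last hypothesis says that the pivots, whose numerators are theta at t plus
  the tail sums, do not vanish.\<close>

theorem frobenius_determinant:
  assumes "\<theta> t \<noteq> 0" "\<And>i j. i \<in> {1..n} ==> j \<in> {1..n} ==> \<theta> (x i - y j) \<noteq> 0"
    "\<And>k. k \<in> {1..n} ==> \<theta> (t + (\<Sum>j\<in>{k..n}. x j - y j)) \<noteq> 0"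
  shows "dt {1..n} (\<lambda>i j. kronecker (x i - y j) t)
     = \<theta> (t + (\<Sum>j\<in>{1..n}. x j - y j)) / \<theta> t * cauchy_product n x y"
  using assms
proof (induction n arbitrary: t)
  case 0
  have "pairs 0 = {}" by auto
  hence "cauchy_product 0 x y = 1" unfolding cauchy_product_def by (simp only:) simp
  thus ?case using 0 by simp
next
  case (Suc n)
  let ?N = "Suc n"
  define c where "c = x ?N - y ?N"
  have tc: "\<theta> (t + c) \<noteq> 0" using Suc.prems(3)[of ?N] by (simp add: c_def)
  have nz: "\<theta> (x i - y j) \<noteq> 0" if "i \<in> {1..?N}" "j \<in> {1..?N}" for i j using that by (rule Suc.prems(2))
  have c0: "\<theta> c \<noteq> 0" unfolding c_def by (rule nz) auto
  have set: "{1..?N} = insert ?N {1..n}" by auto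
  have kc: "kronecker c t = \<theta> (t + c) / (\<theta> c * \<theta> t)" by (simp add: kronecker_def add.commute)
  have sum: "(\<Sum>j\<in>{k..?N}. x j - y j) = c + (\<Sum>j\<in>{k..n}. x j - y j)" if "k \<le> ?N" for k
    using that by (simp add: c_def sum.nat_ivl_Suc')
  have IH: "dt {1..n} (\<lambda>i j. kronecker (x i - y j) (t + c))
     = \<theta> (t + c + (\<Sum>j\<in>{1..n}. x j - y j)) / \<theta> (t + c) * cauchy_product n x y"
  proof (rule Suc.IH[OF tc])
    fix k assume k: "k \<in> {1..n}"
    hence "t + (\<Sum>j\<in>{k..?N}. x j - y j) = t + c + (\<Sum>j\<in>{k..n}. x j - y j)"
      by (subst sum) (auto simp: add.assoc)
    moreover have "\<theta> (t + (\<Sum>j\<in>{k..?N}. x j - y j)) \<noteq> 0"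
      by (rule Suc.prems(3)) (use k in auto)
    ultimately show "\<theta> (t + c + (\<Sum>j\<in>{k..n}. x j - y j)) \<noteq> 0" by metis
  qed (use Suc.prems(2) in auto)
  have S: "t + (\<Sum>j\<in>{1..?N}. x j - y j) = t + c + (\<Sum>j\<in>{1..n}. x j - y j)"
    by (subst sum) (auto simp: add.assoc)
  define u where "u = (\<lambda>i. \<theta> (c - (x i - y ?N)) / \<theta> (x i - y ?N))"
  define v where "v = (\<lambda>j. \<theta> (c - (x ?N - y j)) / \<theta> (x ?N - y j))"
  have "dt {1..?N} (\<lambda>i j. kronecker (x i - y j) t)
    = kronecker c t * dt {1..n} (\<lambda>i j. kronecker (x i - y j) t - kronecker (x i - y ?N) t * kronecker (x ?N - y j) t / kronecker c t)"
    unfolding set using c0 tc Suc.prems(1)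
    by (subst dt_Schur_complement) (auto simp: kc c_def[symmetric])
  also have "dt {1..n} (\<lambda>i j. kronecker (x i - y j) t - kronecker (x i - y ?N) t * kronecker (x ?N - y j) t / kronecker c t)
    = dt {1..n} (\<lambda>i j. u i * v j * kronecker (x i - y j) (t + c))"
  proof (rule dt_cong)
    fix i j assume ij: "i \<in> {1..n}" "j \<in> {1..n}"
    have e: "x i - y j = (x i - y ?N) + (x ?N - y j) - c" by (simp add: c_def)
    show "kronecker (x i - y j) t - kronecker (x i - y ?N) t * kronecker (x ?N - y j) t / kronecker c t
       = u i * v j * kronecker (x i - y j) (t + c)"
      unfolding u_def v_def e using ij Suc.prems(1) c0 tc nz
      by (intro kronecker_Schur_complement) (auto simp flip: e)
  qed
  also have "\<dots> = (\<Prod>i\<in>{1..n}. u i * v i) * dt {1..n} (\<lambda>i j. kronecker (x i - y j) (t + c))"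
    by (simp add: dt_scale prod.distrib)
  also have "(\<Prod>i\<in>{1..n}. u i * v i)
     = (\<Prod>i\<in>{1..n}. \<theta> (x i - x ?N) * \<theta> (y i - y ?N) / (\<theta> (x i - y ?N) * \<theta> (y i - x ?N)))"
  proof (rule prod.cong[OF refl])
    fix i
    have 1: "\<theta> (c - (x i - y ?N)) = - \<theta> (x i - x ?N)"
      using theta_uminus[of "x i - x ?N"] by (simp add: c_def)
    have 2: "\<theta> (c - (x ?N - y i)) = \<theta> (y i - y ?N)" by (simp add: c_def)
    have 3: "\<theta> (x ?N - y i) = - \<theta> (y i - x ?N)"
      using theta_uminus[of "y i - x ?N"] by simp
    show "u i * v i = \<theta> (x i - x ?N) * \<theta> (y i - y ?N) / (\<theta> (x i - y ?N) * \<theta> (y i - x ?N))"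
      unfolding u_def v_def 1 2 unfolding 3 by simp
  qed
  finally show ?case
    unfolding cauchy_product_Suc IH kc S c_def[symmetric] using tc Suc.prems(1) by (simp add: mult_ac)
qed

end

section \<open>The Fourier expansion of the Kronecker function\<close>

context upper_half_plane
begin

lemma norm_q_pos: "0 < norm q"
  by simp

text \<open>The exponent 1 - c is a truncated difference with c in {0, 1}. The coefficients for c =
  0 and c = 1 differ by 1 in every mode, a formal delta series, as is to be expected on the two
  sides of the pole at X = 1.\<close>

definition kronecker_coeff :: "nat => int => complex => complex" where
  "kronecker_coeff c k t = - ((q powi k * exp t) ^ (1 - c)) / (1 - q powi k * exp t)"

text \<open>The annulus of convergence belonging to the value \<open>c\<close> of the ordering function.\<close>

definition in_annulus :: "nat => complex => bool" where
  "in_annulus c X \<longleftrightarrow> (c = 0 \<and> 1 < norm X \<and> norm X < inverse (norm q)) \<or> (c = 1 \<and> norm q < norm X \<and> norm X < 1)"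

lemma in_annulus_nonzero: "in_annulus c X ==> X \<noteq> 0"
  using norm_q_pos by (auto simp: in_annulus_def)

lemma in_annulus_not_lattice:
  assumes "in_annulus c (exp x)"
  shows "x \<notin> lattice \<tau>"
proof
  assume "x \<in> lattice \<tau>"
  then obtain b where b: "exp x = q powi b" unfolding mem_lattice_iff by blast
  have eq: "norm (exp x) = exp (- 2 * pi * Im \<tau> * of_int b)"
    by (simp only: b norm_power_int norm_q) (simp add: exp_power_int mult.commute)
  define L where "L = 2 * pi * Im \<tau>"
  have L: "L > 0" using Im_pos by (simp add: L_def)
  have e: "norm (exp x) = exp (- L * of_int b)" "norm q = exp (- L)" "inverse (exp (- L)) = exp L"
    using eq by (simp_all add: L_def norm_q exp_minus)
  have "(0 < - L * of_int b \<and> - L * of_int b < L) \<or> (- L < - L * of_int b \<and> - L * of_int b < 0)"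
    using assms unfolding in_annulus_def e by auto
  hence "(0 < L * of_int (- b) \<and> L * of_int (- b) < L * 1) \<or> (L * (-1) < L * of_int (- b) \<and> L * of_int (-b) < L * 0)"
    by simp
  hence "(0 < - b \<and> - b < 1) \<or> (-1 < - b \<and> - b < 0)"
    using L unfolding mult_less_cancel_left_pos[OF L] by (auto simp: zero_less_mult_iff simp flip: of_int_minus)
  thus False by linarith
qed

text \<open>Mode 0 is excluded because its coefficient has a pole at t = 0. The other modes stay
  regular and decay geometrically, uniformly for t near 0; this justifies both differentiation and
  limits in t.\<close>

lemma kronecker_coeff_bound:
  assumes X: "in_annulus c X"
  obtains C \<rho> \<delta> where "0 < \<delta>" "0 \<le> \<rho>" "\<rho> < 1" "0 \<le> C"
    "\<And>t k. norm t < \<delta> ==> k \<noteq> 0 ==> norm (kronecker_coeff c k t * X powi k) \<le> C * \<rho> ^ nat \<bar>k\<bar>"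
    "\<And>t k. norm t < \<delta> ==> k \<noteq> 0 ==> q powi k * exp t \<noteq> 1"
proof -
  define Q where "Q = norm q"
  have Q: "0 < Q" "Q < 1" using norm_q_less_1 by (auto simp: Q_def)
  \<comment> \<open>With s = sqrt |q| and s < |exp t| < 1/s, the modulus of q^k exp t is at most s
    for k > 0 and at least 1/s for k < 0, so it stays away from 1.\<close>
  define s where "s = sqrt Q"
  have s: "0 < s" "s < 1" "s * s = Q" using Q by (auto simp: s_def)
  define \<delta> where "\<delta> = - ln s"
  have \<delta>: "\<delta> > 0" "exp \<delta> = 1 / s" "exp (- \<delta>) = s" using s by (auto simp: \<delta>_def exp_minus field_simps)
  have t: "s < norm (exp t)" "norm (exp t) < 1 / s" if "norm t < \<delta>" for t :: complex
  proof -
    have "\<bar>Re t\<bar> < \<delta>" using abs_Re_le_cmod[of t] that by linarith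
    hence "exp (- \<delta>) < exp (Re t)" "exp (Re t) < exp \<delta>" by auto
    thus "s < norm (exp t)" "norm (exp t) < 1 / s" by (simp_all add: \<delta>)
  qed
  define d where "d = 1 - s"
  have d: "d > 0" using s by (simp add: d_def)
  have small: "norm (1 / (1 - w)) \<le> 1 / d" "w \<noteq> 1" "norm (w / (1 - w)) \<le> norm w / d" if "norm w \<le> s" for w :: complex
  proof -
    have "d \<le> norm (1 - w)" using norm_triangle_ineq2[of 1 w] that by (simp add: d_def)
    thus "norm (1 / (1 - w)) \<le> 1 / d" "norm (w / (1 - w)) \<le> norm w / d"
      using d unfolding norm_divide norm_one by (auto intro!: frac_le)
    show "w \<noteq> 1" using that s by auto
  qed
  define \<rho> where "\<rho> = (if c = 0 then max (Q * norm X) (inverse (norm X)) else max (norm X) (Q / norm X))"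
  have X0: "0 < norm X" using in_annulus_nonzero[OF X] by simp
  have \<rho>: "0 \<le> \<rho>" "\<rho> < 1"
    using X Q X0 by (auto simp: \<rho>_def in_annulus_def Q_def[symmetric] field_simps max_def)
  have pos: "norm (kronecker_coeff c k t * X powi k) \<le> 1 / (s * d) * \<rho> ^ nat \<bar>k\<bar>" "q powi k * exp t \<noteq> 1"
    if t': "norm t < \<delta>" and k: "k > 0" for t k
  proof -
    obtain m where m: "k = int (Suc m)" using k by (metis gr0_implies_Suc pos_int_cases)
    define w where "w = q powi k * exp t"
    have nw: "norm w \<le> Q ^ Suc m / s"
      using t(2)[OF t'] Q unfolding w_def m power_int_of_nat norm_mult norm_power Q_def[symmetric]
      by (auto intro!: mult_left_mono simp: divide_inverse simp del: power_Suc)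
    also have "Q ^ Suc m / s \<le> Q ^ 1 / s" using Q s by (intro divide_right_mono power_decreasing) auto
    also have "\<dots> = s" using s by (simp add: field_simps)
    finally have w: "norm w \<le> s" .
    show "q powi k * exp t \<noteq> 1" using small(2)[OF w] by (simp add: w_def)
    have nX: "norm (X powi k) = norm X ^ Suc m" by (simp only: m power_int_of_nat norm_power)
    have mk: "nat \<bar>k\<bar> = Suc m" by (simp add: m)
    show "norm (kronecker_coeff c k t * X powi k) \<le> 1 / (s * d) * \<rho> ^ nat \<bar>k\<bar>"
    proof (cases "c = 0")
      case True
      have "norm (kronecker_coeff c k t) = norm (w / (1 - w))" by (simp add: kronecker_coeff_def True w_def norm_divide)
      also have "\<dots> \<le> (Q ^ Suc m / s) / d" using small(3)[OF w] nw d by (meson divide_right_mono less_imp_le order.trans)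
      finally have "norm (kronecker_coeff c k t * X powi k) \<le> (Q ^ Suc m / s) / d * norm X ^ Suc m"
        unfolding norm_mult nX by (intro mult_right_mono) auto
      also have "\<dots> = 1 / (s * d) * (Q * norm X) ^ Suc m" by (simp add: power_mult_distrib)
      also have "\<dots> \<le> 1 / (s * d) * \<rho> ^ Suc m"
        using s d Q by (intro mult_left_mono power_mono) (auto simp: \<rho>_def True)
      finally show ?thesis by (simp only: mk)
    next
      case False
      hence c: "1 - c = 0" using X by (auto simp: in_annulus_def)
      have "kronecker_coeff c k t = - (1 / (1 - w))" unfolding kronecker_coeff_def c w_def by simp
      hence "norm (kronecker_coeff c k t) = norm (1 / (1 - w))" by (simp only: norm_minus_cancel)
      also have "\<dots> \<le> 1 / d" by (rule small(1)[OF w])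
      also have "\<dots> \<le> 1 / (s * d)" using s d by (simp add: field_simps)
      finally have "norm (kronecker_coeff c k t * X powi k) \<le> 1 / (s * d) * norm X ^ Suc m"
        unfolding norm_mult nX by (intro mult_right_mono) auto
      also have "\<dots> \<le> 1 / (s * d) * \<rho> ^ Suc m"
        using s d Q by (intro mult_left_mono power_mono) (auto simp: \<rho>_def False)
      finally show ?thesis by (simp only: mk)
    qed
  qed
  have neg: "norm (kronecker_coeff c k t * X powi k) \<le> 1 / (s * d) * \<rho> ^ nat \<bar>k\<bar>" "q powi k * exp t \<noteq> 1"
    if t': "norm t < \<delta>" and k: "k < 0" for t k
  proof -
    obtain m where m: "k = - int (Suc m)" using k by (metis neg_int_cases gr0_implies_Suc)
    define y where "y = q powi k * exp t"
    define w where "w = 1 / y"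
    have y0: "y \<noteq> 0" by (simp add: y_def)
    have ny: "norm y = norm (exp t) / Q ^ Suc m"
      by (simp only: y_def m power_int_minus power_int_of_nat norm_mult norm_inverse norm_power Q_def[symmetric])
         (simp add: divide_inverse mult.commute)
    have nw: "norm w \<le> Q ^ Suc m / s"
      unfolding w_def norm_divide ny using t(1)[OF t'] Q s by (auto intro!: divide_left_mono simp del: power_Suc)
    also have "Q ^ Suc m / s \<le> Q ^ 1 / s" using Q s by (intro divide_right_mono power_decreasing) auto
    also have "\<dots> = s" using s by (simp add: field_simps)
    finally have w: "norm w \<le> s" .
    have y1: "y \<noteq> 1" using small(2)[OF w] by (auto simp: w_def)
    thus "q powi k * exp t \<noteq> 1" by (simp add: y_def)
    have nX: "norm (X powi k) = inverse (norm X) ^ Suc m"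
      by (simp only: m power_int_minus power_int_of_nat norm_power norm_inverse power_inverse)
    have mk: "nat \<bar>k\<bar> = Suc m" by (simp add: m)
    show "norm (kronecker_coeff c k t * X powi k) \<le> 1 / (s * d) * \<rho> ^ nat \<bar>k\<bar>"
    proof (cases "c = 0")
      case True
      have "- y / (1 - y) = 1 / (1 - w)" using y0 y1 by (simp add: w_def field_simps)
      hence "norm (kronecker_coeff c k t) = norm (1 / (1 - w))" by (simp add: kronecker_coeff_def True flip: y_def)
      also have "\<dots> \<le> 1 / d" by (rule small(1)[OF w])
      also have "\<dots> \<le> 1 / (s * d)" using s d by (simp add: field_simps)
      finally have "norm (kronecker_coeff c k t * X powi k) \<le> 1 / (s * d) * inverse (norm X) ^ Suc m"
        unfolding norm_mult nX by (intro mult_right_mono) auto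
      also have "\<dots> \<le> 1 / (s * d) * \<rho> ^ Suc m"
        using s d Q by (intro mult_left_mono power_mono) (auto simp: \<rho>_def True)
      finally show ?thesis by (simp only: mk)
    next
      case False
      hence c: "1 - c = 0" using X by (auto simp: in_annulus_def)
      have "- 1 / (1 - y) = w / (1 - w)" using y0 y1 by (simp add: w_def field_simps)
      moreover have "kronecker_coeff c k t = - 1 / (1 - y)" unfolding kronecker_coeff_def c y_def by simp
      ultimately have "norm (kronecker_coeff c k t) = norm (w / (1 - w))" by simp
      also have "\<dots> \<le> (Q ^ Suc m / s) / d" using small(3)[OF w] nw d by (meson divide_right_mono less_imp_le order.trans)
      finally have "norm (kronecker_coeff c k t * X powi k) \<le> (Q ^ Suc m / s) / d * inverse (norm X) ^ Suc m"
        unfolding norm_mult nX by (intro mult_right_mono) auto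
      also have "\<dots> = 1 / (s * d) * (Q / norm X) ^ Suc m" by (simp add: power_mult_distrib divide_inverse)
      also have "\<dots> \<le> 1 / (s * d) * \<rho> ^ Suc m"
        using s d Q by (intro mult_left_mono power_mono) (auto simp: \<rho>_def False)
      finally show ?thesis by (simp only: mk)
    qed
  qed
  show ?thesis
    by (rule that[OF \<delta>(1) \<rho>, of "1 / (s * d)"]) (use s d pos neg in \<open>auto simp: neq_iff\<close>)
qed

text \<open>The zeros of 1 - q^k exp t are simple and lie in the lattice. Multiplied by theta, each
  term of the Fourier series thus becomes entire in t.\<close>

lemma theta_quotient_ex: "\<exists>e. \<forall>k. e k holomorphic_on UNIV \<and> (\<forall>t. \<theta> t = (1 - q powi k * exp t) * e k t)"
proof (rule choice, rule allI)
  fix k :: int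
  define h where "h = (\<lambda>t. 1 - q powi k * exp t)"
  have "\<theta> t = 0" if "h t = 0" for t
  proof -
    have "exp t = q powi (- k)" using that by (simp add: h_def power_int_minus field_simps)
    thus ?thesis unfolding theta_eq_0_iff mem_lattice_iff by blast
  qed
  moreover have "deriv h t = - (q powi k * exp t)" for t
    unfolding h_def by (rule DERIV_imp_deriv) (auto intro!: derivative_eq_intros)
  moreover have "h holomorphic_on UNIV" unfolding h_def by (intro holomorphic_intros)
  ultimately obtain e where "e holomorphic_on UNIV" "\<And>t. \<theta> t = h t * e t"
    using entire_quotient[OF theta_holomorphic, of h] by auto
  thus "\<exists>e. e holomorphic_on UNIV \<and> (\<forall>t. \<theta> t = (1 - q powi k * exp t) * e t)"
    unfolding h_def by blast
qed

lemma exists_nat_power_le: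
  assumes "0 \<le> c" "c < (1::real)" "0 < e"
  obtains N where "\<And>m. m \<ge> N ==> c ^ m \<le> e"
proof -
  have "(\<lambda>m. c ^ m) \<longlonglongrightarrow> 0" using assms by (intro LIMSEQ_power_zero) auto
  hence "\<forall>\<^sub>F m in sequentially. c ^ m < e" using assms(3) by (rule order_tendstoD)
  thus ?thesis using that by (auto simp: eventually_sequentially intro: less_imp_le)
qed

text \<open>\<open>\<theta>(t)\<close> times the series is entire in \<open>t\<close> with the quasi-periods of \<open>\<theta>(x + t)\<close>, hence
  proportional to it.\<close>

lemma kronecker_has_sum_inner:
  assumes X: "norm q < norm (exp x)" "norm (exp x) < 1" and t: "t \<notin> lattice \<tau>"
  shows "((\<lambda>k. - 1 / (1 - q powi k * exp t) * exp x powi k) has_sum kronecker x t) UNIV"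
proof -
  define X where "X = exp x"
  have X0: "X \<noteq> 0" by (simp add: X_def)
  note X = X[folded X_def]
  define Q where "Q = norm q"
  have Q: "0 < Q" "Q < 1" using norm_q_less_1 by (auto simp: Q_def)
  obtain e where e: "\<And>k. e k holomorphic_on UNIV" "\<And>k t. \<theta> t = (1 - q powi k * exp t) * e k t"
    using theta_quotient_ex by blast
  define \<rho> where "\<rho> = max (norm X) (Q / norm X)"
  have \<rho>: "0 \<le> \<rho>" "\<rho> < 1" using X X0 Q by (auto simp: \<rho>_def Q_def[symmetric] le_max_iff_disj field_simps)
  \<comment> \<open>A locally uniform majorant: finitely many terms are bounded by compactness; for
    the others the distance of q^k exp t from 1 is controlled by the size of q^k.\<close>
  have bound: "\<exists>M. M summable_on UNIV \<and> (\<forall>k t. norm t \<le> R --> norm (e k t * X powi k) \<le> M k)" for R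
  proof -
    have "bounded (\<theta> ` cball 0 R)"
      by (intro compact_imp_bounded compact_continuous_image holomorphic_on_imp_continuous_on theta_holomorphic) auto
    then obtain B where "\<forall>y\<in>\<theta> ` cball 0 R. norm y \<le> B" unfolding bounded_iff by blast
    hence B: "norm (\<theta> t) \<le> B" if "norm t \<le> R" for t using that by auto
    have "\<exists>b. \<forall>t. norm t \<le> R --> norm (e k t) \<le> b" for k
    proof -
      have "bounded (e k ` cball 0 R)"
        by (intro compact_imp_bounded compact_continuous_image holomorphic_on_imp_continuous_on
            holomorphic_on_subset[OF e(1)]) auto
      then obtain b where "\<forall>y\<in>e k ` cball 0 R. norm y \<le> b" unfolding bounded_iff by blast
      thus ?thesis by (intro exI[of _ b]) auto
    qed
    then obtain b where b: "\<And>k t. norm t \<le> R ==> norm (e k t) \<le> b k" by metis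
    define B' where "B' = max B 0"
    have B': "B' \<ge> 0" "\<And>t. norm t \<le> R ==> norm (\<theta> t) \<le> B'" using B by (auto simp: B'_def le_max_iff_disj)
    obtain N where N: "\<And>m. m \<ge> N ==> Q ^ m \<le> exp (- R) / 2"
      using exists_nat_power_le[of Q "exp (- R) / 2"] Q by auto
    define M where "M = (\<lambda>k. (if nat \<bar>k\<bar> < N then b k * norm (X powi k) else 0) + 2 * B' * exp R * \<rho> ^ nat \<bar>k\<bar>)"
    have "finite {k::int. nat \<bar>k\<bar> < N}"
      by (rule finite_subset[of _ "{- int N..int N}"]) auto
    hence "M summable_on UNIV"
      unfolding M_def
      by (intro summable_on_add summable_on_cmult_right summable_on_int_geometric \<rho> finite_nonzero_values_imp_summable_on)
         (auto elim: rev_finite_subset)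
    moreover have "norm (e k t * X powi k) \<le> M k" if tR: "norm t \<le> R" for k t
    proof (cases "nat \<bar>k\<bar> < N")
      case True
      have "norm (e k t * X powi k) \<le> b k * norm (X powi k)"
        unfolding norm_mult using b[OF tR] by (intro mult_right_mono) auto
      moreover have "2 * B' * exp R * \<rho> ^ nat \<bar>k\<bar> \<ge> 0" using B' \<rho> by simp
      ultimately show ?thesis using True by (simp add: M_def)
    next
      case False
      define m where "m = nat \<bar>k\<bar>"
      have Qm: "Q ^ m \<le> exp (- R) / 2" using False by (intro N) (auto simp: m_def)
      have Re: "Re t \<le> R" "- R \<le> Re t" using tR abs_Re_le_cmod[of t] by linarith+
      define w where "w = q powi k * exp t"
      have th: "norm (\<theta> t) = norm (1 - w) * norm (e k t)" by (subst e(2)[of t k]) (simp add: w_def norm_mult)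
      have "norm (e k t) * norm (X powi k) \<le> 2 * B' * exp R * \<rho> ^ m"
      proof (cases "k \<ge> 0")
        case True
        hence k: "k = int m" by (simp add: m_def)
        have "norm w = Q ^ m * exp (Re t)" by (simp only: w_def k power_int_of_nat norm_mult norm_power Q_def norm_exp_eq_Re)
        also have "\<dots> \<le> exp (- R) / 2 * exp R" using Qm Re by (intro mult_mono) auto
        also have "\<dots> = 1/2" by (simp add: exp_minus)
        finally have "1/2 \<le> norm (1 - w)" using norm_triangle_ineq2[of 1 w] by simp
        hence "1/2 * norm (e k t) \<le> norm (1 - w) * norm (e k t)" by (intro mult_right_mono) auto
        hence "norm (e k t) \<le> 2 * B'" using B'(2)[OF tR] th by simp
        also have "\<dots> \<le> 2 * B' * exp R"
          using B'(1) order.trans[OF norm_ge_zero tR] by (simp add: mult_le_cancel_left1)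
        finally have 1: "norm (e k t) \<le> 2 * B' * exp R" .
        have "norm (X powi k) \<le> \<rho> ^ m"
          unfolding k power_int_of_nat norm_power by (intro power_mono) (auto simp: \<rho>_def)
        thus ?thesis using 1 B' by (intro mult_mono) auto
      next
        case False
        hence k: "k = - int m" by (simp add: m_def)
        have nw: "norm w = exp (Re t) / Q ^ m"
          by (simp only: w_def k power_int_minus power_int_of_nat norm_mult norm_inverse norm_power Q_def norm_exp_eq_Re)
             (simp add: divide_inverse mult.commute)
        have "2 \<le> exp (- R) / Q ^ m" using Qm Q by (simp add: field_simps)
        also have "\<dots> \<le> norm w" unfolding nw using Re Q by (intro divide_right_mono) auto
        finally have "2 \<le> norm w" .
        hence "norm w / 2 \<le> norm (1 - w)" using norm_triangle_ineq2[of w 1] by (simp add: norm_minus_commute)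
        hence "norm w / 2 * norm (e k t) \<le> norm (1 - w) * norm (e k t)" by (intro mult_right_mono) auto
        hence "norm w / 2 * norm (e k t) \<le> B'" using B'(2)[OF tR] th by simp
        hence "norm (e k t) \<le> 2 * B' / norm w"
          using \<open>2 \<le> norm w\<close> by (subst pos_le_divide_eq) (auto simp: mult.commute)
        also have "\<dots> = 2 * B' * (exp (- Re t) * Q ^ m)" unfolding nw by (simp add: exp_minus field_simps)
        also have "\<dots> \<le> 2 * B' * (exp R * Q ^ m)" using B' Re Q by (intro mult_left_mono mult_right_mono) auto
        finally have 1: "norm (e k t) \<le> 2 * B' * (exp R * Q ^ m)" .
        have nX: "norm (X powi k) = 1 / norm X ^ m"
          by (simp only: k power_int_minus power_int_of_nat norm_inverse norm_power) (simp add: divide_inverse)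
        have "norm (e k t) * norm (X powi k) \<le> 2 * B' * (exp R * Q ^ m) * (1 / norm X ^ m)"
          unfolding nX using 1 by (intro mult_right_mono) auto
        also have "2 * B' * (exp R * Q ^ m) * (1 / norm X ^ m) = 2 * B' * exp R * (Q / norm X) ^ m"
          by (simp add: power_divide)
        also have "\<dots> \<le> 2 * B' * exp R * \<rho> ^ m"
          using B' Q by (intro mult_left_mono power_mono) (auto simp: \<rho>_def)
        finally show ?thesis .
      qed
      thus ?thesis using False by (simp add: M_def m_def norm_mult)
    qed
    ultimately show ?thesis by blast
  qed
  define f where "f = (\<lambda>t. - (\<Sum>\<^sub>\<infinity>k\<in>UNIV. e k t * X powi k))"
  have summ: "(\<lambda>k. e k t * X powi k) summable_on UNIV" for t
  proof -
    obtain M where M: "M summable_on UNIV" "\<And>k. norm (e k t * X powi k) \<le> M k"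
      using bound[of "norm t"] by auto
    show ?thesis
      by (rule abs_summable_summable) (rule Infinite_Sum.abs_summable_on_comparison_test'[OF M])
  qed
  have f_hol: "f holomorphic_on UNIV"
  proof (subst holomorphic_on_open, simp, intro ballI)
    fix z :: complex
    obtain M where M: "M summable_on UNIV" "\<And>k w. norm w \<le> norm z + 1 ==> norm (e k w * X powi k) \<le> M k"
      using bound[of "norm z + 1"] by metis
    have "f holomorphic_on ball 0 (norm z + 1)"
      unfolding f_def using M
      by (intro holomorphic_intros infsum_holomorphic[where M = M] holomorphic_on_subset[OF e(1)]) auto
    thus "\<exists>f'. (f has_field_derivative f') (at z)"
      by (auto simp: holomorphic_on_open)
  qed
  have e_cancel: "a t = b t" if "a holomorphic_on UNIV" "b holomorphic_on UNIV"
      "\<And>t. (1 - q powi k * exp t) * a t = (1 - q powi k * exp t) * b t" for a b k t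
  proof (rule theta_cancel[OF that(1,2)])
    fix t show "\<theta> t * a t = \<theta> t * b t" using that(3)[of t] by (subst (1 2) e(2)[of t k]) (simp add: mult_ac)
  qed
  have ep: "e k (t + period) = - e k t" for k t
  proof (rule e_cancel[of "\<lambda>t. e k (t + period)" "\<lambda>t. - e k t" k])
    fix t show "(1 - q powi k * exp t) * e k (t + period) = (1 - q powi k * exp t) * - e k t"
      using theta_period[of t] e(2)[of "t + period" k] e(2)[of t k] by (simp add: exp_add)
  qed (rule holomorphic_on_shift[OF e(1)], rule holomorphic_on_minus[OF e(1)])
  have ew: "e k (t + \<omega>) = - exp (- (\<omega> / 2) - t) * e (k + 1) t" for k t
  proof (rule e_cancel[of "\<lambda>t. e k (t + \<omega>)" "\<lambda>t. - exp (- (\<omega> / 2) - t) * e (k + 1) t" "k + 1"])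
    fix t
    have q': "q powi (k + 1) * exp t = q powi k * exp (t + \<omega>)"
      by (simp add: power_int_add exp_add nome_def[symmetric])
    have "(1 - q powi (k + 1) * exp t) * e k (t + \<omega>) = \<theta> (t + \<omega>)"
      unfolding q' by (rule e(2)[symmetric])
    also have "\<dots> = - exp (- (\<omega> / 2) - t) * ((1 - q powi (k + 1) * exp t) * e (k + 1) t)"
      by (simp only: theta_shift e(2)[of t "k + 1", symmetric])
    finally show "(1 - q powi (k + 1) * exp t) * e k (t + \<omega>)
        = (1 - q powi (k + 1) * exp t) * (- exp (- (\<omega> / 2) - t) * e (k + 1) t)"
      by (simp only: mult_ac)
  qed (rule holomorphic_on_shift[OF e(1)], intro holomorphic_intros e(1))
  have fp: "f (t + period) = - f t" for t
    by (simp add: f_def ep infsum_uminus)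
  have fw: "f (t + \<omega>) = - exp (- (\<omega> / 2) - (t + x)) * f t" for t
  proof -
    have "bij_betw (\<lambda>m::int. m + 1) UNIV UNIV"
      by (rule bij_betw_byWitness[of _ "\<lambda>m. m - 1"]) auto
    hence r: "(\<Sum>\<^sub>\<infinity>k\<in>UNIV. e (k + 1) t * X powi (k + 1)) = - f t"
      unfolding f_def by (subst infsum_reindex_bij_betw[of "\<lambda>m. m + 1" UNIV UNIV "\<lambda>k. e k t * X powi k"]) auto
    have "exp (- (\<omega> / 2) - (t + x)) * X = exp (- (\<omega> / 2) - t)"
      unfolding X_def exp_add[symmetric] by simp
    hence "e k (t + \<omega>) * X powi k = - exp (- (\<omega> / 2) - (t + x)) * (e (k + 1) t * X powi (k + 1))" for k
      using X0 unfolding ew by (simp add: power_int_add mult_ac)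
    hence "f (t + \<omega>) = - (- exp (- (\<omega> / 2) - (t + x)) * (\<Sum>\<^sub>\<infinity>k\<in>UNIV. e (k + 1) t * X powi (k + 1)))"
      by (simp only: f_def infsum_cmult_right')
    thus ?thesis unfolding r by simp
  qed
  have "theta_like (\<lambda>t. f (t + (- x)))"
    unfolding theta_like_def
  proof (intro conjI allI)
    fix z
    have "z + period + - x = z + - x + period" "z + \<omega> + - x = z + - x + \<omega>" by simp_all
    thus "f (z + period + - x) = - f (z + - x)" "f (z + \<omega> + - x) = - exp (- (\<omega> / 2) - z) * f (z + - x)"
      by (simp_all only: fp fw) simp
  qed (rule holomorphic_on_shift[OF f_hol])
  then obtain c where c: "\<And>z. f (z + (- x)) = c * \<theta> z" using theta_like_eq_mult_theta by metis
  have c: "f t = c * \<theta> (x + t)" for t using c[of "x + t"] by simp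
  \<comment> \<open>At t = 0 only the term k = 0 survives, because there the zero of theta is
    cancelled; this normalises the constant.\<close>
  have e0: "e k 0 = (if k = 0 then -1 else 0)" for k
  proof (cases "k = 0")
    case True
    have "((\<lambda>t. 1 - exp t) has_field_derivative - 1) (at (0 :: complex))"
      by (auto intro!: derivative_eq_intros)
    from DERIV_mult[OF this holomorphic_derivI[OF e(1) open_UNIV UNIV_I, of k]]
    have "((\<lambda>t. (1 - q powi k * exp t) * e k t) has_field_derivative - e k 0) (at 0)"
      by (simp add: True)
    moreover have "(\<lambda>t. (1 - q powi k * exp t) * e k t) = \<theta>" using e(2)[of _ k] by auto
    ultimately have "- e k 0 = 1" using DERIV_unique theta_DERIV[of 0] by (metis deriv_theta_0)
    thus ?thesis using True by (simp add: minus_equation_iff)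
  next
    case False
    thus ?thesis using e(2)[of 0 k] by simp
  qed
  have "f 0 = - (\<Sum>\<^sub>\<infinity>k\<in>{0::int}. -1)"
    unfolding f_def by (intro arg_cong[where f = uminus] infsum_cong_neutral) (auto simp: e0)
  hence "c * \<theta> x = 1" using c[of 0] by simp
  moreover from this have "\<theta> x \<noteq> 0" by auto
  ultimately have cx: "\<theta> x \<noteq> 0" "c = 1 / \<theta> x" by (auto simp: eq_divide_eq)
  have t0: "\<theta> t \<noteq> 0" using t by (simp add: theta_eq_0_iff)
  have "((\<lambda>k. e k t * X powi k) has_sum - f t) UNIV"
    unfolding f_def using has_sum_infsum[OF summ] by simp
  hence "((\<lambda>k. - 1 / \<theta> t * (e k t * X powi k)) has_sum - 1 / \<theta> t * (- f t)) UNIV"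
    by (rule has_sum_cmult_right)
  also have "(\<lambda>k. - 1 / \<theta> t * (e k t * X powi k)) = (\<lambda>k. - 1 / (1 - q powi k * exp t) * X powi k)"
  proof
    fix k
    have "1 - q powi k * exp t \<noteq> 0" "e k t \<noteq> 0" using t0 e(2)[of t k] by auto
    thus "- 1 / \<theta> t * (e k t * X powi k) = - 1 / (1 - q powi k * exp t) * X powi k"
      by (subst e(2)[of t k]) (simp add: field_simps)
  qed
  also have "- 1 / \<theta> t * (- f t) = kronecker x t"
    by (simp add: c cx kronecker_def)
  finally show ?thesis by (simp add: X_def)
qed

text \<open>The case c = 0 is the inner expansion at x + \<omega>: multiplication by exp t undoes
  the quasi-period of the Kronecker function and, with w = q^k exp t, turns the coefficient -1/(1 -
  w) into -w/(1 - w).\<close>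

theorem kronecker_has_sum:
  assumes "in_annulus c (exp x)" "t \<notin> lattice \<tau>"
  shows "((\<lambda>k. kronecker_coeff c k t * exp x powi k) has_sum kronecker x t) UNIV"
proof (cases "c = 0")
  case False
  thus ?thesis using kronecker_has_sum_inner[of x t] assms by (auto simp: in_annulus_def kronecker_coeff_def)
next
  case True
  have q': "exp (x + \<omega>) = q * exp x" by (simp add: exp_add nome_def mult.commute)
  have "norm q < norm (exp (x + \<omega>))" "norm (exp (x + \<omega>)) < 1"
    using assms True norm_q_pos unfolding q' norm_mult by (auto simp: in_annulus_def field_simps)
  hence "((\<lambda>k. - 1 / (1 - q powi k * exp t) * exp (x + \<omega>) powi k) has_sum kronecker (x + \<omega>) t) UNIV"
    using assms(2) by (rule kronecker_has_sum_inner)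
  hence "((\<lambda>k. exp t * (- 1 / (1 - q powi k * exp t) * exp (x + \<omega>) powi k)) has_sum exp t * kronecker (x + \<omega>) t) UNIV"
    by (rule has_sum_cmult_right)
  also have "(\<lambda>k. exp t * (- 1 / (1 - q powi k * exp t) * exp (x + \<omega>) powi k)) = (\<lambda>k. kronecker_coeff c k t * exp x powi k)"
    unfolding q' by (auto simp: kronecker_coeff_def True power_int_mult_distrib)
  also have "exp t * kronecker (x + \<omega>) t = kronecker x t"
  proof -
    have "x + \<omega> + t = x + t + \<omega>" by simp
    moreover have "exp t * exp (- (\<omega> / 2) - (x + t)) = exp (- (\<omega> / 2) - x)"
      unfolding exp_add[symmetric] by simp
    moreover have "exp (- (\<omega> / 2) - x) \<noteq> 0" by simp
    moreover define Y Z where "Y = exp (- (\<omega> / 2) - x)" and "Z = exp (- (\<omega> / 2) - (x + t))"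
    ultimately have YZ: "x + \<omega> + t = x + t + \<omega>" "exp t * Z = Y" "Y \<noteq> 0" by simp_all
    have "exp t * kronecker (x + \<omega>) t = (exp t * Z) * \<theta> (x + t) / (Y * \<theta> x * \<theta> t)"
      unfolding kronecker_def YZ(1) theta_shift Y_def[symmetric] Z_def[symmetric] by simp
    thus ?thesis using YZ(3) unfolding YZ(2) by (simp add: kronecker_def)
  qed
  finally show ?thesis .
qed

end

section \<open>Taylor coefficients of the Kronecker function\<close>

lemma exp_minus_one_factor:
  obtains k where "k holomorphic_on UNIV" "\<And>t. 1 - exp t = - t * k t" "k 0 = 1"
proof -
  have "deriv (\<lambda>t::complex. t) = (\<lambda>_. 1)" by auto
  moreover have "(\<lambda>t::complex. 1 - exp t) holomorphic_on UNIV" by (intro holomorphic_intros)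
  ultimately obtain k where k: "k holomorphic_on UNIV" "\<And>t. 1 - exp t = t * k t"
    using entire_quotient[of "\<lambda>t. 1 - exp t" "\<lambda>t. t"] by (auto simp: holomorphic_on_ident)
  have "((\<lambda>t. t * k t) has_field_derivative 1 * k 0 + deriv k 0 * 0) (at 0)"
    by (rule DERIV_mult[OF DERIV_ident holomorphic_derivI[OF k(1) open_UNIV UNIV_I]])
  hence "((\<lambda>t. 1 - exp t) has_field_derivative k 0) (at 0)" by (simp add: k(2)[abs_def])
  moreover have "((\<lambda>t. 1 - exp t) has_field_derivative - 1) (at (0::complex))" by (auto intro!: derivative_eq_intros)
  ultimately have "k 0 = -1" by (rule DERIV_unique)
  thus ?thesis using k by (intro that[of "\<lambda>t. - k t"]) (auto intro!: holomorphic_intros)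
qed

text \<open>Up to sign and a constant, the pole-free part of mode 0 of the Kronecker series. The
  condition determines it near 0 with all derivatives there; the j-th one is -B_(j+1)/(j+1), where
  B_1 = -1/2.\<close>

definition bernoulli_fun :: "complex => complex" where
  "bernoulli_fun = (SOME f. \<exists>r>0. f holomorphic_on ball 0 r \<and> (\<forall>t\<in>ball 0 r - {0}. f t = 1 / (1 - exp t) + 1 / t))"

lemma bernoulli_fun:
  "\<exists>r>0. bernoulli_fun holomorphic_on ball 0 r \<and> (\<forall>t\<in>ball 0 r - {0}. bernoulli_fun t = 1 / (1 - exp t) + 1 / t)"
proof -
  obtain k where k: "k holomorphic_on UNIV" "\<And>t. 1 - exp t = - t * k t" "k 0 = 1"
    using exp_minus_one_factor by blast
  have "(\<lambda>t. k t - 1) holomorphic_on UNIV" by (intro holomorphic_intros k(1))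
  moreover have "deriv (\<lambda>t::complex. t) = (\<lambda>_. 1)" by auto
  ultimately obtain m where m: "m holomorphic_on UNIV" "\<And>t. k t - 1 = t * m t"
    using entire_quotient[of "\<lambda>t. k t - 1" "\<lambda>t. t"] k(3) by (auto simp: holomorphic_on_ident)
  have "open {t. k t \<noteq> 0}" using k(1)
    by (auto intro!: open_Collect_neq holomorphic_on_imp_continuous_on)
  moreover have "0 \<in> {t. k t \<noteq> 0}" by (simp add: k(3))
  ultimately obtain r where r: "r > 0" "ball 0 r \<subseteq> {t. k t \<noteq> 0}" using open_contains_ball by blast
  have "(\<lambda>t. m t / k t) holomorphic_on ball 0 r"
    using r by (intro holomorphic_intros holomorphic_on_subset[OF m(1)] holomorphic_on_subset[OF k(1)]) auto
  moreover have "m t / k t = 1 / (1 - exp t) + 1 / t" if "t \<in> ball 0 r - {0}" for t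
  proof -
    have "t \<noteq> 0" "k t \<noteq> 0" using that r by auto
    moreover from this have "m t = (k t - 1) / t" using m(2)[of t] by simp
    ultimately show ?thesis unfolding k(2) by (simp add: field_simps)
  qed
  ultimately have "\<exists>f. \<exists>r>0. f holomorphic_on ball 0 r \<and> (\<forall>t\<in>ball 0 r - {0}. f t = 1 / (1 - exp t) + 1 / t)"
    using r(1) by (intro exI[of _ "\<lambda>t. m t / k t"] exI[of _ r]) auto
  from someI_ex[OF this] show ?thesis unfolding bernoulli_fun_def .
qed

definition bernoulli_coeff :: "nat => complex" where
  "bernoulli_coeff j = (deriv ^^ j) bernoulli_fun 0"

text \<open>\<open>geom_deriv\<close> is the derivation \<open>d/dt\<close> in terms of \<open>w = 1/(1 - a exp t)\<close>, and \<open>geom_poly s j\<close> its \<open>j\<close>-th power applied to \<open>w - s\<close>.\<close>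

definition geom_deriv :: "complex poly => complex poly" where
  "geom_deriv p = [:0, -1, 1:] * pderiv p"

definition geom_poly :: "complex => nat => complex poly" where
  "geom_poly s j = (geom_deriv ^^ j) [:- s, 1:]"

text \<open>The function w = 1/(1 - a exp t) satisfies w' = w^2 - w, so every derivative is a
  polynomial in w.\<close>

lemma higher_deriv_geometric:
  assumes "a * exp t \<noteq> 1"
  shows "(deriv ^^ j) (\<lambda>t. 1 / (1 - a * exp t) - s) t = poly (geom_poly s j) (1 / (1 - a * exp t))"
  using assms
proof (induction j arbitrary: t)
  case (Suc j)
  define A where "A = {t. a * exp t \<noteq> 1}"
  have A: "open A" "t \<in> A" unfolding A_def using Suc.prems
    by (auto intro!: open_Collect_neq continuous_intros)
  define w where "w = (\<lambda>t. 1 / (1 - a * exp t))"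
  have w: "(w has_field_derivative w t ^ 2 - w t) (at t)"
  proof -
    define u where "u = 1 - a * exp t"
    have u: "u \<noteq> 0" "a * exp t = 1 - u" using Suc.prems by (auto simp: u_def)
    have "((\<lambda>t. 1 / (1 - a * exp t)) has_field_derivative (0 * u - 1 * (0 - a * exp t)) / (u * u)) (at t)"
      unfolding u_def using Suc.prems by (intro DERIV_divide) (auto intro!: derivative_eq_intros)
    also have "(0 * u - 1 * (0 - a * exp t)) / (u * u) = (1 / u)\<^sup>2 - 1 / u"
      using u by (simp add: field_simps power2_eq_square)
    finally show ?thesis by (simp add: w_def u_def)
  qed
  have "(deriv ^^ Suc j) (\<lambda>t. 1 / (1 - a * exp t) - s) t = deriv (\<lambda>t. poly (geom_poly s j) (w t)) t"
    unfolding funpow.simps o_def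
    by (rule deriv_cong_ev) (use eventually_nhds_in_open[OF A] in \<open>auto elim!: eventually_mono simp: Suc.IH A_def w_def\<close>)
  also have "\<dots> = poly (pderiv (geom_poly s j)) (w t) * (w t ^ 2 - w t)"
    by (rule DERIV_imp_deriv) (rule DERIV_chain2[OF poly_DERIV w])
  also have "\<dots> = poly (geom_poly s (Suc j)) (w t)"
    by (simp add: geom_poly_def geom_deriv_def algebra_simps power2_eq_square)
  finally show ?case by (simp add: w_def)
qed (simp add: geom_poly_def)

text \<open>With w = 1/(1 - q^k) one has w - 1 = q^k w, so the polynomial on the left is, up to
  sign, the k-th coefficient of g_{b,a}. The base, w - 1 for a = 0 and w for a > 0, is up to sign
  the Kronecker coefficient in one of the two annuli, and all its derivatives share with the left
  side the root 1 or 0. The prescribed top coefficient does not depend on a.\<close>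

definition is_geometric_expansion :: "nat => nat => (nat => complex) => bool" where
  "is_geometric_expansion b a e \<longleftrightarrow> e (b - 1) = 1 / fact (b - 1) \<and>
     [:-1, 1:] ^ (b - a) * [:0, 1:] ^ a = (\<Sum>j<b. smult (e j) (geom_poly (if a = 0 then 1 else 0) j))"

text \<open>\<open>geom_deriv\<close> shifts the expansion by one place, so division by b turns the
  top coefficient 1/(b-1)! into 1/b!; the multiple of P affects only the lower ones.\<close>

lemma geometric_expansion_step:
  assumes e: "P = (\<Sum>j<b. smult (e j) (geom_poly s j))" "e (b - 1) = 1 / fact (b - 1)" and b: "b \<ge> 1"
  shows "\<exists>e'. e' b = 1 / fact b \<and> smult (1 / of_nat b) (geom_deriv P + smult x P) = (\<Sum>j<Suc b. smult (e' j) (geom_poly s j))"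
proof -
  define e' where "e' = (\<lambda>j. ((if j = 0 then 0 else e (j - 1)) + x * (if j < b then e j else 0)) / of_nat b)"
  have th: "geom_deriv (\<Sum>j\<in>A. smult (e j) (geom_poly s j)) = (\<Sum>j\<in>A. smult (e j) (geom_poly s (Suc j)))" for A
  proof -
    have "pderiv (\<Sum>j\<in>A. smult (e j) (geom_poly s j)) = (\<Sum>j\<in>A. smult (e j) (pderiv (geom_poly s j)))"
      by (induction A rule: infinite_finite_induct) (auto simp: pderiv_add pderiv_smult)
    thus ?thesis by (simp add: geom_deriv_def geom_poly_def sum_distrib_left)
  qed
  have 1: "(\<Sum>j<b. smult (e j) (geom_poly s (Suc j))) = (\<Sum>j<Suc b. smult (if j = 0 then 0 else e (j - 1)) (geom_poly s j))"
    by (simp add: sum.lessThan_Suc_shift del: sum.lessThan_Suc)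
  have 2: "(\<Sum>j<b. smult (e j) (geom_poly s j)) = (\<Sum>j<Suc b. smult (if j < b then e j else 0) (geom_poly s j))"
    by simp
  have sm: "smult c (\<Sum>j\<in>A. F j) = (\<Sum>j\<in>A. smult c (F j))" for c :: complex and F and A :: "nat set"
    by (induction A rule: infinite_finite_induct) (auto simp: smult_add_right)
  have "smult (1 / of_nat b) (geom_deriv P + smult x P) = (\<Sum>j<Suc b. smult (e' j) (geom_poly s j))"
    unfolding e(1) th 1 unfolding 2
    by (simp only: sm sum.distrib[symmetric])
       (intro sum.cong refl, simp add: e'_def smult_add_left[symmetric] add_divide_distrib divide_inverse algebra_simps)
  moreover have "e' b = 1 / fact b"
    using b e(2) by (cases b) (auto simp: e'_def)
  ultimately show ?thesis by blast
qed

text \<open>Induction on b. For P = (w - 1)^(b-a) w^a and D = \<open>geom_deriv\<close> one finds D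
  P + (a - b) P = b (w - 1) P, which raises b and keeps a. For a = b + 1 the step starts from P =
  w^b and is D P + b P = b w P.\<close>

lemma geometric_expansion_ex:
  assumes "b \<ge> 1" "a \<le> b"
  shows "\<exists>e. is_geometric_expansion b a e"
  using assms
proof (induction b arbitrary: a rule: dec_induct)
  case base
  show ?case
  proof (cases "a = 0")
    case True
    thus ?thesis by (intro exI[of _ "\<lambda>_. 1"]) (simp add: is_geometric_expansion_def geom_poly_def)
  next
    case False
    hence "a = 1" using base by simp
    thus ?thesis by (intro exI[of _ "\<lambda>_. 1"]) (simp add: is_geometric_expansion_def geom_poly_def)
  qed
next
  case (step b)
  have b0: "of_nat b \<noteq> (0 :: complex)" using step by simp
  have pd: "pderiv ([:c, 1:] ^ k) = smult (of_nat k) ([:c, 1:] ^ (k - 1))" for c :: complex and k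
    by (simp only: pderiv_power) (simp add: pderiv_pCons)
  have key: "geom_deriv ([:-1, 1:] ^ (b - a) * [:0, 1:] ^ a) =
      smult (of_nat (b - a)) ([:-1, 1:] ^ (b - a) * [:0, 1:] ^ a * [:0, 1:]) + smult (of_nat a) ([:-1, 1:] ^ (b - a) * [:0, 1:] ^ a * [:-1, 1:])" for a
  proof -
    have s: "smult (of_nat k) (p ^ (k - 1)) * p = smult (of_nat k) (p ^ k)" for k and p :: "complex poly"
      by (cases k) (simp_all add: mult.commute)
    have f: "[:0, -1, 1:] = [:-1, 1:] * [:0, 1 :: complex:]" by simp
    have "geom_deriv ([:-1, 1:] ^ (b - a) * [:0, 1:] ^ a)
      = (smult (of_nat (b - a)) ([:-1, 1:] ^ (b - a - 1)) * [:-1, 1:]) * [:0, 1:] ^ a * [:0, 1:]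
        + [:-1, 1:] ^ (b - a) * (smult (of_nat a) ([:0, 1:] ^ (a - 1)) * [:0, 1:]) * [:-1, 1:]"
      unfolding geom_deriv_def pderiv_mult pd f by (simp only: algebra_simps)
    thus ?thesis unfolding s by (simp only: mult_smult_left mult_smult_right)
  qed
  have w1: "P * [:-1, 1:] = P * [:0, 1:] - P" for P :: "complex poly"
    by (simp add: algebra_simps)
  show ?case
  proof (cases "a = Suc b")
    case True
    obtain e where e: "is_geometric_expansion b b e" using step.IH[of b] step by auto
    define P where "P = [:-1, 1:] ^ (b - b) * [:0, 1 :: complex:] ^ b"
    have "P = (\<Sum>j<b. smult (e j) (geom_poly 0 j))" "e (b - 1) = 1 / fact (b - 1)"
      using e step by (auto simp: is_geometric_expansion_def P_def)
    from geometric_expansion_step[OF this step.hyps(1), of "of_nat b"]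
    obtain e' where e': "e' b = 1 / fact b" "smult (1 / of_nat b) (geom_deriv P + smult (of_nat b) P) = (\<Sum>j<Suc b. smult (e' j) (geom_poly 0 j))"
      by blast
    have "geom_deriv P + smult (of_nat b) P = smult (of_nat b) (P * [:0, 1:])"
      unfolding P_def key w1 by (simp add: smult_diff_right)
    hence "smult (1 / of_nat b) (geom_deriv P + smult (of_nat b) P) = P * [:0, 1:]" using b0 by simp
    also have "P * [:0, 1:] = [:-1, 1:] ^ (Suc b - a) * [:0, 1:] ^ a"
      by (simp add: P_def True mult.commute)
    finally show ?thesis using e' True unfolding is_geometric_expansion_def by (intro exI[of _ e']) simp
  next
    case False
    hence ab: "a \<le> b" using step by simp
    obtain e where e: "is_geometric_expansion b a e" using step.IH[OF ab] by auto
    define P where "P = [:-1, 1:] ^ (b - a) * [:0, 1 :: complex:] ^ a"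
    define s where "s = (if a = 0 then 1 else 0 :: complex)"
    have "P = (\<Sum>j<b. smult (e j) (geom_poly s j))" "e (b - 1) = 1 / fact (b - 1)"
      using e step by (auto simp: is_geometric_expansion_def P_def s_def)
    from geometric_expansion_step[OF this step.hyps(1), of "of_nat a - of_nat b"]
    obtain e' where e': "e' b = 1 / fact b" "smult (1 / of_nat b) (geom_deriv P + smult (of_nat a - of_nat b) P) = (\<Sum>j<Suc b. smult (e' j) (geom_poly s j))"
      by blast
    have "geom_deriv P + smult (of_nat a - of_nat b) P = smult (of_nat b) (P * [:-1, 1:])"
    proof -
      have gen: "smult (y - x) Y + smult x (Y - P) + smult (x - y) P = smult y (Y - P)" for x y Y
        by (rule poly_eqI) (simp add: algebra_simps)
      have "geom_deriv P = smult (of_nat b - of_nat a) (P * [:0, 1:]) + smult (of_nat a) (P * [:0, 1:] - P)"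
        using ab unfolding P_def key w1 by (simp add: of_nat_diff)
      thus ?thesis unfolding w1 by (simp only: gen)
    qed
    hence "smult (1 / of_nat b) (geom_deriv P + smult (of_nat a - of_nat b) P) = P * [:-1, 1:]" using b0 by simp
    also have "P * [:-1, 1:] = [:-1, 1:] ^ (Suc b - a) * [:0, 1:] ^ a"
    proof -
      have "[:-1, 1:] ^ (Suc b - a) = [:-1, 1:] ^ (b - a) * [:-1, 1 :: complex:]"
        using ab by (simp only: Suc_diff_le power_Suc mult.commute)
      thus ?thesis by (simp only: P_def mult_ac)
    qed
    finally show ?thesis using e' unfolding is_geometric_expansion_def s_def by (intro exI[of _ e']) simp
  qed
qed

definition geom_coeff :: "nat => nat => nat => complex" where
  "geom_coeff b a = (SOME e. is_geometric_expansion b a e)"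

lemma geom_coeff:
  assumes "b \<ge> 1" "a \<le> b"
  shows "geom_coeff b a (b - 1) = 1 / fact (b - 1)"
    "(w - 1) ^ (b - a) * w ^ a = (\<Sum>j<b. geom_coeff b a j * poly (geom_poly (if a = 0 then 1 else 0) j) w)"
proof -
  have *: "is_geometric_expansion b a (geom_coeff b a)"
    using someI_ex[OF geometric_expansion_ex[OF assms]] by (simp only: geom_coeff_def)
  show "geom_coeff b a (b - 1) = 1 / fact (b - 1)" using * by (simp add: is_geometric_expansion_def)
  have "poly ([:-1, 1:] ^ (b - a) * [:0, 1:] ^ a) w = poly (\<Sum>j<b. smult (geom_coeff b a j) (geom_poly (if a = 0 then 1 else 0) j)) w"
    using * by (simp only: is_geometric_expansion_def)
  thus "(w - 1) ^ (b - a) * w ^ a = (\<Sum>j<b. geom_coeff b a j * poly (geom_poly (if a = 0 then 1 else 0) j) w)"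
    by (simp add: poly_sum poly_power)
qed

section \<open>Taylor coefficients in t and their Fourier series in z\<close>

context upper_half_plane
begin

definition theta_recip :: "complex => complex" where
  "theta_recip t = (if t = 0 then 1 else t / \<theta> t)"

lemma theta_recip_holomorphic:
  obtains r where "r > 0" "theta_recip holomorphic_on ball 0 r" "\<And>t. t \<in> ball 0 r ==> t \<noteq> 0 ==> \<theta> t \<noteq> 0"
proof -
  have "deriv (\<lambda>t::complex. t) = (\<lambda>_. 1)" by auto
  then obtain k where k: "k holomorphic_on UNIV" "\<And>t. \<theta> t = t * k t"
    using entire_quotient[OF theta_holomorphic, of "\<lambda>t. t"] by (auto simp: holomorphic_on_ident)
  have "((\<lambda>t. t * k t) has_field_derivative 1 * k 0 + deriv k 0 * 0) (at 0)"
    by (rule DERIV_mult[OF DERIV_ident holomorphic_derivI[OF k(1) open_UNIV UNIV_I]])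
  moreover have "(\<lambda>t. t * k t) = \<theta>" using k(2) by auto
  ultimately have "(\<theta> has_field_derivative k 0) (at 0)" by simp
  hence k0: "k 0 = 1" using DERIV_unique theta_DERIV[of 0] by (metis deriv_theta_0)
  have "open {t. k t \<noteq> 0}" using k(1)
    by (auto intro!: open_Collect_neq holomorphic_on_imp_continuous_on)
  moreover have "0 \<in> {t. k t \<noteq> 0}" by (simp add: k0)
  ultimately obtain r where r: "r > 0" "ball 0 r \<subseteq> {t. k t \<noteq> 0}" using open_contains_ball by blast
  have "(\<lambda>t. 1 / k t) holomorphic_on ball 0 r"
    using r by (intro holomorphic_intros holomorphic_on_subset[OF k(1)]) auto
  hence "theta_recip holomorphic_on ball 0 r"
    by (rule holomorphic_transform) (auto simp: theta_recip_def k k0)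
  thus ?thesis using r k(2) by (intro that[of r]) auto
qed

text \<open>The j-th derivative at t = 0 of the Kronecker function minus its pole 1/t. It comes from
  Leibniz' rule at order j + 1 for t \<open>kronecker z t\<close> = \<open>theta_recip t\<close>
  theta(z + t) / theta(z); the extra factor t costs the division by j + 1. In this form z enters
  only through the ratios of derivatives of theta to theta.\<close>

definition taylor :: "nat => complex => complex" where
  "taylor j z = (\<Sum>i\<le>Suc j. of_nat (Suc j choose i) * (deriv ^^ i) theta_recip 0
     * ((deriv ^^ (Suc j - i)) \<theta> z / \<theta> z)) / of_nat (Suc j)"

lemma higher_deriv_theta_shift:
  "(deriv ^^ k) (\<lambda>t. c * \<theta> (z + t)) 0 = c * (deriv ^^ k) \<theta> z"
proof -
  have h: "(\<lambda>t. \<theta> (1 * t + z)) holomorphic_on UNIV"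
    using holomorphic_on_shift[OF theta_holomorphic] by simp
  have "(deriv ^^ k) (\<lambda>t. \<theta> (1 * t + z)) 0 = 1 ^ k * (deriv ^^ k) \<theta> (1 * 0 + z)"
    by (rule higher_deriv_compose_linear'[where S = UNIV and T = UNIV]) (auto intro: theta_holomorphic)
  thus ?thesis using higher_deriv_cmult[OF h UNIV_I open_UNIV, of k c 0] by (simp add: add.commute)
qed

lemma taylor_eq_higher_deriv:
  assumes z: "z \<notin> lattice \<tau>" and R: "R holomorphic_on ball 0 e" "e > 0"
    and eq: "\<And>t. t \<in> ball 0 e - {0} ==> kronecker z t = 1 / t + R t"
  shows "(deriv ^^ j) R 0 = taylor j z"
proof -
  obtain r where r: "r > 0" "theta_recip holomorphic_on ball 0 r" "\<And>t. t \<in> ball 0 r ==> t \<noteq> 0 ==> \<theta> t \<noteq> 0"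
    using theta_recip_holomorphic by blast
  define A where "A = ball (0::complex) (min r e)"
  have A: "open A" "0 \<in> A" "A \<subseteq> ball 0 r" "A \<subseteq> ball 0 e" using r(1) R(2) by (auto simp: A_def)
  have z0: "\<theta> z \<noteq> 0" using z by (simp add: theta_eq_0_iff)
  have h1: "(\<lambda>t. 1 / \<theta> z * \<theta> (z + t)) holomorphic_on A"
  proof -
    have "(\<lambda>t. \<theta> (t + z)) holomorphic_on UNIV" by (rule holomorphic_on_shift[OF theta_holomorphic])
    from holomorphic_on_subset[OF this subset_UNIV, of A]
    have "(\<lambda>t. \<theta> (z + t)) holomorphic_on A" by (simp add: add.commute)
    thus ?thesis by (intro holomorphic_intros)
  qed
  have h2: "(\<lambda>t. t * R t) holomorphic_on A"
    using holomorphic_on_subset[OF R(1) A(4)] by (intro holomorphic_intros)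
  have hr: "theta_recip holomorphic_on A" by (rule holomorphic_on_subset[OF r(2) A(3)])
  have eqA: "theta_recip t * (1 / \<theta> z * \<theta> (z + t)) = 1 + t * R t" if "t \<in> A" for t
  proof (cases "t = 0")
    case False
    have "\<theta> t \<noteq> 0" using that A(3) r(3) False by auto
    have "theta_recip t * (1 / \<theta> z * \<theta> (z + t)) = t * kronecker z t"
      using False by (simp add: theta_recip_def kronecker_def)
    also have "\<dots> = 1 + t * R t"
      using eq[of t] that A(4) False by (simp add: distrib_left subset_iff)
    finally show ?thesis .
  qed (use z0 in \<open>simp add: theta_recip_def\<close>)
  have "(deriv ^^ Suc j) (\<lambda>t. theta_recip t * (1 / \<theta> z * \<theta> (z + t))) 0 = (deriv ^^ Suc j) (\<lambda>t. 1 + t * R t) 0"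
    by (rule higher_deriv_transform_within_open[OF holomorphic_on_mult[OF hr h1]
          holomorphic_on_add[OF holomorphic_on_const h2] A(1,2) eqA])
  also have "(deriv ^^ Suc j) (\<lambda>t. 1 + t * R t) 0 = (deriv ^^ Suc j) (\<lambda>t. 1) 0 + (deriv ^^ Suc j) (\<lambda>t. t * R t) 0"
    by (rule higher_deriv_add[OF holomorphic_on_const h2 A(1,2)])
  also have "(deriv ^^ Suc j) (\<lambda>t. 1 :: complex) 0 = 0"
    using fun_cong[OF higher_deriv_const[of "Suc j" 1], of 0] by simp
  also have "(deriv ^^ Suc j) (\<lambda>t. t * R t) 0 = (\<Sum>i = 0..Suc j. of_nat (Suc j choose i) * (deriv ^^ i) (\<lambda>t. t) 0 * (deriv ^^ (Suc j - i)) R 0)"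
    by (rule higher_deriv_mult[OF holomorphic_on_ident holomorphic_on_subset[OF R(1) A(4)] A(1,2)])
  \<comment> \<open>Only the first derivative of t is nonzero at 0.\<close>
  also have "\<dots> = (\<Sum>i\<in>{1}. of_nat (Suc j choose i) * (deriv ^^ i) (\<lambda>t. t) 0 * (deriv ^^ (Suc j - i)) R 0)"
    by (rule sum.mono_neutral_right) (auto simp: higher_deriv_ident)
  also have "\<dots> = of_nat (Suc j) * (deriv ^^ j) R 0" by simp
  also have "(deriv ^^ Suc j) (\<lambda>t. theta_recip t * (1 / \<theta> z * \<theta> (z + t))) 0
     = (\<Sum>i = 0..Suc j. of_nat (Suc j choose i) * (deriv ^^ i) theta_recip 0 * (deriv ^^ (Suc j - i)) (\<lambda>t. 1 / \<theta> z * \<theta> (z + t)) 0)"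
    by (rule higher_deriv_mult[OF hr h1 A(1,2)])
  also have "\<dots> = of_nat (Suc j) * taylor j z"
    unfolding higher_deriv_theta_shift taylor_def atMost_atLeast0 by (simp del: of_nat_Suc)
  finally show ?thesis by (simp del: of_nat_Suc)
qed

definition geom :: "int => complex" where
  "geom k = 1 / (1 - q powi k)"

lemma kronecker_coeff_eq:
  assumes "c \<in> {0, 1}" "q powi k * exp t \<noteq> 1"
  shows "kronecker_coeff c k t = - (1 / (1 - q powi k * exp t) - of_nat (1 - c))"
  using assms by (auto simp: kronecker_coeff_def field_simps)

text \<open>The Fourier expansion is differentiated j times in t at 0. Mode 0 is kept apart: its
  pole is the 1/t of the Kronecker function, and its regular part gives the Bernoulli term.\<close>

lemma taylor_has_sum:
  assumes c: "in_annulus c (exp z)"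
  shows "((\<lambda>k. poly (geom_poly (of_nat (1 - c)) j) (geom k) * exp z powi k)
     has_sum (- taylor j z - bernoulli_coeff j + (if j = 0 then of_nat (1 - c) else 0))) (UNIV - {0})"
proof -
  have z: "z \<notin> lattice \<tau>" by (rule in_annulus_not_lattice[OF c])
  have c01: "c \<in> {0, 1}" using c by (auto simp: in_annulus_def)
  obtain C \<rho> \<delta> where b: "0 < \<delta>" "0 \<le> \<rho>" "\<rho> < 1" "0 \<le> C"
    "\<And>t k. norm t < \<delta> ==> k \<noteq> 0 ==> norm (kronecker_coeff c k t * exp z powi k) \<le> C * \<rho> ^ nat \<bar>k\<bar>"
    "\<And>t k. norm t < \<delta> ==> k \<noteq> 0 ==> q powi k * exp t \<noteq> 1"
    using kronecker_coeff_bound[OF c] by metis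
  obtain r where r: "r > 0" "bernoulli_fun holomorphic_on ball 0 r"
      "\<And>t. t \<in> ball 0 r - {0} ==> bernoulli_fun t = 1 / (1 - exp t) + 1 / t"
    using bernoulli_fun by blast
  obtain r' where r': "r' > 0" "\<And>t. t \<in> ball 0 r' ==> t \<noteq> 0 ==> \<theta> t \<noteq> 0"
    using theta_recip_holomorphic by metis
  define e where "e = min \<delta> (min r r')"
  have e: "e > 0" using b(1) r(1) r'(1) by (simp add: e_def)
  have sub: "ball 0 e \<subseteq> ball 0 \<delta>" "ball 0 e \<subseteq> ball 0 r" "ball 0 e \<subseteq> ball 0 r'" by (auto simp: e_def)
  have e_le: "e \<le> \<delta>" "e \<le> r" "e \<le> r'" by (simp_all add: e_def)
  define s where "s = (of_nat (1 - c) :: complex)"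
  define f where "f = (\<lambda>k t. kronecker_coeff c k t * exp z powi k)"
  have f_eq: "f k t = - (1 / (1 - q powi k * exp t) - s) * exp z powi k" if "t \<in> ball 0 e" "k \<noteq> 0" for k t
    using kronecker_coeff_eq[OF c01 b(6)[of t k]] that e_le by (simp add: f_def s_def)
  have gh: "(\<lambda>t. 1 / (1 - q powi k * exp t) - s) holomorphic_on ball 0 e" if "k \<noteq> 0" for k
  proof -
    have "q powi k * exp t \<noteq> 1" if "t \<in> ball 0 e" for t
      using b(6)[of t k] that e_le \<open>k \<noteq> 0\<close> by simp
    thus ?thesis by (intro holomorphic_intros) auto
  qed
  have f_hol: "f k holomorphic_on ball 0 e" if "k \<in> UNIV - {0}" for k
  proof (rule holomorphic_transform)
    show "(\<lambda>t. - (1 / (1 - q powi k * exp t) - s) * exp z powi k) holomorphic_on ball 0 e"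
      using that by (intro holomorphic_on_mult holomorphic_on_minus holomorphic_on_const gh) auto
  qed (use f_eq that in auto)
  have f_bd: "norm (f k t) \<le> C * \<rho> ^ nat \<bar>k\<bar>" if "k \<in> UNIV - {0}" "t \<in> ball 0 e" for k t
    using b(5)[of t k] that e_le by (simp add: f_def)
  have M: "(\<lambda>k::int. C * \<rho> ^ nat \<bar>k\<bar>) summable_on (UNIV - {0})"
    by (rule summable_on_subset[OF summable_on_cmult_right[OF summable_on_int_geometric[OF b(2,3)]]]) simp
  define S where "S = (\<lambda>t. \<Sum>\<^sub>\<infinity>k\<in>UNIV - {0}. f k t)"
  have S_hol: "S holomorphic_on ball 0 e" unfolding S_def
    by (rule infsum_holomorphic[OF open_ball f_hol f_bd M])
  define R where "R = (\<lambda>t. (- bernoulli_fun t + s) + S t)"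
  have b_hol: "bernoulli_fun holomorphic_on ball 0 e" by (rule holomorphic_on_subset[OF r(2) sub(2)])
  have R_hol: "R holomorphic_on ball 0 e" unfolding R_def by (intro holomorphic_intros b_hol S_hol)
  have 0: "0 \<in> ball 0 e" "0 \<in> UNIV - {0 :: int} ==> False" using e by auto
  have "kronecker z t = 1 / t + R t" if t: "t \<in> ball 0 e - {0}" for t
  proof -
    have tl: "t \<notin> lattice \<tau>" using r'(2)[of t] t e_le by (simp add: theta_eq_0_iff)
    hence et: "exp t \<noteq> 1" unfolding mem_lattice_iff by (metis power_int_0_right)
    have "(\<lambda>k. f k t) summable_on (UNIV - {0})"
      by (rule abs_summable_summable, rule Infinite_Sum.abs_summable_on_comparison_test'[OF M f_bd]) (use t in auto)
    hence "((\<lambda>k. f k t) has_sum S t) (UNIV - {0})" unfolding S_def by (rule has_sum_infsum)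
    hence "((\<lambda>k. f k t) has_sum (f 0 t + S t)) (insert 0 (UNIV - {0}))"
      by (rule has_sum_insert[rotated]) simp
    moreover have "insert 0 (UNIV - {0::int}) = UNIV" by auto
    ultimately have "kronecker z t = f 0 t + S t"
      using has_sum_unique kronecker_has_sum[OF c tl] unfolding f_def by metis
    also have "f 0 t = - (1 / (1 - exp t) - s)"
      using kronecker_coeff_eq[OF c01, of 0 t] et by (simp add: f_def s_def)
    also have "1 / (1 - exp t) = bernoulli_fun t - 1 / t"
      using r(3)[of t] t e_le by simp
    finally show ?thesis by (simp add: R_def)
  qed
  hence "taylor j z = (deriv ^^ j) R 0"
    using taylor_eq_higher_deriv[OF z R_hol e] by simp
  also have "\<dots> = (deriv ^^ j) (\<lambda>t. - bernoulli_fun t + s) 0 + (deriv ^^ j) S 0"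
    unfolding R_def by (rule higher_deriv_add[OF _ S_hol open_ball 0(1)]) (intro holomorphic_intros b_hol)
  also have "(deriv ^^ j) (\<lambda>t. - bernoulli_fun t + s) 0 = (deriv ^^ j) (\<lambda>t. - bernoulli_fun t) 0 + (deriv ^^ j) (\<lambda>t. s) 0"
    by (rule higher_deriv_add[OF _ _ open_ball 0(1)]) (intro holomorphic_intros b_hol)+
  also have "(deriv ^^ j) (\<lambda>t. - bernoulli_fun t) 0 = - bernoulli_coeff j"
    unfolding bernoulli_coeff_def by (rule higher_deriv_uminus[OF b_hol open_ball 0(1)])
  also have "(deriv ^^ j) (\<lambda>t::complex. s) 0 = (if j = 0 then s else 0)"
    using fun_cong[OF higher_deriv_const[of j s], of 0] by simp
  finally have T: "(deriv ^^ j) S 0 = taylor j z + bernoulli_coeff j - (if j = 0 then s else 0)"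
    by (simp add: algebra_simps)
  have "((\<lambda>k. (deriv ^^ j) (f k) 0) has_sum (deriv ^^ j) S 0) (UNIV - {0})"
    unfolding S_def by (rule has_sum_higher_deriv[OF open_ball f_hol f_bd M 0(1)])
  moreover have "(deriv ^^ j) (f k) 0 = - (poly (geom_poly s j) (geom k) * exp z powi k)" if k: "k \<in> UNIV - {0}" for k
  proof -
    have "(deriv ^^ j) (f k) 0 = (deriv ^^ j) (\<lambda>t. (- (exp z powi k)) * (1 / (1 - q powi k * exp t) - s)) 0"
    proof (rule higher_deriv_transform_within_open[OF f_hol[OF k] _ open_ball 0(1)])
      show "(\<lambda>t. (- (exp z powi k)) * (1 / (1 - q powi k * exp t) - s)) holomorphic_on ball 0 e"
        by (rule holomorphic_on_mult[OF holomorphic_on_const gh]) (use k in simp)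
    qed (use k f_eq in \<open>simp add: algebra_simps\<close>)
    also have "\<dots> = - (exp z powi k) * (deriv ^^ j) (\<lambda>t. 1 / (1 - q powi k * exp t) - s) 0"
      by (rule higher_deriv_cmult[OF gh _ open_ball]) (use k e in auto)
    also have "(deriv ^^ j) (\<lambda>t. 1 / (1 - q powi k * exp t) - s) 0 = poly (geom_poly s j) (geom k)"
      using higher_deriv_geometric[of "q powi k" 0 j s] k by (simp add: geom_def)
    finally show ?thesis by simp
  qed
  ultimately have "((\<lambda>k. - (poly (geom_poly s j) (geom k) * exp z powi k)) has_sum (deriv ^^ j) S 0) (UNIV - {0})"
    using has_sum_cong[of "UNIV - {0}" "\<lambda>k. (deriv ^^ j) (f k) 0"
        "\<lambda>k. - (poly (geom_poly s j) (geom k) * exp z powi k)"] by blast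
  hence "((\<lambda>k. poly (geom_poly s j) (geom k) * exp z powi k) has_sum - (deriv ^^ j) S 0) (UNIV - {0})"
    using has_sum_uminus by fastforce
  moreover have "- (deriv ^^ j) S 0 = - taylor j z - bernoulli_coeff j + (if j = 0 then s else 0)"
    by (simp add: T)
  ultimately show ?thesis unfolding s_def by (simp only:)
qed

end

section \<open>The functions g as combinations of Taylor coefficients\<close>

text \<open>The identity theorem for meromorphic functions leaves a discrete set open; there
  \<open>nicely_meromorphic_on\<close> fixes the value, as the limit or as 0 at a pole.\<close>

lemma nicely_meromorphic_unique:
  assumes f: "f nicely_meromorphic_on A" and h: "h nicely_meromorphic_on A"
    and A: "open A" "connected A" and U: "open U" "U \<subseteq> A" "U \<noteq> {}" "\<And>z. z \<in> U ==> f z = h z"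
    and z: "z \<in> A"
  shows "f z = h z"
proof -
  obtain u where u: "u \<in> U" using U by blast
  have "(\<lambda>z. f z - h z) meromorphic_on A"
    using f h by (intro meromorphic_intros) (auto simp: nicely_meromorphic_on_def)
  from meromorphic_imp_constant_or_avoid[OF this A, of 0]
  have ev: "\<forall>\<^sub>F w in at z. f w = h w" if "z \<in> A" for z
  proof
    assume "\<forall>\<^sub>\<approx>z\<in>A. f z - h z = 0"
    thus ?thesis using that A by (auto simp: eventually_cosparse_open_eq)
  next
    assume "\<forall>\<^sub>\<approx>z\<in>A. f z - h z \<noteq> 0"
    hence 1: "\<forall>\<^sub>F w in at u. f w - h w \<noteq> 0" using u U A by (auto simp: eventually_cosparse_open_eq)
    have 2: "\<forall>\<^sub>F w in at u. w \<in> U" using u U(1) by (rule eventually_at_in_open'[rotated])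
    have "\<forall>\<^sub>F w in at u. False" using 1 2 by eventually_elim (use U in auto)
    thus ?thesis by simp
  qed
  have pole: "is_pole f z \<longleftrightarrow> is_pole h z"
    by (rule is_pole_cong[OF ev[OF z] refl])
  have fz: "is_pole f z \<and> f z = 0 \<or> f \<midarrow>z\<rightarrow> f z" and hz: "is_pole h z \<and> h z = 0 \<or> h \<midarrow>z\<rightarrow> h z"
    using f h z by (auto simp: nicely_meromorphic_on_def)
  show ?thesis
  proof (cases "is_pole f z")
    case True
    hence "\<not> f \<midarrow>z\<rightarrow> f z" "\<not> h \<midarrow>z\<rightarrow> h z"
      using pole not_tendsto_and_filterlim_at_infinity[of "at z"] unfolding is_pole_def by auto
    thus ?thesis using fz hz by simp
  next
    case False
    hence "f \<midarrow>z\<rightarrow> f z" "h \<midarrow>z\<rightarrow> h z" using fz hz pole by auto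
    moreover have "h \<midarrow>z\<rightarrow> f z" using calculation(1) ev[OF z] by (simp add: filterlim_cong)
    ultimately show ?thesis using LIM_unique by blast
  qed
qed

lemma has_sum_finite_sum:
  assumes "finite J" "\<And>j. j \<in> J ==> (f j has_sum s j) A"
  shows "((\<lambda>k. \<Sum>j\<in>J. f j k) has_sum (\<Sum>j\<in>J. s j :: complex)) A"
  using assms by (induction J rule: finite_induct) (auto intro!: has_sum_add has_sum_0)

text \<open>Mode 0 of g corrected by what mode 0 contributes to the Taylor coefficients. It does not
  depend on \<tau>, hence has weight 0.\<close>

definition g_const :: "nat => nat => complex" where
  "g_const b a = (-1) ^ a * (1/2) ^ b
     + (-1) ^ b * (\<Sum>j<b. geom_coeff b a j * ((if j = 0 \<and> a = 0 then 1 else 0) - bernoulli_coeff j))"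

section \<open>Meromorphy in u = exp z of the combinations of Taylor coefficients\<close>

context upper_half_plane
begin

definition g_taylor :: "nat => nat => complex => complex" where
  "g_taylor b a z = g_const b a - (-1) ^ b * (\<Sum>j<b. geom_coeff b a j * taylor j z)"

lemma taylor_period: "taylor j (z + period) = taylor j z"
  by (simp add: taylor_def higher_deriv_theta_period theta_period)

lemma taylor_period_int: "taylor j (z + period * of_int n) = taylor j z"
proof (induction n rule: int_induct[where k = 0])
  case (step1 i)
  thus ?case using taylor_period[of j "z + period * of_int i"] by (simp add: algebra_simps)
next
  case (step2 i)
  thus ?case using taylor_period[of j "z + period * of_int (i - 1)"] by (simp add: algebra_simps)
qed simp

lemma taylor_cong:
  assumes "exp z = exp w"
  shows "taylor j z = taylor j w"
proof -
  from assms obtain n :: int where "z = w + (of_int (2 * n) * of_real pi) * \<i>"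
    by (auto simp: exp_eq)
  hence "z = w + period * of_int n" by (simp add: mult_ac)
  thus ?thesis by (simp only: taylor_period_int)
qed

lemma g_taylor_cong: "exp z = exp w ==> g_taylor b a z = g_taylor b a w"
  by (simp add: g_taylor_def taylor_cong[of z w])

lemma taylor_num_holomorphic:
  obtains N where "N holomorphic_on UNIV" "\<And>z. taylor j z = N z / \<theta> z"
proof
  show "(\<lambda>z. (\<Sum>i\<le>Suc j. of_nat (Suc j choose i) * (deriv ^^ i) theta_recip 0
     * (deriv ^^ (Suc j - i)) \<theta> z) / of_nat (Suc j)) holomorphic_on UNIV"
    by (intro holomorphic_on_divide holomorphic_on_sum holomorphic_on_mult holomorphic_on_const deriv_theta_holomorphic)
       (simp del: of_nat_Suc)
  fix z
  have "(\<Sum>i\<le>Suc j. of_nat (Suc j choose i) * (deriv ^^ i) theta_recip 0 * ((deriv ^^ (Suc j - i)) \<theta> z / \<theta> z))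
     = (\<Sum>i\<le>Suc j. of_nat (Suc j choose i) * (deriv ^^ i) theta_recip 0 * (deriv ^^ (Suc j - i)) \<theta> z) / \<theta> z"
    by (simp only: sum_divide_distrib times_divide_eq_right)
  thus "taylor j z = (\<Sum>i\<le>Suc j. of_nat (Suc j choose i) * (deriv ^^ i) theta_recip 0
     * (deriv ^^ (Suc j - i)) \<theta> z) / of_nat (Suc j) / \<theta> z"
    by (simp only: taylor_def divide_divide_eq_left mult.commute)
qed

lemma g_taylor_num_holomorphic:
  obtains N where "N holomorphic_on UNIV" "\<And>z. z \<notin> lattice \<tau> ==> g_taylor b a z = N z / \<theta> z"
proof -
  have "\<exists>N. N holomorphic_on UNIV \<and> (\<forall>z. taylor j z = N z / \<theta> z)" for j
    using taylor_num_holomorphic[of j] by metis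
  then obtain N where N: "\<And>j. N j holomorphic_on UNIV" "\<And>j z. taylor j z = N j z / \<theta> z" by metis
  show ?thesis
  proof (rule that)
    show "(\<lambda>z. g_const b a * \<theta> z - (-1) ^ b * (\<Sum>j<b. geom_coeff b a j * N j z)) holomorphic_on UNIV"
      by (intro holomorphic_intros N theta_holomorphic)
    fix z assume "z \<notin> lattice \<tau>"
    hence "\<theta> z \<noteq> 0" by (simp add: theta_eq_0_iff)
    moreover have "(\<Sum>j<b. geom_coeff b a j * (N j z / \<theta> z)) = (\<Sum>j<b. geom_coeff b a j * N j z) / \<theta> z"
      by (simp add: sum_divide_distrib)
    ultimately show "g_taylor b a z = (g_const b a * \<theta> z - (-1) ^ b * (\<Sum>j<b. geom_coeff b a j * N j z)) / \<theta> z"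
      by (simp add: g_taylor_def N diff_divide_distrib)
  qed
qed

text \<open>The principal logarithm may have its cut at u, so a branch centred at u is used; by
  periodicity \<open>g_taylor\<close> has the same value for both. The disc of radius |u| omits 0,
  and it is empty for u = 0.\<close>

lemma g_taylor_Ln:
  obtains N L where "N holomorphic_on UNIV" "L holomorphic_on ball u (norm u)"
    "\<And>w. w \<in> ball u (norm u) ==> w \<noteq> 0 \<and> exp (L w) = w"
    "\<And>w. w \<in> ball u (norm u) ==> L w \<notin> lattice \<tau> ==> g_taylor b a (Ln w) = N (L w) / \<theta> (L w)"
proof (cases "u = 0")
  case False
  obtain N where N: "N holomorphic_on UNIV" "\<And>z. z \<notin> lattice \<tau> ==> g_taylor b a z = N z / \<theta> z"
    using g_taylor_num_holomorphic by metis
  define L where "L = (\<lambda>w. Ln (w / u) + Ln u)"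
  have w: "w / u \<notin> \<real>\<^sub>\<le>\<^sub>0" "w \<noteq> 0" if "w \<in> ball u (norm u)" for w
  proof -
    have "norm (w / u - 1) = norm (w - u) / norm u" using False by (simp add: norm_divide[symmetric] diff_divide_distrib)
    also have "\<dots> < 1" using that False by (simp add: dist_norm norm_minus_commute)
    finally have "norm (w / u - 1) < 1" .
    hence "Re (w / u) > 0" using abs_Re_le_cmod[of "w / u - 1"] by (simp add: abs_le_iff)
    thus "w / u \<notin> \<real>\<^sub>\<le>\<^sub>0" "w \<noteq> 0" by (auto simp: complex_nonpos_Reals_iff)
  qed
  have eL: "exp (L w) = w" if "w \<in> ball u (norm u)" for w
    using w[OF that] False by (simp add: L_def exp_add)
  show ?thesis
  proof (rule that[OF N(1), of L])
    show "L holomorphic_on ball u (norm u)"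
      unfolding L_def using False w(1) by (intro holomorphic_intros) auto
    fix x assume x: "x \<in> ball u (norm u)"
    thus "x \<noteq> 0 \<and> exp (L x) = x" using w eL by auto
    assume "L x \<notin> lattice \<tau>"
    moreover have "exp (Ln x) = exp (L x)" using w(2)[OF x] eL[OF x] by simp
    ultimately show "g_taylor b a (Ln x) = N (L x) / \<theta> (L x)" using N(2) g_taylor_cong by metis
  qed
next
  case True
  thus ?thesis using that[of "\<lambda>_. 0" "\<lambda>_. 0"] by (auto intro: holomorphic_intros)
qed

lemma g_taylor_Ln_analytic:
  assumes "u \<noteq> 0" "Ln u \<notin> lattice \<tau>"
  shows "(\<lambda>u. g_taylor b a (Ln u)) analytic_on {u}"
proof -
  obtain N L where NL: "N holomorphic_on UNIV" "L holomorphic_on ball u (norm u)"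
    "\<And>w. w \<in> ball u (norm u) ==> w \<noteq> 0 \<and> exp (L w) = w"
    "\<And>w. w \<in> ball u (norm u) ==> L w \<notin> lattice \<tau> ==> g_taylor b a (Ln w) = N (L w) / \<theta> (L w)"
    using g_taylor_Ln[of u b a] by metis
  have u: "u \<in> ball u (norm u)" using assms by simp
  have hN: "(\<lambda>w. N (L w)) holomorphic_on ball u (norm u)" and ht: "(\<lambda>w. \<theta> (L w)) holomorphic_on ball u (norm u)"
    using holomorphic_on_compose_gen[OF NL(2,1)] holomorphic_on_compose_gen[OF NL(2) theta_holomorphic[of UNIV]]
    by (auto simp: o_def)
  define A where "A = {w \<in> ball u (norm u). \<theta> (L w) \<noteq> 0}"
  have "open (ball u (norm u) \<inter> (\<lambda>w. \<theta> (L w)) -` (- {0}))"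
    by (rule continuous_open_preimage[OF holomorphic_on_imp_continuous_on[OF ht] open_ball]) auto
  also have "\<dots> = A" by (auto simp: A_def)
  finally have A: "open A" .
  have "exp (L u) = exp (Ln u)" using NL(3)[OF u] assms by simp
  hence "L u \<notin> lattice \<tau>" using assms(2) by (simp add: mem_lattice_iff)
  hence uA: "u \<in> A" using u by (simp add: A_def theta_eq_0_iff)
  have "(\<lambda>w. N (L w) / \<theta> (L w)) holomorphic_on A"
    by (intro holomorphic_on_divide holomorphic_on_subset[OF hN] holomorphic_on_subset[OF ht]) (auto simp: A_def)
  hence "(\<lambda>u. g_taylor b a (Ln u)) holomorphic_on A"
    by (rule holomorphic_transform) (use NL(4) in \<open>auto simp: A_def theta_eq_0_iff\<close>)
  thus ?thesis using A uA analytic_at by blast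
qed

text \<open>Near u the function is a quotient of holomorphic functions; what has to be excluded is
  that the denominator theta(L w) vanishes identically.\<close>

lemma g_taylor_Ln_meromorphic: "(\<lambda>u. g_taylor b a (Ln u)) meromorphic_on (- {0})"
proof (subst meromorphic_on_meromorphic_at, intro ballI)
  fix u :: complex assume "u \<in> - {0}"
  hence u0: "u \<noteq> 0" by simp
  obtain N L where NL: "N holomorphic_on UNIV" "L holomorphic_on ball u (norm u)"
    "\<And>w. w \<in> ball u (norm u) ==> w \<noteq> 0 \<and> exp (L w) = w"
    "\<And>w. w \<in> ball u (norm u) ==> L w \<notin> lattice \<tau> ==> g_taylor b a (Ln w) = N (L w) / \<theta> (L w)"
    using g_taylor_Ln[of u b a] by metis
  have u: "u \<in> ball u (norm u)" using u0 by simp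
  have hN: "(\<lambda>w. N (L w)) holomorphic_on ball u (norm u)" and ht: "(\<lambda>w. \<theta> (L w)) holomorphic_on ball u (norm u)"
    using holomorphic_on_compose_gen[OF NL(2,1)] holomorphic_on_compose_gen[OF NL(2) theta_holomorphic[of UNIV]]
    by (auto simp: o_def)
  have an: "(\<lambda>w. N (L w)) analytic_on {u}" "(\<lambda>w. \<theta> (L w)) analytic_on {u}"
    using hN ht u analytic_at by blast+
  have m: "(\<lambda>w. N (L w) / \<theta> (L w)) meromorphic_on {u}"
    by (rule meromorphic_on_divide[OF an[THEN analytic_on_imp_meromorphic_on]])
  have "\<forall>\<^sub>F w in at u. L w \<notin> lattice \<tau>"
  proof -
    have "\<forall>\<^sub>F w in at u. \<theta> (L w) \<noteq> 0"
    proof (rule ccontr)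
      assume "\<not> ?thesis"
      hence fr: "\<exists>\<^sub>F w in at u. \<theta> (L w) = 0" by (simp add: frequently_def)
      have zero: "\<theta> (L w) = 0" if "w \<in> ball u (norm u)" for w
      proof -
        have "(\<lambda>w. \<theta> (L w)) nicely_meromorphic_on ball u (norm u)"
          using ht by (intro analytic_on_imp_nicely_meromorphic_on) (simp add: analytic_on_open)
        from frequently_eq_meromorphic_imp_constant[OF fr this open_ball _ u that] show ?thesis
          by (simp add: convex_connected)
      qed
      \<comment> \<open>The ratio w/u has modulus strictly between 1 and 1/|q|, hence is no power of
        q, so theta composed with L cannot vanish at both u and w.\<close>
      define w where "w = u * (1 + of_real (1 - norm q) / 2)"
      define d where "d = (1 - norm q) / 2"
      have d: "0 < d" "d < 1" "w = u * of_real (1 + d)" "norm q * (1 + d) < 1"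
      proof -
        show "0 < d" using norm_q_less_1 by (simp add: d_def)
        have "-1 < norm q" by (rule less_le_trans[of _ 0]) auto
        thus "d < 1" by (simp add: d_def)
        show "w = u * of_real (1 + d)" by (simp add: w_def d_def)
        have "norm q * (1 + d) = norm q + (norm q - norm q ^ 2) / 2" by (simp add: d_def power2_eq_square field_simps)
        also have "\<dots> < 1"
        proof -
          have "(1 - norm q) * (2 - norm q) > 0" using norm_q_less_1 by simp
          thus ?thesis by (simp add: power2_eq_square field_simps)
        qed
        finally show "norm q * (1 + d) < 1" .
      qed
      have "dist u w = norm u * d" using d by (simp add: dist_norm d(3) algebra_simps norm_mult)
      hence wb: "w \<in> ball u (norm u)" using d u0 by simp
      obtain k l where kl: "exp (L u) = q powi k" "exp (L w) = q powi l"
        using zero[OF u] zero[OF wb] by (auto simp: theta_eq_0_iff mem_lattice_iff)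
      hence "u = q powi k" "w = q powi l" using NL(3)[OF u] NL(3)[OF wb] by auto
      hence "q powi (l - k) = w / u" by (simp add: power_int_diff)
      also have "w / u = of_real (1 + d)" using d(3) u0 by simp
      finally have "q powi (l - k) = of_real (1 + d)" .
      hence nrm: "norm (q powi (l - k)) = 1 + d" using d(1) by (simp only: norm_of_real)
      show False
      proof (cases "l - k \<ge> 0")
        case True
        then obtain m where m: "l - k = int m" by (metis nonneg_int_cases)
        have "norm (q powi (l - k)) \<le> 1" using norm_q_less_1 unfolding m
          by (simp add: norm_power power_le_one)
        thus False using nrm d by simp
      next
        case False
        then obtain m where m: "l - k = - int (Suc m)" by (metis neg_int_cases gr0_implies_Suc not_le)
        have e: "norm q ^ Suc m * (1 + d) = 1"
          using nrm unfolding m by (simp only: power_int_minus power_int_of_nat norm_inverse norm_power) (simp add: field_simps)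
        have "norm q ^ Suc m \<le> norm q ^ 1" using norm_q_less_1 by (intro power_decreasing) auto
        hence "norm q ^ Suc m * (1 + d) \<le> norm q * (1 + d)" using d by (intro mult_right_mono) auto
        thus False using d(4) unfolding e by simp
      qed
    qed
    thus ?thesis by (simp add: theta_eq_0_iff)
  qed
  moreover have "\<forall>\<^sub>F w in at u. w \<in> ball u (norm u)" using u by (intro eventually_at_in_open') auto
  ultimately have "\<forall>\<^sub>F w in at u. g_taylor b a (Ln w) = N (L w) / \<theta> (L w)"
    by eventually_elim (use NL(4) in auto)
  thus "(\<lambda>u. g_taylor b a (Ln u)) meromorphic_on {u}"
    using meromorphic_on_cong[of "{u}" "\<lambda>u. g_taylor b a (Ln u)" "\<lambda>w. N (L w) / \<theta> (L w)"] m by auto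
qed

section \<open>Convergence of the series defining g and its continuation\<close>

definition g_annulus :: "nat => nat => complex set" where
  "g_annulus b a = {u. norm q ^ a < norm u \<and> norm u < norm q powi (int a - int b)}"

lemma open_g_annulus: "open (g_annulus b a)"
  unfolding g_annulus_def by (intro open_Collect_conj open_Collect_less continuous_intros)

lemma g_annulus_nonzero: "u \<in> g_annulus b a ==> u \<noteq> 0"
  by (auto simp: g_annulus_def)

text \<open>For k > 0 the denominator is at least (1 - |q|)^b in modulus. For k < 0 the fraction is
  expanded by q^(b |k|), which brings the denominator to the same form and turns the numerator into
  q^(a |k|).\<close>

lemma g_coeff_bound:
  assumes "a \<le> b" "0 < r1" "r1 \<le> norm u" "norm u \<le> r2"
  shows "norm (g_coeff \<tau> b a k * u powi k) \<le> 1 / (1 - norm q) ^ b * max (norm q ^ (b - a) * r2) (norm q ^ a / r1) ^ nat \<bar>k\<bar>"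
proof -
  define Q where "Q = norm q"
  have Q: "0 < Q" "Q < 1" using norm_q_less_1 by (auto simp: Q_def)
  define \<rho> where "\<rho> = max (Q ^ (b - a) * r2) (Q ^ a / r1)"
  have dist: "1 - Q \<le> norm (1 - q ^ Suc m)" for m
  proof -
    have "Q ^ Suc m \<le> Q ^ 1" using Q by (intro power_decreasing) auto
    moreover have "norm (q ^ Suc m) = Q ^ Suc m" by (simp only: norm_power Q_def)
    ultimately show ?thesis using norm_triangle_ineq2[of 1 "q ^ Suc m"] by (simp del: power_Suc)
  qed
  have db: "1 / norm (1 - q ^ Suc m) ^ b \<le> 1 / (1 - Q) ^ b" for m
    using dist[of m] Q by (intro divide_left_mono power_mono mult_pos_pos zero_less_power) auto
  consider "k = 0" | m where "k = int (Suc m)" | m where "k = - int (Suc m)"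
    by (metis neg_int_cases pos_int_cases gr0_implies_Suc linorder_neqE)
  hence "norm (g_coeff \<tau> b a k * u powi k) \<le> 1 / (1 - Q) ^ b * \<rho> ^ nat \<bar>k\<bar>"
  proof cases
    case 1
    have "(1/2 :: real) ^ b \<le> 1" by (simp add: power_le_one)
    moreover have "1 \<le> 1 / (1 - Q) ^ b" using Q by (simp add: power_le_one)
    ultimately show ?thesis unfolding 1 by (simp add: g_coeff_def norm_mult norm_power norm_divide power_one_over[symmetric])
  next
    case (2 m)
    have "int b - int a = int (b - a)" using assms(1) by simp
    hence ba: "(int b - int a) * k = int ((b - a) * Suc m)" by (simp only: 2 of_nat_mult)
    have e: "norm (q powi int ((b - a) * Suc m)) = (Q ^ (b - a)) ^ Suc m"
      by (simp only: power_int_of_nat norm_power Q_def power_mult)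
    have qk: "q powi k = q ^ Suc m" "norm (u powi k) = norm u ^ Suc m" by (simp_all only: 2 power_int_of_nat norm_power)
    have "norm (g_coeff \<tau> b a k) = (Q ^ (b - a)) ^ Suc m / norm (1 - q ^ Suc m) ^ b"
    proof -
      have "k \<noteq> 0" using 2 by simp
      thus ?thesis unfolding g_coeff_def ba qk
        by (simp only: if_False norm_mult norm_divide norm_power e norm_minus_cancel norm_one power_one mult_1)
    qed
    hence "norm (g_coeff \<tau> b a k * u powi k) = (Q ^ (b - a) * norm u) ^ Suc m * (1 / norm (1 - q ^ Suc m) ^ b)"
      unfolding norm_mult qk by (simp add: power_mult_distrib del: power_Suc)
    also have "\<dots> \<le> \<rho> ^ Suc m * (1 / (1 - Q) ^ b)"
      using assms Q db[of m] by (intro mult_mono power_mono) (auto simp: \<rho>_def le_max_iff_disj intro!: mult_left_mono simp del: power_Suc)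
    finally have "norm (g_coeff \<tau> b a k * u powi k) \<le> 1 / (1 - Q) ^ b * \<rho> ^ Suc m" by (simp only: mult.commute)
    moreover have "nat \<bar>k\<bar> = Suc m" by (simp add: 2)
    ultimately show ?thesis by (simp only:)
  next
    case (3 m)
    have "int b - int a = int (b - a)" using assms(1) by simp
    hence ba: "(int b - int a) * k = - int ((b - a) * Suc m)" by (simp only: 3 of_nat_mult mult_minus_right)
    define x where "x = q ^ Suc m"
    have x: "x \<noteq> 0" "1 - x \<noteq> 0" using one_minus_q_power_nonzero by (auto simp: x_def)
    have e1: "norm (1 - inverse x) = norm (1 - x) / norm x"
    proof -
      have "1 - inverse x = - ((1 - x) / x)" using x by (simp add: field_simps)
      thus ?thesis by (simp only: norm_minus_cancel norm_divide)
    qed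
    have "norm (g_coeff \<tau> b a k) = inverse (norm x ^ (b - a)) / norm (1 - inverse x) ^ b"
    proof -
      have e: "norm (q powi (- int ((b - a) * Suc m))) = inverse (norm x ^ (b - a))"
        by (simp only: power_int_minus power_int_of_nat norm_inverse norm_power x_def power_mult[symmetric] mult.commute)
      have k0: "k \<noteq> 0" using 3 by simp
      have qk: "q powi k = inverse x" by (simp only: 3 x_def power_int_minus power_int_of_nat)
      show ?thesis
        using k0 unfolding g_coeff_def ba qk
        by (simp only: if_False norm_mult norm_divide norm_power e norm_minus_cancel norm_one power_one mult_1)
    qed
    also have "\<dots> = norm x ^ a * (1 / norm (1 - x) ^ b)"
    proof -
      have "norm x ^ b = norm x ^ (b - a) * norm x ^ a" using assms(1) by (simp flip: power_add)
      thus ?thesis using x unfolding e1 by (simp add: power_divide field_simps)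
    qed
    finally have n1: "norm (g_coeff \<tau> b a k) = norm x ^ a * (1 / norm (1 - x) ^ b)" .
    have n2: "norm (u powi k) = (1 / norm u) ^ Suc m"
      by (simp only: 3 power_int_minus power_int_of_nat norm_inverse norm_power) (simp add: divide_inverse power_inverse del: power_Suc)
    have n3: "norm x ^ a * (1 / norm u) ^ Suc m = (Q ^ a / norm u) ^ Suc m"
      by (simp add: x_def Q_def norm_power power_mult[symmetric] power_divide mult.commute del: power_Suc)
    have "norm (g_coeff \<tau> b a k * u powi k) = (norm x ^ a * (1 / norm u) ^ Suc m) * (1 / norm (1 - x) ^ b)"
      unfolding norm_mult n1 n2 by (simp only: mult_ac)
    also have "\<dots> = (Q ^ a / norm u) ^ Suc m * (1 / norm (1 - q ^ Suc m) ^ b)"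
      unfolding n3 unfolding x_def ..
    also have "\<dots> \<le> \<rho> ^ Suc m * (1 / (1 - Q) ^ b)"
      using assms Q db[of m] by (intro mult_mono power_mono) (auto simp: \<rho>_def le_max_iff_disj intro!: divide_left_mono mult_pos_pos simp del: power_Suc)
    finally have "norm (g_coeff \<tau> b a k * u powi k) \<le> 1 / (1 - Q) ^ b * \<rho> ^ Suc m" by (simp only: mult.commute)
    moreover have "nat \<bar>k\<bar> = Suc m" by (simp add: 3)
    ultimately show ?thesis by (simp only:)
  qed
  thus ?thesis by (simp add: Q_def \<rho>_def)
qed

definition g_series :: "nat => nat => complex => complex" where
  "g_series b a u = (\<Sum>\<^sub>\<infinity>k\<in>UNIV. g_coeff \<tau> b a k * u powi k)"

lemma g_series_local:
  assumes "a \<le> b" "u \<in> g_annulus b a"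
  shows "\<exists>A. open A \<and> u \<in> A \<and> g_series b a holomorphic_on A"
    and "(\<lambda>k. g_coeff \<tau> b a k * u powi k) summable_on UNIV"
proof -
  define Q where "Q = norm q"
  have Q: "0 < Q" "Q < 1" using norm_q_less_1 by (auto simp: Q_def)
  have u: "Q ^ a < norm u" "norm u < Q powi (int a - int b)" using assms(2) by (auto simp: g_annulus_def Q_def)
  obtain r1 where r1: "Q ^ a < r1" "r1 < norm u" using dense[OF u(1)] by blast
  obtain r2 where r2: "norm u < r2" "r2 < Q powi (int a - int b)" using dense[OF u(2)] by blast
  have r1p: "0 < r1" using r1(1) Q by (meson less_trans zero_less_power)
  define \<rho> where "\<rho> = max (Q ^ (b - a) * r2) (Q ^ a / r1)"
  have "Q powi (int a - int b) = inverse (Q ^ (b - a))"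
  proof -
    have e: "int a - int b = - int (b - a)" using assms(1) by simp
    show ?thesis unfolding e power_int_minus power_int_of_nat ..
  qed
  hence "Q ^ (b - a) * r2 < Q ^ (b - a) * inverse (Q ^ (b - a))"
    using r2(2) Q by (intro mult_strict_left_mono) auto
  hence "Q ^ (b - a) * r2 < 1" using Q by simp
  moreover have "Q ^ a / r1 < 1" using r1(1) r1p by simp
  ultimately have \<rho>: "0 \<le> \<rho>" "\<rho> < 1" using Q r1p by (auto simp: \<rho>_def le_max_iff_disj)
  define A where "A = {w::complex. r1 < norm w \<and> norm w < r2}"
  have A: "open A" "u \<in> A" unfolding A_def using r1 r2
    by (auto intro!: open_Collect_conj open_Collect_less continuous_intros)
  define M where "M = (\<lambda>k::int. 1 / (1 - Q) ^ b * \<rho> ^ nat \<bar>k\<bar>)"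
  have M: "M summable_on UNIV" unfolding M_def
    by (intro summable_on_cmult_right summable_on_int_geometric \<rho>)
  have bd: "norm (g_coeff \<tau> b a k * w powi k) \<le> M k" if "w \<in> A" for k w
    using g_coeff_bound[OF assms(1) r1p, of w r2 k] that by (simp add: A_def M_def \<rho>_def Q_def)
  have "0 \<notin> A" using r1p by (auto simp: A_def)
  hence "(\<lambda>w. g_coeff \<tau> b a k * w powi k) holomorphic_on A" for k
    by (intro holomorphic_intros) auto
  hence "g_series b a holomorphic_on A"
    unfolding g_series_def[abs_def] by (intro infsum_holomorphic[OF A(1) _ bd M]) auto
  thus "\<exists>A. open A \<and> u \<in> A \<and> g_series b a holomorphic_on A" using A by blast
  show "(\<lambda>k. g_coeff \<tau> b a k * u powi k) summable_on UNIV"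
    by (rule abs_summable_summable, rule Infinite_Sum.abs_summable_on_comparison_test'[OF M bd[OF A(2)]])
qed

lemma g_series_analytic: "a \<le> b ==> g_series b a analytic_on (g_annulus b a)"
  using g_series_local(1) by (subst analytic_on_analytic_at) (meson analytic_at)

lemma g_coeff_eq_geom:
  assumes "a \<le> b" "k \<noteq> 0"
  shows "g_coeff \<tau> b a k = (-1) ^ b * ((geom k - 1) ^ (b - a) * geom k ^ a)"
proof -
  have nz: "1 - q powi k \<noteq> 0" using assms(2) by simp
  have "geom k - 1 = q powi k / (1 - q powi k)" using nz by (simp add: geom_def field_simps)
  hence "(geom k - 1) ^ (b - a) * geom k ^ a = (q powi k) ^ (b - a) / ((1 - q powi k) ^ (b - a) * (1 - q powi k) ^ a)"
    by (simp add: geom_def power_divide)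
  also have "(1 - q powi k) ^ (b - a) * (1 - q powi k) ^ a = (1 - q powi k) ^ b"
    using assms(1) by (simp flip: power_add)
  also have "(q powi k) ^ (b - a) = q powi ((int b - int a) * k)"
    using assms(1) by (simp add: power_int_mult of_nat_diff mult.commute[of "int b - int a"] flip: power_int_of_nat)
  finally show ?thesis using assms(2) by (simp add: g_coeff_def)
qed

text \<open>Compared on one of the two basic annuli only, where the Kronecker expansion is
  available; the annulus of g_{b,a} is in general wider. Whether a = 0 decides which of the two fits
  the base of the geometric expansion.\<close>

lemma g_series_eq_g_taylor:
  assumes "1 \<le> b" "a \<le> b" "in_annulus (if a = 0 then 0 else 1) (exp z)"
  shows "g_series b a (exp z) = g_taylor b a z"
proof -
  define c where "c = (if a = 0 then 0 else 1 :: nat)"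
  define s where "s = (of_nat (1 - c) :: complex)"
  have s: "s = (if a = 0 then 1 else 0)" by (simp add: s_def c_def)
  have "((\<lambda>k. \<Sum>j<b. ((-1) ^ b * geom_coeff b a j) * (poly (geom_poly s j) (geom k) * exp z powi k))
     has_sum (\<Sum>j<b. ((-1) ^ b * geom_coeff b a j) * (- taylor j z - bernoulli_coeff j + (if j = 0 then s else 0)))) (UNIV - {0})"
    unfolding s_def by (intro has_sum_finite_sum has_sum_cmult_right taylor_has_sum) (use assms(3) in \<open>auto simp: c_def\<close>)
  also have "?this \<longleftrightarrow> ((\<lambda>k. g_coeff \<tau> b a k * exp z powi k)
     has_sum (\<Sum>j<b. ((-1) ^ b * geom_coeff b a j) * (- taylor j z - bernoulli_coeff j + (if j = 0 then s else 0)))) (UNIV - {0})"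
  proof (rule has_sum_cong)
    fix k :: int
    show "k \<in> UNIV - {0} ==> (\<Sum>j<b. ((-1) ^ b * geom_coeff b a j) * (poly (geom_poly s j) (geom k) * exp z powi k)) = g_coeff \<tau> b a k * exp z powi k"
    proof -
      assume "k \<in> UNIV - {0}"
      hence k: "k \<noteq> 0" by simp
      show ?thesis
        unfolding g_coeff_eq_geom[OF assms(2) k] geom_coeff(2)[OF assms(1,2)] s sum_distrib_left sum_distrib_right
        by (intro sum.cong refl) (simp only: mult_ac)
    qed
  qed
  finally have 1: "((\<lambda>k. g_coeff \<tau> b a k * exp z powi k)
     has_sum (\<Sum>j<b. ((-1) ^ b * geom_coeff b a j) * (- taylor j z - bernoulli_coeff j + (if j = 0 then s else 0)))) (UNIV - {0})" .
  have "((\<lambda>k. g_coeff \<tau> b a k * exp z powi k)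
     has_sum (g_coeff \<tau> b a 0 * exp z powi 0 + (\<Sum>j<b. ((-1) ^ b * geom_coeff b a j) * (- taylor j z - bernoulli_coeff j + (if j = 0 then s else 0))))) (insert 0 (UNIV - {0}))"
    by (rule has_sum_insert[OF _ 1]) simp
  moreover have "insert 0 (UNIV - {0::int}) = UNIV" by auto
  ultimately have "g_series b a (exp z) = g_coeff \<tau> b a 0 + (\<Sum>j<b. ((-1) ^ b * geom_coeff b a j) * (- taylor j z - bernoulli_coeff j + (if j = 0 then s else 0)))"
    unfolding g_series_def by (simp add: infsumI)
  also have "\<dots> = g_taylor b a z"
  proof -
    have "(\<Sum>j<b. ((-1) ^ b * geom_coeff b a j) * (- taylor j z - bernoulli_coeff j + (if j = 0 then s else 0)))
      = (-1) ^ b * (\<Sum>j<b. geom_coeff b a j * ((if j = 0 \<and> a = 0 then 1 else 0) - bernoulli_coeff j))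
        - (-1) ^ b * (\<Sum>j<b. geom_coeff b a j * taylor j z)"
      unfolding sum_distrib_left sum_subtractf[symmetric]
      by (intro sum.cong refl) (auto simp: s algebra_simps)
    thus ?thesis by (simp add: g_taylor_def g_const_def g_coeff_def)
  qed
  finally show ?thesis .
qed

text \<open>The combination of Taylor coefficients, as a function of u with removable singularities
  filled in, agrees with the series on a basic annulus, hence on the whole annulus of convergence.
  So a function as required in the definition of \<open>g\<close> exists, and by uniqueness it is
  this one.\<close>

theorem
  assumes "1 \<le> b" "a \<le> b"
  shows g_eq_g_series: "u \<in> g_annulus b a ==> g \<tau> b a u = g_series b a u"
    and g_eq_g_taylor: "z \<notin> lattice \<tau> ==> g \<tau> b a (exp z) = g_taylor b a z"
proof -
  define H where "H = remove_sings (\<lambda>u. g_taylor b a (Ln u))"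
  have H: "H nicely_meromorphic_on (- {0})" unfolding H_def
    by (rule remove_sings_nicely_meromorphic[OF g_taylor_Ln_meromorphic])
  have H_eq: "H (exp z) = g_taylor b a z" if "z \<notin> lattice \<tau>" for z
  proof -
    have "exp (Ln (exp z)) = exp z" by simp
    hence "Ln (exp z) \<notin> lattice \<tau>" using that by (simp add: mem_lattice_iff)
    hence "H (exp z) = g_taylor b a (Ln (exp z))"
      unfolding H_def by (intro remove_sings_at_analytic g_taylor_Ln_analytic) auto
    thus ?thesis using g_taylor_cong[of "Ln (exp z)" z] by simp
  qed
  define c where "c = (if a = 0 then 0 else 1 :: nat)"
  define U where "U = {u. in_annulus c u}"
  define Q where "Q = norm q"
  have Q: "0 < Q" "Q < 1" using norm_q_less_1 by (auto simp: Q_def)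
  have U: "open U" "U \<noteq> {}"
  proof -
    show "open U" unfolding U_def in_annulus_def
      by (intro open_Collect_disj open_Collect_conj open_Collect_less continuous_intros open_Collect_const)
    obtain x y where x: "Q < x" "x < 1" and y: "1 < y" "y < inverse Q"
      using dense[OF Q(2)] dense[of 1 "inverse Q"] Q one_less_inverse by blast
    have "of_real (if a = 0 then y else x) \<in> U" using x y Q by (auto simp: U_def c_def in_annulus_def Q_def[symmetric])
    thus "U \<noteq> {}" by blast
  qed
  have UA: "U \<subseteq> g_annulus b a"
  proof
    fix u assume u: "u \<in> U"
    have inv: "Q powi (int a - int b) = inverse (Q ^ (b - a))"
    proof -
      have e: "int a - int b = - int (b - a)" using assms(2) by simp
      show ?thesis unfolding e power_int_minus power_int_of_nat ..
    qed
    show "u \<in> g_annulus b a"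
    proof (cases "a = 0")
      case True
      have "Q ^ b \<le> Q ^ 1" using Q assms(1) by (intro power_decreasing) auto
      hence "inverse Q \<le> inverse (Q ^ b)" using Q by (intro le_imp_inverse_le) auto
      thus ?thesis using u True inv by (auto simp: U_def c_def in_annulus_def g_annulus_def Q_def[symmetric])
    next
      case False
      have "Q ^ a \<le> Q ^ 1" using Q False by (intro power_decreasing) auto
      moreover have "1 \<le> inverse (Q ^ (b - a))" using Q by (intro one_le_inverse) (auto simp: power_le_one)
      ultimately show ?thesis using u False inv by (auto simp: U_def c_def in_annulus_def g_annulus_def Q_def[symmetric])
    qed
  qed
  have HU: "H u = g_series b a u" if "u \<in> U" for u
  proof -
    have u: "in_annulus c (exp (Ln u))" "exp (Ln u) = u" using that in_annulus_nonzero by (auto simp: U_def)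
    show ?thesis
      using H_eq[OF in_annulus_not_lattice[OF u(1)]] g_series_eq_g_taylor[OF assms, of "Ln u"] u by (simp add: c_def)
  qed
  have An: "g_annulus b a \<subseteq> - {0}" using g_annulus_nonzero by auto
  have conn: "connected (g_annulus b a)"
    using connected_annulus(1)[of "norm q ^ a" "0 :: complex" "norm q powi (int a - int b)"]
    by (simp add: g_annulus_def)
  have HA: "H u = g_series b a u" if "u \<in> g_annulus b a" for u
    by (rule nicely_meromorphic_unique[OF nicely_meromorphic_on_subset[OF H An]
        analytic_on_imp_nicely_meromorphic_on[OF g_series_analytic[OF assms(2)]] open_g_annulus conn U(1) UA U(2) HU that])
  have "\<exists>F. F nicely_meromorphic_on (- {0}) \<and> (\<forall>u. norm q ^ a < norm u \<and> norm u < norm q powi (int a - int b) -->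
        F u = (\<Sum>\<^sub>\<infinity>k\<in>UNIV. g_coeff \<tau> b a k * u powi k))"
    using H HA unfolding g_annulus_def g_series_def by blast
  from someI_ex[OF this] have G: "g \<tau> b a nicely_meromorphic_on (- {0})"
    "\<And>u. u \<in> g_annulus b a ==> g \<tau> b a u = g_series b a u"
    unfolding g_def[symmetric] g_annulus_def g_series_def by blast+
  show "u \<in> g_annulus b a ==> g \<tau> b a u = g_series b a u" by (rule G(2))
  have conn': "connected (- {0 :: complex})"
    by (rule connected_punctured_universe) simp
  have "g \<tau> b a u = H u" if "u \<noteq> 0" for u
    by (rule nicely_meromorphic_unique[OF G(1) H _ conn' open_g_annulus[of b a] An])
       (use that UA U(2) G(2) HA in auto)
  thus "z \<notin> lattice \<tau> ==> g \<tau> b a (exp z) = g_taylor b a z" using H_eq by simp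
qed

end

section \<open>Sums over integer labellings\<close>

lemma
  fixes f :: "'a => int => complex"
  assumes "finite A" "\<And>i. i \<in> A ==> (\<lambda>k. norm (f i k)) summable_on UNIV"
  shows summable_norm_prod_PiE: "(\<lambda>k. norm (\<Prod>i\<in>A. f i (k i))) summable_on (PiE A (\<lambda>_. UNIV))"
    and has_sum_prod_PiE: "((\<lambda>k. \<Prod>i\<in>A. f i (k i)) has_sum (\<Prod>i\<in>A. \<Sum>\<^sub>\<infinity>k. f i k)) (PiE A (\<lambda>_. UNIV))"
proof -
  have "Infinite_Set_Sum.abs_summable_on (\<lambda>k. \<Prod>i\<in>A. f i (k i)) (PiE A (\<lambda>_. UNIV))"
    by (rule abs_summable_on_prod_PiE) (use assms in \<open>auto simp flip: abs_summable_equivalent\<close>)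
  thus s: "(\<lambda>k. norm (\<Prod>i\<in>A. f i (k i))) summable_on (PiE A (\<lambda>_. UNIV))"
    by (simp only: abs_summable_equivalent)
  have "infsum (\<lambda>k. \<Prod>i\<in>A. f i (k i)) (PiE A (\<lambda>_. UNIV)) = (\<Prod>i\<in>A. \<Sum>\<^sub>\<infinity>k. f i k)"
    by (rule infsum_prod_PiE_abs) (use assms in auto)
  thus "((\<lambda>k. \<Prod>i\<in>A. f i (k i)) has_sum (\<Prod>i\<in>A. \<Sum>\<^sub>\<infinity>k. f i k)) (PiE A (\<lambda>_. UNIV))"
    using has_sum_infsum[OF abs_summable_summable[OF s]] by simp
qed

lemma
  assumes "distinct K"
  shows prod_nth_distinct: "(\<Prod>j<length K. f (K ! j)) = (\<Prod>i\<in>set K. f i :: 'b::comm_monoid_mult)"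
    and prod_nth_cyclic: "(\<Prod>j<length K. f (K ! (Suc j mod length K))) = (\<Prod>i\<in>set K. f i :: 'b::comm_monoid_mult)"
proof -
  have *: "(\<Prod>j<length L. f (L ! j)) = (\<Prod>i\<in>set L. f i)" if "distinct L" for L
    using prod.reindex_bij_betw[OF bij_betw_nth[OF that refl refl], of f] by simp
  show "(\<Prod>j<length K. f (K ! j)) = (\<Prod>i\<in>set K. f i)" by (rule *[OF assms])
  have "(\<Prod>j<length K. f (K ! (Suc j mod length K))) = (\<Prod>j<length (rotate1 K). f (rotate1 K ! j))"
    by (intro prod.cong) (auto simp: nth_rotate1)
  also have "\<dots> = (\<Prod>i\<in>set K. f i)" using assms by (subst *) auto
  finally show "(\<Prod>j<length K. f (K ! (Suc j mod length K))) = (\<Prod>i\<in>set K. f i)" .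
qed

lemma summable_on_finite_sum:
  fixes f :: "'a => 'b => real"
  assumes "finite J" "\<And>j. j \<in> J ==> f j summable_on A"
  shows "(\<lambda>k. \<Sum>j\<in>J. f j k) summable_on A"
  using assms by (induction J rule: finite_induct) (auto intro!: summable_on_add)

lemma cyc_cong:
  assumes "\<And>i j. i \<in> set K ==> j \<in> set K ==> M i j = N i j"
  shows "cyc M K = cyc N K"
  unfolding cyc_def
proof (rule prod.cong[OF refl])
  fix j assume "j \<in> {..<length K}"
  hence j: "j < length K" by simp
  moreover have "Suc j mod length K < length K" using j by (intro mod_less_divisor) auto
  ultimately show "M (K ! j) (K ! (Suc j mod length K)) = N (K ! j) (K ! (Suc j mod length K))"
    by (intro assms nth_mem)
qed

lemma cycle_weight_cong:
  assumes "\<And>i j. i \<in> S ==> j \<in> S ==> M i j = N i j"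
  shows "cycle_weight M S = cycle_weight N S"
  unfolding cycle_weight_def
  by (intro arg_cong2[where f = "(*)"] sum.cong refl cyc_cong assms) (auto dest: permutations_of_setD)

text \<open>A nonzero product forces equal labels at consecutive entries, hence along the whole
  cycle.\<close>

lemma cyc_level_sets_nonconstant:
  assumes "cyc (\<lambda>i j. if k i = k j then a (k i) i j else 0) K \<noteq> 0" "i \<in> set K" "j \<in> set K"
  shows "k i = k j"
proof -
  have step: "k (K ! l) = k (K ! (Suc l mod length K))" if "l < length K" for l
  proof -
    have "(if k (K ! l) = k (K ! (Suc l mod length K)) then a (k (K ! l)) (K ! l) (K ! (Suc l mod length K)) else 0) \<noteq> 0"
      using assms(1) that unfolding cyc_def by (subst (asm) prod_zero_iff) auto
    thus ?thesis by (auto split: if_splits)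
  qed
  have 0: "k (K ! l) = k (K ! 0)" if "l < length K" for l
    using that
  proof (induction l)
    case (Suc l)
    thus ?case using step[of l] by simp
  qed simp
  obtain l l' where "l < length K" "K ! l = i" "l' < length K" "K ! l' = j"
    using assms(2,3) by (auto simp: in_set_conv_nth)
  thus ?thesis using 0 by metis
qed

text \<open>The determinant of the matrix cut down to the level sets of \<open>k\<close> splits into cycles on which
  \<open>k\<close> is constant, so that summing over \<open>k\<close> gives one sum for each block.\<close>

lemma has_sum_dt_level_sets:
  fixes a :: "int => 'a => 'a => complex"
  assumes A: "finite A"
    and summ: "\<And>S K. S \<subseteq> A ==> S \<noteq> {} ==> K \<in> permutations_of_set S ==> (\<lambda>l. norm (cyc (a l) K)) summable_on UNIV"
  shows "((\<lambda>k. dt A (\<lambda>i j. if k i = k j then a (k i) i j else 0))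
     has_sum partition_sum (\<lambda>S. \<Sum>\<^sub>\<infinity>l. cycle_weight (a l) S) A) (PiE A (\<lambda>_. UNIV))"
proof -
  define M where "M = (\<lambda>(k :: 'a => int) i j. if k i = k j then a (k i) i j else 0)"
  have block: "((\<lambda>k. \<Prod>S\<in>P. cycle_weight (M k) S) has_sum (\<Prod>S\<in>P. \<Sum>\<^sub>\<infinity>l. cycle_weight (a l) S)) (PiE A (\<lambda>_. UNIV))"
    if P: "partition_on A P" for P
  proof -
    have finP: "finite P" using finite_elements[OF A P] .
    define bl where "bl = (\<lambda>i. THE S. S \<in> P \<and> i \<in> S)"
    have bl: "bl i = S" if "S \<in> P" "i \<in> S" for i S
      unfolding bl_def using that P by (intro the_equality) (auto simp: partition_on_def disjoint_def)
    have blP: "bl i \<in> P" if "i \<in> A" for i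
      using that bl P by (metis UnionE partition_onD1)
    \<comment> \<open>Spreads a label of each block over its elements; the image is the set of
      labellings constant on every block. Outside of it some block carries two labels and all its
      cycles vanish.\<close>
    define \<Phi> where "\<Phi> = (\<lambda>(l :: 'a set => int). \<lambda>i\<in>A. l (bl i))"
    have SA: "S \<subseteq> A" "S \<noteq> {}" if "S \<in> P" for S using that P by (auto simp: partition_on_def)
    have \<Phi>: "\<Phi> l i = l S" if "S \<in> P" "i \<in> S" for l i S
      using that SA bl by (auto simp: \<Phi>_def)
    have inj: "inj_on \<Phi> (PiE P (\<lambda>_. UNIV))"
    proof (rule inj_onI)
      fix l l' assume l: "l \<in> PiE P (\<lambda>_. UNIV)" "l' \<in> PiE P (\<lambda>_. UNIV)" and eq: "\<Phi> l = \<Phi> l'"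
      show "l = l'"
      proof (rule PiE_ext[OF l])
        fix S assume S: "S \<in> P"
        then obtain i where "i \<in> S" using SA by blast
        thus "l S = l' S" using \<Phi>[OF S, of i l] \<Phi>[OF S, of i l'] eq by simp
      qed
    qed
    have w: "cycle_weight (M (\<Phi> l)) S = cycle_weight (a (l S)) S" if "S \<in> P" for l S
      by (rule cycle_weight_cong) (use \<Phi>[OF that] in \<open>auto simp: M_def\<close>)
    have wsumm: "(\<lambda>l. norm (cycle_weight (a l) S)) summable_on UNIV" if "S \<in> P" for S
    proof (rule Infinite_Sum.abs_summable_on_comparison_test')
      show "(\<lambda>l. norm ((-1) ^ (card S - 1) / of_nat (card S) :: complex) * (\<Sum>K\<in>permutations_of_set S. norm (cyc (a l) K))) summable_on UNIV"
        using summ[OF SA[OF that]] by (intro summable_on_cmult_right summable_on_finite_sum) auto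
      show "norm (cycle_weight (a l) S) \<le> norm ((-1) ^ (card S - 1) / of_nat (card S) :: complex) * (\<Sum>K\<in>permutations_of_set S. norm (cyc (a l) K))" for l
        unfolding cycle_weight_def norm_mult by (intro mult_left_mono norm_sum) auto
    qed
    have "((\<lambda>l. \<Prod>S\<in>P. cycle_weight (a (l S)) S) has_sum (\<Prod>S\<in>P. \<Sum>\<^sub>\<infinity>l. cycle_weight (a l) S)) (PiE P (\<lambda>_. UNIV))"
      by (rule has_sum_prod_PiE[OF finP wsumm])
    also have "?this \<longleftrightarrow> (((\<lambda>k. \<Prod>S\<in>P. cycle_weight (M k) S) \<circ> \<Phi>) has_sum (\<Prod>S\<in>P. \<Sum>\<^sub>\<infinity>l. cycle_weight (a l) S)) (PiE P (\<lambda>_. UNIV))"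
      by (intro has_sum_cong) (simp add: w)
    also have "\<dots> \<longleftrightarrow> ((\<lambda>k. \<Prod>S\<in>P. cycle_weight (M k) S) has_sum (\<Prod>S\<in>P. \<Sum>\<^sub>\<infinity>l. cycle_weight (a l) S)) (\<Phi> ` PiE P (\<lambda>_. UNIV))"
      by (rule has_sum_reindex[OF inj, symmetric])
    also have "\<dots> \<longleftrightarrow> ((\<lambda>k. \<Prod>S\<in>P. cycle_weight (M k) S) has_sum (\<Prod>S\<in>P. \<Sum>\<^sub>\<infinity>l. cycle_weight (a l) S)) (PiE A (\<lambda>_. UNIV))"
    proof (rule has_sum_cong_neutral)
      fix k assume k: "k \<in> PiE A (\<lambda>_. UNIV) - \<Phi> ` PiE P (\<lambda>_. UNIV)"
      have "\<exists>S\<in>P. \<exists>i\<in>S. \<exists>j\<in>S. k i \<noteq> k j"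
      proof (rule ccontr)
        assume "\<not> ?thesis"
        hence const: "k i = k j" if "S \<in> P" "i \<in> S" "j \<in> S" for S i j using that by blast
        define l where "l = (\<lambda>S\<in>P. k (SOME i. i \<in> S))"
        have "k = \<Phi> l"
        proof (rule PiE_ext[where k = A and s = "\<lambda>_. UNIV"])
          show "\<Phi> l \<in> PiE A (\<lambda>_. UNIV)" by (auto simp: \<Phi>_def)
          fix i assume i: "i \<in> A"
          have iS: "i \<in> bl i" using i bl P by (metis UnionE partition_onD1)
          have "(SOME j. j \<in> bl i) \<in> bl i" using iS by (rule someI)
          hence "k (SOME j. j \<in> bl i) = k i" using const[OF blP[OF i] _ iS] by simp
          thus "k i = \<Phi> l i" using i blP[OF i] by (simp add: \<Phi>_def l_def)
        qed (use k in auto)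
        moreover have "l \<in> PiE P (\<lambda>_. UNIV)" by (auto simp: l_def)
        ultimately show False using k by blast
      qed
      then obtain S i j where S: "S \<in> P" "i \<in> S" "j \<in> S" "k i \<noteq> k j" by blast
      have "cyc (M k) K = 0" if "K \<in> permutations_of_set S" for K
        using cyc_level_sets_nonconstant[of k a K i j] S that by (auto simp: M_def dest: permutations_of_setD)
      hence "cycle_weight (M k) S = 0" by (simp add: cycle_weight_def)
      thus "(\<Prod>S\<in>P. cycle_weight (M k) S) = 0" using S(1) finP by (intro prod_zero) auto
    next
      fix k assume "k \<in> \<Phi> ` PiE P (\<lambda>_. UNIV) - PiE A (\<lambda>_. UNIV)"
      thus "(\<Prod>S\<in>P. cycle_weight (M k) S) = 0" by (auto simp: \<Phi>_def)
    qed auto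
    finally show ?thesis .
  qed
  have "((\<lambda>k. \<Sum>P\<in>{P. partition_on A P}. \<Prod>S\<in>P. cycle_weight (M k) S)
     has_sum (\<Sum>P\<in>{P. partition_on A P}. \<Prod>S\<in>P. \<Sum>\<^sub>\<infinity>l. cycle_weight (a l) S)) (PiE A (\<lambda>_. UNIV))"
    by (rule has_sum_finite_sum) (use block A finitely_many_partition_on in auto)
  thus ?thesis
    unfolding partition_sum_def[symmetric] by (simp add: dt_eq_partition_sum[OF A] M_def)
qed

text \<open>Collects the exponent of v_j in the product of the (v_i / v_(p i))^(k_i). It is 0 for
  every j exactly if k is constant along the cycles of p.\<close>

lemma prod_permuted_powi:
  fixes v :: "nat => 'a::field"
  assumes p: "p permutes A" and v: "\<And>i. i \<in> A ==> v i \<noteq> 0"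
  shows "(\<Prod>j\<in>A. v j powi (k j - k (inv p j))) = (\<Prod>i\<in>A. (v i / v (p i)) powi k i)"
proof -
  have "(\<Prod>j\<in>A. v j powi (k j - k (inv p j))) = (\<Prod>j\<in>A. v j powi k j) / (\<Prod>j\<in>A. v j powi k (inv p j))"
    using v by (simp add: power_int_diff prod_dividef)
  also have "(\<Prod>j\<in>A. v j powi k (inv p j)) = (\<Prod>i\<in>A. v (p i) powi k i)"
    using prod.permute[OF p, of "\<lambda>j. v j powi k (inv p j)"] permutes_inverses(2)[OF p] by (simp add: o_def)
  finally show ?thesis by (simp add: power_int_divide_distrib prod_dividef)
qed


section \<open>The torus integral\<close>

context upper_half_plane
begin

lemma theta_eventually_nonzero: "\<forall>\<^sub>F t in at 0. \<theta> (t + s) \<noteq> 0"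
proof (cases "\<theta> s = 0")
  case False
  have "isCont (\<lambda>t. \<theta> (t + s)) 0"
    using holomorphic_on_imp_continuous_on[OF holomorphic_on_shift[OF theta_holomorphic, of s]]
    by (simp add: continuous_on_eq_continuous_at)
  thus ?thesis using False by (intro tendsto_imp_eventually_ne[where c = "\<theta> s"]) (auto simp: isCont_def)
next
  case True
  have hol: "(\<lambda>t. \<theta> (t + s)) holomorphic_on UNIV" by (rule holomorphic_on_shift[OF theta_holomorphic])
  obtain r where r: "r > 0" "\<And>t. t \<in> ball 0 r ==> t \<noteq> 0 ==> \<theta> t \<noteq> 0"
    using theta_recip_holomorphic by metis
  define b where "b = complex_of_real (r / 2)"
  have "b \<in> ball 0 r" "b \<noteq> 0" using r(1) by (auto simp: b_def)
  hence "\<theta> ((b - s) + s) \<noteq> 0" using r(2) by simp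
  then obtain e where "e > 0" "\<And>t. t \<in> ball 0 e - {0} ==> \<theta> (t + s) \<noteq> 0"
    using isolated_zeros[OF hol open_UNIV connected_UNIV UNIV_I, of 0 "b - s"] True by auto
  thus ?thesis unfolding eventually_at by (intro exI[of _ e]) (auto simp: dist_norm)
qed

lemma varpi_eq:
  "varpi n \<tau> z w = \<theta> (\<Sum>k\<in>{1..n}. z k) * cauchy_product n (\<lambda>i. z i + w i) w"
proof -
  have e: "z i + w i - z j - w j = (z i + w i) - (z j + w j)" "w i - z j - w j = w i - (z j + w j)" for i j
    by (simp_all add: algebra_simps)
  show ?thesis unfolding varpi_def cauchy_product_def e by simp
qed

end

locale torus_region = upper_half_plane \<tau> for \<tau> +
  fixes n :: nat and chi :: "index => index => nat" and z :: "nat => complex" and s :: "nat => real"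
  assumes ordering: "is_ordering n chi"
    and s_pos: "\<And>j. j \<in> {1..n} ==> s j > 0"
    and torus_subset: "\<And>v. (\<forall>j\<in>{1..n}. norm (v j) = s j) ==> (\<lambda>i. exp (z i), v) \<in> Omega n chi \<tau>"
begin

definition c where "c i j = chi (Idx i) (Bar j)"

text \<open>The ratio of x_i to the x of j-bar at the point of the torus with v_j = s_j. Along a
  cycle the radii cancel, and the product of these ratios is the product of the u_i.\<close>

definition X where "X i j = exp (z i) * of_real (s i) / of_real (s j)"

lemma c_01: "i \<in> {1..n} ==> j \<in> {1..n} ==> c i j \<in> {0, 1}"
  using ordering by (simp add: is_ordering_def c_def indices_def)

lemma annulus:
  assumes "\<forall>j\<in>{1..n}. norm (v j) = s j" "i \<in> {1..n}" "j \<in> {1..n}"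
  shows "in_annulus (c i j) (exp (z i) * v i / v j)"
proof -
  have "norm (v j) = s j" using assms(1,3) by blast
  hence vj: "v j \<noteq> 0" using s_pos[OF assms(3)] by auto
  have ij: "Idx i \<in> indices n" "Bar j \<in> indices n" "Idx i \<noteq> Bar j" using assms by (auto simp: indices_def)
  have "(\<lambda>i. exp (z i), v) \<in> Omega n chi \<tau>" by (rule torus_subset[OF assms(1)])
  hence "(chi (Idx i) (Bar j) = 0 --> norm (exp (z i) * v i) > norm (v j)) \<and>
     (chi (Idx i) (Bar j) = 1 --> norm (exp (z i) * v i) < norm (v j)) \<and>
     norm q < norm (exp (z i) * v i / v j) \<and> norm (exp (z i) * v i / v j) < inverse (norm q)"
    using ij unfolding Omega_def by fastforce
  thus ?thesis using c_01[OF assms(2,3)] vj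
    unfolding in_annulus_def c_def by (auto simp: norm_divide field_simps)
qed

lemma norm_s: "j \<in> {1..n} ==> norm (complex_of_real (s j)) = s j"
  using s_pos[of j] by (simp only: norm_of_real abs_of_pos)

lemma annulus_X: "i \<in> {1..n} ==> j \<in> {1..n} ==> in_annulus (c i j) (X i j)"
  using annulus[of "\<lambda>j. of_real (s j)" i j] norm_s unfolding X_def by blast

text \<open>Mode l of the Kronecker matrix, with the radii included so that single entries are
  summable over l; in cycles the radii drop out.\<close>

definition A where "A t l i j = kronecker_coeff (c i j) l t * X i j powi l"

lemma uniform_bound:
  obtains C \<rho> \<delta> where "0 < \<delta>" "0 \<le> \<rho>" "\<rho> < 1" "0 \<le> C"
    "\<And>i j t l. i \<in> {1..n} ==> j \<in> {1..n} ==> norm t < \<delta> ==> l \<noteq> 0 ==> norm (A t l i j) \<le> C * \<rho> ^ nat \<bar>l\<bar>"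
    "\<And>t l. norm t < \<delta> ==> l \<noteq> 0 ==> q powi l * exp t \<noteq> 1"
proof -
  \<comment> \<open>An auxiliary point that provides the nonvanishing of 1 - q^l exp t independently
    of the pairs (i, j), of which there are none for n = 0.\<close>
  obtain X0 where X0: "in_annulus 1 X0"
  proof -
    obtain x where "norm q < x" "x < 1" using dense[OF norm_q_less_1] by blast
    moreover from this have "0 < x" using norm_q_pos by (meson less_trans)
    ultimately have "in_annulus 1 (of_real x)" by (auto simp: in_annulus_def)
    thus ?thesis by (rule that)
  qed
  obtain \<delta>0 where \<delta>0: "0 < \<delta>0" "\<And>t l. norm t < \<delta>0 ==> l \<noteq> 0 ==> q powi l * exp t \<noteq> 1"
    using kronecker_coeff_bound[OF X0] by metis
  define I where "I = {1..n} \<times> {1..n}"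
  have "\<exists>C \<rho> \<delta>. 0 < \<delta> \<and> 0 \<le> \<rho> \<and> \<rho> < 1 \<and> 0 \<le> C \<and>
    (\<forall>t l. norm t < \<delta> --> l \<noteq> 0 --> norm (A t l (fst x) (snd x)) \<le> C * \<rho> ^ nat \<bar>l\<bar>)" if "x \<in> I" for x
    unfolding A_def using kronecker_coeff_bound[OF annulus_X[of "fst x" "snd x"]] that
    by (auto simp: I_def) metis
  then obtain C' \<rho>' \<delta>' where b: "\<And>x. x \<in> I ==> 0 < \<delta>' x \<and> 0 \<le> \<rho>' x \<and> \<rho>' x < 1 \<and> 0 \<le> C' x \<and>
    (\<forall>t l. norm t < \<delta>' x --> l \<noteq> 0 --> norm (A t l (fst x) (snd x)) \<le> C' x * \<rho>' x ^ nat \<bar>l\<bar>)"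
    by metis
  have fin: "finite I" by (simp add: I_def)
  define C where "C = Max (insert 0 (C' ` I))"
  define \<rho> where "\<rho> = Max (insert 0 (\<rho>' ` I))"
  define \<delta> where "\<delta> = Min (insert \<delta>0 (\<delta>' ` I))"
  show ?thesis
  proof (rule that[of \<delta> \<rho> C])
    show "0 < \<delta>" "\<rho> < 1" unfolding \<delta>_def \<rho>_def using fin b \<delta>0 by auto
    show "0 \<le> \<rho>" "0 \<le> C" unfolding \<rho>_def C_def using fin by (auto intro: Max_ge)
    hence C0: "0 \<le> C" by simp
    have \<delta>le: "\<delta> \<le> \<delta>0" unfolding \<delta>_def using fin by (intro Min_le) auto
    show "q powi l * exp t \<noteq> 1" if "norm t < \<delta>" "l \<noteq> 0" for t l
      using \<delta>0(2)[of t l] that \<delta>le by simp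
    fix i j :: nat and t :: complex and l :: int assume ij: "i \<in> {1..n}" "j \<in> {1..n}" and t: "norm t < \<delta>" "l \<noteq> 0"
    have x: "(i, j) \<in> I" using ij by (simp add: I_def)
    have le: "\<delta> \<le> \<delta>' (i,j)" "\<rho>' (i,j) \<le> \<rho>" "C' (i,j) \<le> C"
      unfolding \<delta>_def \<rho>_def C_def using fin x by (auto intro!: Min_le Max_ge)
    have "norm (A t l i j) \<le> C' (i,j) * \<rho>' (i,j) ^ nat \<bar>l\<bar>" using b[OF x] t le by auto
    also have "\<dots> \<le> C * \<rho> ^ nat \<bar>l\<bar>"
      using b[OF x] le C0 by (intro mult_mono power_mono) auto
    finally show "norm (A t l i j) \<le> C * \<rho> ^ nat \<bar>l\<bar>" .
  qed
qed

lemma cyc_bound: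
  obtains \<delta> where "0 < \<delta>" "\<And>t l. norm t < \<delta> ==> l \<noteq> 0 ==> q powi l * exp t \<noteq> 1"
    "\<And>i j t. i \<in> {1..n} ==> j \<in> {1..n} ==> norm t < \<delta> ==> (\<lambda>l. norm (A t l i j)) summable_on UNIV"
    "\<And>S K. S \<subseteq> {1..n} ==> S \<noteq> {} ==> K \<in> permutations_of_set S ==>
      \<exists>M. M summable_on UNIV \<and> (\<forall>t l. norm t < \<delta> --> l \<noteq> 0 --> norm (cyc (A t l) K) \<le> M l)"
proof -
  obtain C \<rho> \<delta> where b: "0 < \<delta>" "0 \<le> \<rho>" "\<rho> < 1" "0 \<le> C"
    "\<And>i j t l. i \<in> {1..n} ==> j \<in> {1..n} ==> norm t < \<delta> ==> l \<noteq> 0 ==> norm (A t l i j) \<le> C * \<rho> ^ nat \<bar>l\<bar>"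
    "\<And>t l. norm t < \<delta> ==> l \<noteq> 0 ==> q powi l * exp t \<noteq> 1"
    using uniform_bound by metis
  show ?thesis
  proof (rule that[OF b(1,6)])
    fix i j :: nat and t :: complex assume ij: "i \<in> {1..n}" "j \<in> {1..n}" and t: "norm t < \<delta>"
    show "(\<lambda>l. norm (A t l i j)) summable_on UNIV"
    proof (rule Infinite_Sum.abs_summable_on_comparison_test')
      show "(\<lambda>l. C * \<rho> ^ nat \<bar>l\<bar> + (if l = 0 then norm (A t 0 i j) else 0)) summable_on UNIV"
        by (intro summable_on_add summable_on_cmult_right summable_on_int_geometric b finite_nonzero_values_imp_summable_on)
           (auto intro: finite_subset[of _ "{0}"])
      show "norm (A t l i j) \<le> C * \<rho> ^ nat \<bar>l\<bar> + (if l = 0 then norm (A t 0 i j) else 0)" for l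
        using b(5)[OF ij t, of l] b(4) by auto
    qed
  next
    fix S K assume S: "S \<subseteq> {1..n}" "S \<noteq> {}" and K: "K \<in> permutations_of_set S"
    have lenK: "length K > 0" "set K \<subseteq> {1..n}" using K S by (auto dest: permutations_of_setD)
    show "\<exists>M. M summable_on UNIV \<and> (\<forall>t l. norm t < \<delta> --> l \<noteq> 0 --> norm (cyc (A t l) K) \<le> M l)"
    proof (intro exI conjI allI impI)
      show "(\<lambda>l::int. C ^ length K * \<rho> ^ nat \<bar>l\<bar>) summable_on UNIV"
        by (intro summable_on_cmult_right summable_on_int_geometric b)
      fix t :: complex and l :: int assume t: "norm t < \<delta>" "l \<noteq> 0"
      have "norm (cyc (A t l) K) = (\<Prod>j<length K. norm (A t l (K ! j) (K ! (Suc j mod length K))))"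
        by (simp add: cyc_def prod_norm)
      also have "\<dots> \<le> (\<Prod>j<length K. C * \<rho> ^ nat \<bar>l\<bar>)"
      proof (rule prod_mono)
        fix j assume "j \<in> {..<length K}"
        hence j: "j < length K" by simp
        moreover have "Suc j mod length K < length K" using j by (intro mod_less_divisor) auto
        ultimately have "K ! j \<in> {1..n}" "K ! (Suc j mod length K) \<in> {1..n}" using lenK nth_mem by blast+
        thus "0 \<le> norm (A t l (K ! j) (K ! (Suc j mod length K))) \<and>
          norm (A t l (K ! j) (K ! (Suc j mod length K))) \<le> C * \<rho> ^ nat \<bar>l\<bar>"
          using b(5) t by simp
      qed
      also have "\<dots> = C ^ length K * (\<rho> ^ nat \<bar>l\<bar>) ^ length K" by (simp add: power_mult_distrib)
      \<comment> \<open>A cycle has at least one factor, so one power of \<rho>^|l| is kept and the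
        others are dropped.\<close>
      also have "\<dots> \<le> C ^ length K * (\<rho> ^ nat \<bar>l\<bar>) ^ 1"
        using b Suc_leI[OF lenK(1)] by (intro mult_left_mono power_decreasing) (auto simp: power_le_one)
      finally show "norm (cyc (A t l) K) \<le> C ^ length K * \<rho> ^ nat \<bar>l\<bar>" by simp
    qed
  qed
qed

text \<open>The nonzero modes of a cycle. At t = 0 this is the series of g_{b,a} at the product of
  the u_i, without its constant term.\<close>

definition N where "N t K = (\<Sum>\<^sub>\<infinity>l\<in>UNIV-{0}. cyc (A t l) K)"

definition block_sum where "block_sum t S = (\<Sum>\<^sub>\<infinity>l. cycle_weight (A t l) S)"

definition N_block where
  "N_block t S = (-1) ^ (card S - 1) / of_nat (card S) * (\<Sum>K\<in>permutations_of_set S. N t K)"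

text \<open>Collects what the limit t -> 0 needs: on a common neighbourhood of 0, each block sum
  splits into the singular mode 0 and a part that is continuous at t = 0.\<close>

lemma region_facts:
  obtains \<delta> where "0 < \<delta>" "\<And>t l. norm t < \<delta> ==> l \<noteq> 0 ==> q powi l * exp t \<noteq> 1"
    "\<And>i j t. i \<in> {1..n} ==> j \<in> {1..n} ==> norm t < \<delta> ==> (\<lambda>l. norm (A t l i j)) summable_on UNIV"
    "\<And>S K t. S \<subseteq> {1..n} ==> S \<noteq> {} ==> K \<in> permutations_of_set S ==> norm t < \<delta> ==>
       (\<lambda>l. norm (cyc (A t l) K)) summable_on UNIV"
    "\<And>S t. S \<subseteq> {1..n} ==> S \<noteq> {} ==> norm t < \<delta> ==> block_sum t S = cycle_weight (A t 0) S + N_block t S"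
    "\<And>S. S \<subseteq> {1..n} ==> S \<noteq> {} ==> ((\<lambda>t. N_block t S) \<longlongrightarrow> N_block 0 S) (at 0)"
proof -
  obtain \<delta> where d: "0 < \<delta>" "\<And>t l. norm t < \<delta> ==> l \<noteq> 0 ==> q powi l * exp t \<noteq> 1"
    "\<And>i j t. i \<in> {1..n} ==> j \<in> {1..n} ==> norm t < \<delta> ==> (\<lambda>l. norm (A t l i j)) summable_on UNIV"
    "\<And>S K. S \<subseteq> {1..n} ==> S \<noteq> {} ==> K \<in> permutations_of_set S ==>
      \<exists>M. M summable_on UNIV \<and> (\<forall>t l. norm t < \<delta> --> l \<noteq> 0 --> norm (cyc (A t l) K) \<le> M l)"
  proof (rule cyc_bound, goal_cases)
    case 1
    show ?case by (rule that; fact 1)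
  qed
  have summ: "(\<lambda>l. norm (cyc (A t l) K)) summable_on UNIV"
    if SK: "S \<subseteq> {1..n}" "S \<noteq> {}" "K \<in> permutations_of_set S" and t: "norm t < \<delta>" for S K t
  proof -
    obtain M where M: "M summable_on UNIV" "\<And>t l. norm t < \<delta> ==> l \<noteq> 0 ==> norm (cyc (A t l) K) \<le> M l"
      using d(4)[OF SK] by metis
    have "(\<lambda>l. norm (cyc (A t l) K)) summable_on (UNIV - {0})"
      by (rule Infinite_Sum.abs_summable_on_comparison_test'[OF summable_on_subset[OF M(1)]]) (use M(2)[OF t] in auto)
    moreover have "(\<lambda>l. norm (cyc (A t l) K)) summable_on {0}" by simp
    ultimately have "(\<lambda>l. norm (cyc (A t l) K)) summable_on (UNIV - {0} \<union> {0})" by (rule summable_on_union)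
    thus ?thesis by simp
  qed
  have lim: "((\<lambda>t. N t K) \<longlongrightarrow> N 0 K) (at 0)" if SK: "S \<subseteq> {1..n}" "S \<noteq> {}" "K \<in> permutations_of_set S" for S K
  proof -
    obtain M where M: "M summable_on UNIV" "\<And>t l. norm t < \<delta> ==> l \<noteq> 0 ==> norm (cyc (A t l) K) \<le> M l"
      using d(4)[OF SK] by metis
    have hA: "(\<lambda>t. A t l i j) holomorphic_on ball 0 \<delta>" if "l \<noteq> 0" for l i j
      unfolding A_def kronecker_coeff_def
      by (intro holomorphic_intros) (use d(2)[OF _ that] in auto)
    have "(\<lambda>t. \<Sum>\<^sub>\<infinity>l\<in>UNIV-{0}. cyc (A t l) K) holomorphic_on ball 0 \<delta>"
    proof (rule infsum_holomorphic[where M = M])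
      show "(\<lambda>t. cyc (A t l) K) holomorphic_on ball 0 \<delta>" if "l \<in> UNIV - {0}" for l
        unfolding cyc_def using that by (intro holomorphic_on_prod hA) auto
      show "M summable_on UNIV - {0}" by (rule summable_on_subset[OF M(1)]) auto
    qed (use M(2) in auto)
    hence "continuous_on (ball 0 \<delta>) (\<lambda>t. N t K)" unfolding N_def by (rule holomorphic_on_imp_continuous_on)
    thus ?thesis using d(1) by (simp add: continuous_on_eq_continuous_at isCont_def)
  qed
  show ?thesis
  proof (rule that[OF d(1,2,3) summ])
    fix S assume S: "S \<subseteq> {1..n}" "S \<noteq> {}"
    show "((\<lambda>t. N_block t S) \<longlongrightarrow> N_block 0 S) (at 0)"
      unfolding N_block_def by (intro tendsto_mult tendsto_const tendsto_sum lim[OF S])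
    fix t :: complex assume t: "norm t < \<delta>"
    have hs: "((\<lambda>l. cyc (A t l) K) has_sum (cyc (A t 0) K + N t K)) UNIV" if K: "K \<in> permutations_of_set S" for K
    proof -
      have "(\<lambda>l. cyc (A t l) K) summable_on (UNIV - {0})"
        by (rule summable_on_subset[OF abs_summable_summable[OF summ[OF S K t]]]) auto
      hence "((\<lambda>l. cyc (A t l) K) has_sum N t K) (UNIV - {0})" unfolding N_def by (rule has_sum_infsum)
      hence "((\<lambda>l. cyc (A t l) K) has_sum (cyc (A t 0) K + N t K)) (insert 0 (UNIV - {0}))"
        by (rule has_sum_insert[rotated]) simp
      moreover have "insert 0 (UNIV - {0::int}) = UNIV" by auto
      ultimately show ?thesis by simp
    qed
    have "((\<lambda>l. cycle_weight (A t l) S) has_sum ((-1) ^ (card S - 1) / of_nat (card S) * (\<Sum>K\<in>permutations_of_set S. cyc (A t 0) K + N t K))) UNIV"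
      unfolding cycle_weight_def by (intro has_sum_cmult_right has_sum_finite_sum hs) auto
    hence "block_sum t S = (-1) ^ (card S - 1) / of_nat (card S) * (\<Sum>K\<in>permutations_of_set S. cyc (A t 0) K + N t K)"
      unfolding block_sum_def by (rule infsumI)
    thus "block_sum t S = cycle_weight (A t 0) S + N_block t S"
      by (simp add: cycle_weight_def N_block_def sum.distrib distrib_left)
  qed
qed

text \<open>By Frobenius' formula the integrand is a multiple of a determinant of Kronecker
  functions. Expanding all entries gives terms indexed by a permutation p and a labelling k of the
  rows by modes; the constant term in v retains those with k constant along the cycles of p. The sum
  over p then is a determinant cut down to the level sets of k. The range {1..Suc n} contains an
  empty tail, so that k = 1 is admissible also for n = 0.\<close>

lemma torus_integral_cauchy_product:
  assumes t: "\<theta> t \<noteq> 0" "\<And>k. k \<in> {1..Suc n} ==> \<theta> (t + (\<Sum>j\<in>{k..n}. z j)) \<noteq> 0"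
    and sA: "\<And>i j. i \<in> {1..n} ==> j \<in> {1..n} ==> (\<lambda>l. norm (A t l i j)) summable_on UNIV"
    and sK: "\<And>S K. S \<subseteq> {1..n} ==> S \<noteq> {} ==> K \<in> permutations_of_set S ==> (\<lambda>l. norm (cyc (A t l) K)) summable_on UNIV"
  shows "torus_integral n s (\<lambda>v. d * cauchy_product n (\<lambda>i. z i + Ln (v i)) (\<lambda>i. Ln (v i))) v0
     = d * (\<theta> t / \<theta> (t + (\<Sum>j\<in>{1..n}. z j))) * partition_sum (block_sum t) {1..n}"
proof -
  define e where "e = d * (\<theta> t / \<theta> (t + (\<Sum>j\<in>{1..n}. z j)))"
  have tZ: "\<theta> (t + (\<Sum>j\<in>{1..n}. z j)) \<noteq> 0" using t(2)[of 1] by simp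
  define Ps where "Ps = {p. p permutes {1..n}}"
  define Ks where "Ks = PiE {1..n} (\<lambda>_. UNIV :: int set)"
  \<comment> \<open>Pairs of a permutation and a labelling, as a disjoint union over the
    permutations, so that sums over it split.\<close>
  define I where "I = (\<Union>p\<in>Ps. Pair p ` Ks)"
  have finP: "finite Ps" unfolding Ps_def by (rule finite_permutations) simp
  define cc where "cc = (\<lambda>(p, k). e * (of_int (sign p) * (\<Prod>i\<in>{1..n}. kronecker_coeff (c i (p i)) (k i) t * exp (z i) powi k i)))"
  define mm where "mm = (\<lambda>(p :: nat => nat, k :: nat => int) j. k j - k (inv p j))"
  have mono: "cc (p, k) * (\<Prod>j\<in>{1..n}. v j powi mm (p, k) j)
      = e * (of_int (sign p) * (\<Prod>i\<in>{1..n}. kronecker_coeff (c i (p i)) (k i) t * (exp (z i) * v i / v (p i)) powi k i))"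
    if "p \<in> Ps" "\<forall>i\<in>{1..n}. v i \<noteq> 0" for p k v
  proof -
    have "(\<Prod>j\<in>{1..n}. v j powi mm (p, k) j) = (\<Prod>i\<in>{1..n}. (v i / v (p i)) powi k i)"
      unfolding mm_def prod.case using that by (intro prod_permuted_powi) (auto simp: Ps_def)
    moreover have "(\<Prod>i\<in>{1..n}. kronecker_coeff (c i (p i)) (k i) t * (exp (z i) * v i / v (p i)) powi k i)
       = (\<Prod>i\<in>{1..n}. kronecker_coeff (c i (p i)) (k i) t * exp (z i) powi k i) * (\<Prod>i\<in>{1..n}. (v i / v (p i)) powi k i)"
      unfolding prod.distrib[symmetric]
      by (intro prod.cong refl) (simp add: power_int_mult_distrib power_int_divide_distrib)
    ultimately show ?thesis by (simp only: cc_def prod.case mult.assoc)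
  qed
  have p_in: "p i \<in> {1..n}" if "p \<in> Ps" "i \<in> {1..n}" for p i
    using that by (simp add: Ps_def permutes_in_image del: atLeastAtMost_iff)
  have monoA: "cc (p, k) * (\<Prod>j\<in>{1..n}. of_real (s j) powi mm (p, k) j) = e * (of_int (sign p) * (\<Prod>i\<in>{1..n}. A t (k i) i (p i)))"
    if "p \<in> Ps" for p k
  proof -
    have nz: "\<forall>i\<in>{1..n}. complex_of_real (s i) \<noteq> 0" using s_pos by force
    show ?thesis unfolding A_def X_def by (rule mono[OF that nz])
  qed
  have disj: "Pair p ` Ks \<inter> Pair p' ` Ks = {}" if "p \<noteq> p'" for p p' :: "nat => nat" using that by auto
  have inj: "inj_on (Pair p) Ks" for p :: "nat => nat" by (auto simp: inj_on_def)
  have summA: "(\<lambda>k. norm (\<Prod>i\<in>{1..n}. A t (k i) i (p i))) summable_on Ks" if "p \<in> Ps" for p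
    unfolding Ks_def by (rule summable_norm_prod_PiE) (use sA p_in[OF that] in auto)
  have "torus_integral n s (\<lambda>v. d * cauchy_product n (\<lambda>i. z i + Ln (v i)) (\<lambda>i. Ln (v i))) v0
     = (\<Sum>\<^sub>\<infinity>x\<in>{x\<in>I. \<forall>j\<in>{1..n}. mm x j = 0}. cc x)"
  proof (rule torus_integral_infsum)
    show "s j > 0" if "j \<in> {1..n}" for j using that by (rule s_pos)
    show "(\<lambda>x. norm (cc x) * (\<Prod>j\<in>{1..n}. s j powi mm x j)) summable_on I"
      unfolding I_def
    proof (rule summable_on_finite_union_disjoint[OF finP _ disj])
      fix p assume p: "p \<in> Ps"
      have eq: "norm (cc (p, k)) * (\<Prod>j\<in>{1..n}. s j powi mm (p, k) j) = norm e * norm (\<Prod>i\<in>{1..n}. A t (k i) i (p i))" for k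
      proof -
        have "norm (cc (p, k)) * (\<Prod>j\<in>{1..n}. s j powi mm (p, k) j) = norm (cc (p, k) * (\<Prod>j\<in>{1..n}. of_real (s j) powi mm (p, k) j))"
        proof -
          have "(\<Prod>j\<in>{1..n}. s j powi mm (p, k) j) = norm (\<Prod>j\<in>{1..n}. complex_of_real (s j) powi mm (p, k) j)"
            unfolding prod_norm[symmetric] norm_power_int by (intro prod.cong refl) (simp only: norm_s)
          thus ?thesis by (simp only: norm_mult)
        qed
        also have "\<dots> = norm e * norm (\<Prod>i\<in>{1..n}. A t (k i) i (p i))"
          unfolding monoA[OF p] norm_mult by (simp add: sign_def)
        finally show ?thesis .
      qed
      show "(\<lambda>x. norm (cc x) * (\<Prod>j\<in>{1..n}. s j powi mm x j)) summable_on (Pair p ` Ks)"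
        unfolding summable_on_reindex[OF inj] o_def eq by (intro summable_on_cmult_right summA p)
    qed
    fix v :: "nat => complex" assume v: "\<forall>j\<in>{1..n}. norm (v j) = s j"
    have v0: "v i \<noteq> 0" if "i \<in> {1..n}" for i
    proof -
      have "norm (v i) = s i" using v that by blast
      thus ?thesis using s_pos[OF that] by auto
    qed
    hence v0b: "\<forall>i\<in>{1..n}. v i \<noteq> 0" by blast
    define x where "x = (\<lambda>i. z i + Ln (v i))"
    define y where "y = (\<lambda>i. Ln (v i))"
    have exy: "exp (x i - y j) = exp (z i) * v i / v j" if "i \<in> {1..n}" "j \<in> {1..n}" for i j
      using v0[OF that(1)] v0[OF that(2)] by (simp add: x_def y_def exp_add exp_diff)
    have ann: "in_annulus (c i j) (exp (x i - y j))" if "i \<in> {1..n}" "j \<in> {1..n}" for i j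
      unfolding exy[OF that] by (rule annulus[OF v that])
    have xyz: "x j - y j = z j" for j by (simp add: x_def y_def)
    have frob: "dt {1..n} (\<lambda>i j. kronecker (x i - y j) t)
       = \<theta> (t + (\<Sum>j\<in>{1..n}. x j - y j)) / \<theta> t * cauchy_product n x y"
    proof (rule frobenius_determinant[OF t(1)])
      show "\<theta> (x i - y j) \<noteq> 0" if "i \<in> {1..n}" "j \<in> {1..n}" for i j
        using in_annulus_not_lattice[OF ann[OF that]] by (simp add: theta_eq_0_iff)
      show "\<theta> (t + (\<Sum>j\<in>{k..n}. x j - y j)) \<noteq> 0" if "k \<in> {1..n}" for k
        unfolding xyz using t(2)[of k] that by simp
    qed
    have tl: "t \<notin> lattice \<tau>" using t(1) by (simp add: theta_eq_0_iff)
    define f where "f = (\<lambda>p i l. kronecker_coeff (c i (p i)) l t * exp (x i - y (p i)) powi l)"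
    have nf: "norm (f p i l) = norm (A t l i (p i))" if "p \<in> Ps" "i \<in> {1..n}" for p i l
    proof -
      have "norm (exp (x i - y (p i))) = norm (X i (p i))"
      proof -
        have "norm (v i) = s i" "norm (v (p i)) = s (p i)" using v p_in[OF that] that(2) by blast+
        thus ?thesis unfolding exy[OF that(2) p_in[OF that]] X_def norm_mult norm_divide
          norm_s[OF that(2)] norm_s[OF p_in[OF that]] by simp
      qed
      thus ?thesis by (simp add: f_def A_def norm_mult norm_power_int)
    qed
    have fs: "(\<lambda>l. norm (f p i l)) summable_on UNIV" if "p \<in> Ps" "i \<in> {1..n}" for p i
      unfolding nf[OF that] by (rule sA[OF that(2) p_in[OF that]])
    have "d * cauchy_product n x y = e * dt {1..n} (\<lambda>i j. kronecker (x i - y j) t)"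
      unfolding frob e_def xyz using t(1) tZ by simp
    also have "\<dots> = (\<Sum>p\<in>Ps. e * (of_int (sign p) * (\<Prod>i\<in>{1..n}. kronecker (x i - y (p i)) t)))"
      by (simp add: dt_def Ps_def sum_distrib_left)
    also have "\<dots> = (\<Sum>p\<in>Ps. infsum (\<lambda>x. cc x * (\<Prod>j\<in>{1..n}. v j powi mm x j)) (Pair p ` Ks))"
    proof (rule sum.cong[OF refl])
      fix p assume p: "p \<in> Ps"
      have "((\<lambda>k. \<Prod>i\<in>{1..n}. f p i (k i)) has_sum (\<Prod>i\<in>{1..n}. \<Sum>\<^sub>\<infinity>l. f p i l)) Ks"
        unfolding Ks_def by (rule has_sum_prod_PiE) (use fs[OF p] in auto)
      also have "(\<Prod>i\<in>{1..n}. \<Sum>\<^sub>\<infinity>l. f p i l) = (\<Prod>i\<in>{1..n}. kronecker (x i - y (p i)) t)"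
        unfolding f_def by (intro prod.cong refl infsumI kronecker_has_sum ann tl p_in[OF p]) auto
      finally have "((\<lambda>k. e * (of_int (sign p) * (\<Prod>i\<in>{1..n}. f p i (k i)))) has_sum
          e * (of_int (sign p) * (\<Prod>i\<in>{1..n}. kronecker (x i - y (p i)) t))) Ks"
        by (intro has_sum_cmult_right)
      moreover have "e * (of_int (sign p) * (\<Prod>i\<in>{1..n}. f p i (k i))) = cc (p, k) * (\<Prod>j\<in>{1..n}. v j powi mm (p, k) j)" for k
        unfolding mono[OF p v0b] f_def using exy p_in[OF p] by (auto intro!: prod.cong)
      ultimately show "e * (of_int (sign p) * (\<Prod>i\<in>{1..n}. kronecker (x i - y (p i)) t))
          = infsum (\<lambda>x. cc x * (\<Prod>j\<in>{1..n}. v j powi mm x j)) (Pair p ` Ks)"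
        unfolding infsum_reindex[OF inj] o_def by (simp add: infsumI)
    qed
    also have "\<dots> = (\<Sum>\<^sub>\<infinity>x\<in>I. cc x * (\<Prod>j\<in>{1..n}. v j powi mm x j))"
      unfolding I_def
    proof (rule sum_infsum[OF finP _ disj])
      fix p assume p: "p \<in> Ps"
      have eq: "norm (cc (p, k) * (\<Prod>j\<in>{1..n}. v j powi mm (p, k) j)) = norm e * norm (\<Prod>i\<in>{1..n}. A t (k i) i (p i))" for k
      proof -
        have "norm (\<Prod>i\<in>{1..n}. kronecker_coeff (c i (p i)) (k i) t * (exp (z i) * v i / v (p i)) powi k i) = norm (\<Prod>i\<in>{1..n}. A t (k i) i (p i))"
          unfolding prod_norm[symmetric]
          using nf[OF p] exy p_in[OF p] by (intro prod.cong refl) (auto simp: f_def)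
        thus ?thesis unfolding mono[OF p v0b] norm_mult[of e] norm_mult[of "of_int (sign p)"] by (simp add: sign_def)
      qed
      have "(\<lambda>x. norm (cc x * (\<Prod>j\<in>{1..n}. v j powi mm x j))) summable_on (Pair p ` Ks)"
        unfolding summable_on_reindex[OF inj] o_def eq by (intro summable_on_cmult_right summA p)
      thus "(\<lambda>x. cc x * (\<Prod>j\<in>{1..n}. v j powi mm x j)) summable_on (Pair p ` Ks)"
        by (rule abs_summable_summable)
    qed
    finally show "d * cauchy_product n (\<lambda>i. z i + Ln (v i)) (\<lambda>i. Ln (v i)) = (\<Sum>\<^sub>\<infinity>x\<in>I. cc x * (\<Prod>j\<in>{1..n}. v j powi mm x j))"
      unfolding x_def y_def .
  qed
  \<comment> \<open>The constant-term condition on (p, k) is encoded by zero factors: a term is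
    retained if and only if k i = k (p i) for every i.\<close>
  also have "\<dots> = (\<Sum>\<^sub>\<infinity>x\<in>I. e * (of_int (sign (fst x)) * (\<Prod>i\<in>{1..n}. if snd x i = snd x (fst x i) then A t (snd x i) i (fst x i) else 0)))"
  proof (rule infsum_cong_neutral)
    fix x assume x: "x \<in> I - {x\<in>I. \<forall>j\<in>{1..n}. mm x j = 0}"
    then obtain p k where pk: "x = (p, k)" "p \<in> Ps" by (auto simp: I_def)
    then obtain j where j: "j \<in> {1..n}" "k j \<noteq> k (inv p j)" using x by (auto simp: mm_def)
    have p: "p permutes {1..n}" using pk by (simp add: Ps_def)
    have "inv p j \<in> {1..n}" "p (inv p j) = j"
      using j p permutes_in_image[OF permutes_inv[OF p]] permutes_inverses(1)[OF p] by auto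
    hence "(\<Prod>i\<in>{1..n}. if k i = k (p i) then A t (k i) i (p i) else 0) = 0"
      using j(2) by (intro prod_zero bexI[of _ "inv p j"]) auto
    thus "e * (of_int (sign (fst x)) * (\<Prod>i\<in>{1..n}. if snd x i = snd x (fst x i) then A t (snd x i) i (fst x i) else 0)) = 0"
      unfolding pk by (simp only: fst_conv snd_conv) simp
  next
    fix x assume x: "x \<in> {x\<in>I. \<forall>j\<in>{1..n}. mm x j = 0} \<inter> I"
    then obtain p k where pk: "x = (p, k)" "p \<in> Ps" by (auto simp: I_def)
    have p: "p permutes {1..n}" using pk by (simp add: Ps_def)
    have m0: "mm (p, k) j = 0" if "j \<in> {1..n}" for j using x that by (simp add: pk)
    have "k i = k (p i)" if "i \<in> {1..n}" for i
      using m0[OF p_in[OF pk(2) that]] permutes_inverses(2)[OF p] by (simp add: mm_def)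
    hence "(\<Prod>i\<in>{1..n}. if k i = k (p i) then A t (k i) i (p i) else 0) = (\<Prod>i\<in>{1..n}. A t (k i) i (p i))"
      by (intro prod.cong refl) (simp only: simp_thms if_True)
    moreover have "(\<Prod>j\<in>{1..n}. complex_of_real (s j) powi mm (p, k) j) = 1" using m0 by (intro prod.neutral) simp
    ultimately show "cc x = e * (of_int (sign (fst x)) * (\<Prod>i\<in>{1..n}. if snd x i = snd x (fst x i) then A t (snd x i) i (fst x i) else 0))"
      using monoA[OF pk(2), of k] unfolding pk by (simp only: fst_conv snd_conv) simp
  qed auto
  also have "\<dots> = e * partition_sum (block_sum t) {1..n}"
  proof -
    define B where "B = (\<lambda>p k. \<Prod>i\<in>{1..n}. if k i = k (p i) then A t (k i) i (p i) else 0)"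
    have sB: "B p summable_on Ks" if "p \<in> Ps" for p
    proof (rule abs_summable_summable, rule Infinite_Sum.abs_summable_on_comparison_test'[OF summA[OF that]])
      fix k
      show "norm (B p k) \<le> norm (\<Prod>i\<in>{1..n}. A t (k i) i (p i))"
        unfolding B_def prod_norm[symmetric] by (intro prod_mono) auto
    qed
    have split_I: "(\<Sum>\<^sub>\<infinity>x\<in>I. e * (of_int (sign (fst x)) * (\<Prod>i\<in>{1..n}. if snd x i = snd x (fst x i) then A t (snd x i) i (fst x i) else 0)))
      = (\<Sum>p\<in>Ps. infsum (\<lambda>x. e * (of_int (sign (fst x)) * (\<Prod>i\<in>{1..n}. if snd x i = snd x (fst x i) then A t (snd x i) i (fst x i) else 0))) (Pair p ` Ks))"
      unfolding I_def
    proof (rule sum_infsum[OF finP _ disj, symmetric])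
      fix p assume p: "p \<in> Ps"
      show "(\<lambda>x. e * (of_int (sign (fst x)) * (\<Prod>i\<in>{1..n}. if snd x i = snd x (fst x i) then A t (snd x i) i (fst x i) else 0))) summable_on (Pair p ` Ks)"
        unfolding summable_on_reindex[OF inj] o_def fst_conv snd_conv
        using sB[OF p] unfolding B_def by (intro summable_on_cmult_right)
    qed
    have "((\<lambda>k. \<Sum>p\<in>Ps. of_int (sign p) * B p k) has_sum (\<Sum>p\<in>Ps. of_int (sign p) * infsum (B p) Ks)) Ks"
      using sB by (intro has_sum_finite_sum[OF finP] has_sum_cmult_right has_sum_infsum)
    moreover have "((\<lambda>k. \<Sum>p\<in>Ps. of_int (sign p) * B p k) has_sum partition_sum (block_sum t) {1..n}) Ks"
      using has_sum_dt_level_sets[of "{1..n}" "A t", OF _ sK]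
      unfolding dt_def B_def Ps_def Ks_def block_sum_def[abs_def] by simp
    ultimately have "(\<Sum>p\<in>Ps. of_int (sign p) * infsum (B p) Ks) = partition_sum (block_sum t) {1..n}"
      by (rule has_sum_unique)
    moreover have "infsum (\<lambda>x. e * (of_int (sign (fst x)) * (\<Prod>i\<in>{1..n}. if snd x i = snd x (fst x i) then A t (snd x i) i (fst x i) else 0))) (Pair p ` Ks)
      = e * (of_int (sign p) * infsum (B p) Ks)" for p
      unfolding infsum_reindex[OF inj] o_def fst_conv snd_conv infsum_cmult_right' B_def by (rule refl)
    ultimately show ?thesis
      unfolding split_I by (simp only: sum_distrib_left[symmetric])
  qed
  finally show ?thesis by (simp only: e_def)
qed

end

section \<open>The closed formula on a region\<close>

text \<open>The sign of a partition is distributed over its blocks as (-1)^(|S|-1), and the value 0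
  on {0} encodes the exclusion of that block, so that all partitions may be summed.\<close>

definition block_term :: "(index => index => nat) => complex => (nat => complex) => nat set => complex" where
  "block_term chi \<tau> u S = (if S = {0} then 0
     else (-1) ^ (card S - 1) / of_nat (card S) * (if 0 \<in> S then G_u0 chi \<tau> S else G chi \<tau> S u))"

lemma sum_partition_term:
  "(\<Sum>P\<in>partitions_star n. partition_term n chi \<tau> u P) = partition_sum (block_term chi \<tau> u) {0..n}"
proof -
  have "(\<Sum>P\<in>partitions_star n. partition_term n chi \<tau> u P)
      = (\<Sum>P\<in>partitions_star n. \<Prod>S\<in>P. block_term chi \<tau> u S)"
  proof (rule sum.cong[OF refl])
    fix P assume P: "P \<in> partitions_star n"
    hence pP: "partition_on {0..n} P" and z: "{0} \<notin> P" by (auto simp: partitions_star_def)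
    have fS: "finite S" "1 \<le> card S" if "S \<in> P" for S
    proof -
      have "S \<subseteq> {0..n}" "S \<noteq> {}" using pP that by (auto simp: partition_on_def)
      thus "finite S" "1 \<le> card S" using finite_subset[of S "{0..n}"] by (auto simp: Suc_le_eq card_gt_0_iff)
    qed
    have "card {0..n} = (\<Sum>S\<in>P. card S)"
      using pP fS card_Union_disjoint[of P] by (auto simp: partition_on_def disjoint_def pairwise_def disjnt_def)
    hence "(\<Sum>S\<in>P. card S - 1) = n + 1 - card P"
      using fS sum_subtractf_nat[of P "\<lambda>_. 1" card] by simp
    hence "(-1 :: complex) ^ (n + 1 - card P) = (-1) ^ (\<Sum>S\<in>P. card S - 1)" by (simp only:)
    also have "\<dots> = (\<Prod>S\<in>P. (-1) ^ (card S - 1))" by (rule power_sum)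
    finally have "(-1 :: complex) ^ (n + 1 - card P) = (\<Prod>S\<in>P. (-1) ^ (card S - 1))" .
    hence "partition_term n chi \<tau> u P
       = (\<Prod>S\<in>P. (-1) ^ (card S - 1) * (1 / of_nat (card S) * (if 0 \<in> S then G_u0 chi \<tau> S else G chi \<tau> S u)))"
      unfolding partition_term_def prod.distrib by simp
    also have "\<dots> = (\<Prod>S\<in>P. block_term chi \<tau> u S)"
      using z by (intro prod.cong refl) (auto simp: block_term_def)
    finally show "partition_term n chi \<tau> u P = (\<Prod>S\<in>P. block_term chi \<tau> u S)" .
  qed
  also have "\<dots> = partition_sum (block_term chi \<tau> u) {0..n}"
    unfolding partition_sum_def
  proof (rule sum.mono_neutral_left)
    show "finite {P. partition_on {0..n} P}" by (rule finitely_many_partition_on) simp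
    show "\<forall>P\<in>{P. partition_on {0..n} P} - partitions_star n. (\<Prod>S\<in>P. block_term chi \<tau> u S) = 0"
    proof
      fix P assume "P \<in> {P. partition_on {0..n} P} - partitions_star n"
      hence "{0} \<in> P" "finite P" by (auto simp: partitions_star_def intro: finite_elements)
      thus "(\<Prod>S\<in>P. block_term chi \<tau> u S) = 0" by (intro prod_zero) (auto simp: block_term_def)
    qed
  qed (auto simp: partitions_star_def)
  finally show ?thesis .
qed

text \<open>The entry at \<open>(0, 0)\<close> is the one making the weight of the block \<open>{0}\<close> vanish.\<close>

definition const_kernel :: "(index => index => nat) => nat => nat => complex" where
  "const_kernel chi i j = (if i = 0 \<and> j = 0 then 0 else 1/2 - of_nat (chi0 chi i j))"

lemma chi0_01: "is_ordering n chi ==> i \<in> {0..n} ==> j \<in> {0..n} ==> chi0 chi i j \<in> {0, 1}"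
  by (simp add: is_ordering_def chi0_def indices_def)

lemma permutations_of_set_nth:
  assumes "K \<in> permutations_of_set S" "j < length K"
  shows "K ! j \<in> S" "K ! (Suc j mod length K) \<in> S" "length K = card S"
proof -
  have "Suc j mod length K < length K" using assms(2) by (intro mod_less_divisor) auto
  thus "K ! j \<in> S" "K ! (Suc j mod length K) \<in> S"
    using assms(2) permutations_of_setD(1)[OF assms(1)] by (metis nth_mem)+
  show "length K = card S" using assms(1) by (rule length_finite_permutations_of_set)
qed

lemma chi_seq_le:
  assumes "is_ordering n chi" "S \<subseteq> {0..n}" "K \<in> permutations_of_set S"
  shows "chi_seq chi K \<le> card S"
proof -
  have "chi_seq chi K \<le> (\<Sum>j<length K. 1)"
    unfolding chi_seq_def
  proof (rule sum_mono)
    fix j assume "j \<in> {..<length K}"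
    hence "K ! j \<in> {0..n}" "K ! (Suc j mod length K) \<in> {0..n}" using permutations_of_set_nth[OF assms(3), of j] assms(2) by blast+
    thus "chi0 chi (K ! j) (K ! (Suc j mod length K)) \<le> 1" using chi0_01[OF assms(1)] by fastforce
  qed
  also have "\<dots> = card S" using length_finite_permutations_of_set[OF assms(3)] by simp
  finally show ?thesis .
qed

text \<open>Each step of the sequence contributes 1/2 - \<chi> = (1/2)(-1)^\<chi>, so the constant
  term (-1)^a (1/2)^b is a product along the cycle.\<close>

lemma g_coeff_0_eq_cyc:
  assumes ord: "is_ordering n chi" and S: "S \<subseteq> {0..n}" "S \<noteq> {0}" and K: "K \<in> permutations_of_set S"
  shows "g_coeff \<tau> (card S) (chi_seq chi K) 0 = cyc (const_kernel chi) K"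
proof -
  have len: "length K = card S" using K by (rule length_finite_permutations_of_set)
  have d: "distinct K" "set K = S" using K by (auto dest: permutations_of_setD)
  have "cyc (const_kernel chi) K = (\<Prod>j<length K. (-1) ^ chi0 chi (K ! j) (K ! (Suc j mod length K)) * (1/2))"
    unfolding cyc_def
  proof (rule prod.cong[OF refl])
    fix j assume "j \<in> {..<length K}"
    hence j: "j < length K" by simp
    have jj: "K ! j \<in> {0..n}" "K ! (Suc j mod length K) \<in> {0..n}" using permutations_of_set_nth[OF K j] S by blast+
    \<comment> \<open>In a distinct sequence, 0 is followed by 0 only if the sequence is [0], which
      is excluded.\<close>
    have "\<not> (K ! j = 0 \<and> K ! (Suc j mod length K) = 0)"
    proof
      assume a: "K ! j = 0 \<and> K ! (Suc j mod length K) = 0"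
      have "Suc j mod length K < length K" using j by (intro mod_less_divisor) auto
      hence "j = Suc j mod length K" using a d(1) j nth_eq_iff_index_eq by metis
      hence "length K = 1" using j by (cases "Suc j = length K") auto
      then obtain x where "K = [x]" by (auto simp: length_Suc_conv)
      thus False using a d(2) S(2) j by auto
    qed
    thus "const_kernel chi (K ! j) (K ! (Suc j mod length K)) = (-1) ^ chi0 chi (K ! j) (K ! (Suc j mod length K)) * (1/2)"
      using chi0_01[OF ord jj] by (auto simp: const_kernel_def)
  qed
  also have "\<dots> = (-1) ^ chi_seq chi K * (1/2) ^ card S"
    unfolding prod.distrib chi_seq_def power_sum by (simp add: len)
  finally show ?thesis by (simp add: g_coeff_def)
qed

text \<open>The index 0 borders the matrix 1/2 - \<chi> by a row of 1/2 and a column of -1/2, which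
  yields the factor 1/4. Next to a column of ones, any constant may be added to the other columns;
  so 1/2 - \<chi> may be replaced by 1 - \<chi>, which is what mode 0 contains besides 1/(exp t -
  1).\<close>

lemma dt_const_kernel:
  assumes "finite Q" "0 \<notin> Q"
  shows "4 * dt (insert 0 Q) (const_kernel chi)
    = (\<Sum>b\<in>Q. dt Q (\<lambda>i j. if j = b then 1 else of_nat 1 - of_nat (chi (Idx i) (Bar j))))"
proof -
  have one: "dt Q (\<lambda>i j. if j = b then const_kernel chi i 0 else const_kernel chi i j)
     = - (1/2) * dt Q (\<lambda>i j. if j = b then 1 else of_nat 1 - of_nat (chi (Idx i) (Bar j)))" if b: "b \<in> Q" for b
  proof -
    have nz: "i \<noteq> 0" if "i \<in> Q" for i using that assms(2) by metis
    have "dt Q (\<lambda>i j. if j = b then 1 else of_nat 1 - of_nat (chi (Idx i) (Bar j)) :: complex)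
       = dt Q (\<lambda>i j. if j = b then 1 else if j \<in> Q - {b} then (of_nat 1 - of_nat (chi (Idx i) (Bar j))) + 1 * (-1/2)
           else of_nat 1 - of_nat (chi (Idx i) (Bar j)))"
      by (rule dt_column_add_multiples[symmetric]) (use assms b in auto)
    also have "\<dots> = dt Q (\<lambda>i j. if j = b then 1 else const_kernel chi i j)"
      using nz by (intro dt_cong) (auto simp: const_kernel_def chi0_def)
    finally have e: "dt Q (\<lambda>i j. if j = b then 1 else of_nat 1 - of_nat (chi (Idx i) (Bar j))) = dt Q (\<lambda>i j. if j = b then 1 else const_kernel chi i j)" .
    have "dt Q (\<lambda>i j. if j = b then const_kernel chi i 0 else const_kernel chi i j)
      = dt Q (\<lambda>i j. if j = b then 0 + (-1/2) * 1 else const_kernel chi i j)"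
      using nz by (intro dt_cong) (auto simp: const_kernel_def chi0_def)
    also have "\<dots> = dt Q (\<lambda>i j. if j = b then 0 else const_kernel chi i j) + (-1/2) * dt Q (\<lambda>i j. if j = b then 1 else const_kernel chi i j)"
      by (rule dt_column_linear[OF assms(1) b])
    also have "dt Q (\<lambda>i j. if j = b then 0 else const_kernel chi i j) = 0"
      using dt_column_linear[OF assms(1) b, of "\<lambda>_. 0" "-1" "\<lambda>_. 0" "const_kernel chi"] by (simp only: mult_zero_right add_0_right) simp
    finally show ?thesis unfolding e by simp
  qed
  have "dt (insert 0 Q) (const_kernel chi) = - (\<Sum>b\<in>Q. const_kernel chi 0 b * dt Q (\<lambda>i j. if j = b then const_kernel chi i 0 else const_kernel chi i j))"
    by (simp add: dt_insert[OF assms] const_kernel_def)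
  also have "(\<Sum>b\<in>Q. const_kernel chi 0 b * dt Q (\<lambda>i j. if j = b then const_kernel chi i 0 else const_kernel chi i j))
     = (\<Sum>b\<in>Q. 1/2 * (- (1/2) * dt Q (\<lambda>i j. if j = b then 1 else of_nat 1 - of_nat (chi (Idx i) (Bar j)))))"
    using assms(2) by (intro sum.cong refl arg_cong2[where f = "(*)"] one) (auto simp: const_kernel_def chi0_def intro: gr0I)
  finally show ?thesis unfolding sum_distrib_left[symmetric] by (simp add: mult.commute[of 4])
qed

section \<open>Mode 0 and nonzero modes of the blocks; the integral over a torus\<close>

context torus_region
begin

lemma chi_seq_eq:
  assumes "S \<subseteq> {1..n}" "K \<in> permutations_of_set S"
  shows "chi_seq chi K = (\<Sum>j<length K. c (K ! j) (K ! (Suc j mod length K)))"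
  unfolding chi_seq_def
proof (rule sum.cong[OF refl])
  fix j assume "j \<in> {..<length K}"
  hence "K ! j \<in> {1..n}" "K ! (Suc j mod length K) \<in> {1..n}" using permutations_of_set_nth[OF assms(2), of j] assms(1) by blast+
  thus "chi0 chi (K ! j) (K ! (Suc j mod length K)) = c (K ! j) (K ! (Suc j mod length K))"
    by (simp add: chi0_def c_def)
qed

text \<open>The inequalities of the annuli, multiplied along the cycle, place the product of the u_i
  in the annulus of g_{b,a}, where a counts the steps with \<chi> = 1. The product of the Kronecker
  coefficients of mode l at t = 0 is the l-th coefficient of g_{b,a}, because q^l enters the
  numerator once for each step with \<chi> = 0.\<close>

lemma g_block:
  assumes S: "S \<subseteq> {1..n}" "S \<noteq> {}" and K: "K \<in> permutations_of_set S"
  shows "(\<Prod>i\<in>S. exp (z i)) \<in> g_annulus (card S) (chi_seq chi K)" (is "?u \<in> _")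
    and "g \<tau> (card S) (chi_seq chi K) (\<Prod>i\<in>S. exp (z i)) = g_coeff \<tau> (card S) (chi_seq chi K) 0 + N 0 K"
proof -
  define b where "b = card S"
  define cj where "cj = (\<lambda>j. c (K ! j) (K ! (Suc j mod length K)))"
  define Xj where "Xj = (\<lambda>j. X (K ! j) (K ! (Suc j mod length K)))"
  have len: "length K = b" unfolding b_def using K by (rule length_finite_permutations_of_set)
  have d: "distinct K" "set K = S" using K by (auto dest: permutations_of_setD)
  have finS: "finite S" using S(1) finite_subset by auto
  have b1: "1 \<le> b" using S(2) finS by (simp add: b_def Suc_le_eq card_gt_0_iff)
  have a_eq: "chi_seq chi K = sum cj {..<b}" unfolding chi_seq_eq[OF S(1) K] cj_def len ..
  have mem: "K ! j \<in> {1..n}" "K ! (Suc j mod b) \<in> {1..n}" if "j < b" for j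
    using permutations_of_set_nth[OF K, of j] that len S(1) by auto
  have ann: "in_annulus (cj j) (Xj j)" if "j < b" for j
    unfolding cj_def Xj_def len by (rule annulus_X[OF mem[OF that]])
  have cj01: "cj j = 0 \<or> cj j = 1" if "j < b" for j
    using c_01[OF mem[OF that]] by (auto simp: cj_def len)
  have a_le: "sum cj {..<b} \<le> b"
    using sum_mono[of "{..<b}" cj "\<lambda>_. 1"] cj01 by fastforce
  have prodX: "(\<Prod>j<b. Xj j) = ?u"
  proof -
    have "(\<Prod>j<b. Xj j) = (\<Prod>j<b. exp (z (K ! j))) * (\<Prod>j<b. of_real (s (K ! j))) / (\<Prod>j<b. of_real (s (K ! (Suc j mod b))))"
      by (simp add: Xj_def X_def len prod.distrib prod_dividef)
    also have "(\<Prod>j<b. of_real (s (K ! (Suc j mod b)))) = (\<Prod>i\<in>S. complex_of_real (s i))"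
      using prod_nth_cyclic[OF d(1), of "\<lambda>i. complex_of_real (s i)"] by (simp add: len d(2))
    also have "(\<Prod>j<b. of_real (s (K ! j))) = (\<Prod>i\<in>S. complex_of_real (s i))"
      using prod_nth_distinct[OF d(1), of "\<lambda>i. complex_of_real (s i)"] by (simp add: len d(2))
    also have "(\<Prod>j<b. exp (z (K ! j))) = (\<Prod>i\<in>S. exp (z i))"
      using prod_nth_distinct[OF d(1), of "\<lambda>i. exp (z i)"] by (simp add: len d(2))
    finally have "(\<Prod>j<b. Xj j) = (\<Prod>i\<in>S. exp (z i)) * (\<Prod>i\<in>S. complex_of_real (s i)) / (\<Prod>i\<in>S. complex_of_real (s i))" .
    moreover have "s i \<noteq> 0" if "i \<in> S" for i using s_pos[of i] S(1) that by fastforce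
    hence "(\<Prod>i\<in>S. complex_of_real (s i)) \<noteq> 0" using finS by (simp add: prod_zero_iff)
    ultimately show ?thesis by simp
  qed
  have bnd: "norm q ^ cj j < norm (Xj j) \<and> norm (Xj j) < norm q powi (int (cj j) - 1)" if "j < b" for j
    using ann[OF that] by (auto simp: in_annulus_def power_int_minus)
  have Q: "norm q > 0" by (rule norm_q_pos)
  have ne: "0 \<in> {..<b}" using b1 by simp
  have "(\<Prod>j<b. norm q ^ cj j) < (\<Prod>j<b. norm (Xj j))"
    using bnd Q ne by (intro prod_mono_strict[OF ne]) (auto intro: less_imp_le dest: ann in_annulus_nonzero)
  hence l1: "norm q ^ sum cj {..<b} < norm ?u" by (simp add: power_sum prodX[symmetric] prod_norm)
  have "(\<Prod>j<b. norm (Xj j)) < (\<Prod>j<b. norm q powi (int (cj j) - 1))"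
    using bnd Q ne by (intro prod_mono_strict[OF ne]) (auto intro: less_imp_le)
  moreover have "(\<Prod>j<m. norm q powi (int (cj j) - 1)) = norm q powi (int (sum cj {..<m}) - int m)" for m
    using Q by (induction m) (auto simp: power_int_add[symmetric] algebra_simps)
  ultimately have l2: "norm ?u < norm q powi (int (sum cj {..<b}) - int b)" by (simp add: prodX[symmetric] prod_norm)
  show mem_ann: "?u \<in> g_annulus (card S) (chi_seq chi K)"
    using l1 l2 by (simp add: g_annulus_def a_eq b_def)
  have ab: "chi_seq chi K \<le> b" using a_le a_eq by simp
  have "g \<tau> b (chi_seq chi K) ?u = g_series b (chi_seq chi K) ?u"
    using mem_ann b1 ab by (intro g_eq_g_series) (auto simp: b_def)
  also have "\<dots> = (\<Sum>\<^sub>\<infinity>k\<in>insert 0 (UNIV - {0}). g_coeff \<tau> b (chi_seq chi K) k * ?u powi k)"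
    unfolding g_series_def by (intro arg_cong2[where f = infsum] refl) auto
  also have "\<dots> = g_coeff \<tau> b (chi_seq chi K) 0 * ?u powi 0 + (\<Sum>\<^sub>\<infinity>k\<in>UNIV - {0}. g_coeff \<tau> b (chi_seq chi K) k * ?u powi k)"
    by (rule infsum_insert) (use summable_on_subset[OF g_series_local(2)[OF ab, of ?u]] mem_ann in \<open>auto simp: b_def\<close>)
  also have "(\<Sum>\<^sub>\<infinity>k\<in>UNIV - {0}. g_coeff \<tau> b (chi_seq chi K) k * ?u powi k) = N 0 K"
    unfolding N_def
  proof (rule infsum_cong)
    fix l :: int assume "l \<in> UNIV - {0}"
    hence l: "l \<noteq> 0" by simp
    have one: "1 - q powi l \<noteq> 0" using q_powi_eq_1_iff[of l] l by simp
    have "cyc (A 0 l) K = (\<Prod>j<b. (-1) * (q powi l) ^ (1 - cj j) / (1 - q powi l) * Xj j powi l)"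
      by (simp add: cyc_def A_def kronecker_coeff_def cj_def Xj_def len)
    also have "\<dots> = (-1) ^ b * (q powi l) ^ (\<Sum>j<b. 1 - cj j) / (1 - q powi l) ^ b * (\<Prod>j<b. Xj j powi l)"
      by (simp only: prod.distrib prod_dividef power_sum prod_constant card_lessThan)
    also have "(\<Sum>j<b. 1 - cj j) = b - sum cj {..<b}"
      using sum_subtractf_nat[of "{..<b}" cj "\<lambda>_. 1"] cj01 by fastforce
    also have "(q powi l) ^ (b - sum cj {..<b}) = q powi ((int b - int (sum cj {..<b})) * l)"
    proof -
      have "(q powi l) ^ m = q powi (int m * l)" for m
        by (simp add: power_int_mult mult.commute[of _ l])
      thus ?thesis using a_le by (simp add: of_nat_diff)
    qed
    also have "(\<Prod>j<b. Xj j powi l) = ?u powi l"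
    proof -
      have "(\<Prod>j<m. Xj j powi l) = (\<Prod>j<m. Xj j) powi l" for m
        by (induction m) (auto simp: power_int_mult_distrib)
      thus ?thesis by (simp add: prodX[symmetric])
    qed
    finally show "g_coeff \<tau> b (chi_seq chi K) l * ?u powi l = cyc (A 0 l) K"
      using l by (simp add: g_coeff_def a_eq)
  qed
  finally show "g \<tau> (card S) (chi_seq chi K) (\<Prod>i\<in>S. exp (z i)) = g_coeff \<tau> (card S) (chi_seq chi K) 0 + N 0 K"
    by (simp add: b_def)
qed

text \<open>Mode 0 of a block gives the cycles of \<open>const_kernel\<close>, the other modes give
  \<open>N_block 0\<close>; from a block containing 0 only the constant term is extracted.\<close>

lemma block_term_split:
  assumes S: "S \<subseteq> {0..n}" "S \<noteq> {}"
  shows "block_term chi \<tau> (\<lambda>i. exp (z i)) S = cycle_weight (const_kernel chi) S + (if 0 \<in> S then 0 else N_block 0 S)"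
proof (cases "S = {0}")
  case True
  thus ?thesis by (simp add: block_term_def cycle_weight_def cyc_def const_kernel_def)
next
  case False
  show ?thesis
  proof (cases "0 \<in> S")
    case True
    have "G_u0 chi \<tau> S = (\<Sum>K\<in>permutations_of_set S. cyc (const_kernel chi) K)"
      unfolding G_u0_def by (intro sum.cong refl g_coeff_0_eq_cyc[OF ordering S(1) False])
    thus ?thesis using True False by (simp add: block_term_def cycle_weight_def)
  next
    case F: False
    have S1: "S \<subseteq> {1..n}"
    proof
      fix x assume "x \<in> S"
      moreover from this have "x \<noteq> 0" using F by metis
      ultimately show "x \<in> {1..n}" using S(1) by auto
    qed
    have "G chi \<tau> S (\<lambda>i. exp (z i)) = (\<Sum>K\<in>permutations_of_set S. cyc (const_kernel chi) K + N 0 K)"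
      unfolding G_def
      by (intro sum.cong refl) (simp only: g_block(2)[OF S1 S(2)] g_coeff_0_eq_cyc[OF ordering S(1) False])
    thus ?thesis using F False by (simp add: block_term_def cycle_weight_def N_block_def sum.distrib distrib_left)
  qed
qed

text \<open>Every block is split into mode 0 and the rest. Q collects the indices whose blocks carry
  mode 0; together with the index 0 these blocks assemble into a bordered determinant.\<close>

lemma partition_sum_block_term:
  "4 * partition_sum (block_term chi \<tau> (\<lambda>i. exp (z i))) {0..n}
   = (\<Sum>Q\<in>Pow {1..n}. (\<Sum>b\<in>Q. dt Q (\<lambda>i j. if j = b then 1 else of_nat 1 - of_nat (c i j))) * partition_sum (N_block 0) ({1..n} - Q))"
proof -
  define fN where "fN = (\<lambda>S. if 0 \<in> S then 0 else N_block 0 S)"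
  have ins: "{0..n} = insert 0 {1..n}" by auto
  have "partition_sum (block_term chi \<tau> (\<lambda>i. exp (z i))) {0..n} = partition_sum (\<lambda>S. cycle_weight (const_kernel chi) S + fN S) {0..n}"
    unfolding fN_def by (rule partition_sum_cong) (rule block_term_split)
  also have "\<dots> = (\<Sum>B\<in>Pow (insert 0 {1..n}). partition_sum (cycle_weight (const_kernel chi)) B * partition_sum fN ({0..n} - B))"
    unfolding ins by (rule partition_sum_add) simp
  also have "\<dots> = (\<Sum>B\<in>Pow {1..n}. partition_sum (cycle_weight (const_kernel chi)) (insert 0 B) * partition_sum fN ({0..n} - insert 0 B))"
  proof -
    have "(\<Sum>B\<in>Pow {1..n}. partition_sum (cycle_weight (const_kernel chi)) B * partition_sum fN ({0..n} - B)) = 0"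
    proof (rule sum.neutral, rule ballI)
      fix B assume "B \<in> Pow {1..n}"
      hence "partition_sum fN ({0..n} - B) = 0"
        by (intro partition_sum_eq_0[where r = 0]) (auto simp: fN_def)
      thus "partition_sum (cycle_weight (const_kernel chi)) B * partition_sum fN ({0..n} - B) = 0" by simp
    qed
    thus ?thesis by (subst sum_Pow_insert) auto
  qed
  also have "4 * \<dots> = (\<Sum>Q\<in>Pow {1..n}. (\<Sum>b\<in>Q. dt Q (\<lambda>i j. if j = b then 1 else of_nat 1 - of_nat (c i j))) * partition_sum (N_block 0) ({1..n} - Q))"
    unfolding sum_distrib_left
  proof (rule sum.cong[OF refl])
    fix Q assume Q: "Q \<in> Pow {1..n}"
    hence fQ: "finite Q" "0 \<notin> Q" using finite_subset[of Q "{1..n}"] by auto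
    have "{0..n} - insert 0 Q = {1..n} - Q" by auto
    moreover have "partition_sum fN ({1..n} - Q) = partition_sum (N_block 0) ({1..n} - Q)"
      by (rule partition_sum_cong) (auto simp: fN_def)
    moreover have "partition_sum (cycle_weight (const_kernel chi)) (insert 0 Q) = dt (insert 0 Q) (const_kernel chi)"
      using fQ by (simp add: dt_eq_partition_sum)
    ultimately show "4 * (partition_sum (cycle_weight (const_kernel chi)) (insert 0 Q) * partition_sum fN ({0..n} - insert 0 Q))
      = (\<Sum>b\<in>Q. dt Q (\<lambda>i j. if j = b then 1 else of_nat 1 - of_nat (c i j))) * partition_sum (N_block 0) ({1..n} - Q)"
      using dt_const_kernel[OF fQ, of chi] unfolding c_def by (simp only: mult.assoc[symmetric])
  qed
  finally show ?thesis .
qed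

lemma theta_pole_limit: "((\<lambda>t. \<theta> t * (1 / (exp t - 1))) \<longlongrightarrow> 1) (at 0)"
proof -
  have "(\<theta> has_field_derivative 1) (at 0)"
    using theta_DERIV[of 0] deriv_theta_0 by simp
  hence a: "((\<lambda>t. \<theta> t / t) \<longlongrightarrow> 1) (at 0)" by (simp add: has_field_derivative_iff theta_0)
  have "(exp has_field_derivative exp 0) (at (0::complex))" by (rule DERIV_exp)
  hence b: "((\<lambda>t::complex. (exp t - 1) / t) \<longlongrightarrow> 1) (at 0)" by (simp add: has_field_derivative_iff)
  have "((\<lambda>t. (\<theta> t / t) / ((exp t - 1) / t)) \<longlongrightarrow> 1 / 1) (at 0)" by (intro tendsto_divide a b) simp
  moreover have "\<forall>\<^sub>F t in at 0. (\<theta> t / t) / ((exp t - 1) / t) = \<theta> t * (1 / (exp t - 1))"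
    unfolding eventually_at by (rule exI[of _ 1]) simp
  ultimately have "((\<lambda>t. \<theta> t * (1 / (exp t - 1))) \<longlongrightarrow> 1 / 1) (at 0)" by (rule Lim_transform_eventually)
  thus ?thesis by simp
qed

text \<open>The integral T' without the factor theta(Z) is independent of t, while
  \<open>R t\<close> = theta(t + Z) T' is computed from the determinant. As t -> 0 the factor
  theta(t) suppresses everything except the simple pole of mode 0, and the surviving residue is what
  the bordered determinants of the index 0 give.\<close>

theorem T_integral_eq:
  "T_integral n s \<tau> z = 4 * (\<Sum>P\<in>partitions_star n. partition_term n chi \<tau> (\<lambda>i. exp (z i)) P)"
proof -
  obtain \<delta> where d: "0 < \<delta>" "\<And>t l. norm t < \<delta> ==> l \<noteq> 0 ==> q powi l * exp t \<noteq> 1"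
    "\<And>i j t. i \<in> {1..n} ==> j \<in> {1..n} ==> norm t < \<delta> ==> (\<lambda>l. norm (A t l i j)) summable_on UNIV"
    "\<And>S K t. S \<subseteq> {1..n} ==> S \<noteq> {} ==> K \<in> permutations_of_set S ==> norm t < \<delta> ==>
       (\<lambda>l. norm (cyc (A t l) K)) summable_on UNIV"
    "\<And>S t. S \<subseteq> {1..n} ==> S \<noteq> {} ==> norm t < \<delta> ==> block_sum t S = cycle_weight (A t 0) S + N_block t S"
    "\<And>S. S \<subseteq> {1..n} ==> S \<noteq> {} ==> ((\<lambda>t. N_block t S) \<longlongrightarrow> N_block 0 S) (at 0)"
  proof (rule region_facts, goal_cases)
    case 1
    show ?case by (rule that; fact 1)
  qed
  define Z where "Z = (\<Sum>j\<in>{1..n}. z j)"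
  define T' where "T' = torus_integral n s (\<lambda>v. 1 * cauchy_product n (\<lambda>i. z i + Ln (v i)) (\<lambda>i. Ln (v i))) (\<lambda>_. 0)"
  define B where "B = (\<lambda>i j. of_nat 1 - of_nat (c i j) :: complex)"
  define \<beta> where "\<beta> = (\<lambda>Q. \<Sum>b\<in>Q. dt Q (\<lambda>i j. if j = b then 1 else B i j))"
  define R where "R = (\<lambda>t. \<Sum>Q\<in>Pow {1..n}. (\<theta> t * dt Q B + \<theta> t * (1 / (exp t - 1)) * \<beta> Q) * partition_sum (N_block t) ({1..n} - Q))"
  have TI: "T_integral n s \<tau> z = torus_integral n s (\<lambda>v. \<theta> Z * cauchy_product n (\<lambda>i. z i + Ln (v i)) (\<lambda>i. Ln (v i))) (\<lambda>_. 0)"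
    by (simp add: T_integral_def varpi_eq Z_def)
  have "\<forall>\<^sub>F t in at 0. norm t < \<delta> \<and> t \<noteq> (0::complex)"
    unfolding eventually_at using d(1) by (intro exI[of _ \<delta>]) auto
  moreover have "\<forall>\<^sub>F t in at 0. \<theta> t \<noteq> 0" using theta_eventually_nonzero[of 0] by simp
  moreover have "\<forall>\<^sub>F t in at 0. \<forall>k\<in>{1..Suc n}. \<theta> (t + (\<Sum>j\<in>{k..n}. z j)) \<noteq> 0"
    by (intro eventually_ball_finite ballI theta_eventually_nonzero) auto
  ultimately have good: "\<forall>\<^sub>F t in at 0. (norm t < \<delta> \<and> t \<noteq> (0::complex)) \<and> \<theta> t \<noteq> 0 \<and> (\<forall>k\<in>{1..Suc n}. \<theta> (t + (\<Sum>j\<in>{k..n}. z j)) \<noteq> 0)"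
    by eventually_elim blast
  have ti: "torus_integral n s (\<lambda>v. e * cauchy_product n (\<lambda>i. z i + Ln (v i)) (\<lambda>i. Ln (v i))) (\<lambda>_. 0)
     = e * (\<theta> t / \<theta> (t + Z)) * partition_sum (block_sum t) {1..n}"
    if "norm t < \<delta>" "\<theta> t \<noteq> 0" "\<forall>k\<in>{1..Suc n}. \<theta> (t + (\<Sum>j\<in>{k..n}. z j)) \<noteq> 0" for t e
    unfolding Z_def by (rule torus_integral_cauchy_product) (use that d(3,4) in blast)+
  obtain t where t: "(norm t < \<delta> \<and> t \<noteq> (0::complex)) \<and> \<theta> t \<noteq> 0 \<and> (\<forall>k\<in>{1..Suc n}. \<theta> (t + (\<Sum>j\<in>{k..n}. z j)) \<noteq> 0)"
    using eventually_happens[OF good] by auto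
  \<comment> \<open>Linearity of the integral in the scalar, obtained by evaluating both scalars at
    the same admissible t; theta(Z) may be 0 here.\<close>
  have TT': "T_integral n s \<tau> z = \<theta> Z * T'"
  proof -
    note e = ti[of t "\<theta> Z"] ti[of t 1]
    show ?thesis unfolding TI T'_def using e t by auto
  qed
  have RT: "R t = \<theta> (t + Z) * T'"
    if t: "(norm t < \<delta> \<and> t \<noteq> (0::complex)) \<and> \<theta> t \<noteq> 0 \<and> (\<forall>k\<in>{1..Suc n}. \<theta> (t + (\<Sum>j\<in>{k..n}. z j)) \<noteq> 0)" for t
  proof -
    have tZ: "\<theta> (t + Z) \<noteq> 0" using t unfolding Z_def by (auto dest!: bspec[of _ _ 1])
    have e1: "exp t \<noteq> 1"
    proof
      assume "exp t = 1"
      hence "t \<in> lattice \<tau>" using mem_lattice_iff[of t] by (auto intro: exI[of _ 0])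
      thus False using t theta_eq_0_iff by blast
    qed
    \<comment> \<open>Mode 0 is 1 - \<chi> plus 1/(exp t - 1): the singular part is the same in all
      entries, hence of rank one.\<close>
    have A0: "A t 0 i j = B i j + 1 * (1 / (exp t - 1))" if "i \<in> {1..n}" "j \<in> {1..n}" for i j
    proof -
      have "kronecker_coeff (c i j) 0 t = - (1 / (1 - exp t) - of_nat (1 - c i j))"
        using kronecker_coeff_eq[of "c i j" 0 t] c_01[OF that] e1 by simp
      thus ?thesis using c_01[OF that] e1 by (auto simp: A_def B_def field_simps)
    qed
    have "\<theta> (t + Z) * T' = \<theta> t * partition_sum (block_sum t) {1..n}"
      unfolding T'_def using ti[of t 1] t tZ by auto
    also have "partition_sum (block_sum t) {1..n} = partition_sum (\<lambda>S. cycle_weight (A t 0) S + N_block t S) {1..n}"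
      by (rule partition_sum_cong) (use d(5) t in blast)
    also have "\<dots> = (\<Sum>Q\<in>Pow {1..n}. partition_sum (cycle_weight (A t 0)) Q * partition_sum (N_block t) ({1..n} - Q))"
      by (rule partition_sum_add) simp
    also have "\<theta> t * \<dots> = R t"
      unfolding R_def sum_distrib_left
    proof (rule sum.cong[OF refl])
      fix Q assume Q: "Q \<in> Pow {1..n}"
      hence fQ: "finite Q" using finite_subset[of Q "{1..n}"] by auto
      have "partition_sum (cycle_weight (A t 0)) Q = dt Q (A t 0)" using fQ by (simp add: dt_eq_partition_sum)
      also have "\<dots> = dt Q (\<lambda>i j. B i j + 1 * (1 / (exp t - 1)))" by (rule dt_cong) (use A0 Q in blast)
      also have "\<dots> = dt Q B + (\<Sum>b\<in>Q. 1 / (exp t - 1) * dt Q (\<lambda>i j. if j = b then 1 else B i j))"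
        by (rule dt_rank_one_update[OF fQ])
      also have "\<dots> = dt Q B + 1 / (exp t - 1) * \<beta> Q" unfolding \<beta>_def sum_distrib_left ..
      finally show "\<theta> t * (partition_sum (cycle_weight (A t 0)) Q * partition_sum (N_block t) ({1..n} - Q))
        = (\<theta> t * dt Q B + \<theta> t * (1 / (exp t - 1)) * \<beta> Q) * partition_sum (N_block t) ({1..n} - Q)"
        by (simp add: algebra_simps)
    qed
    finally show ?thesis by simp
  qed
  have cont: "((\<lambda>t. \<theta> (t + a)) \<longlongrightarrow> \<theta> a) (at 0)" for a
  proof -
    have "isCont (\<lambda>t. \<theta> (t + a)) 0"
      using holomorphic_on_imp_continuous_on[OF holomorphic_on_shift[OF theta_holomorphic, of a]]
      by (simp add: continuous_on_eq_continuous_at)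
    thus ?thesis by (simp add: isCont_def)
  qed
  have c0: "(\<theta> \<longlongrightarrow> 0) (at 0)" using cont[of 0] by (simp add: theta_0)
  have psl: "((\<lambda>t. partition_sum (N_block t) Q) \<longlongrightarrow> partition_sum (N_block 0) Q) (at 0)" if "Q \<subseteq> {1..n}" for Q
    unfolding partition_sum_def
  proof (intro tendsto_sum tendsto_prod d(6))
    fix P S assume "P \<in> {P. partition_on Q P}" "S \<in> P"
    thus "S \<subseteq> {1..n}" "S \<noteq> {}" using that by (auto simp: partition_on_def)
  qed
  have "(R \<longlongrightarrow> (\<Sum>Q\<in>Pow {1..n}. (0 * dt Q B + 1 * \<beta> Q) * partition_sum (N_block 0) ({1..n} - Q))) (at 0)"
    unfolding R_def by (intro tendsto_sum tendsto_mult tendsto_add tendsto_const c0 theta_pole_limit psl) auto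
  moreover have "((\<lambda>t. \<theta> (t + Z) * T') \<longlongrightarrow> \<theta> Z * T') (at 0)" by (intro tendsto_mult tendsto_const cont)
  hence "(R \<longlongrightarrow> \<theta> Z * T') (at 0)"
    by (rule Lim_transform_eventually) (use good RT in \<open>auto elim!: eventually_mono\<close>)
  ultimately have "\<theta> Z * T' = (\<Sum>Q\<in>Pow {1..n}. (0 * dt Q B + 1 * \<beta> Q) * partition_sum (N_block 0) ({1..n} - Q))"
    using tendsto_unique[OF trivial_limit_at] by blast
  thus ?thesis unfolding TT' sum_partition_term partition_sum_block_term \<beta>_def B_def by simp
qed

end

section \<open>Meromorphic functions of several variables\<close>

lemma polydisc_self: "p \<in> Cn n ==> r > 0 ==> p \<in> polydisc n p r"
  by (simp add: polydisc_def)

lemma polydisc_subset: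
  assumes "z \<in> polydisc n p r"
  obtains e where "e > 0" "polydisc n z e \<subseteq> polydisc n p r"
proof -
  define e where "e = Min (insert 1 ((\<lambda>i. r - norm (z i - p i)) ` {1..n}))"
  have "e > 0" using assms by (auto simp: e_def polydisc_def)
  moreover have "polydisc n z e \<subseteq> polydisc n p r"
  proof
    fix y assume y: "y \<in> polydisc n z e"
    have "norm (y i - p i) < r" if i: "i \<in> {1..n}" for i
    proof -
      have "norm (y i - z i) < e" using y i by (simp add: polydisc_def)
      also have "e \<le> r - norm (z i - p i)" unfolding e_def using i by (intro Min_le) auto
      finally have "norm (y i - z i) + norm (z i - p i) < r" by simp
      thus ?thesis using norm_triangle_ineq[of "y i - z i" "z i - p i"] by simp
    qed
    thus "y \<in> polydisc n p r" using y by (auto simp: polydisc_def)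
  qed
  ultimately show ?thesis by (rule that)
qed

text \<open>A basic neighbourhood constrains each coordinate by an open set; on \<open>Cn n\<close>
  only the first n coordinates can vary, so one positive radius suffices.\<close>

lemma polydisc_nhd:
  assumes W: "open W" "z \<in> W"
  obtains e where "e > 0" "z \<in> Cn n ==> polydisc n z e \<subseteq> W"
proof -
  have "openin (product_topology (\<lambda>i. euclidean) UNIV) W" using W by (simp add: open_fun_def)
  then obtain Y where Y: "z \<in> PiE UNIV Y" "\<And>i. open (Y i)" "PiE UNIV Y \<subseteq> W"
    using product_topology_open_contains_basis[of "\<lambda>i. euclidean" UNIV W z] W(2) by auto
  have "\<exists>e>0. ball (z i) e \<subseteq> Y i" for i
  proof -
    have "z i \<in> Y i" using Y(1) by (simp add: PiE_iff)
    thus ?thesis using Y(2)[of i] open_contains_ball by blast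
  qed
  then obtain e where e: "\<And>i. e i > 0" "\<And>i. ball (z i) (e i) \<subseteq> Y i" by metis
  define d where "d = Min (insert 1 (e ` {1..n}))"
  have d: "d > 0" "\<And>i. i \<in> {1..n} ==> d \<le> e i"
    using e(1) by (simp add: d_def, unfold d_def) (intro Min_le, auto)
  show ?thesis
  proof (rule that[OF d(1)])
    assume z: "z \<in> Cn n"
    show "polydisc n z d \<subseteq> W"
    proof
      fix y assume y: "y \<in> polydisc n z d"
      have "y i \<in> Y i" for i
      proof (cases "i \<in> {1..n}")
        case True
        hence "norm (y i - z i) < d" using y unfolding polydisc_def by blast
        hence "norm (y i - z i) < e i" using d(2)[OF True] by simp
        thus ?thesis using e(2)[of i] by (auto simp: dist_norm norm_minus_commute)
      next
        case False
        hence "y i = z i" using y z by (simp add: polydisc_def Cn_def)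
        thus ?thesis using Y(1) by (simp add: PiE_iff)
      qed
      thus "y \<in> W" using Y(3) by (auto simp: PiE_iff)
    qed
  qed
qed

lemma open_polydisc: "\<exists>W. open W \<and> polydisc n p r = W \<inter> Cn n"
proof -
  have "open (\<Inter>i\<in>{1..n}. {z. norm (z i - p i) < r})"
    by (intro open_INT ballI open_Collect_less continuous_intros continuous_on_product_coordinates) auto
  moreover have "polydisc n p r = (\<Inter>i\<in>{1..n}. {z. norm (z i - p i) < r}) \<inter> Cn n" by (auto simp: polydisc_def)
  ultimately show ?thesis by blast
qed

lemma closure_Cn_iff:
  assumes "X \<subseteq> Cn n" "z \<in> Cn n"
  shows "z \<in> closure X \<longleftrightarrow> (\<forall>e>0. \<exists>y\<in>X. y \<in> polydisc n z e)"
proof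
  assume z: "z \<in> closure X"
  show "\<forall>e>0. \<exists>y\<in>X. y \<in> polydisc n z e"
  proof (intro allI impI)
    fix e :: real assume e: "e > 0"
    obtain W where W: "open W" "polydisc n z e = W \<inter> Cn n" using open_polydisc by blast
    have "z \<in> W" using polydisc_self[OF assms(2) e] W(2) by blast
    hence "X \<inter> W \<noteq> {}" using z W(1) unfolding closure_iff_nhds_not_empty by blast
    thus "\<exists>y\<in>X. y \<in> polydisc n z e" using assms(1) W(2) by blast
  qed
next
  assume d: "\<forall>e>0. \<exists>y\<in>X. y \<in> polydisc n z e"
  show "z \<in> closure X"
    unfolding closure_iff_nhds_not_empty
  proof (intro allI impI)
    fix A W assume W: "W \<subseteq> A" "open W" "z \<in> W"
    obtain e where "e > 0" "polydisc n z e \<subseteq> W" using polydisc_nhd[OF W(2,3), of n] assms(2) by blast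
    thus "X \<inter> A \<noteq> {}" using d W(1) by blast
  qed
qed

lemma continuous_on_polydisc_nonzero:
  assumes f: "continuous_on (polydisc n p r) (f :: _ => complex)" and z: "z \<in> polydisc n p r" "f z \<noteq> 0"
  obtains e where "e > 0" "polydisc n z e \<subseteq> polydisc n p r" "\<And>y. y \<in> polydisc n z e ==> f y \<noteq> 0"
proof -
  obtain V where V: "open V" "polydisc n p r = V \<inter> Cn n" using open_polydisc by blast
  obtain W where W: "open W" "W \<inter> polydisc n p r = f -` (- {0}) \<inter> polydisc n p r"
    using continuous_on_open_invariant[THEN iffD1, OF f, rule_format, of "- {0}"] by auto
  have zC: "z \<in> Cn n" using z(1) by (simp add: polydisc_def)
  have "z \<in> W \<inter> V" using z W(2) V(2) by blast
  then obtain e where e: "e > 0" "polydisc n z e \<subseteq> W \<inter> V"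
    using polydisc_nhd[of "W \<inter> V" z n] W(1) V(1) zC by blast
  show ?thesis
  proof (rule that[OF e(1)])
    show s: "polydisc n z e \<subseteq> polydisc n p r" using e(2) V(2) by (auto simp: polydisc_def)
    show "f y \<noteq> 0" if "y \<in> polydisc n z e" for y using that s e(2) W(2) by blast
  qed
qed

lemma holomorphic_Cn_subset: "holomorphic_Cn n f U ==> V \<subseteq> U ==> holomorphic_Cn n f V"
  unfolding holomorphic_Cn_def by (meson continuous_on_subset subsetD)

lemma holomorphic_Cn_mult: "holomorphic_Cn n f U ==> holomorphic_Cn n h U ==> holomorphic_Cn n (\<lambda>z. f z * h z) U"
  unfolding holomorphic_Cn_def by (auto intro!: continuous_on_mult field_differentiable_mult)

lemma holomorphic_Cn_add: "holomorphic_Cn n f U ==> holomorphic_Cn n h U ==> holomorphic_Cn n (\<lambda>z. f z + h z) U"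
  unfolding holomorphic_Cn_def by (auto intro!: continuous_on_add field_differentiable_add)

lemma holomorphic_Cn_diff: "holomorphic_Cn n f U ==> holomorphic_Cn n h U ==> holomorphic_Cn n (\<lambda>z. f z - h z) U"
  unfolding holomorphic_Cn_def by (auto intro!: continuous_on_diff field_differentiable_diff)

lemma holomorphic_Cn_const: "holomorphic_Cn n (\<lambda>z. a) U"
  unfolding holomorphic_Cn_def by (auto intro!: field_differentiable_const)

lemma holomorphic_Cn_divide:
  assumes "holomorphic_Cn n f U" "holomorphic_Cn n h U" "\<And>z. z \<in> U ==> h z \<noteq> 0"
  shows "holomorphic_Cn n (\<lambda>z. f z / h z) U"
  using assms unfolding holomorphic_Cn_def by (auto intro!: continuous_on_divide field_differentiable_divide)

lemma holomorphic_Cn_prod: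
  "(\<And>i. i \<in> I ==> holomorphic_Cn n (f i) U) ==> holomorphic_Cn n (\<lambda>z. \<Prod>i\<in>I. f i z) U"
  by (induction I rule: infinite_finite_induct) (auto intro!: holomorphic_Cn_const holomorphic_Cn_mult)

lemma holomorphic_Cn_sum:
  "(\<And>i. i \<in> I ==> holomorphic_Cn n (f i) U) ==> holomorphic_Cn n (\<lambda>z. \<Sum>i\<in>I. f i z) U"
  by (induction I rule: infinite_finite_induct) (auto intro!: holomorphic_Cn_const holomorphic_Cn_add)

lemma holomorphic_Cn_compose_sum:
  assumes "f holomorphic_on UNIV"
  shows "holomorphic_Cn n (\<lambda>z. f (\<Sum>i\<in>I. z i)) U"
  unfolding holomorphic_Cn_def
proof (intro conjI ballI)
  have "continuous_on (range (\<lambda>z. \<Sum>i\<in>I. z i)) f"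
    using holomorphic_on_imp_continuous_on[OF assms] continuous_on_subset by blast
  moreover have "continuous_on UNIV (\<lambda>z. \<Sum>i\<in>I. z i :: complex)"
    by (intro continuous_on_sum continuous_on_product_coordinates)
  ultimately have "continuous_on UNIV (\<lambda>z. f (\<Sum>i\<in>I. z i))" by (rule continuous_on_compose2[OF _ _ subset_refl])
  thus "continuous_on U (\<lambda>z. f (\<Sum>i\<in>I. z i))" by (rule continuous_on_subset) simp
next
  fix z :: "nat => complex" and i assume "z \<in> U" "i \<in> {1..n}"
  have "(\<lambda>x. \<Sum>j\<in>I. (z(i := x)) j) field_differentiable at (z i)"
  proof (rule field_differentiable_sum)
    fix j show "(\<lambda>x. (z(i := x)) j) field_differentiable at (z i)"
      by (cases "j = i") (auto intro: field_differentiable_const field_differentiable_ident)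
  qed
  moreover have "f field_differentiable at w" for w
    using assms by (simp add: holomorphic_on_def)
  ultimately show "(\<lambda>x. f (\<Sum>j\<in>I. (z(i := x)) j)) field_differentiable at (z i)"
    using field_differentiable_compose[of "\<lambda>x. \<Sum>j\<in>I. (z(i := x)) j" "z i" f] by (simp add: o_def)
qed

text \<open>Coordinates are released one at a time: if the first k are unrestricted and the others
  are near q, the one-variable identity theorem in coordinate k + 1 frees that one too.\<close>

lemma holomorphic_Cn_identity:
  assumes f: "holomorphic_Cn n f (polydisc n p r)"
    and q: "q \<in> polydisc n p r" "e > 0" "\<And>z. z \<in> polydisc n q e ==> z \<in> polydisc n p r ==> f z = 0"
    and z: "z \<in> polydisc n p r"
  shows "f z = 0"
proof -
  have "\<forall>z\<in>polydisc n p r. (\<forall>i\<in>{k+1..n}. norm (z i - q i) < e) --> f z = 0" if "k \<le> n" for k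
    using that
  proof (induction k)
    case 0
    show ?case using q(3) by (auto simp: polydisc_def)
  next
    case (Suc k)
    show ?case
    proof (intro ballI impI)
      fix z assume z: "z \<in> polydisc n p r" and zi: "\<forall>i\<in>{Suc k + 1..n}. norm (z i - q i) < e"
      define m where "m = Suc k"
      have m: "m \<in> {1..n}" using Suc.prems by (simp add: m_def)
      define D where "D = ball (p m) r"
      define D' where "D' = D \<inter> ball (q m) e"
      have up: "z(m := x) \<in> polydisc n p r" if "x \<in> D" for x
        using z that m by (auto simp: polydisc_def Cn_def D_def dist_norm norm_minus_commute)
      have hol: "(\<lambda>x. f (z(m := x))) holomorphic_on D"
        unfolding holomorphic_on_def
      proof
        fix x assume x: "x \<in> D"
        have "(\<lambda>y. f ((z(m := x))(m := y))) field_differentiable at ((z(m := x)) m)"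
          using f up[OF x] m unfolding holomorphic_Cn_def by blast
        hence "(\<lambda>y. f (z(m := y))) field_differentiable at x" by simp
        thus "(\<lambda>y. f (z(m := y))) field_differentiable at x within D" by (rule field_differentiable_at_within)
      qed
      have 0: "f (z(m := x)) = 0" if x: "x \<in> D'" for x
      proof -
        have "norm ((z(m := x)) i - q i) < e" if "i \<in> {k + 1..n}" for i
          using x zi that by (cases "i = m") (auto simp: D'_def m_def dist_norm norm_minus_commute)
        moreover have "z(m := x) \<in> polydisc n p r" by (rule up) (use x in \<open>simp add: D'_def\<close>)
        ultimately show ?thesis using Suc by auto
      qed
      have "q m \<in> D'" using q m by (simp add: D'_def D_def polydisc_def dist_norm norm_minus_commute)
      hence ne: "D' \<noteq> {}" by blast
      have zm: "z m \<in> D" using z m by (simp add: D_def polydisc_def dist_norm norm_minus_commute)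
      have "f (z(m := z m)) = 0"
        by (rule analytic_continuation_open[where g = "\<lambda>_. 0" and s = D' and s' = D, OF _ _ ne _ _ hol])
           (use zm 0 in \<open>auto simp: D_def D'_def\<close>)
      thus "f z = 0" by simp
    qed
  qed
  from this[of n] z show ?thesis by simp
qed

lemma holomorphic_Cn_nonzero_dense:
  assumes f: "holomorphic_Cn n f (polydisc n p r)" and z: "z \<in> polydisc n p r" "f z \<noteq> 0"
    and q: "q \<in> polydisc n p r" "e > 0"
  obtains y d where "y \<in> polydisc n q e" "y \<in> polydisc n p r" "d > 0"
    "polydisc n y d \<subseteq> polydisc n q e" "polydisc n y d \<subseteq> polydisc n p r" "\<And>x. x \<in> polydisc n y d ==> f x \<noteq> 0"
proof -
  obtain y where y: "y \<in> polydisc n q e" "y \<in> polydisc n p r" "f y \<noteq> 0"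
    using holomorphic_Cn_identity[OF f q _ z(1)] z(2) by blast
  have "continuous_on (polydisc n p r) f" using f by (simp add: holomorphic_Cn_def)
  then obtain d where d: "d > 0" "polydisc n y d \<subseteq> polydisc n p r" "\<And>x. x \<in> polydisc n y d ==> f x \<noteq> 0"
    using continuous_on_polydisc_nonzero[of n p r f, OF _ y(2,3)] by metis
  obtain d' where d': "d' > 0" "polydisc n y d' \<subseteq> polydisc n q e" using polydisc_subset[OF y(1)] by metis
  have s: "polydisc n y (min d d') \<subseteq> polydisc n y d" "polydisc n y (min d d') \<subseteq> polydisc n y d'" by (auto simp: polydisc_def)
  show ?thesis
    by (rule that[of y "min d d'"]) (use y d d' s in auto)
qed

lemma polydisc_UN: "z \<in> Cn n ==> p \<in> Cn n ==> \<exists>r>0. z \<in> polydisc n p r"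
proof -
  assume z: "z \<in> Cn n"
  define r where "r = Max (insert 0 ((\<lambda>i. norm (z i - p i)) ` {1..n})) + 1"
  have "norm (z i - p i) < r" if "i \<in> {1..n}" for i
  proof -
    have "norm (z i - p i) \<le> Max (insert 0 ((\<lambda>i. norm (z i - p i)) ` {1..n}))" using that by (intro Max_ge) auto
    thus ?thesis by (simp add: r_def)
  qed
  moreover have "0 \<le> Max (insert 0 ((\<lambda>i. norm (z i - p i)) ` {1..n}))" by (intro Max_ge) auto
  hence "r > 0" unfolding r_def by linarith
  ultimately show ?thesis using z by (auto simp: polydisc_def)
qed

lemma entire_nonzero_dense:
  assumes B: "holomorphic_Cn n B UNIV" "z1 \<in> Cn n" "B z1 \<noteq> 0" and p: "p \<in> Cn n" "e > 0"
  obtains y d where "y \<in> polydisc n p e" "d > 0" "polydisc n y d \<subseteq> polydisc n p e" "\<And>x. x \<in> polydisc n y d ==> B x \<noteq> 0"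
proof -
  obtain r where r: "r > 0" "z1 \<in> polydisc n p r" using polydisc_UN[OF B(2) p(1)] by blast
  have "holomorphic_Cn n B (polydisc n p r)" by (rule holomorphic_Cn_subset[OF B(1)]) simp
  from this r(2) B(3) polydisc_self[OF p(1) r(1)] p(2) show ?thesis
  proof (rule holomorphic_Cn_nonzero_dense, goal_cases)
    case (1 y d)
    show ?case by (rule that[of y d]; fact 1)
  qed
qed

text \<open>Identities between meromorphic functions propagate along segments: on a polydisc where
  \<open>F = A'/B'\<close>, the function \<open>A' B - A B'\<close> vanishes identically as soon as it does on a small part.\<close>

lemma meromorphic_Cn_eq_fraction:
  assumes mero: "meromorphic_Cn n F" and A: "holomorphic_Cn n A UNIV" and B: "holomorphic_Cn n B UNIV"
    and p0: "p0 \<in> Cn n" "r0 > 0" "\<And>z. z \<in> polydisc n p0 r0 ==> F z * B z = A z"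
    and p: "p \<in> Cn n" "B p \<noteq> 0"
  shows "F p = A p / B p"
proof -
  \<comment> \<open>Weaker than an identity near c: F is known as A'/B' only off the zeros of B', so
    the identity is asked on small polydiscs arbitrarily close to c, not on one around c.\<close>
  define good where "good = (\<lambda>c. \<forall>e>0. \<exists>y d. d > 0 \<and> y \<in> polydisc n c e \<and> polydisc n y d \<subseteq> polydisc n c e \<and> (\<forall>z\<in>polydisc n y d. F z * B z = A z))"
  have loc: "\<exists>r>0. \<exists>A' B'. holomorphic_Cn n B' (polydisc n c r) \<and> (\<exists>z\<in>polydisc n c r. B' z \<noteq> 0) \<and>
      (\<forall>z\<in>polydisc n c r. B' z \<noteq> 0 --> F z = A' z / B' z) \<and>
      (\<forall>y d. d > 0 --> y \<in> polydisc n c r --> polydisc n y d \<subseteq> polydisc n c r --> (\<forall>z\<in>polydisc n y d. F z * B z = A z) -->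
         (\<forall>z\<in>polydisc n c r. A' z * B z = A z * B' z))" if c: "c \<in> Cn n" for c
  proof -
    obtain r A' B' where r: "r > 0" "holomorphic_Cn n A' (polydisc n c r)" "holomorphic_Cn n B' (polydisc n c r)"
      "\<exists>z\<in>polydisc n c r. B' z \<noteq> 0" "\<forall>z\<in>polydisc n c r. B' z \<noteq> 0 --> F z = A' z / B' z"
      using mero c unfolding meromorphic_Cn_def by metis
    have "A' z * B z - A z * B' z = 0"
      if y: "d > 0" "y \<in> polydisc n c r" "polydisc n y d \<subseteq> polydisc n c r" "\<forall>z\<in>polydisc n y d. F z * B z = A z"
        and z: "z \<in> polydisc n c r" for y d z
    proof -
      have hol: "holomorphic_Cn n (\<lambda>z. A' z * B z - A z * B' z) (polydisc n c r)"
        by (intro holomorphic_Cn_diff holomorphic_Cn_mult r holomorphic_Cn_subset[OF A] holomorphic_Cn_subset[OF B]) auto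
      obtain z' where "z' \<in> polydisc n c r" "B' z' \<noteq> 0" using r(4) by blast
      then obtain y' d' where y': "y' \<in> polydisc n c r" "d' > 0" "polydisc n y' d' \<subseteq> polydisc n y d" "\<And>x. x \<in> polydisc n y' d' ==> B' x \<noteq> 0"
        using holomorphic_Cn_nonzero_dense[OF r(3) _ _ y(2,1)] by metis
      have "A' x * B x - A x * B' x = 0" if x: "x \<in> polydisc n y' d'" for x
      proof -
        have "F x = A' x / B' x" "F x * B x = A x" "B' x \<noteq> 0" using r(5) y'(3,4) y(3,4) x by blast+
        hence "A' x = F x * B' x" by simp
        thus ?thesis using \<open>F x * B x = A x\<close> by (metis mult.assoc mult.commute right_minus_eq)
      qed
      thus ?thesis using holomorphic_Cn_identity[OF hol y'(1,2) _ z] by blast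
    qed
    thus ?thesis using r by (intro exI[of _ r] conjI exI[of _ A'] exI[of _ B']) auto
  qed
  define \<phi> where "\<phi> = (\<lambda>t::real. \<lambda>i. p0 i + of_real t * (p i - p0 i))"
  have \<phi>C: "\<phi> t \<in> Cn n" for t using p0(1) p(1) by (auto simp: \<phi>_def Cn_def)
  have \<phi>cont: "continuous_on UNIV \<phi>"
    unfolding \<phi>_def by (intro continuous_on_coordinatewise_then_product continuous_intros)
  have good_sub: "\<exists>y d. d > 0 \<and> y \<in> polydisc n c r \<and> polydisc n y d \<subseteq> polydisc n c r \<and> (\<forall>z\<in>polydisc n y d. F z * B z = A z)"
    if c': "c' \<in> polydisc n c r" "good c'" for c c' r
  proof -
    obtain e where "e > 0" "polydisc n c' e \<subseteq> polydisc n c r" using polydisc_subset[OF c'(1)] by metis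
    moreover from this obtain y d where "d > 0" "y \<in> polydisc n c' e" "polydisc n y d \<subseteq> polydisc n c' e"
      "\<forall>z\<in>polydisc n y d. F z * B z = A z" using c'(2)[unfolded good_def, rule_format, of e] by blast
    ultimately show ?thesis by (intro exI[of _ y] exI[of _ d]) auto
  qed
  have good_propagates: "good c2"
    if U: "holomorphic_Cn n B' (polydisc n c r)" "\<exists>z\<in>polydisc n c r. B' z \<noteq> 0"
      "\<forall>z\<in>polydisc n c r. B' z \<noteq> 0 --> F z = A' z / B' z" "\<forall>z\<in>polydisc n c r. A' z * B z = A z * B' z"
      and c2: "c2 \<in> polydisc n c r" for c r A' B' c2
    unfolding good_def
  proof (intro allI impI)
    fix e :: real assume e: "e > 0"
    obtain y d where y: "y \<in> polydisc n c2 e" "d > 0" "polydisc n y d \<subseteq> polydisc n c2 e" "polydisc n y d \<subseteq> polydisc n c r"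
      "\<And>x. x \<in> polydisc n y d ==> B' x \<noteq> 0"
      using holomorphic_Cn_nonzero_dense[OF U(1) _ _ c2 e] U(2) by metis
    have "F z * B z = A z" if "z \<in> polydisc n y d" for z
    proof -
      have "F z = A' z / B' z" "A' z * B z = A z * B' z" "B' z \<noteq> 0" using U(3,4) y(4,5) that by blast+
      hence "A z * B' z = F z * B z * B' z" by simp
      thus ?thesis using \<open>B' z \<noteq> 0\<close> by simp
    qed
    thus "\<exists>y d. d > 0 \<and> y \<in> polydisc n c2 e \<and> polydisc n y d \<subseteq> polydisc n c2 e \<and> (\<forall>z\<in>polydisc n y d. F z * B z = A z)"
      using y by blast
  qed
  have "good (\<phi> 1)"
  \<comment> \<open>Connectedness of the segment from p0 to p: goodness is carried across each
    neighbourhood on which F is represented as a quotient.\<close>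
  proof (rule connected_induction_simple[of "{0..1}" 0 1 "\<lambda>t. good (\<phi> t)"])
    show "good (\<phi> 0)"
      unfolding good_def
    proof (intro allI impI)
      fix e :: real assume "e > 0"
      have "\<phi> 0 = p0" by (simp add: \<phi>_def)
      moreover have "polydisc n p0 (min e r0) \<subseteq> polydisc n p0 e" "polydisc n p0 (min e r0) \<subseteq> polydisc n p0 r0"
        by (auto simp: polydisc_def)
      ultimately show "\<exists>y d. d > 0 \<and> y \<in> polydisc n (\<phi> 0) e \<and> polydisc n y d \<subseteq> polydisc n (\<phi> 0) e \<and> (\<forall>z\<in>polydisc n y d. F z * B z = A z)"
        using p0 \<open>e > 0\<close> polydisc_self[OF p0(1)] by (intro exI[of _ p0] exI[of _ "min e r0"]) auto
    qed
    fix t :: real assume t: "t \<in> {0..1}"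
    obtain r A' B' where r: "r > 0" "holomorphic_Cn n B' (polydisc n (\<phi> t) r)" "\<exists>z\<in>polydisc n (\<phi> t) r. B' z \<noteq> 0"
      "\<forall>z\<in>polydisc n (\<phi> t) r. B' z \<noteq> 0 --> F z = A' z / B' z"
      "\<forall>y d. d > 0 --> y \<in> polydisc n (\<phi> t) r --> polydisc n y d \<subseteq> polydisc n (\<phi> t) r --> (\<forall>z\<in>polydisc n y d. F z * B z = A z) -->
         (\<forall>z\<in>polydisc n (\<phi> t) r. A' z * B z = A z * B' z)"
      using loc[OF \<phi>C[of t]] by (elim exE conjE) (rule that)
    obtain W where W: "open W" "polydisc n (\<phi> t) r = W \<inter> Cn n" using open_polydisc by blast
    have oW: "open (\<phi> -` W)" using continuous_on_open_vimage[OF open_UNIV] \<phi>cont W(1) by auto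
    have in_iff: "s \<in> \<phi> -` W \<longleftrightarrow> \<phi> s \<in> polydisc n (\<phi> t) r" for s unfolding W(2) using \<phi>C[of s] by blast
    show "\<exists>T. openin (top_of_set {0..1}) T \<and> t \<in> T \<and> (\<forall>x\<in>T. \<forall>y\<in>T. good (\<phi> x) --> good (\<phi> y))"
    proof (intro exI conjI ballI impI)
      show "openin (top_of_set {0..1}) ({0..1} \<inter> \<phi> -` W)" using oW by (rule openin_open_Int)
      show "t \<in> {0..1} \<inter> \<phi> -` W" using t in_iff polydisc_self[OF \<phi>C r(1)] by blast
      fix x y assume x: "x \<in> {0..1} \<inter> \<phi> -` W" "good (\<phi> x)" and y: "y \<in> {0..1} \<inter> \<phi> -` W"
      have "\<forall>z\<in>polydisc n (\<phi> t) r. A' z * B z = A z * B' z"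
      proof -
        have "\<phi> x \<in> polydisc n (\<phi> t) r" using x in_iff by blast
        from good_sub[OF this x(2)] obtain y0 d0 where "d0 > 0" "y0 \<in> polydisc n (\<phi> t) r" "polydisc n y0 d0 \<subseteq> polydisc n (\<phi> t) r"
          "\<forall>z\<in>polydisc n y0 d0. F z * B z = A z" by blast
        thus ?thesis using r(5)[rule_format, of d0 y0] by blast
      qed
      moreover have "\<phi> y \<in> polydisc n (\<phi> t) r" using y in_iff by blast
      ultimately show "good (\<phi> y)" by (rule good_propagates[OF r(2,3,4)])
    qed
  qed auto
  moreover have "\<phi> 1 = p" by (simp add: \<phi>_def)
  ultimately have gp: "good p" by simp
  obtain r A' B' where r: "r > 0" "holomorphic_Cn n B' (polydisc n p r)" "\<exists>z\<in>polydisc n p r. B' z \<noteq> 0"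
      "\<forall>z\<in>polydisc n p r. B' z \<noteq> 0 --> F z = A' z / B' z"
      "\<forall>y d. d > 0 --> y \<in> polydisc n p r --> polydisc n y d \<subseteq> polydisc n p r --> (\<forall>z\<in>polydisc n y d. F z * B z = A z) -->
         (\<forall>z\<in>polydisc n p r. A' z * B z = A z * B' z)"
    using loc[OF p(1)] by (elim exE conjE) (rule that)
  have AB: "\<forall>z\<in>polydisc n p r. A' z * B z = A z * B' z"
  proof -
    from good_sub[OF polydisc_self[OF p(1) r(1)] gp] obtain y0 d0 where "d0 > 0" "y0 \<in> polydisc n p r" "polydisc n y0 d0 \<subseteq> polydisc n p r"
      "\<forall>z\<in>polydisc n y0 d0. F z * B z = A z" by blast
    thus ?thesis using r(5)[rule_format, of d0 y0] by blast
  qed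
  have "continuous_on (polydisc n p r) B" using B continuous_on_subset by (auto simp: holomorphic_Cn_def)
  then obtain e where e: "e > 0" "polydisc n p e \<subseteq> polydisc n p r" "\<And>y. y \<in> polydisc n p e ==> B y \<noteq> 0"
    using continuous_on_polydisc_nonzero[of n p r B, OF _ polydisc_self[OF p(1) r(1)] p(2)] by metis
  have hH: "holomorphic_Cn n (\<lambda>z. A z / B z) (polydisc n p e)"
    by (intro holomorphic_Cn_divide holomorphic_Cn_subset[OF A] holomorphic_Cn_subset[OF B] e(3)) auto
  \<comment> \<open>The second clause of \<open>meromorphic_Cn\<close> will give the value at p
    itself, because F agrees with A/B on a dense part of a polydisc around p.\<close>
  have "polydisc n p e \<subseteq> closure {z \<in> polydisc n p e. F z = A z / B z}"
  proof
    fix z assume z: "z \<in> polydisc n p e"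
    have "z \<in> Cn n" using z by (simp add: polydisc_def)
    moreover have "{z \<in> polydisc n p e. F z = A z / B z} \<subseteq> Cn n" by (auto simp: polydisc_def)
    moreover have "\<exists>y\<in>{z \<in> polydisc n p e. F z = A z / B z}. y \<in> polydisc n z d" if d: "d > 0" for d
    proof -
      obtain d0 where d0: "d0 > 0" "polydisc n z d0 \<subseteq> polydisc n p e" using polydisc_subset[OF z] by metis
      obtain z' where z': "z' \<in> polydisc n p r" "B' z' \<noteq> 0" using r(3) by blast
      obtain y where y: "y \<in> polydisc n z (min d d0)" "y \<in> polydisc n p r" "B' y \<noteq> 0"
      proof (rule holomorphic_Cn_nonzero_dense[OF r(2) z' subsetD[OF e(2) z], of "min d d0"], goal_cases)
        case (2 y d')
        have "y \<in> polydisc n y d'" using 2 by (intro polydisc_self) (auto simp: polydisc_def)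
        thus ?case using 2 that by blast
      qed (use d d0 in auto)
      have y2: "y \<in> polydisc n z d" "y \<in> polydisc n z d0" using y(1) by (auto simp: polydisc_def)
      have "F y = A' y / B' y" "A' y * B y = A y * B' y" "B y \<noteq> 0" using y y2 d0 r(4) AB e(3) by blast+
      hence "A y * B' y = F y * B y * B' y" by simp
      hence "F y = A y / B y" using y(3) \<open>B y \<noteq> 0\<close> by simp
      thus ?thesis using y2 d0 by blast
    qed
    ultimately show "z \<in> closure {z \<in> polydisc n p e. F z = A z / B z}" by (simp add: closure_Cn_iff)
  qed
  thus ?thesis using mero p(1) e(1) hH unfolding meromorphic_Cn_def by blast
qed

text \<open>At a zero of B the value is the limit through the nonzeros of B if there is one, as the
  normalisation at removable singularities demands.\<close>

definition fill_in :: "nat => ((nat => complex) => complex) => ((nat => complex) => complex) => (nat => complex) => complex" where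
  "fill_in n R B p = (if B p = 0 \<and> (\<exists>l. (R \<longlongrightarrow> l) (at p within {z \<in> Cn n. B z \<noteq> 0}))
     then Lim (at p within {z \<in> Cn n. B z \<noteq> 0}) R else R p)"

lemma nontrivial_at_within_nonzero:
  assumes "holomorphic_Cn n B UNIV" "z1 \<in> Cn n" "B z1 \<noteq> 0" "p \<in> Cn n" "B p = 0"
  shows "at p within {z \<in> Cn n. B z \<noteq> 0} \<noteq> bot"
proof -
  have "p \<in> closure {z \<in> Cn n. B z \<noteq> 0}"
  proof (subst closure_Cn_iff[of _ n])
    show "\<forall>e>0. \<exists>y\<in>{z \<in> Cn n. B z \<noteq> 0}. y \<in> polydisc n p e"
    proof (intro allI impI)
      fix e :: real assume e: "e > 0"
      obtain y d where "y \<in> polydisc n p e" "d > 0" "\<And>x. x \<in> polydisc n y d ==> B x \<noteq> 0"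
        using entire_nonzero_dense[OF assms(1-4) e] by metis
      moreover from this have "y \<in> Cn n" by (simp add: polydisc_def)
      ultimately show "\<exists>y\<in>{z \<in> Cn n. B z \<noteq> 0}. y \<in> polydisc n p e" using polydisc_self by blast
    qed
  qed (use assms in auto)
  moreover have "{z \<in> Cn n. B z \<noteq> 0} - {p} = {z \<in> Cn n. B z \<noteq> 0}" using assms(5) by auto
  ultimately show ?thesis by (simp add: at_within_eq_bot_iff)
qed

lemma fill_in_eq:
  assumes "holomorphic_Cn n B UNIV" "z1 \<in> Cn n" "B z1 \<noteq> 0" "p \<in> Cn n"
    "B p = 0 ==> (R \<longlongrightarrow> l) (at p within {z \<in> Cn n. B z \<noteq> 0})" "B p \<noteq> 0 ==> R p = l"
  shows "fill_in n R B p = l"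
  using assms nontrivial_at_within_nonzero[OF assms(1-4)] by (auto simp: fill_in_def tendsto_Lim)

text \<open>A holomorphic H that agrees with the function on a dense set agrees with A/B wherever B
  is nonzero, by continuity; at a zero of B its value is therefore the limit that
  \<open>fill_in\<close> takes.\<close>

lemma meromorphic_fill_in:
  assumes A: "holomorphic_Cn n A UNIV" and B: "holomorphic_Cn n B UNIV" and z1: "z1 \<in> Cn n" "B z1 \<noteq> 0"
    and R: "\<And>z. z \<in> Cn n ==> B z \<noteq> 0 ==> R z = A z / B z"
  shows "meromorphic_Cn n (fill_in n R B)"
  unfolding meromorphic_Cn_def
proof (intro conjI ballI allI impI)
  fix p assume p: "p \<in> Cn n"
  obtain y d where "y \<in> polydisc n p 1" "d > 0" "\<And>x. x \<in> polydisc n y d ==> B x \<noteq> 0"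
    using entire_nonzero_dense[OF B z1 p, of 1] by (metis zero_less_one)
  moreover from this have "y \<in> Cn n" by (simp add: polydisc_def)
  ultimately have "\<exists>z\<in>polydisc n p 1. B z \<noteq> 0" using polydisc_self by blast
  moreover have "fill_in n R B z = A z / B z" if "z \<in> polydisc n p 1" "B z \<noteq> 0" for z
    using that R by (simp add: fill_in_def polydisc_def)
  ultimately show "\<exists>r>0. \<exists>A B'. holomorphic_Cn n A (polydisc n p r) \<and> holomorphic_Cn n B' (polydisc n p r) \<and>
        (\<exists>z\<in>polydisc n p r. B' z \<noteq> 0) \<and> (\<forall>z\<in>polydisc n p r. B' z \<noteq> 0 --> fill_in n R B z = A z / B' z)"
    using holomorphic_Cn_subset[OF A] holomorphic_Cn_subset[OF B]
    by (intro exI[of _ 1] conjI exI[of _ A] exI[of _ B]) auto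
next
  fix p r H assume p: "p \<in> Cn n" and r: "r > (0::real)"
    and H: "holomorphic_Cn n H (polydisc n p r) \<and> polydisc n p r \<subseteq> closure {z \<in> polydisc n p r. fill_in n R B z = H z}"
  have HR: "H z = A z / B z" if z: "z \<in> polydisc n p r" "B z \<noteq> 0" for z
  proof (rule ccontr)
    assume ne: "H z \<noteq> A z / B z"
    have zC: "z \<in> Cn n" using z by (simp add: polydisc_def)
    have cont: "continuous_on (polydisc n p r) (\<lambda>z. (H z * B z - A z) * B z)"
      using H A B continuous_on_subset unfolding holomorphic_Cn_def by (intro continuous_intros) blast+
    have "(H z * B z - A z) * B z \<noteq> 0" using ne z(2) by (auto simp: field_simps)
    then obtain e where e: "e > 0" "polydisc n z e \<subseteq> polydisc n p r" "\<And>y. y \<in> polydisc n z e ==> (H y * B y - A y) * B y \<noteq> 0"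
      using continuous_on_polydisc_nonzero[OF cont z(1)] by metis
    have "z \<in> closure {z \<in> polydisc n p r. fill_in n R B z = H z}" using H z(1) by blast
    moreover have "{z \<in> polydisc n p r. fill_in n R B z = H z} \<subseteq> Cn n" by (auto simp: polydisc_def)
    ultimately obtain y where y: "fill_in n R B y = H y" "y \<in> polydisc n z e"
      using closure_Cn_iff[of _ n z] zC e(1) by blast
    have yC: "y \<in> Cn n" using y by (simp add: polydisc_def)
    have "B y \<noteq> 0" using e(3)[OF y(2)] by auto
    hence "H y = A y / B y" using y(1) R[OF yC] by (simp add: fill_in_def)
    thus False using e(3)[OF y(2)] \<open>B y \<noteq> 0\<close> by simp
  qed
  obtain W where W: "open W" "polydisc n p r = W \<inter> Cn n" using open_polydisc by blast
  have pW: "p \<in> polydisc n p r" by (rule polydisc_self[OF p r])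
  show "fill_in n R B p = H p"
  proof (rule fill_in_eq[OF B z1 p])
    show "R p = H p" if "B p \<noteq> 0" using HR[OF pW that] R[OF p that] by simp
    have "(H \<longlongrightarrow> H p) (at p within polydisc n p r)"
      using H pW by (auto simp: holomorphic_Cn_def continuous_on_def)
    hence "(H \<longlongrightarrow> H p) (at p within Cn n)"
      using at_within_nhd[of p W "Cn n" "W \<inter> Cn n"] W pW by (auto simp: Int_commute)
    hence "(H \<longlongrightarrow> H p) (at p within {z \<in> Cn n. B z \<noteq> 0})" by (rule tendsto_within_subset) auto
    moreover have "\<forall>\<^sub>F z in at p within {z \<in> Cn n. B z \<noteq> 0}. H z = R z"
      unfolding eventually_at_topological using W pW HR R by (intro exI[of _ W]) auto
    ultimately show "(R \<longlongrightarrow> H p) (at p within {z \<in> Cn n. B z \<noteq> 0})" by (rule Lim_transform_eventually)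
  qed
qed

section \<open>The continuation of the integral\<close>

context upper_half_plane
begin

definition closed_form where
  "closed_form n chi z = 4 * partition_sum (block_term chi \<tau> (\<lambda>i. exp (z i))) {0..n}"

text \<open>A common denominator of all partition products, nonzero exactly at the regular
  points.\<close>

definition polar :: "nat => (nat => complex) => complex" where
  "polar n z = (\<Prod>I\<in>Pow {1..n} - {{}}. \<theta> (\<Sum>i\<in>I. z i))"

lemma polar_nonzero_iff: "z \<in> Cn n ==> polar n z \<noteq> 0 \<longleftrightarrow> z \<in> regular_points n \<tau>"
  by (auto simp: polar_def regular_points_def prod_zero_iff theta_eq_0_iff simp del: Pow_iff)

lemma polar_holomorphic: "holomorphic_Cn n (polar n) UNIV"
  unfolding polar_def[abs_def] by (intro holomorphic_Cn_prod holomorphic_Cn_compose_sum theta_holomorphic)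

lemma regular_point_exists: "\<exists>z1\<in>Cn n. polar n z1 \<noteq> 0"
proof -
  obtain r where r: "r > 0" "\<And>t. t \<in> ball 0 r ==> t \<noteq> 0 ==> \<theta> t \<noteq> 0"
    using theta_recip_holomorphic by metis
  \<comment> \<open>Equal small positive coordinates: every partial sum is nonzero and of modulus
    below r, so it is no zero of theta.\<close>
  define z1 where "z1 = (\<lambda>i. if i \<in> {1..n} then complex_of_real (r / (real n + 1)) else 0)"
  have "\<theta> (\<Sum>i\<in>I. z1 i) \<noteq> 0" if I: "I \<in> Pow {1..n} - {{}}" for I
  proof -
    have "(\<Sum>i\<in>I. z1 i) = (\<Sum>i\<in>I. complex_of_real (r / (real n + 1)))"
      using I by (intro sum.cong) (auto simp: z1_def)
    hence e: "(\<Sum>i\<in>I. z1 i) = complex_of_real (real (card I) * (r / (real n + 1)))" by simp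
    have fI: "finite I" using I finite_subset by auto
    hence c: "0 < card I" "card I \<le> n" using I card_mono[of "{1..n}" I] by (auto simp: card_gt_0_iff)
    have "real (card I) * (r / (real n + 1)) > 0" using c r(1) by simp
    moreover have "real (card I) * r < (real n + 1) * r" using c r(1) by (intro mult_strict_right_mono) auto
    hence "real (card I) * (r / (real n + 1)) < r" by (simp add: field_simps)
    ultimately have "norm (\<Sum>i\<in>I. z1 i) < r" "(\<Sum>i\<in>I. z1 i) \<noteq> 0" unfolding e norm_of_real of_real_eq_0_iff by linarith+
    thus ?thesis by (intro r(2)) auto
  qed
  hence "polar n z1 \<noteq> 0" by (simp add: polar_def prod_zero_iff)
  moreover have "z1 \<in> Cn n" by (auto simp: Cn_def z1_def)
  ultimately show ?thesis by blast
qed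

definition block_pole :: "(nat => complex) => nat set => complex" where
  "block_pole z S = (if 0 \<in> S then 1 else \<theta> (\<Sum>i\<in>S. z i))"

lemma block_pole_holomorphic: "holomorphic_Cn n (\<lambda>z. block_pole z S) UNIV"
  by (cases "0 \<in> S") (auto simp: block_pole_def intro: holomorphic_Cn_const holomorphic_Cn_compose_sum theta_holomorphic)

lemma polar_eq: "polar n z = (\<Prod>S\<in>Pow {0..n} - {{}}. block_pole z S)"
  unfolding polar_def
proof (rule prod.mono_neutral_cong_left)
  show "\<forall>S\<in>Pow {0..n} - {{}} - (Pow {1..n} - {{}}). block_pole z S = 1"
  proof
    fix S assume S: "S \<in> Pow {0..n} - {{}} - (Pow {1..n} - {{}})"
    hence "\<not> S \<subseteq> {1..n}" "S \<subseteq> {0..n}" by auto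
    then obtain x where "x \<in> S" "x \<notin> {1..n}" "x \<in> {0..n}" by blast
    moreover from this have "x = 0" by auto
    ultimately have "0 \<in> S" by blast
    thus "block_pole z S = 1" by (simp add: block_pole_def)
  qed
qed (auto simp: block_pole_def)

lemma in_regular_not_lattice:
  "z \<in> regular_points n \<tau> ==> S \<subseteq> {1..n} ==> S \<noteq> {} ==> (\<Sum>i\<in>S. z i) \<notin> lattice \<tau>"
  by (simp add: regular_points_def)

lemma subset_without_0: "S \<subseteq> {0..n} ==> (0::nat) \<notin> S ==> S \<subseteq> {1..n}"
proof
  fix x assume a: "S \<subseteq> {0..n}" "0 \<notin> S" "x \<in> S"
  hence "x \<noteq> 0" by metis
  thus "x \<in> {1..n}" using a by auto
qed

lemma G_eq_taylor:
  assumes ord: "is_ordering n chi" and S: "S \<subseteq> {1..n}" "S \<noteq> {}" and z: "z \<in> regular_points n \<tau>"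
  shows "G chi \<tau> S (\<lambda>i. exp (z i)) = (\<Sum>K\<in>permutations_of_set S. g_taylor (card S) (chi_seq chi K) (\<Sum>i\<in>S. z i))"
  unfolding G_def
proof (rule sum.cong[OF refl])
  fix K assume K: "K \<in> permutations_of_set S"
  have f: "finite S" using S(1) finite_subset by auto
  have "chi_seq chi K \<le> card S" by (rule chi_seq_le[OF ord _ K]) (use S in auto)
  moreover have "1 \<le> card S" using f S(2) by (simp add: Suc_le_eq card_gt_0_iff)
  ultimately have "g \<tau> (card S) (chi_seq chi K) (exp (\<Sum>i\<in>S. z i)) = g_taylor (card S) (chi_seq chi K) (\<Sum>i\<in>S. z i)"
    using in_regular_not_lattice[OF z S] by (intro g_eq_g_taylor)
  thus "g \<tau> (card S) (chi_seq chi K) (\<Prod>i\<in>S. exp (z i)) = g_taylor (card S) (chi_seq chi K) (\<Sum>i\<in>S. z i)"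
    using f by (simp add: exp_sum)
qed

lemma block_term_0: "0 \<in> S ==> block_term chi \<tau> u S = block_term chi \<tau> u' S"
  by (simp add: block_term_def)

text \<open>G_S has at most a simple pole where the sum over S meets the lattice, and a block
  containing 0 is constant.\<close>

lemma block_num_holomorphic:
  assumes ord: "is_ordering n chi" and S: "S \<subseteq> {0..n}" "S \<noteq> {}"
  shows "\<exists>N. holomorphic_Cn n N UNIV \<and> (\<forall>z\<in>regular_points n \<tau>. block_term chi \<tau> (\<lambda>i. exp (z i)) S * block_pole z S = N z)"
proof (cases "0 \<in> S")
  case True
  show ?thesis
    by (rule exI[of _ "\<lambda>z. block_term chi \<tau> (\<lambda>_. 0) S"])
       (use True in \<open>auto simp: block_pole_def intro: holomorphic_Cn_const block_term_0\<close>)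
next
  case False
  have S1: "S \<subseteq> {1..n}" by (rule subset_without_0[OF S(1) False])
  have "\<exists>N. N holomorphic_on UNIV \<and> (\<forall>z. z \<notin> lattice \<tau> --> g_taylor (card S) a z = N z / \<theta> z)" for a
    using g_taylor_num_holomorphic[of "card S" a] by metis
  then obtain N where N: "\<And>a. N a holomorphic_on UNIV" "\<And>a z. z \<notin> lattice \<tau> ==> g_taylor (card S) a z = N a z / \<theta> z"
    by metis
  show ?thesis
  proof (intro exI conjI ballI)
    show "holomorphic_Cn n (\<lambda>z. (-1) ^ (card S - 1) / of_nat (card S) * (\<Sum>K\<in>permutations_of_set S. N (chi_seq chi K) (\<Sum>i\<in>S. z i))) UNIV"
      by (intro holomorphic_Cn_mult holomorphic_Cn_const holomorphic_Cn_sum holomorphic_Cn_compose_sum N)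
    fix z assume z: "z \<in> regular_points n \<tau>"
    have l: "(\<Sum>i\<in>S. z i) \<notin> lattice \<tau>" by (rule in_regular_not_lattice[OF z S1 S(2)])
    have t: "\<theta> (\<Sum>i\<in>S. z i) \<noteq> 0" using l theta_eq_0_iff by blast
    have "G chi \<tau> S (\<lambda>i. exp (z i)) = (\<Sum>K\<in>permutations_of_set S. N (chi_seq chi K) (\<Sum>i\<in>S. z i)) / \<theta> (\<Sum>i\<in>S. z i)"
      unfolding G_eq_taylor[OF ord S1 S(2) z] by (simp add: N(2)[OF l] sum_divide_distrib)
    thus "block_term chi \<tau> (\<lambda>i. exp (z i)) S * block_pole z S
      = (-1) ^ (card S - 1) / of_nat (card S) * (\<Sum>K\<in>permutations_of_set S. N (chi_seq chi K) (\<Sum>i\<in>S. z i))"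
      using False t by (auto simp: block_term_def block_pole_def)
  qed
qed

text \<open>A partition uses each block once, so multiplication by \<open>polar\<close> clears all
  its denominators and leaves the factors of the sets that are not blocks.\<close>

lemma closed_form_fraction:
  assumes ord: "is_ordering n chi"
  obtains A where "holomorphic_Cn n A UNIV" "\<And>z. z \<in> Cn n ==> polar n z \<noteq> 0 ==> closed_form n chi z = A z / polar n z"
proof -
  obtain N where N: "\<And>S. S \<subseteq> {0..n} ==> S \<noteq> {} ==> holomorphic_Cn n (N S) UNIV"
     "\<And>S z. S \<subseteq> {0..n} ==> S \<noteq> {} ==> z \<in> regular_points n \<tau> ==> block_term chi \<tau> (\<lambda>i. exp (z i)) S * block_pole z S = N S z"
    using block_num_holomorphic[OF ord] by metis
  define Q where "Q = Pow {0..n} - {{}}"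
  define A where "A = (\<lambda>z. 4 * (\<Sum>P\<in>{P. partition_on {0..n} P}. (\<Prod>S\<in>P. N S z) * (\<Prod>S\<in>Q-P. block_pole z S)))"
  have PQ: "P \<subseteq> Q" if "partition_on {0..n} P" for P using that by (auto simp: partition_on_def Q_def)
  show ?thesis
  proof (rule that[of A])
    show "holomorphic_Cn n A UNIV"
      unfolding A_def
    proof (intro holomorphic_Cn_mult holomorphic_Cn_const holomorphic_Cn_sum holomorphic_Cn_prod block_pole_holomorphic)
      fix P S assume "P \<in> {P. partition_on {0..n} P}" "S \<in> P"
      thus "holomorphic_Cn n (N S) UNIV" using PQ by (intro N(1)) (auto simp: Q_def)
    qed
    fix z assume z: "z \<in> Cn n" "polar n z \<noteq> 0"
    have reg: "z \<in> regular_points n \<tau>" using polar_nonzero_iff z by blast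
    have "(\<Prod>S\<in>P. block_term chi \<tau> (\<lambda>i. exp (z i)) S) * polar n z = (\<Prod>S\<in>P. N S z) * (\<Prod>S\<in>Q-P. block_pole z S)"
      if P: "P \<in> {P. partition_on {0..n} P}" for P
    proof -
      have "polar n z = (\<Prod>S\<in>Q-P. block_pole z S) * (\<Prod>S\<in>P. block_pole z S)"
        unfolding polar_eq Q_def[symmetric] using PQ P by (intro prod.subset_diff) (auto simp: Q_def)
      moreover have "(\<Prod>S\<in>P. N S z) = (\<Prod>S\<in>P. block_term chi \<tau> (\<lambda>i. exp (z i)) S * block_pole z S)"
        using PQ P by (intro prod.cong refl N(2)[symmetric] reg) (auto simp: Q_def)
      ultimately show ?thesis by (simp add: prod.distrib)
    qed
    hence "closed_form n chi z * polar n z = A z"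
      by (simp add: closed_form_def partition_sum_def A_def sum_distrib_right mult.assoc)
    thus "closed_form n chi z = A z / polar n z" using z(2) by (simp add: field_simps)
  qed
qed

text \<open>The moduli are powers of \<mu> > 1 by rank in the ordering, with \<mu> so close to 1
  that all ratios stay below 1/|q|. The conditions are strict, so they persist for z near z0 with
  the same torus.\<close>

lemma region_exists:
  assumes ord: "is_ordering n chi"
  obtains z0 e s where "z0 \<in> Cn n" "e > 0" "\<And>j. j \<in> {1..n} ==> s j > 0"
    "\<And>z v. z \<in> polydisc n z0 e ==> (\<forall>j\<in>{1..n}. norm (v j) = s j) ==> (\<lambda>i. exp (z i), v) \<in> Omega n chi \<tau>"
proof -
  define I where "I = indices n"
  have fI: "finite I" by (simp add: I_def indices_def)
  define rank where "rank = (\<lambda>a. card {b \<in> I. b \<noteq> a \<and> chi a b = 0})"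
  have chi: "chi a b \<in> {0, 1} \<and> chi a b + chi b a = 1" if "a \<in> I" "b \<in> I" "a \<noteq> b" for a b
    using ord that unfolding is_ordering_def I_def by blast
  have tr: "chi a c = 0" if "a \<in> I" "b \<in> I" "c \<in> I" "a \<noteq> b" "b \<noteq> c" "a \<noteq> c" "chi a b = 0" "chi b c = 0" for a b c
    using ord that unfolding is_ordering_def I_def by blast
  have rank_less: "rank b < rank a" if ab: "a \<in> I" "b \<in> I" "a \<noteq> b" "chi a b = 0" for a b
    unfolding rank_def
  proof (rule psubset_card_mono)
    show "{c \<in> I. c \<noteq> b \<and> chi b c = 0} \<subset> {c \<in> I. c \<noteq> a \<and> chi a c = 0}"
    proof (rule psubsetI)
      show "{c \<in> I. c \<noteq> b \<and> chi b c = 0} \<subseteq> {c \<in> I. c \<noteq> a \<and> chi a c = 0}"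
      proof clarify
        fix c assume c: "c \<in> I" "c \<noteq> b" "chi b c = 0"
        have "c \<noteq> a" using c chi[OF ab(1-3)] ab(4) by auto
        thus "c \<noteq> a \<and> chi a c = 0" using tr[OF ab(1,2) c(1)] ab c by auto
      qed
      show "{c \<in> I. c \<noteq> b \<and> chi b c = 0} \<noteq> {c \<in> I. c \<noteq> a \<and> chi a c = 0}" using ab by auto
    qed
  qed (use fI in auto)
  define M where "M = card I"
  have rank_le: "rank a \<le> M" for a unfolding rank_def M_def using fI by (intro card_mono) auto
  define L where "L = ln (1 / norm q)"
  have L: "L > 0" unfolding L_def using norm_q_less_1 norm_q_pos by (intro ln_gt_zero) (simp add: field_simps)
  \<comment> \<open>Dividing by M + 1 instead of M makes |q| \<mu>^M < 1 strict.\<close>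
  define \<mu> where "\<mu> = exp (L / (real M + 1))"
  have \<mu>1: "\<mu> > 1" using L by (simp add: \<mu>_def)
  have "real M * L < (real M + 1) * L" using L by (intro mult_strict_right_mono) auto
  hence less: "exp (real M * (L / (real M + 1))) < exp L" by (simp add: divide_less_eq mult.commute)
  have "\<mu> ^ M = exp (real M * (L / (real M + 1)))" by (simp only: \<mu>_def exp_of_nat_mult)
  also note less
  also have "exp L = 1 / norm q" unfolding L_def using norm_q_pos by simp
  finally have \<mu>M: "norm q * \<mu> ^ M < 1" using norm_q_pos by (simp add: field_simps)
  define s where "s = (\<lambda>j. \<mu> ^ rank (Bar j))"
  have s: "s j > 0" for j using \<mu>1 by (simp add: s_def)
  define z0 where "z0 = (\<lambda>i. if i \<in> {1..n} then complex_of_real (ln (\<mu> ^ rank (Idx i) / s i)) else 0)"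
  define nv where "nv = (\<lambda>(z :: nat => complex) a. case a of Idx i => norm (exp (z i)) * s i | Bar j => s j)"
  have nv0: "nv z0 a = \<mu> ^ rank a" if "a \<in> I" for a
  proof (cases a)
    case (Idx i)
    hence i: "i \<in> {1..n}" using that by (auto simp: I_def indices_def)
    have "norm (exp (z0 i)) = exp (ln (\<mu> ^ rank (Idx i) / s i))" using i by (simp add: z0_def del: atLeastAtMost_iff)
    also have "\<dots> = \<mu> ^ rank (Idx i) / s i" using \<mu>1 s[of i] by simp
    finally show ?thesis using Idx s[of i] by (simp add: nv_def)
  qed (simp add: nv_def s_def)
  have nvpos: "nv z a > 0" for z a using s by (cases a) (auto simp: nv_def)
  have nvcont: "continuous_on UNIV (\<lambda>z. nv z a)" for a
    by (cases a) (auto simp: nv_def intro!: continuous_intros continuous_on_product_coordinates)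
  define cond where "cond = (\<lambda>z a b. (chi a b = 0 --> nv z b < nv z a) \<and> (chi a b = 1 --> nv z a < nv z b) \<and>
    norm q * nv z b < nv z a \<and> norm q * nv z a < nv z b)"
  define W where "W = (\<Inter>a\<in>I. \<Inter>b\<in>I-{a}. {z. cond z a b})"
  have oimp: "open {z. P --> nv z a < nv z b}" for P a b
    by (cases P) (auto intro!: open_Collect_less nvcont)
  have "open W"
    unfolding W_def cond_def
    by (intro open_INT ballI fI finite_Diff open_Collect_conj oimp open_Collect_less continuous_intros nvcont)
  moreover have "z0 \<in> W"
    unfolding W_def
  proof (intro INT_I CollectI)
    fix a b assume ab: "a \<in> I" "b \<in> I - {a}"
    have q: "norm q * \<mu> ^ rank b < \<mu> ^ rank a" for a b
    proof -
      have "norm q * \<mu> ^ rank b \<le> norm q * \<mu> ^ M"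
        using \<mu>1 rank_le[of b] by (intro mult_left_mono power_increasing) auto
      also have "\<dots> < 1" by (rule \<mu>M)
      also have "1 \<le> \<mu> ^ rank a" using \<mu>1 by (simp add: one_le_power)
      finally show ?thesis .
    qed
    have "chi b a = 0" if "chi a b = 1" using chi[of a b] ab that by auto
    thus "cond z0 a b"
      using rank_less[of a b] rank_less[of b a] ab \<mu>1 q nv0 by (auto simp: cond_def)
  qed
  moreover have z0: "z0 \<in> Cn n" by (auto simp: z0_def Cn_def)
  ultimately obtain e where e: "e > 0" "polydisc n z0 e \<subseteq> W" using polydisc_nhd[of W z0 n] by blast
  show ?thesis
  proof (rule that[OF z0 e(1), of s])
    show "s j > 0" for j by (rule s)
    fix z and v :: "nat => complex" assume z: "z \<in> polydisc n z0 e" and v: "\<forall>j\<in>{1..n}. norm (v j) = s j"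
    have nx: "norm (xval (\<lambda>i. exp (z i)) v a) = nv z a" if "a \<in> I" for a
      using that v by (auto simp: I_def indices_def nv_def norm_mult)
    have c: "cond z a b" if "a \<in> I" "b \<in> I" "a \<noteq> b" for a b using z e(2) that unfolding W_def by blast
    show "(\<lambda>i. exp (z i), v) \<in> Omega n chi \<tau>"
      unfolding Omega_def I_def[symmetric]
    proof (intro CollectI case_prodI ballI impI)
      fix a b assume ab: "a \<in> I" "b \<in> I" "a \<noteq> b"
      show "(chi a b = 0 --> norm (xval (\<lambda>i. exp (z i)) v b) < norm (xval (\<lambda>i. exp (z i)) v a)) \<and>
        (chi a b = 1 --> norm (xval (\<lambda>i. exp (z i)) v a) < norm (xval (\<lambda>i. exp (z i)) v b)) \<and>
        norm q < norm (xval (\<lambda>i. exp (z i)) v a / xval (\<lambda>i. exp (z i)) v b) \<and>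
        norm (xval (\<lambda>i. exp (z i)) v a / xval (\<lambda>i. exp (z i)) v b) < inverse (norm q)"
        using c[OF ab] nvpos[of z a] nvpos[of z b] norm_q_pos unfolding norm_divide nx[OF ab(1)] nx[OF ab(2)] cond_def
        by (auto simp: field_simps)
    qed
  qed
qed

end

section \<open>Continuity of the closed form over the region, polar hyperplanes included\<close>

context torus_region
begin

lemma g_tendsto:
  assumes "a \<le> b" "1 \<le> b" "u \<in> g_annulus b a" "(f \<longlongrightarrow> u) F"
  shows "((\<lambda>x. g \<tau> b a (f x)) \<longlongrightarrow> g \<tau> b a u) F"
proof -
  obtain U where U: "open U" "u \<in> U" "g_series b a holomorphic_on U" using g_series_local(1)[OF assms(1,3)] by blast
  have "isCont (g_series b a) u"
    using holomorphic_on_imp_continuous_on[OF U(3)] U(1,2) by (simp add: continuous_on_eq_continuous_at)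
  hence "((\<lambda>x. g_series b a (f x)) \<longlongrightarrow> g_series b a u) F" using assms(4) by (rule isCont_tendsto_compose)
  moreover have "\<forall>\<^sub>F x in F. f x \<in> g_annulus b a"
    using topological_tendstoD[OF assms(4) open_g_annulus assms(3)] .
  hence "\<forall>\<^sub>F x in F. g_series b a (f x) = g \<tau> b a (f x)"
    by eventually_elim (rule g_eq_g_series[symmetric, OF assms(2,1)])
  ultimately have "((\<lambda>x. g \<tau> b a (f x)) \<longlongrightarrow> g_series b a u) F" by (rule Lim_transform_eventually)
  thus ?thesis using g_eq_g_series[OF assms(2,1,3)] by simp
qed

text \<open>A point z over the region need not be regular: a partial sum of z may be in the lattice
  while the series of g_{b,a} converges there. Inside the annuli the closed form is nevertheless
  continuous, so the limits used by \<open>fill_in\<close> are its values.\<close>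

lemma closed_form_tendsto: "(closed_form n chi \<longlongrightarrow> closed_form n chi z) (at z within Y)"
proof -
  have coord: "((\<lambda>z'. z' i) \<longlongrightarrow> z i) (at z within Y)" for i
    using continuous_on_subset[OF continuous_on_product_coordinates[of i], of "UNIV"]
    by (auto simp: continuous_on_def intro: tendsto_within_subset)
  have bt: "((\<lambda>z'. block_term chi \<tau> (\<lambda>i. exp (z' i)) S) \<longlongrightarrow> block_term chi \<tau> (\<lambda>i. exp (z i)) S) (at z within Y)"
    if S: "S \<subseteq> {0..n}" "S \<noteq> {}" for S
  proof (cases "0 \<in> S")
    case True
    have "(\<lambda>z'. block_term chi \<tau> (\<lambda>i. exp (z' i)) S) = (\<lambda>_. block_term chi \<tau> (\<lambda>i. exp (z i)) S)"
      by (intro ext block_term_0[OF True])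
    thus ?thesis by (simp only: tendsto_const)
  next
    case False
    have S1: "S \<subseteq> {1..n}" by (rule subset_without_0[OF S(1) False])
    have f: "finite S" using S(1) finite_subset by auto
    have b1: "1 \<le> card S" using f S(2) by (simp add: Suc_le_eq card_gt_0_iff)
    have "((\<lambda>z'. G chi \<tau> S (\<lambda>i. exp (z' i))) \<longlongrightarrow> G chi \<tau> S (\<lambda>i. exp (z i))) (at z within Y)"
      unfolding G_def
    proof (intro tendsto_sum g_tendsto)
      fix K assume K: "K \<in> permutations_of_set S"
      show "chi_seq chi K \<le> card S" by (rule chi_seq_le[OF ordering S(1) K])
      show "1 \<le> card S" by (rule b1)
      show "(\<Prod>i\<in>S. exp (z i)) \<in> g_annulus (card S) (chi_seq chi K)" by (rule g_block(1)[OF S1 S(2) K])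
      show "((\<lambda>z'. \<Prod>i\<in>S. exp (z' i)) \<longlongrightarrow> (\<Prod>i\<in>S. exp (z i))) (at z within Y)"
        by (intro tendsto_prod tendsto_exp coord)
    qed
    moreover have "block_term chi \<tau> u S = (-1) ^ (card S - 1) / of_nat (card S) * G chi \<tau> S u" for u
      using False by (auto simp: block_term_def)
    ultimately show ?thesis by (simp only:) (intro tendsto_mult tendsto_const)
  qed
  show ?thesis
    unfolding closed_form_def[abs_def] partition_sum_def
    by (intro tendsto_mult tendsto_const tendsto_sum tendsto_prod bt) (auto simp: partition_on_def)
qed

lemma T_integral_closed_form: "T_integral n s \<tau> z = closed_form n chi z"
  unfolding T_integral_eq closed_form_def sum_partition_term ..

end

context upper_half_plane
begin

lemma is_T_fill_in:
  assumes ord: "is_ordering n chi"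
  shows "is_T n chi \<tau> (fill_in n (closed_form n chi) (polar n))"
  unfolding is_T_def
proof (intro conjI ballI allI impI)
  obtain A where A: "holomorphic_Cn n A UNIV" "\<And>z. z \<in> Cn n ==> polar n z \<noteq> 0 ==> closed_form n chi z = A z / polar n z"
    using closed_form_fraction[OF ord] by metis
  obtain z1 where z1: "z1 \<in> Cn n" "polar n z1 \<noteq> 0" using regular_point_exists by blast
  show "meromorphic_Cn n (fill_in n (closed_form n chi) (polar n))"
    by (rule meromorphic_fill_in[OF A(1) polar_holomorphic z1 A(2)])
  fix z r assume z: "z \<in> Cn n" and r: "(\<forall>j\<in>{1..n}. 0 < r j) \<and> (\<forall>v. (\<forall>j\<in>{1..n}. norm (v j) = r j) --> (\<lambda>i. exp (z i), v) \<in> Omega n chi \<tau>)"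
  interpret torus_region \<tau> n chi z r
    by unfold_locales (use ord r in auto)
  show "fill_in n (closed_form n chi) (polar n) z = T_integral n r \<tau> z"
    unfolding T_integral_closed_form
    by (rule fill_in_eq[OF polar_holomorphic z1 z]) (auto intro: closed_form_tendsto)
qed

text \<open>\<open>T\<close> is chosen, and a candidate exists by the filled-in closed form. Any
  candidate equals the integral for an open set of z, hence agrees there with a quotient of entire
  functions with denominator \<open>polar\<close>, and this propagates to every regular
  point.\<close>

theorem T_eq_closed_form:
  assumes ord: "is_ordering n chi" and z: "z \<in> regular_points n \<tau>"
  shows "T n chi \<tau> z = closed_form n chi z"
proof -
  have isT: "is_T n chi \<tau> (T n chi \<tau>)" unfolding T_def by (rule someI[of "is_T n chi \<tau>"]) (rule is_T_fill_in[OF ord])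
  obtain A where A: "holomorphic_Cn n A UNIV" "\<And>z. z \<in> Cn n ==> polar n z \<noteq> 0 ==> closed_form n chi z = A z / polar n z"
    using closed_form_fraction[OF ord] by metis
  obtain z1 where z1: "z1 \<in> Cn n" "polar n z1 \<noteq> 0" using regular_point_exists by blast
  obtain z0 e s where z0: "z0 \<in> Cn n" "e > 0" "\<And>j. j \<in> {1..n} ==> s j > 0"
    "\<And>z v. z \<in> polydisc n z0 e ==> (\<forall>j\<in>{1..n}. norm (v j) = s j) ==> (\<lambda>i. exp (z i), v) \<in> Omega n chi \<tau>"
  proof (rule region_exists[OF ord], goal_cases)
    case (1 z0 e s)
    show ?case by (rule that[of z0 e s]; fact 1)
  qed
  obtain y d where y: "y \<in> polydisc n z0 e" "d > 0" "polydisc n y d \<subseteq> polydisc n z0 e" "\<And>x. x \<in> polydisc n y d ==> polar n x \<noteq> 0"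
  proof (rule entire_nonzero_dense[OF polar_holomorphic z1 z0(1,2)], goal_cases)
    case (1 y d)
    show ?case by (rule that[of y d]; fact 1)
  qed
  have zC: "z \<in> Cn n" using z by (simp add: regular_points_def)
  have pz: "polar n z \<noteq> 0" using polar_nonzero_iff[OF zC] z by blast
  have yC: "y \<in> Cn n" using y(1) by (simp add: polydisc_def)
  have eq: "T n chi \<tau> x * polar n x = A x" if x: "x \<in> polydisc n y d" for x
  proof -
    have xe: "x \<in> polydisc n z0 e" using x y(3) by blast
    have xC: "x \<in> Cn n" using x by (simp add: polydisc_def)
    interpret torus_region \<tau> n chi x s
      by unfold_locales (use ord z0(3) z0(4)[OF xe] in auto)
    have "T n chi \<tau> x = T_integral n s \<tau> x"
      using isT xC z0(3) z0(4)[OF xe] unfolding is_T_def by blast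
    also have "\<dots> = A x / polar n x" unfolding T_integral_closed_form by (rule A(2)[OF xC y(4)[OF x]])
    finally show ?thesis using y(4)[OF x] by simp
  qed
  have "T n chi \<tau> z = A z / polar n z"
    by (rule meromorphic_Cn_eq_fraction[OF _ A(1) polar_holomorphic yC y(2) eq zC pz])
       (use isT in \<open>simp_all add: is_T_def\<close>)
  thus ?thesis using A(2)[OF zC pz] by simp
qed

end

section \<open>The second Eisenstein series\<close>

lemma has_sum_int_split:
  fixes f :: "int => complex"
  assumes "((\<lambda>k::nat. f (int k)) has_sum a) UNIV" "((\<lambda>k::nat. f (- int k - 1)) has_sum b) UNIV"
  shows "(f has_sum (a + b)) UNIV"
proof -
  have 1: "(f has_sum a) (range int)"
    using assms(1) by (subst has_sum_reindex) (auto simp: o_def)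
  have 2: "(f has_sum b) (range (\<lambda>k::nat. - int k - 1))"
    using assms(2) by (subst has_sum_reindex) (auto simp: o_def inj_def)
  have 3: "range int \<union> range (\<lambda>k::nat. - int k - 1) = UNIV"
  proof (intro equalityI subsetI UNIV_I)
    fix x :: int
    show "x \<in> range int \<union> range (\<lambda>k::nat. - int k - 1)"
    proof (cases "x \<ge> 0")
      case True
      hence "x = int (nat x)" by simp
      thus ?thesis by blast
    next
      case False
      hence "x = - int (nat (- x - 1)) - 1" by simp
      thus ?thesis by blast
    qed
  qed
  have "(f has_sum (a + b)) (range int \<union> range (\<lambda>k::nat. - int k - 1))"
    by (rule has_sum_Un_disjoint[OF 1 2]) auto
  thus ?thesis by (simp only: 3)
qed

text \<open>Logarithmic derivative of the reflection formula for the Gamma function. Differentiated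
  once more, it sums 1/(a + z)^2 over all integers a.\<close>

lemma Digamma_reflection:
  assumes z: "(z::complex) \<notin> \<int>"
  shows "Digamma z - Digamma (1 - z) = - of_real pi * (cos (of_real pi * z) / sin (of_real pi * z))"
proof -
  have z1: "1 - z \<notin> \<int>" using z by (metis Ints_1 Ints_diff diff_diff_eq2 add_diff_cancel_left')
  have np: "z \<notin> \<int>\<^sub>\<le>\<^sub>0" "1 - z \<notin> \<int>\<^sub>\<le>\<^sub>0" using z z1 nonpos_Ints_subset_Ints by blast+
  have sn: "sin (of_real pi * z) \<noteq> 0"
  proof
    assume "sin (of_real pi * z) = 0"
    then obtain k :: int where "of_real pi * z = of_real (of_int k * pi)" unfolding sin_eq_0 by blast
    hence "z = of_int k" by simp
    thus False using z by simp
  qed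
  have d1: "((\<lambda>z. Gamma z * Gamma (1 - z)) has_field_derivative
      (Gamma z * Digamma z * Gamma (1 - z) - Gamma z * (Gamma (1 - z) * Digamma (1 - z)))) (at z)"
    by (rule derivative_eq_intros refl np | simp add: np)+
  have d2: "((\<lambda>z. of_real pi / sin (of_real pi * z)) has_field_derivative
      (- of_real pi * (of_real pi * cos (of_real pi * z)) / sin (of_real pi * z) ^ 2)) (at z)"
    by (rule derivative_eq_intros refl sn | simp add: sn power2_eq_square)+
  have "(\<lambda>z. Gamma z * Gamma (1 - z)) = (\<lambda>z::complex. of_real pi / sin (of_real pi * z))"
    by (intro ext Gamma_reflection_complex)
  hence "Gamma z * Digamma z * Gamma (1 - z) - Gamma z * (Gamma (1 - z) * Digamma (1 - z))
    = - of_real pi * (of_real pi * cos (of_real pi * z)) / sin (of_real pi * z) ^ 2"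
    using DERIV_unique[OF d1] d2 by simp
  hence "(Gamma z * Gamma (1 - z)) * (Digamma z - Digamma (1 - z)) = - of_real pi * (of_real pi * cos (of_real pi * z)) / sin (of_real pi * z) ^ 2"
    by (simp add: algebra_simps)
  hence "of_real pi / sin (of_real pi * z) * (Digamma z - Digamma (1 - z)) = of_real pi / sin (of_real pi * z) * (- of_real pi * (cos (of_real pi * z) / sin (of_real pi * z)))"
    unfolding Gamma_reflection_complex by (simp add: power2_eq_square)
  moreover have "of_real pi / sin (of_real pi * z) \<noteq> 0" using sn by simp
  ultimately show ?thesis unfolding mult_cancel_left by blast
qed

lemma Polygamma_1_reflection:
  assumes z: "(z::complex) \<notin> \<int>"
  shows "Polygamma 1 z + Polygamma 1 (1 - z) = of_real pi ^ 2 / sin (of_real pi * z) ^ 2"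
proof -
  have z1: "1 - z \<notin> \<int>" using z by (metis Ints_1 Ints_diff diff_diff_eq2 add_diff_cancel_left')
  have np: "z \<notin> \<int>\<^sub>\<le>\<^sub>0" "1 - z \<notin> \<int>\<^sub>\<le>\<^sub>0" using z z1 nonpos_Ints_subset_Ints by blast+
  have sn: "sin (of_real pi * z) \<noteq> 0"
  proof
    assume "sin (of_real pi * z) = 0"
    then obtain k :: int where "of_real pi * z = of_real (of_int k * pi)" unfolding sin_eq_0 by blast
    hence "z = of_int k" by simp
    thus False using z by simp
  qed
  have a: "(Polygamma 0 has_field_derivative Polygamma 1 z) (at z)" "(Polygamma 0 has_field_derivative Polygamma 1 (1 - z)) (at (1 - z))"
    using has_field_derivative_Polygamma[OF np(1), of 0] has_field_derivative_Polygamma[OF np(2), of 0] by simp_all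
  have "((\<lambda>z. Digamma (1 - z)) has_field_derivative Polygamma 1 (1 - z) * (0 - 1)) (at z)"
    by (rule DERIV_chain'[of "\<lambda>z. 1 - z", OF _ a(2)]) (intro derivative_intros)
  hence d1: "((\<lambda>z. Digamma z - Digamma (1 - z)) has_field_derivative (Polygamma 1 z - Polygamma 1 (1 - z) * (0 - 1))) (at z)"
    by (intro DERIV_diff a(1))
  have d2: "((\<lambda>z. - of_real pi * (cos (of_real pi * z) / sin (of_real pi * z))) has_field_derivative
     (- of_real pi * ((- sin (of_real pi * z) * of_real pi * sin (of_real pi * z) - cos (of_real pi * z) * (cos (of_real pi * z) * of_real pi)) / (sin (of_real pi * z) * sin (of_real pi * z))))) (at z)"
    by (rule derivative_eq_intros refl sn | simp add: sn)+
  have "open (- \<int> :: complex set)" by (simp add: open_Compl closed_Ints)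
  hence "((\<lambda>z. Digamma z - Digamma (1 - z)) has_field_derivative
     (- of_real pi * ((- sin (of_real pi * z) * of_real pi * sin (of_real pi * z) - cos (of_real pi * z) * (cos (of_real pi * z) * of_real pi)) / (sin (of_real pi * z) * sin (of_real pi * z))))) (at z)"
    by (rule has_field_derivative_transform_within_open[OF d2]) (use z Digamma_reflection in auto)
  hence "Polygamma 1 z - Polygamma 1 (1 - z) * (0 - 1)
    = - of_real pi * ((- sin (of_real pi * z) * of_real pi * sin (of_real pi * z) - cos (of_real pi * z) * (cos (of_real pi * z) * of_real pi)) / (sin (of_real pi * z) * sin (of_real pi * z)))"
    by (rule DERIV_unique[OF d1])
  also have "- sin (of_real pi * z) * of_real pi * sin (of_real pi * z) - cos (of_real pi * z) * (cos (of_real pi * z) * of_real pi)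
     = - of_real pi * (sin (of_real pi * z) ^ 2 + cos (of_real pi * z) ^ 2)"
    by algebra
  also have "sin (of_real pi * z) ^ 2 + cos (of_real pi * z) ^ 2 = 1" by (rule sin_cos_squared_add)
  finally show ?thesis by (simp add: power2_eq_square)
qed

lemma has_sum_inverse_squares_shift:
  assumes z: "(z::complex) \<notin> \<int>"
  shows "((\<lambda>k::nat. 1 / (of_nat k + z) ^ 2) has_sum Polygamma 1 z) UNIV"
proof (rule norm_summable_imp_has_sum)
  have z0: "z \<noteq> 0" using z by auto
  show "(\<lambda>k. 1 / (of_nat k + z) ^ 2) sums Polygamma 1 z"
    using Polygamma_LIMSEQ[OF z0, of 1] by (simp add: numeral_2_eq_2 inverse_eq_divide add.commute)
  show "summable (\<lambda>k. norm (1 / (of_nat k + z) ^ 2))"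
  proof (rule summable_comparison_test')
    show "summable (\<lambda>k. 4 * inverse (real k ^ 2))"
      by (intro summable_mult inverse_power_summable) simp
    fix k assume k: "k \<ge> nat \<lceil>2 * norm z\<rceil> + 1"
    hence k2: "2 * norm z \<le> real k" "k \<ge> 1" by linarith+
    have "real k \<le> norm (of_nat k + z) + norm z"
      using norm_triangle_ineq[of "of_nat k + z" "- z"] by simp
    hence "real k / 2 \<le> norm (of_nat k + z)" using k2 by simp
    hence "(real k / 2) ^ 2 \<le> norm (of_nat k + z) ^ 2" by (intro power_mono) auto
    moreover from this have "0 < norm (of_nat k + z)" using k2 \<open>real k / 2 \<le> norm (of_nat k + z)\<close> by linarith
    ultimately have "1 / norm (of_nat k + z) ^ 2 \<le> 1 / (real k / 2) ^ 2"
      using k2(2) by (intro divide_left_mono mult_pos_pos zero_less_power) auto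
    thus "norm (norm (1 / (of_nat k + z) ^ 2)) \<le> 4 * inverse (real k ^ 2)"
      by (simp add: norm_divide norm_power power_divide field_simps)
  qed
qed

lemma has_sum_int_inverse_squares:
  assumes z: "(z::complex) \<notin> \<int>"
  shows "((\<lambda>a::int. 1 / (of_int a + z) ^ 2) has_sum (of_real pi ^ 2 / sin (of_real pi * z) ^ 2)) UNIV"
proof -
  have z1: "1 - z \<notin> \<int>" using z by (metis Ints_1 Ints_diff diff_diff_eq2 add_diff_cancel_left')
  have "1 / (of_int (- int k - 1) + z) ^ 2 = 1 / (of_nat k + (1 - z)) ^ 2" for k
  proof -
    have "of_int (- int k - 1) + z = - (of_nat k + (1 - z))" by simp
    thus ?thesis by (simp only: power2_minus)
  qed
  hence "((\<lambda>k::nat. 1 / (of_int (- int k - 1) + z) ^ 2) has_sum Polygamma 1 (1 - z)) UNIV"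
    using has_sum_inverse_squares_shift[OF z1] by (simp only:)
  moreover have "((\<lambda>k::nat. 1 / (of_int (int k) + z) ^ 2) has_sum Polygamma 1 z) UNIV"
    using has_sum_inverse_squares_shift[OF z] by simp
  ultimately show ?thesis
    unfolding Polygamma_1_reflection[OF z, symmetric] by (intro has_sum_int_split)
qed

text \<open>The term a = 0 is 1/0 = 0, so this is twice the sum of the inverse squares.\<close>

lemma has_sum_int_inverse_squares_0:
  "((\<lambda>a::int. 1 / of_int a ^ 2 :: complex) has_sum (of_real pi ^ 2 / 3)) UNIV"
proof -
  have s: "(\<lambda>n. 1 / of_nat (Suc n) ^ 2 :: complex) sums (of_real pi ^ 2 / 6)"
    using sums_of_real[OF inverse_squares_sums, where ?'a = complex] by (simp add: add.commute)
  have "summable (\<lambda>n. 1 / real (Suc n) ^ 2)" using inverse_squares_sums by (simp add: sums_iff add.commute)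
  hence n: "summable (\<lambda>n. norm (1 / of_nat (Suc n) ^ 2 :: complex))" by (simp only: norm_divide norm_power norm_of_nat norm_one)
  have 2: "((\<lambda>k::nat. 1 / of_int (- int k - 1) ^ 2 :: complex) has_sum (of_real pi ^ 2 / 6)) UNIV"
  proof -
    have "1 / of_int (- int k - 1) ^ 2 = (1 / of_nat (Suc k) ^ 2 :: complex)" for k
    proof -
      have "of_int (- int k - 1) = - (of_nat (Suc k) :: complex)" by simp
      thus ?thesis by (simp only: power2_minus)
    qed
    thus ?thesis using norm_summable_imp_has_sum[OF n s] by (simp only:)
  qed
  have 1: "((\<lambda>k::nat. 1 / of_int (int k) ^ 2 :: complex) has_sum (of_real pi ^ 2 / 6)) UNIV"
  proof (rule norm_summable_imp_has_sum)
    show "summable (\<lambda>k. norm (1 / of_int (int k) ^ 2 :: complex))"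
      using n summable_Suc_iff[of "\<lambda>k. norm (1 / of_nat k ^ 2 :: complex)"] by simp
    show "(\<lambda>k. 1 / of_int (int k) ^ 2 :: complex) sums (of_real pi ^ 2 / 6)"
      using sums_Suc[of "\<lambda>k. 1 / of_nat k ^ 2 :: complex", OF s] by simp
  qed
  from has_sum_int_split[OF 1 2] show ?thesis by simp
qed

section \<open>The second Eisenstein series as a q-series, and the derivatives of theta at 0\<close>

context upper_half_plane
begin

text \<open>Eisenstein summation sums the rows first: for b > 0 the row is -1/(4 sin(pi \<tau> b)^2)
  = q^b/(1 - q^b)^2, the row of -b is the same, and the row b = 0 gives -1/12.\<close>

lemma eisenstein_2: "eisenstein 2 \<tau> = - 1 / 24 + (\<Sum>n. product_coeff n)"
proof -
  define F where "F = (\<lambda>b::int. \<Sum>\<^sub>\<infinity>a\<in>{a :: int. (a, b) \<noteq> (0, 0)}.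
        1 / (2 * of_real pi * \<i> * of_int a + 2 * of_real pi * \<i> * \<tau> * of_int b) ^ 2)"
  \<comment> \<open>The square of 1/(2 pi i), taken out of every term.\<close>
  define C where "C = - 1 / (4 * complex_of_real pi ^ 2)"
  have term_eq: "1 / (2 * of_real pi * \<i> * of_int a + 2 * of_real pi * \<i> * \<tau> * of_int b) ^ 2
     = C * (1 / (of_int a + \<tau> * of_int b) ^ 2)" for a b :: int
  proof -
    have "2 * of_real pi * \<i> * of_int a + 2 * of_real pi * \<i> * \<tau> * of_int b = (2 * of_real pi * \<i>) * (of_int a + \<tau> * of_int b)"
      by (simp add: algebra_simps)
    thus ?thesis by (simp add: power_mult_distrib C_def)
  qed
  have F0: "F 0 = - 1 / 12"
  proof -
    have "((\<lambda>a::int. C * (1 / of_int a ^ 2 :: complex)) has_sum (C * (of_real pi ^ 2 / 3))) UNIV"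
      by (intro has_sum_cmult_right has_sum_int_inverse_squares_0)
    hence "((\<lambda>a::int. C * (1 / of_int a ^ 2 :: complex)) has_sum (C * (of_real pi ^ 2 / 3))) {a. (a, 0::int) \<noteq> (0, 0)}"
      by (subst has_sum_cong_neutral[where T = UNIV and g = "\<lambda>a::int. C * (1 / of_int a ^ 2)"]) auto
    hence "F 0 = C * (of_real pi ^ 2 / 3)" unfolding F_def term_eq by (simp add: infsumI)
    thus ?thesis by (simp add: C_def)
  qed
  have Fsin: "F b = - 1 / (4 * sin (of_real pi * (\<tau> * of_int b)) ^ 2)" if "b \<noteq> 0" for b
  proof -
    have "Im (\<tau> * of_int b) \<noteq> 0" using Im_pos that by simp
    hence ni: "\<tau> * of_int b \<notin> \<int>" using complex_is_Int_iff by blast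
    have "((\<lambda>a::int. C * (1 / (of_int a + \<tau> * of_int b) ^ 2)) has_sum (C * (of_real pi ^ 2 / sin (of_real pi * (\<tau> * of_int b)) ^ 2))) UNIV"
      by (intro has_sum_cmult_right has_sum_int_inverse_squares ni)
    moreover have "{a :: int. (a, b) \<noteq> (0, 0)} = UNIV" using that by auto
    ultimately have "F b = C * (of_real pi ^ 2 / sin (of_real pi * (\<tau> * of_int b)) ^ 2)"
      unfolding F_def term_eq by (simp add: infsumI)
    thus ?thesis by (simp add: C_def)
  qed
  have F_Suc: "F (int (Suc k)) = product_coeff k" for k
  proof -
    define E where "E = exp (\<i> * (of_real pi * (\<tau> * of_int (int (Suc k)))))"
    have E0: "E \<noteq> 0" by (simp add: E_def)
    have "E ^ 2 = exp (of_nat (Suc k) * (2 * of_real pi * \<i> * \<tau>))"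
      by (simp add: E_def exp_double[symmetric] power2_eq_square exp_add[symmetric] algebra_simps)
    hence E2: "E ^ 2 = q ^ Suc k" by (simp only: nome_def exp_of_nat_mult)
    have Einv: "exp (- (\<i> * (of_real pi * (\<tau> * of_int (int (Suc k)))))) = 1 / E"
      by (simp only: E_def exp_minus inverse_eq_divide)
    have "sin (of_real pi * (\<tau> * of_int (int (Suc k)))) = (E - 1 / E) / (2 * \<i>)"
      by (simp only: sin_exp_eq Einv E_def[symmetric])
    hence "4 * sin (of_real pi * (\<tau> * of_int (int (Suc k)))) ^ 2 = - ((E - 1 / E) ^ 2)"
      by (simp add: power_divide power_mult_distrib)
    also have "(E - 1 / E) ^ 2 = (E ^ 2 - 1) ^ 2 / E ^ 2"
    proof -
      have "E - 1 / E = (E ^ 2 - 1) / E" using E0 by (simp add: field_simps power2_eq_square)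
      thus ?thesis by (simp only: power_divide)
    qed
    finally have s4: "4 * sin (of_real pi * (\<tau> * of_int (int (Suc k)))) ^ 2 = - ((E ^ 2 - 1) ^ 2 / E ^ 2)" .
    have "F (int (Suc k)) = E ^ 2 / (E ^ 2 - 1) ^ 2"
      using Fsin[of "int (Suc k)"] unfolding s4 by simp
    thus ?thesis unfolding E2 product_coeff_def by (simp add: power2_commute)
  qed
  have F_neg: "F (- b) = F b" for b
    by (cases "b = 0") (auto simp: Fsin)
  have pc: "summable (\<lambda>n. norm (product_coeff n))" "product_coeff sums (\<Sum>n. product_coeff n)"
    using summable_product_coeff summable_norm_cancel by (auto intro: summable_sums)
  have 2: "((\<lambda>k::nat. F (- int k - 1)) has_sum (\<Sum>n. product_coeff n)) UNIV"
  proof -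
    have "F (- int k - 1) = product_coeff k" for k
    proof -
      have "- int k - 1 = - int (Suc k)" by simp
      thus ?thesis using F_neg F_Suc by (simp only:)
    qed
    thus ?thesis using norm_summable_imp_has_sum[OF pc] by simp
  qed
  have 1: "((\<lambda>k::nat. F (int k)) has_sum ((\<Sum>n. product_coeff n) + F 0)) UNIV"
  proof (rule norm_summable_imp_has_sum)
    show "summable (\<lambda>k. norm (F (int k)))"
      using pc(1) summable_Suc_iff[of "\<lambda>k. norm (F (int k))"] unfolding F_Suc by simp
    show "(\<lambda>k. F (int k)) sums ((\<Sum>n. product_coeff n) + F 0)"
      using sums_Suc[of "\<lambda>k. F (int k)"] pc(2) unfolding F_Suc by simp
  qed
  have "infsum F UNIV = (\<Sum>n. product_coeff n) + F 0 + (\<Sum>n. product_coeff n)"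
    by (rule infsumI[OF has_sum_int_split[OF 1 2]])
  moreover have "eisenstein 2 \<tau> = 1/2 * infsum F UNIV" unfolding eisenstein_def F_def by simp
  ultimately have "eisenstein 2 \<tau> = 1/2 * ((\<Sum>n. product_coeff n) + - 1 / 12 + (\<Sum>n. product_coeff n))" by (simp only: F0)
  also have "\<dots> = - 1 / 24 + (\<Sum>n. product_coeff n)" by (simp add: field_simps)
  finally show ?thesis .
qed

lemma theta_deriv_even: "even k ==> (deriv ^^ k) \<theta> 0 = 0"
proof -
  assume k: "even k"
  have "(deriv ^^ k) (\<lambda>w. \<theta> (-1 * w)) 0 = (-1) ^ k * (deriv ^^ k) \<theta> (-1 * 0)"
    by (rule higher_deriv_compose_linear[OF theta_holomorphic open_UNIV open_UNIV]) auto
  moreover have "(\<lambda>w. \<theta> (-1 * w)) = (\<lambda>w. - \<theta> w)" by (auto simp: theta_uminus)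
  moreover have "(deriv ^^ k) (\<lambda>w. - \<theta> w) 0 = - (deriv ^^ k) \<theta> 0"
    by (rule higher_deriv_uminus[OF theta_holomorphic open_UNIV UNIV_I])
  ultimately show ?thesis using k by simp
qed

text \<open>Theta is S(z) p(u(z)) with p = \<open>prod_fun\<close> and u of order z^2, so its third
  derivative at 0 sees p to first order only: it is 1/4 + 6 p'(0), and p'(0) is minus the sum of
  coefficients that occurs in the Eisenstein series.\<close>

lemma theta_deriv_3: "(deriv ^^ 3) \<theta> 0 = - 6 * eisenstein 2 \<tau>"
proof -
  define p where "p = (\<lambda>k. (deriv ^^ k) prod_fun)"
  have p: "(p k has_field_derivative p (Suc k) w) (at w)" for k w
    unfolding p_def by (simp, rule holomorphic_derivI[OF holomorphic_higher_deriv[OF prod_fun_holomorphic open_UNIV] open_UNIV UNIV_I])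
  define u where "u = (\<lambda>z::complex. exp z + exp (- z) - 2)"
  define v where "v = (\<lambda>z::complex. exp z - exp (- z))"
  define S where "S = (\<lambda>z::complex. exp (z / 2) - exp (- z / 2))"
  define D where "D = (\<lambda>z::complex. (exp (z / 2) + exp (- z / 2)) / 2)"
  have du: "(u has_field_derivative v z) (at z)" for z
    unfolding u_def v_def by (rule derivative_eq_intros refl | simp)+
  have dv: "(v has_field_derivative (u z + 2)) (at z)" for z
    unfolding u_def v_def by (rule derivative_eq_intros refl | simp)+
  have dS: "(S has_field_derivative D z) (at z)" for z
    unfolding S_def D_def by (rule derivative_eq_intros refl | simp)+
  have dD: "(D has_field_derivative S z / 4) (at z)" for z
    unfolding S_def D_def by (rule derivative_eq_intros refl | simp add: field_simps)+
  have dp: "((\<lambda>z. p k (u z)) has_field_derivative p (Suc k) (u z) * v z) (at z)" for k z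
    by (rule DERIV_chain2[OF p du])
  have t0: "\<theta> = (\<lambda>z. S z * p 0 (u z))"
    by (rule ext) (simp add: theta_eq_theta_product theta_product_def S_def u_def p_def)
  have t1: "deriv \<theta> = (\<lambda>z. D z * p 0 (u z) + S z * (p 1 (u z) * v z))"
  proof
    fix z show "deriv \<theta> z = D z * p 0 (u z) + S z * (p 1 (u z) * v z)"
      unfolding t0 by (rule DERIV_imp_deriv, rule DERIV_cong[OF DERIV_mult[OF dS dp[of 0]]]) (simp add: mult_ac)
  qed
  have t2: "deriv (deriv \<theta>) = (\<lambda>z. S z / 4 * p 0 (u z) + 2 * (D z * (p 1 (u z) * v z)) + S z * (p 2 (u z) * v z * v z + p 1 (u z) * (u z + 2)))"
  proof
    fix z show "deriv (deriv \<theta>) z = S z / 4 * p 0 (u z) + 2 * (D z * (p 1 (u z) * v z)) + S z * (p 2 (u z) * v z * v z + p 1 (u z) * (u z + 2))"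
      unfolding t1
      by (rule DERIV_imp_deriv, rule DERIV_cong[OF DERIV_add[OF DERIV_mult[OF dD dp[of 0]] DERIV_mult[OF dS DERIV_mult[OF dp[of 1] dv]]]])
         (simp add: numeral_2_eq_2 algebra_simps)
  qed
  have val: "u 0 = 0" "v 0 = 0" "S 0 = 0" "D 0 = 1" by (simp_all add: u_def v_def S_def D_def)
  define W where "W = (\<lambda>z. p 2 (u z) * v z * v z + p 1 (u z) * (u z + 2))"
  have dW: "(W has_field_derivative (p 3 (u z) * v z * v z * v z + p 2 (u z) * (u z + 2) * v z + p 2 (u z) * v z * (u z + 2)
      + p 2 (u z) * v z * (u z + 2) + p 1 (u z) * v z)) (at z)" for z
    unfolding W_def
    by (rule DERIV_cong[OF DERIV_add[OF DERIV_mult[OF DERIV_mult[OF dp[of 2] dv] dv] DERIV_mult[OF dp[of 1] DERIV_add[OF du DERIV_const]]]])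
       (simp add: numeral_3_eq_3 numeral_2_eq_2 algebra_simps)
  have "((\<lambda>z. S z / 4 * p 0 (u z) + 2 * (D z * (p 1 (u z) * v z)) + S z * W z) has_field_derivative
      (1 / 4 * p 0 (u 0) + 2 * (p 1 (u 0) * (u 0 + 2)) + W 0)) (at 0)"
    by (rule DERIV_cong[OF DERIV_add[OF DERIV_add[OF DERIV_mult[OF DERIV_cdivide[OF dS, of 4] dp[of 0]]
        DERIV_cmult[OF DERIV_mult[OF dD DERIV_mult[OF dp[of 1] dv]], of 2]] DERIV_mult[OF dS dW]]]) (simp add: val)
  hence "deriv (deriv (deriv \<theta>)) 0 = 1 / 4 * p 0 (u 0) + 2 * (p 1 (u 0) * (u 0 + 2)) + W 0"
    unfolding t2 W_def by (rule DERIV_imp_deriv)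
  also have "\<dots> = 1 / 4 + 6 * deriv prod_fun 0" unfolding W_def val by (simp add: p_def)
  also have "\<dots> = - 6 * eisenstein 2 \<tau>" unfolding eisenstein_2 deriv_prod_fun_0 by (simp add: algebra_simps)
  finally show ?thesis by (simp add: numeral_3_eq_3)
qed

text \<open>Leibniz' rule for \<open>theta_recip t\<close> theta(t) = t, at order m + 1.\<close>

lemma theta_recip_deriv_rec:
  assumes "m \<ge> 1"
  shows "(deriv ^^ m) theta_recip 0
    = - (\<Sum>i<m. of_nat (Suc m choose i) * (deriv ^^ i) theta_recip 0 * (deriv ^^ (Suc m - i)) \<theta> 0) / of_nat (Suc m)"
proof -
  obtain r where r: "r > 0" "theta_recip holomorphic_on ball 0 r" "\<And>t. t \<in> ball 0 r ==> t \<noteq> 0 ==> \<theta> t \<noteq> 0"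
    using theta_recip_holomorphic by metis
  have 0: "0 \<in> ball (0::complex) r" using r by simp
  have "(deriv ^^ Suc m) (\<lambda>w. theta_recip w * \<theta> w) 0 = (deriv ^^ Suc m) (\<lambda>w. w) 0"
  proof (rule higher_deriv_transform_within_open[OF _ _ open_ball 0])
    show "(\<lambda>w. theta_recip w * \<theta> w) holomorphic_on ball 0 r" by (intro holomorphic_on_mult r(2) theta_holomorphic)
    show "theta_recip w * \<theta> w = w" if "w \<in> ball 0 r" for w using r(3)[OF that] by (auto simp: theta_recip_def theta_0)
  qed (intro holomorphic_intros)
  hence "(\<Sum>i = 0..Suc m. of_nat (Suc m choose i) * (deriv ^^ i) theta_recip 0 * (deriv ^^ (Suc m - i)) \<theta> 0) = 0"
    unfolding higher_deriv_mult[OF r(2) theta_holomorphic open_ball 0] higher_deriv_ident using assms by simp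
  moreover have "{0..Suc m} = insert (Suc m) (insert m {..<m})" by auto
  ultimately have "of_nat (Suc m) * (deriv ^^ m) theta_recip 0
     + (\<Sum>i<m. of_nat (Suc m choose i) * (deriv ^^ i) theta_recip 0 * (deriv ^^ (Suc m - i)) \<theta> 0) = 0"
    by (simp add: theta_0 deriv_theta_0 Suc_diff_le)
  hence "of_nat (Suc m) * (deriv ^^ m) theta_recip 0
     = - (\<Sum>i<m. of_nat (Suc m choose i) * (deriv ^^ i) theta_recip 0 * (deriv ^^ (Suc m - i)) \<theta> 0)"
    by (simp add: add_eq_0_iff2)
  moreover have "of_nat (Suc m) \<noteq> (0::complex)" by (simp del: of_nat_Suc)
  ultimately show ?thesis by (metis nonzero_mult_div_cancel_left)
qed

text \<open>The M-th derivative in t at 0 of the addition formula at (x, t), divided by theta(x)^2.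
  The derivative of order M + 1 at 0 enters through \<open>theta_hirota\<close>, twice from theta'^2
  and -M times from -theta theta'', with total factor 2 - M. This is 0 for M = 2, which is why the
  third derivative has to be found separately.\<close>

lemma theta_deriv_rec:
  assumes x: "\<theta> x \<noteq> 0" and M: "even M" "M \<ge> 4"
  shows "(deriv ^^ Suc M) \<theta> 0 = 1 / (2 - of_nat M) *
    ((\<Sum>k=0..M. (of_nat (M choose k) * (-1) ^ (M - k)) * (((deriv ^^ k) \<theta> x / \<theta> x) * ((deriv ^^ (M - k)) \<theta> x / \<theta> x)))
     + (\<Sum>k=1..M-1. of_nat (M choose k) * ((deriv ^^ k) \<theta> 0 * (deriv ^^ (M - k)) \<theta> 0))
         * (((deriv ^^ 1) \<theta> x / \<theta> x) * ((deriv ^^ 1) \<theta> x / \<theta> x) + (-1) * ((deriv ^^ 2) \<theta> x / \<theta> x))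
     + ((\<Sum>k=2..M. of_nat (M choose k) * ((deriv ^^ k) \<theta> 0 * (deriv ^^ (Suc (Suc M) - k)) \<theta> 0))
     + (-1) * (\<Sum>k=1..M-1. of_nat (M choose k) * ((deriv ^^ (Suc k)) \<theta> 0 * (deriv ^^ (Suc M - k)) \<theta> 0))))"
proof -
  let ?d = "\<lambda>k. (deriv ^^ k) \<theta>"
  have hol: "?d k holomorphic_on UNIV" for k by (rule deriv_theta_holomorphic)
  have h1: "deriv \<theta> holomorphic_on UNIV" "deriv (deriv \<theta>) holomorphic_on UNIV" using hol[of 1] hol[of 2] by (simp_all add: numeral_2_eq_2)
  have sh: "(deriv ^^ k) (deriv \<theta>) = ?d (Suc k)" "(deriv ^^ k) (deriv (deriv \<theta>)) = ?d (Suc (Suc k))" for k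
    by (simp_all add: funpow_swap1)
  have s1: "(deriv ^^ k) (\<lambda>t. \<theta> (1 * t + x)) 0 = 1 ^ k * ?d k (1 * 0 + x)" for k
    by (rule higher_deriv_compose_linear'[OF theta_holomorphic open_UNIV open_UNIV]) auto
  have s2: "(deriv ^^ k) (\<lambda>t. \<theta> (-1 * t + x)) 0 = (-1) ^ k * ?d k (-1 * 0 + x)" for k
    by (rule higher_deriv_compose_linear'[OF theta_holomorphic open_UNIV open_UNIV]) auto
  have hs: "(\<lambda>t. \<theta> (1 * t + x)) holomorphic_on UNIV" "(\<lambda>t. \<theta> (-1 * t + x)) holomorphic_on UNIV"
    by (rule holomorphic_on_compose[of "\<lambda>t. 1 * t + x" UNIV \<theta>, unfolded o_def], intro holomorphic_intros, rule theta_holomorphic)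
       (rule holomorphic_on_compose[of "\<lambda>t. -1 * t + x" UNIV \<theta>, unfolded o_def], intro holomorphic_intros, rule theta_holomorphic)
  have L: "(deriv ^^ M) (\<lambda>t. \<theta> (1 * t + x) * \<theta> (-1 * t + x)) 0 = (\<Sum>k=0..M. of_nat (M choose k) * ?d k x * ((-1) ^ (M - k) * ?d (M - k) x))"
    unfolding higher_deriv_mult[OF hs open_UNIV UNIV_I] s1 s2 by simp
  have H: "(deriv ^^ M) theta_hirota 0 = (\<Sum>k=0..M. of_nat (M choose k) * ?d (Suc k) 0 * ?d (Suc (M - k)) 0)
      - (\<Sum>k=0..M. of_nat (M choose k) * ?d k 0 * ?d (Suc (Suc (M - k))) 0)"
  proof -
    have "theta_hirota = (\<lambda>t. deriv \<theta> t * deriv \<theta> t - \<theta> t * deriv (deriv \<theta>) t)"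
      by (rule ext) (simp add: theta_hirota_def power2_eq_square)
    hence "(deriv ^^ M) theta_hirota 0 = (deriv ^^ M) (\<lambda>t. deriv \<theta> t * deriv \<theta> t) 0 - (deriv ^^ M) (\<lambda>t. \<theta> t * deriv (deriv \<theta>) t) 0"
      using higher_deriv_diff[OF holomorphic_on_mult[OF h1(1) h1(1)] holomorphic_on_mult[OF theta_holomorphic h1(2)] open_UNIV UNIV_I, of M 0]
      by simp
    thus ?thesis
      unfolding higher_deriv_mult[OF h1(1) h1(1) open_UNIV UNIV_I] higher_deriv_mult[OF theta_holomorphic h1(2) open_UNIV UNIV_I] sh .
  qed
  have Q: "(deriv ^^ M) (\<lambda>t. \<theta> t * \<theta> t) 0 = (\<Sum>k=0..M. of_nat (M choose k) * ?d k 0 * ?d (M - k) 0)"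
    by (rule higher_deriv_mult[OF theta_holomorphic theta_holomorphic open_UNIV UNIV_I])
  have add: "(\<lambda>t. \<theta> (1 * t + x) * \<theta> (-1 * t + x)) = (\<lambda>t. \<theta> x ^ 2 * theta_hirota t - theta_hirota x * (\<theta> t * \<theta> t))"
  proof
    fix t show "\<theta> (1 * t + x) * \<theta> (-1 * t + x) = \<theta> x ^ 2 * theta_hirota t - theta_hirota x * (\<theta> t * \<theta> t)"
      using theta_addition[of x t] by (simp add: add.commute power2_eq_square mult_ac)
  qed
  have "(deriv ^^ M) (\<lambda>t. \<theta> x ^ 2 * theta_hirota t - theta_hirota x * (\<theta> t * \<theta> t)) 0
     = (deriv ^^ M) (\<lambda>t. \<theta> x ^ 2 * theta_hirota t) 0 - (deriv ^^ M) (\<lambda>t. theta_hirota x * (\<theta> t * \<theta> t)) 0"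
    by (rule higher_deriv_diff[OF _ _ open_UNIV UNIV_I])
       (intro holomorphic_on_mult holomorphic_on_const theta_hirota_holomorphic theta_holomorphic)+
  also have "(deriv ^^ M) (\<lambda>t. \<theta> x ^ 2 * theta_hirota t) 0 = \<theta> x ^ 2 * (deriv ^^ M) theta_hirota 0"
    by (rule higher_deriv_cmult[OF theta_hirota_holomorphic UNIV_I open_UNIV])
  also have "(deriv ^^ M) (\<lambda>t. theta_hirota x * (\<theta> t * \<theta> t)) 0 = theta_hirota x * (deriv ^^ M) (\<lambda>t. \<theta> t * \<theta> t) 0"
    by (rule higher_deriv_cmult[OF _ UNIV_I open_UNIV]) (intro holomorphic_on_mult theta_holomorphic)
  finally have main: "(\<Sum>k=0..M. of_nat (M choose k) * ?d k x * ((-1) ^ (M - k) * ?d (M - k) x))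
     = \<theta> x ^ 2 * (deriv ^^ M) theta_hirota 0 - theta_hirota x * (\<Sum>k=0..M. of_nat (M choose k) * ?d k 0 * ?d (M - k) 0)"
    unfolding add[symmetric] L Q .
  define U where "U = (\<Sum>k=1..M-1. of_nat (M choose k) * (?d (Suc k) 0 * ?d (Suc M - k) 0))"
  define V where "V = (\<Sum>k=2..M. of_nat (M choose k) * (?d k 0 * ?d (Suc (Suc M) - k) 0))"
  have M1: "0 \<notin> {1..M-1}" "M \<notin> {1..M-1}" "0 \<notin> {2..M}" "1 \<notin> {2..M}" using M by auto
  have i1: "{0..M} = insert 0 (insert M {1..M-1})" using M by auto
  have i2: "{0..M} = insert 0 (insert 1 {2..M})" using M by auto
  have a: "(\<Sum>k=0..M. of_nat (M choose k) * ?d (Suc k) 0 * ?d (Suc (M - k)) 0) = 2 * ?d (Suc M) 0 + U"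
  proof -
    have "(\<Sum>k=0..M. of_nat (M choose k) * ?d (Suc k) 0 * ?d (Suc (M - k)) 0) = (\<Sum>k=0..M. of_nat (M choose k) * (?d (Suc k) 0 * ?d (Suc M - k) 0))"
      by (intro sum.cong refl) (simp add: Suc_diff_le del: funpow.simps)
    also have "\<dots> = ?d (Suc 0) 0 * ?d (Suc M) 0 + (?d (Suc M) 0 * ?d (Suc 0) 0 + U)"
      unfolding i1 U_def using M M1 by (simp add: Suc_diff_le del: funpow.simps)
    also have "?d (Suc 0) 0 = 1" by (simp add: deriv_theta_0)
    finally show ?thesis by simp
  qed
  have b: "(\<Sum>k=0..M. of_nat (M choose k) * ?d k 0 * ?d (Suc (Suc (M - k))) 0) = of_nat M * ?d (Suc M) 0 + V"
  proof -
    have "(\<Sum>k=0..M. of_nat (M choose k) * ?d k 0 * ?d (Suc (Suc (M - k))) 0) = (\<Sum>k=0..M. of_nat (M choose k) * (?d k 0 * ?d (Suc (Suc M) - k) 0))"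
      by (intro sum.cong refl) (simp add: Suc_diff_le del: funpow.simps)
    also have "\<dots> = ?d 0 0 * ?d (Suc (Suc M)) 0 + (of_nat M * (?d 1 0 * ?d (Suc M) 0) + V)"
      unfolding i2 V_def using M1 by (simp del: funpow.simps)
    also have "?d 0 0 = 0" by (simp add: theta_0)
    also have "?d 1 0 = 1" by (simp add: deriv_theta_0)
    finally show ?thesis by simp
  qed
  have c: "(\<Sum>k=0..M. of_nat (M choose k) * ?d k 0 * ?d (M - k) 0) = (\<Sum>k=1..M-1. of_nat (M choose k) * (?d k 0 * ?d (M - k) 0))"
    unfolding i1 using M M1 by (simp add: theta_0 mult.assoc)
  define P where "P = (\<Sum>k=1..M-1. of_nat (M choose k) * (?d k 0 * ?d (M - k) 0))"
  define LL where "LL = (\<Sum>k=0..M. (of_nat (M choose k) * (-1) ^ (M - k)) * ((?d k x / \<theta> x) * (?d (M - k) x / \<theta> x)))"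
  define hh where "hh = theta_hirota x / \<theta> x ^ 2"
  have "(\<Sum>k=0..M. of_nat (M choose k) * ?d k x * ((-1) ^ (M - k) * ?d (M - k) x)) = \<theta> x ^ 2 * LL"
    unfolding LL_def sum_distrib_left using x by (intro sum.cong refl) (simp add: field_simps power2_eq_square)
  hence "\<theta> x ^ 2 * LL = \<theta> x ^ 2 * ((2 * ?d (Suc M) 0 + U) - (of_nat M * ?d (Suc M) 0 + V)) - \<theta> x ^ 2 * (hh * P)"
    using main x unfolding H a b c P_def[symmetric] hh_def by simp
  hence "\<theta> x ^ 2 * LL = \<theta> x ^ 2 * ((2 * ?d (Suc M) 0 + U) - (of_nat M * ?d (Suc M) 0 + V) - hh * P)"
    by (simp only: right_diff_distrib)
  hence "LL = (2 * ?d (Suc M) 0 + U) - (of_nat M * ?d (Suc M) 0 + V) - hh * P" using x by simp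
  hence "(2 - of_nat M) * ?d (Suc M) 0 = LL + P * hh + (V + (-1) * U)" by (simp add: algebra_simps)
  moreover have "2 - of_nat M \<noteq> (0::complex)"
  proof
    assume "2 - of_nat M = (0::complex)"
    hence "of_nat M = (of_nat 2 :: complex)" by simp
    thus False using M unfolding of_nat_eq_iff by simp
  qed
  ultimately have "?d (Suc M) 0 = 1 / (2 - of_nat M) * (LL + P * hh + (V + (-1) * U))" by (simp add: field_simps)
  moreover have "hh = (?d 1 x / \<theta> x) * (?d 1 x / \<theta> x) + (-1) * (?d 2 x / \<theta> x)"
    using x by (simp add: hh_def theta_hirota_def field_simps power2_eq_square numeral_2_eq_2)
  ultimately show ?thesis unfolding LL_def P_def V_def U_def by (simp only:)
qed

end

section \<open>Quasi-elliptic functions\<close>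

text \<open>\<open>quasi_elliptic\<close> speaks of total functions, while identities such as
  theta/theta = 1 hold at regular points only; this closes it under equality there.\<close>

definition qell :: "nat => nat => (complex => (nat => complex) => complex) => bool" where
  "qell n m f \<longleftrightarrow> (\<exists>h. quasi_elliptic n m h \<and> (\<forall>\<tau> z. Im \<tau> > 0 --> z \<in> regular_points n \<tau> --> f \<tau> z = h \<tau> z))"

lemma qell_cong:
  "qell n m f ==> (\<And>\<tau> z. Im \<tau> > 0 ==> z \<in> regular_points n \<tau> ==> h \<tau> z = f \<tau> z) ==> qell n m h"
  unfolding qell_def by metis

lemma qell_zero: "qell n m (\<lambda>\<tau> z. 0)"
  unfolding qell_def using quasi_elliptic.zero by blast

lemma qell_const: "qell n 0 (\<lambda>\<tau> z. a)"
  unfolding qell_def using quasi_elliptic.const by blast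

lemma qell_add: "qell n m f ==> qell n m h ==> qell n m (\<lambda>\<tau> z. f \<tau> z + h \<tau> z)"
  unfolding qell_def
proof (elim exE conjE)
  fix f' h' assume "quasi_elliptic n m f'" "quasi_elliptic n m h'"
    "\<forall>\<tau> z. 0 < Im \<tau> --> z \<in> regular_points n \<tau> --> f \<tau> z = f' \<tau> z" "\<forall>\<tau> z. 0 < Im \<tau> --> z \<in> regular_points n \<tau> --> h \<tau> z = h' \<tau> z"
  thus "\<exists>k. quasi_elliptic n m k \<and> (\<forall>\<tau> z. 0 < Im \<tau> --> z \<in> regular_points n \<tau> --> f \<tau> z + h \<tau> z = k \<tau> z)"
    by (intro exI[of _ "\<lambda>\<tau> z. f' \<tau> z + h' \<tau> z"]) (auto intro: quasi_elliptic.add)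
qed

lemma qell_mult: "qell n m f ==> qell n l h ==> k = m + l ==> qell n k (\<lambda>\<tau> z. f \<tau> z * h \<tau> z)"
  unfolding qell_def
proof (elim exE conjE)
  fix f' h' assume k: "k = m + l" and "quasi_elliptic n m f'" "quasi_elliptic n l h'"
    "\<forall>\<tau> z. 0 < Im \<tau> --> z \<in> regular_points n \<tau> --> f \<tau> z = f' \<tau> z" "\<forall>\<tau> z. 0 < Im \<tau> --> z \<in> regular_points n \<tau> --> h \<tau> z = h' \<tau> z"
  thus "\<exists>h'. quasi_elliptic n k h' \<and> (\<forall>\<tau> z. 0 < Im \<tau> --> z \<in> regular_points n \<tau> --> f \<tau> z * h \<tau> z = h' \<tau> z)"
    unfolding k by (intro exI[of _ "\<lambda>\<tau> z. f' \<tau> z * h' \<tau> z"]) (auto intro: quasi_elliptic.mult)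
qed

lemma qell_cmult: "qell n m f ==> qell n m (\<lambda>\<tau> z. a * f \<tau> z)"
  by (rule qell_mult[OF qell_const]) auto

lemma qell_sum: "(\<And>i. i \<in> I ==> qell n m (f i)) ==> qell n m (\<lambda>\<tau> z. \<Sum>i\<in>I. f i \<tau> z)"
  by (induction I rule: infinite_finite_induct) (auto intro: qell_zero qell_add)

lemma qell_theta_ratio:
  assumes I: "I \<noteq> {}" "I \<subseteq> {1..n}"
  shows "qell n k (\<lambda>\<tau> z. (deriv ^^ k) (theta \<tau>) (\<Sum>i\<in>I. z i) / theta \<tau> (\<Sum>i\<in>I. z i))"
proof (cases "k = 0")
  case True
  have "(deriv ^^ k) (theta \<tau>) (\<Sum>i\<in>I. z i) / theta \<tau> (\<Sum>i\<in>I. z i) = 1" if "Im \<tau> > 0" "z \<in> regular_points n \<tau>" for \<tau> z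
  proof -
    interpret upper_half_plane \<tau> by unfold_locales (rule that)
    have "theta \<tau> (\<Sum>i\<in>I. z i) \<noteq> 0"
      using in_regular_not_lattice[OF that(2) I(2,1)] theta_eq_0_iff by blast
    thus ?thesis using True by simp
  qed
  thus ?thesis using True qell_cong[OF qell_const[of n 1]] by simp
next
  case False
  thus ?thesis using I unfolding qell_def
    by (intro exI[of _ "\<lambda>\<tau> z. (deriv ^^ k) (theta \<tau>) (\<Sum>i\<in>I. z i) / theta \<tau> (\<Sum>i\<in>I. z i)"]) (auto intro!: quasi_elliptic.theta)
qed

text \<open>The recursion is read at x = z_1, available because n is at least 1, and every term on
  its right has weight k - 1. Even orders vanish; orders 1 and 3 are the constant 1 and a multiple
  of the second Eisenstein series.\<close>

lemma qell_theta_deriv_0: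
  assumes n: "n \<ge> 1"
  shows "qell n (k - 1) (\<lambda>\<tau> z. (deriv ^^ k) (theta \<tau>) 0)"
proof (induction k rule: less_induct)
  case (less k)
  consider "even k" | "k = 1" | "k = 3" | "odd k" "k \<ge> 5"
  proof -
    have "even k \<or> k = 1 \<or> k = 3 \<or> (odd k \<and> k \<ge> 5)" by presburger
    thus ?thesis using that by blast
  qed
  thus ?case
  proof cases
    case 1
    have "(deriv ^^ k) (theta \<tau>) 0 = 0" if "Im \<tau> > 0" for \<tau>
      by (rule upper_half_plane.theta_deriv_even[OF upper_half_plane.intro[OF that] 1])
    thus ?thesis by (intro qell_cong[OF qell_zero]) auto
  next
    case 2
    have "(deriv ^^ 1) (theta \<tau>) 0 = 1" if "Im \<tau> > 0" for \<tau>
      using upper_half_plane.deriv_theta_0[OF upper_half_plane.intro[OF that]] by simp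
    hence "qell n 0 (\<lambda>\<tau> z. (deriv ^^ 1) (theta \<tau>) 0)" by (intro qell_cong[OF qell_const[of n 1]]) auto
    thus ?thesis unfolding 2 by simp
  next
    case 3
    have "(deriv ^^ k) (theta \<tau>) 0 = - 6 * eisenstein 2 \<tau>" if "Im \<tau> > 0" for \<tau>
      using upper_half_plane.theta_deriv_3[OF upper_half_plane.intro[OF that]] 3 by simp
    moreover have "qell n 2 (\<lambda>\<tau> z. eisenstein 2 \<tau>)"
      unfolding qell_def by (intro exI[of _ "\<lambda>\<tau> z. eisenstein 2 \<tau>"]) (auto intro: quasi_elliptic.eisenstein)
    moreover have "k - 1 = 2" using 3 by simp
    ultimately show ?thesis by (simp only:) (rule qell_cong[OF qell_cmult[of n 2 "\<lambda>\<tau> z. eisenstein 2 \<tau>" "- 6"]], auto)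
  next
    case 4
    define M where "M = k - 1"
    have k: "k = Suc M" and M: "even M" "M \<ge> 4" using 4 by (auto simp: M_def)
    have I: "{1} \<noteq> {}" "{1} \<subseteq> {1..n}" using n by auto
    have rat: "qell n j (\<lambda>\<tau> z. (deriv ^^ j) (theta \<tau>) (z 1) / theta \<tau> (z 1))" for j
      using qell_theta_ratio[OF I, of j] by simp
    have IH: "qell n (j - 1) (\<lambda>\<tau> z. (deriv ^^ j) (theta \<tau>) 0)" if "j \<le> M" for j
      by (rule less.IH) (use that k in simp)
    have 1: "qell n M (\<lambda>\<tau> z. \<Sum>k=0..M. (of_nat (M choose k) * (-1) ^ (M - k)) *
      (((deriv ^^ k) (theta \<tau>) (z 1) / theta \<tau> (z 1)) * ((deriv ^^ (M - k)) (theta \<tau>) (z 1) / theta \<tau> (z 1))))"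
      by (rule qell_sum, rule qell_cmult, rule qell_mult[OF rat rat]) auto
    have 2: "qell n (M - 2) (\<lambda>\<tau> z. \<Sum>k=1..M-1. of_nat (M choose k) * ((deriv ^^ k) (theta \<tau>) 0 * (deriv ^^ (M - k)) (theta \<tau>) 0))"
      by (rule qell_sum, rule qell_cmult, rule qell_mult[OF IH IH]) auto
    have 3: "qell n 2 (\<lambda>\<tau> z. ((deriv ^^ 1) (theta \<tau>) (z 1) / theta \<tau> (z 1)) * ((deriv ^^ 1) (theta \<tau>) (z 1) / theta \<tau> (z 1))
       + (-1) * ((deriv ^^ 2) (theta \<tau>) (z 1) / theta \<tau> (z 1)))"
      by (rule qell_add, rule qell_mult[OF rat rat], simp, rule qell_cmult, rule rat)
    have 4: "qell n M (\<lambda>\<tau> z. \<Sum>k=2..M. of_nat (M choose k) * ((deriv ^^ k) (theta \<tau>) 0 * (deriv ^^ (Suc (Suc M) - k)) (theta \<tau>) 0))"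
      by (rule qell_sum, rule qell_cmult, rule qell_mult[OF IH IH]) auto
    have 5: "qell n M (\<lambda>\<tau> z. \<Sum>k=1..M-1. of_nat (M choose k) * ((deriv ^^ (Suc k)) (theta \<tau>) 0 * (deriv ^^ (Suc M - k)) (theta \<tau>) 0))"
      by (rule qell_sum, rule qell_cmult, rule qell_mult[OF IH IH]) auto
    note all = qell_cmult[OF qell_add[OF qell_add[OF 1 qell_mult[OF 2 3]] qell_add[OF 4 qell_cmult[OF 5]]], of "1 / (2 - of_nat M)" "- 1"]
    show ?thesis
      unfolding k diff_Suc_1
    proof (rule qell_cong[OF all])
      show "M = M - 2 + 2" using M by simp
      fix \<tau> :: complex and z assume \<tau>: "Im \<tau> > 0" and z: "z \<in> regular_points n \<tau>"
      interpret upper_half_plane \<tau> by unfold_locales (rule \<tau>)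
      have "theta \<tau> (z 1) \<noteq> 0"
        using in_regular_not_lattice[OF z I(2,1)] theta_eq_0_iff by simp
      from theta_deriv_rec[OF this M]
      show "(deriv ^^ Suc M) (theta \<tau>) 0 = 1 / (2 - of_nat M) *
    ((\<Sum>k=0..M. (of_nat (M choose k) * (-1) ^ (M - k)) * (((deriv ^^ k) (theta \<tau>) (z 1) / theta \<tau> (z 1)) * ((deriv ^^ (M - k)) (theta \<tau>) (z 1) / theta \<tau> (z 1))))
     + (\<Sum>k=1..M-1. of_nat (M choose k) * ((deriv ^^ k) (theta \<tau>) 0 * (deriv ^^ (M - k)) (theta \<tau>) 0))
         * (((deriv ^^ 1) (theta \<tau>) (z 1) / theta \<tau> (z 1)) * ((deriv ^^ 1) (theta \<tau>) (z 1) / theta \<tau> (z 1)) + (-1) * ((deriv ^^ 2) (theta \<tau>) (z 1) / theta \<tau> (z 1)))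
     + ((\<Sum>k=2..M. of_nat (M choose k) * ((deriv ^^ k) (theta \<tau>) 0 * (deriv ^^ (Suc (Suc M) - k)) (theta \<tau>) 0))
     + (- 1) * (\<Sum>k=1..M-1. of_nat (M choose k) * ((deriv ^^ (Suc k)) (theta \<tau>) 0 * (deriv ^^ (Suc M - k)) (theta \<tau>) 0))))" .
    qed
  qed
qed

lemma qell_theta_recip:
  assumes n: "n \<ge> 1"
  shows "qell n m (\<lambda>\<tau> z. (deriv ^^ m) (upper_half_plane.theta_recip \<tau>) 0)"
proof (induction m rule: less_induct)
  case (less m)
  show ?case
  proof (cases "m = 0")
    case True
    have "(deriv ^^ m) (upper_half_plane.theta_recip \<tau>) 0 = 1" if "Im \<tau> > 0" for \<tau>
      using upper_half_plane.theta_recip_def[OF upper_half_plane.intro[OF that]] True by simp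
    thus ?thesis unfolding True by (intro qell_cong[OF qell_const[of n 1]]) auto
  next
    case False
    have "qell n m (\<lambda>\<tau> z. (- 1 / of_nat (Suc m)) * (\<Sum>i<m. of_nat (Suc m choose i) *
        ((deriv ^^ i) (upper_half_plane.theta_recip \<tau>) 0 * (deriv ^^ (Suc m - i)) (theta \<tau>) 0)))"
      by (rule qell_cmult, rule qell_sum, rule qell_cmult, rule qell_mult[OF less.IH qell_theta_deriv_0[OF n]]) auto
    thus ?thesis
    proof (rule qell_cong)
      fix \<tau> :: complex and z assume "Im \<tau> > 0"
      then interpret upper_half_plane \<tau> by unfold_locales
      show "(deriv ^^ m) theta_recip 0 = (- 1 / of_nat (Suc m)) * (\<Sum>i<m. of_nat (Suc m choose i) *
        ((deriv ^^ i) theta_recip 0 * (deriv ^^ (Suc m - i)) (theta \<tau>) 0))"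
        using theta_recip_deriv_rec[of m] False by (simp add: mult.assoc del: of_nat_Suc)
    qed
  qed
qed

definition block_taylor where
  "block_taylor \<tau> z S = upper_half_plane.taylor \<tau> (card S - 1) (\<Sum>i\<in>S. z i)"

lemma qell_taylor:
  assumes n: "n \<ge> 1" and I: "I \<noteq> {}" "I \<subseteq> {1..n}"
  shows "qell n (Suc j) (\<lambda>\<tau> z. upper_half_plane.taylor \<tau> j (\<Sum>i\<in>I. z i))"
proof -
  have "qell n (Suc j) (\<lambda>\<tau> z. (1 / of_nat (Suc j)) * (\<Sum>i\<le>Suc j. of_nat (Suc j choose i) *
     ((deriv ^^ i) (upper_half_plane.theta_recip \<tau>) 0 * ((deriv ^^ (Suc j - i)) (theta \<tau>) (\<Sum>i\<in>I. z i) / theta \<tau> (\<Sum>i\<in>I. z i)))))"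
    by (rule qell_cmult, rule qell_sum, rule qell_cmult, rule qell_mult[OF qell_theta_recip[OF n] qell_theta_ratio[OF I]]) auto
  thus ?thesis
  proof (rule qell_cong)
    fix \<tau> :: complex and z :: "nat => complex" assume "Im \<tau> > 0"
    then interpret upper_half_plane \<tau> by unfold_locales
    show "taylor j (\<Sum>i\<in>I. z i) = (1 / of_nat (Suc j)) * (\<Sum>i\<le>Suc j. of_nat (Suc j choose i) *
     ((deriv ^^ i) theta_recip 0 * ((deriv ^^ (Suc j - i)) (theta \<tau>) (\<Sum>i\<in>I. z i) / theta \<tau> (\<Sum>i\<in>I. z i))))"
      unfolding taylor_def by (simp only: mult.assoc) simp
  qed
qed

section \<open>Calculus of leading parts\<close>

definition lower_weight :: "nat => nat => (complex => (nat => complex) => complex) => bool" where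
  "lower_weight n m f \<longleftrightarrow> (\<exists>e. (\<forall>k. qell n k (e k)) \<and>
     (\<forall>\<tau> z. Im \<tau> > 0 --> z \<in> regular_points n \<tau> --> f \<tau> z = (\<Sum>k<m. e k \<tau> z)))"

lemma lower_weight_cong:
  "lower_weight n m f ==> (\<And>\<tau> z. Im \<tau> > 0 ==> z \<in> regular_points n \<tau> ==> h \<tau> z = f \<tau> z) ==> lower_weight n m h"
  unfolding lower_weight_def by metis

lemma lower_weight_zero: "lower_weight n m (\<lambda>\<tau> z. 0)"
  unfolding lower_weight_def by (intro exI[of _ "\<lambda>k \<tau> z. 0"]) (auto intro: qell_zero)

lemma lower_weight_qell:
  assumes "qell n k f" "k < m"
  shows "lower_weight n m f"
proof -
  have "qell n j (\<lambda>\<tau> z. if j = k then f \<tau> z else 0)" for j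
    using assms(1) by (cases "j = k") (simp_all add: qell_zero)
  thus ?thesis using assms(2) unfolding lower_weight_def
    by (intro exI[of _ "\<lambda>j \<tau> z. if j = k then f \<tau> z else 0"]) auto
qed

lemma lower_weight_add: "lower_weight n m f ==> lower_weight n m h ==> lower_weight n m (\<lambda>\<tau> z. f \<tau> z + h \<tau> z)"
  unfolding lower_weight_def
proof (elim exE conjE)
  fix e e' assume "\<forall>k. qell n k (e k)" "\<forall>k. qell n k (e' k)"
    "\<forall>\<tau> z. 0 < Im \<tau> --> z \<in> regular_points n \<tau> --> f \<tau> z = (\<Sum>k<m. e k \<tau> z)" "\<forall>\<tau> z. 0 < Im \<tau> --> z \<in> regular_points n \<tau> --> h \<tau> z = (\<Sum>k<m. e' k \<tau> z)"
  thus "\<exists>e. (\<forall>k. qell n k (e k)) \<and> (\<forall>\<tau> z. 0 < Im \<tau> --> z \<in> regular_points n \<tau> --> f \<tau> z + h \<tau> z = (\<Sum>k<m. e k \<tau> z))"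
    by (intro exI[of _ "\<lambda>k \<tau> z. e k \<tau> z + e' k \<tau> z"]) (auto intro: qell_add simp: sum.distrib)
qed

lemma lower_weight_sum: "(\<And>i. i \<in> I ==> lower_weight n m (f i)) ==> lower_weight n m (\<lambda>\<tau> z. \<Sum>i\<in>I. f i \<tau> z)"
  by (induction I rule: infinite_finite_induct) (auto intro: lower_weight_zero lower_weight_add)

lemma lower_weight_mult_qell:
  assumes "lower_weight n m f" "qell n l h" "m + l \<le> k"
  shows "lower_weight n k (\<lambda>\<tau> z. f \<tau> z * h \<tau> z)"
proof -
  obtain e where e: "\<And>k. qell n k (e k)" "\<And>\<tau> z. Im \<tau> > 0 ==> z \<in> regular_points n \<tau> ==> f \<tau> z = (\<Sum>k<m. e k \<tau> z)"
    using assms(1) unfolding lower_weight_def by metis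
  have "lower_weight n k (\<lambda>\<tau> z. \<Sum>j<m. e j \<tau> z * h \<tau> z)"
  proof (rule lower_weight_sum)
    fix j assume "j \<in> {..<m}"
    thus "lower_weight n k (\<lambda>\<tau> z. e j \<tau> z * h \<tau> z)"
      using assms(3) by (intro lower_weight_qell[OF qell_mult[OF e(1) assms(2) refl]]) simp
  qed
  thus ?thesis by (rule lower_weight_cong) (simp add: e(2) sum_distrib_right)
qed

lemma lower_weight_mult:
  assumes "lower_weight n m f" "lower_weight n l h"
  shows "lower_weight n (m + l) (\<lambda>\<tau> z. f \<tau> z * h \<tau> z)"
proof -
  obtain e where e: "\<And>k. qell n k (e k)" "\<And>\<tau> z. Im \<tau> > 0 ==> z \<in> regular_points n \<tau> ==> f \<tau> z = (\<Sum>k<m. e k \<tau> z)"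
    using assms(1) unfolding lower_weight_def by metis
  have "lower_weight n (m + l) (\<lambda>\<tau> z. \<Sum>j<m. h \<tau> z * e j \<tau> z)"
    by (rule lower_weight_sum, rule lower_weight_mult_qell[OF assms(2) e(1)]) auto
  thus ?thesis by (rule lower_weight_cong) (simp add: e(2) sum_distrib_left mult.commute)
qed

text \<open>L may be 0 here, so that sums and products need no case distinction; nonvanishing is
  shown once, for the final leading part.\<close>

definition leading :: "nat => nat => (complex => (nat => complex) => complex) => (complex => (nat => complex) => complex) => bool" where
  "leading n m f L \<longleftrightarrow> qell n m L \<and> lower_weight n m (\<lambda>\<tau> z. f \<tau> z - L \<tau> z)"

lemma leading_cong:
  assumes "leading n m f L" "\<And>\<tau> z. Im \<tau> > 0 ==> z \<in> regular_points n \<tau> ==> f' \<tau> z = f \<tau> z"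
    "\<And>\<tau> z. Im \<tau> > 0 ==> z \<in> regular_points n \<tau> ==> L' \<tau> z = L \<tau> z"
  shows "leading n m f' L'"
  using assms unfolding leading_def by (auto intro: qell_cong lower_weight_cong)

lemma leading_const: "leading n 0 (\<lambda>\<tau> z. a) (\<lambda>\<tau> z. a)"
  by (simp add: leading_def qell_const lower_weight_zero)

lemma leading_lower: "lower_weight n m f ==> leading n m f (\<lambda>\<tau> z. 0)"
  by (simp add: leading_def qell_zero)

lemma lower_weight_mono: "lower_weight n l f ==> l \<le> m ==> lower_weight n m f"
  using lower_weight_mult_qell[OF _ qell_const[of n 1], of l f m] by simp

lemma leading_imp_lower: "leading n l f L ==> l < m ==> lower_weight n m f"
proof -
  assume a: "leading n l f L" "l < m"
  have "lower_weight n m (\<lambda>\<tau> z. (f \<tau> z - L \<tau> z) + L \<tau> z)"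
    using a by (intro lower_weight_add lower_weight_qell[of n l L]) (auto simp: leading_def intro: lower_weight_mono)
  thus ?thesis by simp
qed

lemma leading_add:
  assumes "leading n m f L" "leading n m h K"
  shows "leading n m (\<lambda>\<tau> z. f \<tau> z + h \<tau> z) (\<lambda>\<tau> z. L \<tau> z + K \<tau> z)"
proof -
  have "lower_weight n m (\<lambda>\<tau> z. (f \<tau> z - L \<tau> z) + (h \<tau> z - K \<tau> z))"
    using assms by (intro lower_weight_add) (auto simp: leading_def)
  hence "lower_weight n m (\<lambda>\<tau> z. (f \<tau> z + h \<tau> z) - (L \<tau> z + K \<tau> z))" by (rule lower_weight_cong) simp
  thus ?thesis using assms by (simp add: leading_def qell_add)
qed

lemma leading_mult:
  assumes "leading n m f L" "leading n l h K" "k = m + l"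
  shows "leading n k (\<lambda>\<tau> z. f \<tau> z * h \<tau> z) (\<lambda>\<tau> z. L \<tau> z * K \<tau> z)"
proof -
  have a: "qell n m L" "qell n l K" "lower_weight n m (\<lambda>\<tau> z. f \<tau> z - L \<tau> z)" "lower_weight n l (\<lambda>\<tau> z. h \<tau> z - K \<tau> z)"
    using assms by (auto simp: leading_def)
  have "lower_weight n (m + l) (\<lambda>\<tau> z. (f \<tau> z - L \<tau> z) * (h \<tau> z - K \<tau> z) + ((f \<tau> z - L \<tau> z) * K \<tau> z + (h \<tau> z - K \<tau> z) * L \<tau> z))"
    by (intro lower_weight_add lower_weight_mult a lower_weight_mult_qell[OF a(3,2)] lower_weight_mult_qell[OF a(4,1)]) auto
  hence "lower_weight n k (\<lambda>\<tau> z. f \<tau> z * h \<tau> z - L \<tau> z * K \<tau> z)"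
    unfolding assms(3) by (rule lower_weight_cong) (simp add: algebra_simps)
  thus ?thesis using qell_mult[OF a(1,2) assms(3)] by (simp add: leading_def)
qed

lemma leading_cmult: "leading n m f L ==> leading n m (\<lambda>\<tau> z. a * f \<tau> z) (\<lambda>\<tau> z. a * L \<tau> z)"
  by (rule leading_mult[OF leading_const]) auto

lemma leading_sum:
  "(\<And>i. i \<in> I ==> leading n m (f i) (L i)) ==> leading n m (\<lambda>\<tau> z. \<Sum>i\<in>I. f i \<tau> z) (\<lambda>\<tau> z. \<Sum>i\<in>I. L i \<tau> z)"
  by (induction I rule: infinite_finite_induct) (auto intro: leading_add leading_lower lower_weight_zero)

lemma leading_prod:
  "finite I ==> (\<And>i. i \<in> I ==> leading n (w i) (f i) (L i)) ==>
    leading n (\<Sum>i\<in>I. w i) (\<lambda>\<tau> z. \<Prod>i\<in>I. f i \<tau> z) (\<lambda>\<tau> z. \<Prod>i\<in>I. L i \<tau> z)"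
proof (induction I rule: finite_induct)
  case empty
  show ?case by (simp add: leading_const)
next
  case (insert x I)
  have "leading n (w x + sum w I) (\<lambda>\<tau> z. f x \<tau> z * (\<Prod>i\<in>I. f i \<tau> z)) (\<lambda>\<tau> z. L x \<tau> z * (\<Prod>i\<in>I. L i \<tau> z))"
    by (rule leading_mult[OF insert.prems insert.IH refl]) (use insert.prems in auto)
  thus ?case using insert.hyps by simp
qed

text \<open>With b = |S|, only the Taylor coefficient of order b - 1 has weight b, and its factor
  1/(b-1)! does not depend on a. This is where independence of the ordering originates.\<close>

lemma leading_g_taylor:
  assumes n: "n \<ge> 1" and S: "S \<subseteq> {1..n}" "S \<noteq> {}" and a: "a \<le> card S"
  shows "leading n (card S) (\<lambda>\<tau> z. upper_half_plane.g_taylor \<tau> (card S) a (\<Sum>i\<in>S. z i))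
    (\<lambda>\<tau> z. - ((-1) ^ card S) / fact (card S - 1) * block_taylor \<tau> z S)"
proof -
  have f: "finite S" using S(1) finite_subset by auto
  hence "card S \<ge> 1" using S(2) by (simp add: Suc_le_eq card_gt_0_iff)
  then obtain b where b: "card S = Suc b" by (cases "card S") auto
  have t: "qell n (Suc j) (\<lambda>\<tau> z. upper_half_plane.taylor \<tau> j (\<Sum>i\<in>S. z i))" for j
    by (rule qell_taylor[OF n S(2,1)])
  have "lower_weight n (Suc b) (\<lambda>\<tau> z. g_const (Suc b) a + (\<Sum>j<b. (- ((-1) ^ Suc b) * geom_coeff (Suc b) a j) * upper_half_plane.taylor \<tau> j (\<Sum>i\<in>S. z i)))"
  proof (intro lower_weight_add lower_weight_sum)
    show "lower_weight n (Suc b) (\<lambda>\<tau> z. g_const (Suc b) a)" by (rule lower_weight_qell[OF qell_const]) simp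
    show "lower_weight n (Suc b) (\<lambda>\<tau> z. (- ((-1) ^ Suc b) * geom_coeff (Suc b) a j) * upper_half_plane.taylor \<tau> j (\<Sum>i\<in>S. z i))"
      if "j \<in> {..<b}" for j by (rule lower_weight_qell[OF qell_cmult[OF t]]) (use that in simp)
  qed
  hence "lower_weight n (Suc b) (\<lambda>\<tau> z. upper_half_plane.g_taylor \<tau> (Suc b) a (\<Sum>i\<in>S. z i) - (- ((-1) ^ Suc b) / fact b * upper_half_plane.taylor \<tau> b (\<Sum>i\<in>S. z i)))"
  proof (rule lower_weight_cong)
    fix \<tau> :: complex and z :: "nat => complex" assume "Im \<tau> > 0"
    then interpret upper_half_plane \<tau> by unfold_locales
    have gc: "geom_coeff (Suc b) a b = 1 / fact b" using geom_coeff(1)[of "Suc b" a] a b by simp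
    show "g_taylor (Suc b) a (\<Sum>i\<in>S. z i) - (- ((-1) ^ Suc b) / fact b * taylor b (\<Sum>i\<in>S. z i))
      = g_const (Suc b) a + (\<Sum>j<b. (- ((-1) ^ Suc b) * geom_coeff (Suc b) a j) * taylor j (\<Sum>i\<in>S. z i))"
      unfolding g_taylor_def lessThan_Suc by (simp add: gc algebra_simps sum_distrib_left sum_negf)
  qed
  thus ?thesis using qell_cmult[OF t[of b], of "(-1) ^ b / fact b"] unfolding leading_def b block_taylor_def by simp
qed

text \<open>All |S|! sequences have the same leading part; with b = |S| the constants (-1)^(b-1)/b,
  b! and -(-1)^b/(b-1)! multiply to 1.\<close>

lemma leading_block_term:
  assumes n: "n \<ge> 1" and ord: "is_ordering n chi" and S: "S \<subseteq> {1..n}" "S \<noteq> {}"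
  shows "leading n (card S) (\<lambda>\<tau> z. block_term chi \<tau> (\<lambda>i. exp (z i)) S) (\<lambda>\<tau> z. block_taylor \<tau> z S)"
proof -
  have f: "finite S" using S(1) finite_subset by auto
  hence "card S \<ge> 1" using S(2) by (simp add: Suc_le_eq card_gt_0_iff)
  then obtain b where b: "card S = Suc b" by (cases "card S") auto
  have "leading n (card S) (\<lambda>\<tau> z. (-1) ^ (card S - 1) / of_nat (card S) *
      (\<Sum>K\<in>permutations_of_set S. upper_half_plane.g_taylor \<tau> (card S) (chi_seq chi K) (\<Sum>i\<in>S. z i)))
    (\<lambda>\<tau> z. (-1) ^ (card S - 1) / of_nat (card S) * (\<Sum>K\<in>permutations_of_set S. - ((-1) ^ card S) / fact (card S - 1) * block_taylor \<tau> z S))"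
    by (intro leading_cmult leading_sum leading_g_taylor[OF n S] chi_seq_le[OF ord]) (use S in auto)
  thus ?thesis
  proof (rule leading_cong)
    fix \<tau> :: complex and z assume \<tau>: "Im \<tau> > 0" and z: "z \<in> regular_points n \<tau>"
    interpret upper_half_plane \<tau> by unfold_locales (rule \<tau>)
    have "0 \<notin> S" using S by auto
    thus "block_term chi \<tau> (\<lambda>i. exp (z i)) S = (-1) ^ (card S - 1) / of_nat (card S) *
      (\<Sum>K\<in>permutations_of_set S. g_taylor (card S) (chi_seq chi K) (\<Sum>i\<in>S. z i))"
      using G_eq_taylor[OF ord S z] by (auto simp: block_term_def)
    have e: "(-1) ^ b * (-1) ^ b = (1 :: complex)" by (simp add: power_mult_distrib[symmetric])
    have "(fact (Suc b) :: complex) = of_nat (Suc b) * fact b" by (simp add: fact_Suc)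
    moreover have "of_nat (Suc b) \<noteq> (0::complex)" by (simp del: of_nat_Suc)
    ultimately have "(-1) ^ b / of_nat (Suc b) * (fact (Suc b) * ((-1) ^ b / fact b * x)) = ((-1) ^ b * (-1) ^ b) * x" for x :: complex
      by (simp del: of_nat_Suc fact_Suc)
    thus "block_taylor \<tau> z S = (-1) ^ (card S - 1) / of_nat (card S) * (\<Sum>K\<in>permutations_of_set S. - ((-1) ^ card S) / fact (card S - 1) * block_taylor \<tau> z S)"
      using f unfolding e by (simp add: b card_permutations_of_set del: of_nat_Suc fact_Suc)
  qed
qed

lemma sum_card_partition:
  assumes "finite A" "partition_on A P"
  shows "(\<Sum>S\<in>P. card S) = card A"
proof -
  have "card (\<Union>P) = (\<Sum>S\<in>P. card S)"
    using assms by (intro card_Union_disjoint) (auto simp: partition_on_def disjoint_def pairwise_def disjnt_def intro: finite_subset[OF _ assms(1)])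
  thus ?thesis using assms(2) by (simp add: partition_on_def)
qed

lemma leading_partition_sum:
  assumes n: "n \<ge> 1" and ord: "is_ordering n chi" and A: "A \<subseteq> {1..n}"
  shows "leading n (card A) (\<lambda>\<tau> z. partition_sum (block_term chi \<tau> (\<lambda>i. exp (z i))) A) (\<lambda>\<tau> z. partition_sum (block_taylor \<tau> z) A)"
  unfolding partition_sum_def
proof (rule leading_sum)
  fix P assume "P \<in> {P. partition_on A P}"
  hence P: "partition_on A P" by simp
  have f: "finite A" using A finite_subset by auto
  have "leading n (\<Sum>S\<in>P. card S) (\<lambda>\<tau> z. \<Prod>S\<in>P. block_term chi \<tau> (\<lambda>i. exp (z i)) S) (\<lambda>\<tau> z. \<Prod>S\<in>P. block_taylor \<tau> z S)"
    by (rule leading_prod[OF finite_elements[OF f P]], rule leading_block_term[OF n ord]) (use P A in \<open>auto simp: partition_on_def\<close>)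
  thus "leading n (card A) (\<lambda>\<tau> z. \<Prod>S\<in>P. block_term chi \<tau> (\<lambda>i. exp (z i)) S) (\<lambda>\<tau> z. \<Prod>S\<in>P. block_taylor \<tau> z S)"
    by (simp only: sum_card_partition[OF f P])
qed

text \<open>S is the rest of the block of 0. That block is a constant and removes |S| from the
  weight n. Since the block {0} has weight factor 0, the case |S| = 1 dominates, with constant 4
  times 1/4.\<close>

definition leading_part :: "nat => complex => (nat => complex) => complex" where
  "leading_part n \<tau> z = (\<Sum>S\<in>Pow {1..n}. if card S = 1 then partition_sum (block_taylor \<tau> z) ({1..n} - S) else 0)"

text \<open>Both sequences of 0 and i have one step from 0, of value 0, and one step to 0, of value
  1, so a = 1 for every ordering.\<close>

lemma block_term_pair:
  assumes "i \<noteq> 0"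
  shows "block_term chi \<tau> u {0, i} = 1 / 4"
proof -
  have "permutations_of_set {0, i} = {[0, i], [i, 0]}" using assms by (intro permutations_of_set_doubleton) simp
  moreover have "chi_seq chi [0, i] = 1" "chi_seq chi [i, 0] = 1"
    using assms by (simp_all add: chi_seq_def chi0_def lessThan_Suc)
  moreover have "card {0, i} = 2" using assms by simp
  moreover have "[0, i] \<noteq> [i, 0]" using assms by simp
  ultimately have "G_u0 chi \<tau> {0, i} = - 1 / 2"
    unfolding G_u0_def by (simp add: g_coeff_def power2_eq_square)
  moreover have "{0, i} \<noteq> {0}" using assms by auto
  ultimately show ?thesis using \<open>card {0, i} = 2\<close> by (simp add: block_term_def)
qed

lemma leading_closed_form:
  assumes n: "n \<ge> 1" and ord: "is_ordering n chi"
  shows "leading n (n - 1) (\<lambda>\<tau> z. upper_half_plane.closed_form \<tau> n chi z) (leading_part n)"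
proof -
  \<comment> \<open>The factor of a block containing 0 is independent of \<tau> and u, so it is
    represented by its value at arbitrary arguments.\<close>
  define \<kappa> where "\<kappa> = (\<lambda>S. 4 * block_term chi 0 (\<lambda>_. 0) (insert 0 S))"
  have \<kappa>: "4 * block_term chi \<tau> u (insert 0 S) = \<kappa> S" for \<tau> u S
    by (simp add: \<kappa>_def block_term_def G_u0_def g_coeff_def)
  have "leading n (n - 1) (\<lambda>\<tau> z. \<Sum>S\<in>Pow {1..n}. \<kappa> S * partition_sum (block_term chi \<tau> (\<lambda>i. exp (z i))) ({1..n} - S))
     (\<lambda>\<tau> z. \<Sum>S\<in>Pow {1..n}. if card S = 1 then partition_sum (block_taylor \<tau> z) ({1..n} - S) else 0)"
  proof (rule leading_sum)
    fix S assume "S \<in> Pow {1..n}"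
    hence S: "S \<subseteq> {1..n}" by simp
    hence f: "finite S" using finite_subset by auto
    have c: "card ({1..n} - S) = n - card S" using S f by (simp add: card_Diff_subset)
    have le: "card S \<le> n" using card_mono[OF _ S] by simp
    have l: "leading n (n - card S) (\<lambda>\<tau> z. \<kappa> S * partition_sum (block_term chi \<tau> (\<lambda>i. exp (z i))) ({1..n} - S))
       (\<lambda>\<tau> z. \<kappa> S * partition_sum (block_taylor \<tau> z) ({1..n} - S))"
      using leading_cmult[OF leading_partition_sum[OF n ord, of "{1..n} - S"], of "\<kappa> S"] unfolding c by blast
    consider "card S = 0" | "card S = 1" | "card S \<ge> 2" by linarith
    thus "leading n (n - 1) (\<lambda>\<tau> z. \<kappa> S * partition_sum (block_term chi \<tau> (\<lambda>i. exp (z i))) ({1..n} - S))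
       (\<lambda>\<tau> z. if card S = 1 then partition_sum (block_taylor \<tau> z) ({1..n} - S) else 0)"
    proof cases
      case 1
      hence "S = {}" using f by simp
      hence "\<kappa> S = 0" by (simp add: \<kappa>_def block_term_def)
      thus ?thesis using 1 by (simp add: leading_lower lower_weight_zero)
    next
      case 2
      then obtain i where i: "S = {i}" by (auto simp: card_1_singleton_iff)
      have "i \<noteq> 0" using S i by auto
      hence "\<kappa> S = 4 * (1 / 4)" unfolding \<kappa>_def i by (simp only: block_term_pair[OF \<open>i \<noteq> 0\<close>])
      thus ?thesis using l 2 by simp
    next
      case 3
      hence "lower_weight n (n - 1) (\<lambda>\<tau> z. \<kappa> S * partition_sum (block_term chi \<tau> (\<lambda>i. exp (z i))) ({1..n} - S))"
        using le by (intro leading_imp_lower[OF l]) simp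
      thus ?thesis using 3 by (simp add: leading_lower)
    qed
  qed
  thus ?thesis
  proof (rule leading_cong)
    fix \<tau> :: complex and z :: "nat => complex" assume "Im \<tau> > 0"
    then interpret upper_half_plane \<tau> by unfold_locales
    have ins: "{0..n} = insert 0 {1..n}" and zero_notin: "0 \<notin> {1..n}" by auto
    show "closed_form n chi z = (\<Sum>S\<in>Pow {1..n}. \<kappa> S * partition_sum (block_term chi \<tau> (\<lambda>i. exp (z i))) ({1..n} - S))"
      unfolding closed_form_def ins
      by (simp only: partition_sum_insert[OF finite_atLeastAtMost zero_notin] sum_distrib_left mult.assoc[symmetric] \<kappa>)
  qed (simp add: leading_part_def)
qed

section \<open>Nonvanishing of the leading part\<close>

context upper_half_plane
begin

lemma theta_recip_tendsto: "(theta_recip \<longlongrightarrow> 1) (at 0)"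
proof -
  obtain r where r: "r > 0" "theta_recip holomorphic_on ball 0 r" using theta_recip_holomorphic by metis
  have "isCont theta_recip 0"
    using holomorphic_on_imp_continuous_on[OF r(2)] r(1) by (simp add: continuous_on_eq_continuous_at)
  thus ?thesis by (simp add: isCont_def theta_recip_def)
qed

lemma scaled_recip_tendsto:
  assumes "b \<ge> 1"
  shows "((\<lambda>s. s / \<theta> (of_nat b * s)) \<longlongrightarrow> 1 / of_nat b) (at 0)"
proof -
  have b0: "of_nat b \<noteq> (0::complex)" using assms by simp
  have "filterlim (\<lambda>s. of_nat b * s) (at 0) (at (0::complex))"
    using b0 by (auto simp: filterlim_at eventually_at intro!: tendsto_eq_intros exI[of _ 1])
  hence "((\<lambda>s. theta_recip (of_nat b * s) * (1 / of_nat b)) \<longlongrightarrow> 1 * (1 / of_nat b)) (at 0)"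
    by (intro tendsto_mult tendsto_const filterlim_compose[OF theta_recip_tendsto])
  moreover have "\<forall>\<^sub>F s in at 0. theta_recip (of_nat b * s) * (1 / of_nat b) = s / \<theta> (of_nat b * s)"
    using b0 by (auto simp: eventually_at theta_recip_def intro!: exI[of _ 1])
  ultimately have "((\<lambda>s. s / \<theta> (of_nat b * s)) \<longlongrightarrow> 1 * (1 / of_nat b)) (at 0)" by (rule Lim_transform_eventually)
  thus ?thesis by simp
qed

text \<open>The pole of \<open>taylor (b - 1)\<close> at 0 is at most simple, so s^b suppresses it
  for b > 1; for b = 1 the residue 1 of theta'/theta survives.\<close>

lemma scaled_taylor_tendsto:
  assumes "b \<ge> 1"
  shows "((\<lambda>s. s ^ b * taylor (b - 1) (of_nat b * s)) \<longlongrightarrow> (if b = 1 then 1 else 0)) (at 0)"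
proof (cases "b = 1")
  case True
  have "taylor 0 s = deriv \<theta> s / \<theta> s + deriv theta_recip 0 * (\<theta> s / \<theta> s)" for s
    by (simp add: taylor_def theta_recip_def)
  hence e: "s * taylor 0 s = s / \<theta> s * deriv \<theta> s + s * (deriv theta_recip 0 * (\<theta> s / \<theta> s))" for s
    by (simp add: algebra_simps)
  have "isCont (deriv \<theta>) 0"
    using holomorphic_on_imp_continuous_on[OF deriv_theta_holomorphic[of 1 UNIV]]
    by (simp add: continuous_on_eq_continuous_at)
  hence d: "(deriv \<theta> \<longlongrightarrow> 1) (at 0)" by (simp add: isCont_def deriv_theta_0)
  have one: "((\<lambda>s. \<theta> s / \<theta> s) \<longlongrightarrow> 1) (at 0)"
  proof (rule Lim_transform_eventually[OF tendsto_const])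
    show "\<forall>\<^sub>F s in at 0. 1 = \<theta> s / \<theta> s" using theta_eventually_nonzero[of 0] by (auto elim: eventually_mono)
  qed
  have "((\<lambda>s. s / \<theta> s * deriv \<theta> s + s * (deriv theta_recip 0 * (\<theta> s / \<theta> s))) \<longlongrightarrow> 1 * 1 + 0 * (deriv theta_recip 0 * 1)) (at 0)"
    using scaled_recip_tendsto[of 1] by (intro tendsto_add tendsto_mult tendsto_const d one tendsto_ident_at) simp
  thus ?thesis unfolding True by (simp add: e)
next
  case False
  obtain N where N: "N holomorphic_on UNIV" "\<And>z. taylor (b - 1) z = N z / \<theta> z" using taylor_num_holomorphic by metis
  have "isCont (\<lambda>s. N (of_nat b * s)) 0"
    using holomorphic_on_imp_continuous_on[OF N(1)] by (intro continuous_at_compose[of 0 "\<lambda>s. of_nat b * s" N, unfolded o_def] continuous_intros) (simp add: continuous_on_eq_continuous_at)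
  hence c: "((\<lambda>s. N (of_nat b * s)) \<longlongrightarrow> N 0) (at 0)" by (simp add: isCont_def)
  have "((\<lambda>s. s ^ (b - 1) * (N (of_nat b * s) * (s / \<theta> (of_nat b * s)))) \<longlongrightarrow> 0 ^ (b - 1) * (N 0 * (1 / of_nat b))) (at 0)"
    by (intro tendsto_mult c scaled_recip_tendsto assms tendsto_power tendsto_ident_at)
  moreover have "s ^ (b - 1) * (N (of_nat b * s) * (s / \<theta> (of_nat b * s))) = s ^ b * taylor (b - 1) (of_nat b * s)" for s
  proof -
    have "s ^ b = s ^ (b - 1) * s" using assms power_minus_mult[of b s] by simp
    thus ?thesis unfolding N(2) by simp
  qed
  ultimately show ?thesis using False assms by (simp add: zero_power)
qed

end

lemma partition_sum_scale:
  assumes "finite A"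
  shows "s ^ card A * partition_sum f A = partition_sum (\<lambda>S. s ^ card S * f S) A"
  unfolding partition_sum_def sum_distrib_left
  by (intro sum.cong refl) (simp add: prod.distrib power_sum[symmetric] sum_card_partition[OF assms])

text \<open>The partition into singletons is the only one with a nonzero product.\<close>

lemma partition_sum_singletons:
  "finite A ==> partition_sum (\<lambda>S. if card S = 1 then 1 else 0) A = 1"
proof (induction A rule: finite_induct)
  case (insert r A)
  have "partition_sum (\<lambda>S. if card S = 1 then 1 else 0) (insert r A)
    = (\<Sum>S\<in>Pow A. (if card (insert r S) = 1 then 1 else 0) * partition_sum (\<lambda>S. if card S = 1 then 1 else 0) (A - S))"
    using insert by (intro partition_sum_insert)
  also have "\<dots> = (\<Sum>S\<in>{{}}. (if card (insert r S) = 1 then 1 else 0) * partition_sum (\<lambda>S. if card S = 1 then 1 else 0) (A - S))"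
  proof (rule sum.mono_neutral_right)
    show "\<forall>S\<in>Pow A - {{}}. (if card (insert r S) = 1 then 1 else 0) * partition_sum (\<lambda>S. if card S = 1 then 1 else 0) (A - S) = 0"
    proof
      fix S assume S: "S \<in> Pow A - {{}}"
      hence "finite S" "r \<notin> S" using insert finite_subset by auto
      hence "card (insert r S) \<noteq> 1" using S by simp
      thus "(if card (insert r S) = 1 then 1 else 0) * partition_sum (\<lambda>S. if card S = 1 then 1 else 0) (A - S) = (0 :: complex)" by simp
    qed
  qed (use insert in auto)
  finally show ?case using insert by simp
qed simp

text \<open>On the diagonal z = (s, ..., s) the leading part behaves like n s^(1-n) as s -> 0: each
  of the n choices of the index joined to 0 leaves the partition of the others into singletons,
  whose n - 1 factors behave like 1/s.\<close>

lemma leading_part_nonzero: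
  assumes n: "n \<ge> 1"
  shows "\<exists>\<tau> z. Im \<tau> > 0 \<and> z \<in> regular_points n \<tau> \<and> leading_part n \<tau> z \<noteq> 0"
proof -
  interpret upper_half_plane \<i> by unfold_locales simp
  define zz where "zz = (\<lambda>s i. if i \<in> {1..n} then s else (0::complex))"
  have sumz: "(\<Sum>i\<in>S. zz s i) = of_nat (card S) * s" if "S \<subseteq> {1..n}" for S s
  proof -
    have "(\<Sum>i\<in>S. zz s i) = (\<Sum>i\<in>S. s)" using that by (intro sum.cong) (auto simp: zz_def)
    thus ?thesis by simp
  qed
  have cp: "card S \<ge> 1" if "S \<subseteq> {1..n}" "S \<noteq> {}" for S
    using that finite_subset[OF that(1)] by (simp add: Suc_le_eq card_gt_0_iff)
  have lim1: "((\<lambda>s. partition_sum (\<lambda>S. s ^ card S * block_taylor \<i> (zz s) S) A) \<longlongrightarrow> partition_sum (\<lambda>S. if card S = 1 then 1 else 0) A) (at 0)"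
    if A: "A \<subseteq> {1..n}" for A
    unfolding partition_sum_def
  proof (intro tendsto_sum tendsto_prod)
    fix P S assume "P \<in> {P. partition_on A P}" "S \<in> P"
    hence S: "S \<subseteq> {1..n}" "S \<noteq> {}" using A by (auto simp: partition_on_def)
    show "((\<lambda>s. s ^ card S * block_taylor \<i> (zz s) S) \<longlongrightarrow> (if card S = 1 then 1 else 0)) (at 0)"
      unfolding block_taylor_def sumz[OF S(1)] by (rule scaled_taylor_tendsto[OF cp[OF S]])
  qed
  have "((\<lambda>s. \<Sum>S\<in>Pow {1..n}. if card S = 1 then partition_sum (\<lambda>S. s ^ card S * block_taylor \<i> (zz s) S) ({1..n} - S) else 0)
    \<longlongrightarrow> (\<Sum>S\<in>Pow {1..n}. if card S = 1 then partition_sum (\<lambda>S. if card S = 1 then 1 else 0) ({1..n} - S) else 0)) (at 0)"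
  proof (rule tendsto_sum)
    fix S
    show "((\<lambda>s. if card S = 1 then partition_sum (\<lambda>S. s ^ card S * block_taylor \<i> (zz s) S) ({1..n} - S) else 0)
      \<longlongrightarrow> (if card S = 1 then partition_sum (\<lambda>S. if card S = 1 then 1 else 0) ({1..n} - S) else 0)) (at 0)"
      using lim1[of "{1..n} - S"] by (cases "card S = 1") auto
  qed
  moreover have "(\<Sum>S\<in>Pow {1..n}. if card S = 1 then partition_sum (\<lambda>S. if card S = 1 then 1 else 0) ({1..n} - S) else 0) = (of_nat n :: complex)"
  proof -
    have "(\<Sum>S\<in>Pow {1..n}. if card S = 1 then partition_sum (\<lambda>S. if card S = 1 then 1 else 0) ({1..n} - S) else 0)
      = (\<Sum>S\<in>Pow {1..n}. if card S = 1 then 1 else (0::complex))"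
      by (intro sum.cong refl) (simp only: partition_sum_singletons[OF finite_Diff[OF finite_atLeastAtMost]])
    also have "\<dots> = of_nat (card {S. S \<subseteq> {1..n} \<and> card S = 1})"
      by (simp add: sum.If_cases Collect_conj_eq Pow_def)
    also have "card {S. S \<subseteq> {1..n} \<and> card S = 1} = n" using n_subsets[of "{1..n}" 1] by simp
    finally show ?thesis .
  qed
  moreover have "(\<Sum>S\<in>Pow {1..n}. if card S = 1 then partition_sum (\<lambda>S. s ^ card S * block_taylor \<i> (zz s) S) ({1..n} - S) else 0)
     = s ^ (n - 1) * leading_part n \<i> (zz s)" for s
    unfolding leading_part_def sum_distrib_left
  proof (rule sum.cong[OF refl])
    fix S assume "S \<in> Pow {1..n}"
    hence S: "S \<subseteq> {1..n}" "finite S" using finite_subset by auto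
    have c: "card ({1..n} - S) = n - card S" using S by (simp add: card_Diff_subset)
    show "(if card S = 1 then partition_sum (\<lambda>S. s ^ card S * block_taylor \<i> (zz s) S) ({1..n} - S) else 0)
      = s ^ (n - 1) * (if card S = 1 then partition_sum (block_taylor \<i> (zz s)) ({1..n} - S) else 0)"
    proof (cases "card S = 1")
      case True
      have "card ({1..n} - S) = n - 1" using c True by simp
      thus ?thesis using partition_sum_scale[of "{1..n} - S" s "block_taylor \<i> (zz s)"] True by simp
    qed simp
  qed
  ultimately have "((\<lambda>s. s ^ (n - 1) * leading_part n \<i> (zz s)) \<longlongrightarrow> of_nat n) (at 0)" by simp
  moreover have "of_nat n \<noteq> (0::complex)" using n by simp
  ultimately have "\<forall>\<^sub>F s in at 0. s ^ (n - 1) * leading_part n \<i> (zz s) \<noteq> 0" by (rule tendsto_imp_eventually_ne)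
  moreover have "\<forall>\<^sub>F s in at 0. \<forall>b\<in>{1..n}. \<theta> (of_nat b * s) \<noteq> 0"
  proof (intro eventually_ball_finite ballI)
    fix b assume "b \<in> {1..n}"
    hence b: "b \<ge> 1" by simp
    have "\<forall>\<^sub>F s in at 0. s / \<theta> (of_nat b * s) \<noteq> 0"
      by (rule tendsto_imp_eventually_ne[OF scaled_recip_tendsto[OF b]]) (use b in simp)
    thus "\<forall>\<^sub>F s in at 0. \<theta> (of_nat b * s) \<noteq> 0" by eventually_elim auto
  qed simp
  ultimately have "\<forall>\<^sub>F s in at 0. s ^ (n - 1) * leading_part n \<i> (zz s) \<noteq> 0 \<and> (\<forall>b\<in>{1..n}. \<theta> (of_nat b * s) \<noteq> 0)"
    by eventually_elim blast
  then obtain s where s: "s ^ (n - 1) * leading_part n \<i> (zz s) \<noteq> 0" "\<forall>b\<in>{1..n}. \<theta> (of_nat b * s) \<noteq> 0"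
    using eventually_happens[of _ "at (0::complex)"] by auto
  have "zz s \<in> regular_points n \<i>"
    unfolding regular_points_def
  proof (intro CollectI conjI allI impI)
    show "zz s \<in> Cn n" by (auto simp: zz_def Cn_def)
    fix I assume I: "I \<noteq> {} \<and> I \<subseteq> {1..n}"
    have "card I \<in> {1..n}" using cp[of I] I card_mono[of "{1..n}" I] by auto
    thus "(\<Sum>i\<in>I. zz s i) \<notin> lattice \<i>" using s(2) sumz[of I s] I theta_eq_0_iff by metis
  qed
  thus ?thesis using s(1) by (intro exI[of _ \<i>] exI[of _ "zz s"]) auto
qed

lemma has_leading_partI:
  assumes "leading n m f L" "quasi_elliptic n m L'" "\<And>\<tau> z. Im \<tau> > 0 ==> z \<in> regular_points n \<tau> ==> L \<tau> z = L' \<tau> z"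
    and "\<exists>\<tau> z. Im \<tau> > 0 \<and> z \<in> regular_points n \<tau> \<and> L \<tau> z \<noteq> 0"
  shows "has_leading_part n m f L'"
proof -
  obtain e where e: "\<And>k. qell n k (e k)"
     "\<And>\<tau> z. Im \<tau> > 0 ==> z \<in> regular_points n \<tau> ==> f \<tau> z - L \<tau> z = (\<Sum>k<m. e k \<tau> z)"
    using assms(1) unfolding leading_def lower_weight_def by metis
  obtain e' where e': "\<And>k. quasi_elliptic n k (e' k)"
     "\<And>k \<tau> z. Im \<tau> > 0 ==> z \<in> regular_points n \<tau> ==> e k \<tau> z = e' k \<tau> z"
    using e(1) unfolding qell_def by metis
  have "f \<tau> z = L' \<tau> z + (\<Sum>k<m. e' k \<tau> z)" if "Im \<tau> > 0" "z \<in> regular_points n \<tau>" for \<tau> z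
    using e(2)[OF that] e'(2)[OF that] assms(3)[OF that] by (simp add: algebra_simps)
  moreover have "\<exists>\<tau> z. Im \<tau> > 0 \<and> z \<in> regular_points n \<tau> \<and> L' \<tau> z \<noteq> 0" using assms(3,4) by force
  ultimately show ?thesis
    unfolding has_leading_part_def using assms(2) e'(1) by (intro conjI exI[of _ e']) auto
qed

theorem theorem3p18:
  fixes n :: nat
  assumes "n \<ge> 1"
  shows "(\<forall>chi. is_ordering n chi \<longrightarrow>
            (\<forall>\<tau> z. Im \<tau> > 0 \<and> z \<in> regular_points n \<tau> \<longrightarrow>
               T n chi \<tau> z =
                 2^2 * (\<Sum>P\<in>partitions_star n. partition_term n chi \<tau> (\<lambda>i. exp (z i)) P)))
         \<and> (\<exists>L. \<forall>chi. is_ordering n chi \<longrightarrow> has_leading_part n (n - 1) (T n chi) L)"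
proof (intro conjI allI impI)
  fix chi \<tau> z assume ord: "is_ordering n chi" and \<tau>z: "Im \<tau> > 0 \<and> z \<in> regular_points n \<tau>"
  interpret upper_half_plane \<tau> by unfold_locales (use \<tau>z in simp)
  show "T n chi \<tau> z = 2^2 * (\<Sum>P\<in>partitions_star n. partition_term n chi \<tau> (\<lambda>i. exp (z i)) P)"
    using T_eq_closed_form[OF ord] \<tau>z by (simp add: closed_form_def sum_partition_term)
next
  have "qell n (n - 1) (leading_part n)" if "is_ordering n chi" for chi
    using leading_closed_form[OF assms that] by (simp add: leading_def)
  show "\<exists>L. \<forall>chi. is_ordering n chi \<longrightarrow> has_leading_part n (n - 1) (T n chi) L"
  \<comment> \<open>Membership of the leading part in the ring is obtained from some ordering; if
    there is none, the claim is vacuous.\<close>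
  proof (cases "\<exists>chi. is_ordering n chi")
    case True
    then obtain L' where L': "quasi_elliptic n (n - 1) L'"
      "\<And>\<tau> z. Im \<tau> > 0 \<Longrightarrow> z \<in> regular_points n \<tau> \<Longrightarrow> leading_part n \<tau> z = L' \<tau> z"
      using \<open>\<And>chi. is_ordering n chi \<Longrightarrow> qell n (n - 1) (leading_part n)\<close> unfolding qell_def by metis
    have "has_leading_part n (n - 1) (T n chi) L'" if ord: "is_ordering n chi" for chi
    proof (rule has_leading_partI[OF _ L' leading_part_nonzero[OF assms]])
      show "leading n (n - 1) (T n chi) (leading_part n)"
      proof (rule leading_cong[OF leading_closed_form[OF assms ord]])
        fix \<tau> :: complex and z assume \<tau>: "Im \<tau> > 0" and z: "z \<in> regular_points n \<tau>"
        interpret upper_half_plane \<tau> by unfold_locales (rule \<tau>)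
        show "T n chi \<tau> z = closed_form n chi z" by (rule T_eq_closed_form[OF ord z])
      qed simp
    qed
    thus ?thesis by blast
  qed blast
qed

end
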